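(* Let $N\ge1$, $\Lambda=\operatorname{diag}(\lambda_1,\dots,\lambda_N)$ with $\lambda_i>0$, let $\tau_Q$ be the large-$\Lambda$ asymptotic expansion of the Kontsevich–Penner matrix model, and let $F_Q=\log\tau_Q$. Then $$F_Q=\sum_{g,b,n}\frac{Q^b}{n!}\sum_{\phi:\{1,\dots,n\}\to\{1,\dots,N\}}W_{(g,b),n}\bigl(\lambda_{\phi(1)},\dots,\lambda_{\phi(n)}\bigr),$$ where $W_{(g,b),n}$ is the Laplace transform in the face perimeters of the volume of the complex of open ribbon graphs of type $((g,b),n)$, and the sum is over all types $g,b\ge0$, $n\ge1$ of connected ribbon graphs.
   Context: **Ribbon graphs.** A ribbon graph is a collection of data $\Gamma=(\mathfrak h,\sigma_0,\sigma_1,\sigma_2,B)$ where: (1) $\mathfrak h$ is a finite set (of half-edges); (2) $\sigma_0,\sigma_1,\sigma_2$ are permutations of $\mathfrak h$; (3) $\sigma_1$ is a fixed-point-free involution; (4) $\sigma_2=\sigma_0^{-1}\circ\sigma_1$; (5) $B\subset\mathfrak h$ satisfies: $x\in B\Rightarrow\sigma_2(x)\in B$, and $x\in B\Rightarrow\sigma_1(x)\notin B$; (6) no cycle of $\sigma_0$ has length 1 or 2. Vertices $v(\Gamma)$ are the cycles of $\sigma_0$, edges $e(\Gamma)$ the cycles of $\sigma_1$, boundaries the cycles of $\sigma_2$ contained in $B$, faces the cycles of $\sigma_2$ contained in $\mathfrak h\setminus B$. $\Gamma$ is connected if $\langle\sigma_0,\sigma_1\rangle$ acts transitively on $\mathfrak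 h$. A connected ribbon graph has type $((g,b),n)$ if it has $b$ boundaries, $n$ faces and $|v(\Gamma)|-|e(\Gamma)|+n+b=2-2g$. It is face-marked if its faces are bijectively labelled $1,\dots,n$; isomorphisms are bijections of half-edges commuting with $\sigma_0,\sigma_1$ and preserving $B$ and the labels. **Ribbon graph complex.** A metric on $\Gamma$ is an assignment of a positive length $\ell_e$ to each edge, and $\operatorname{Met}(\Gamma)=\mathbb R_+^{|e(\Gamma)|}/\operatorname{Aut}(\Gamma)$ is the orbifold of metrics. The complex $\operatorname{RG}_{(g,b),n}$ is $\bigsqcup_\Gamma\operatorname{Met}(\Gamma)$ over isomorphism classes of connected face-marked ribbon graphs of type $((g,b),n)$, with the topology given by edge contraction. $\widetilde{\operatorname{RG}}_{(g,b),n}$ is its $b!$-fold orbifold cover, obtained by also labelling the $b$ boundary cycles. For $\vec x\in\mathbb R_+^n$, $\vec y\in\mathbb R_+^b$, let $\widetilde{\operatorname{RG}}_{(g,b),n}(\vec x;\vec y)$ be the subset of metric graphs with face perimeters $x_1,\dots,x_n$ and boundary perimeters $y_1,\dots,y_b$ (the perimeter of a cycle being the sum of the lengths of the edges around it, counted with multiplicity). **Volumes.** Index the faces and boundaries as cycles $k=1,\dots,n+b$ (faces first). For each $k$ choose a distinguished edge and let $\ell^{[k]}_1,\dots,\ell^{[k]}_{m_k}$ be the lengths of the edges in order around cycle $k$. Put $$\omega_k=\sum_{i=1}^{m_k-1}\sum_{j=i+1}^{m_k}d\ell^{[k]}_i\wedge d\ell^{[k]}_j,\qquad \Omega=\frac12\sum_{k=1}^{n+b}\omega_k.$$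 The restriction of $\Omega$ to $\widetilde{\operatorname{RG}}_{(g,b),n}(\vec x;\vec y)$ does not depend on the choices, and is non-degenerate on the top-dimensional cells (trivalent graphs), which are oriented by $\Omega^d$. With $d=3g-3+n+b$, define $$\operatorname{Vol}_{(g,b),n}(\vec x;\vec y)=\frac1{b!}\int_{\widetilde{\operatorname{RG}}_{(g,b),n}(\vec x;\vec y)}\frac{\Omega^d}{d!}$$ (an orbifold integral), and $$W_{(g,b),n}(\lambda_1,\dots,\lambda_n)=\int_0^\infty\!\!\cdots\int_0^\infty d\vec x\,d\vec y\;e^{-\vec\lambda\cdot\vec x}\,\operatorname{Vol}_{(g,b),n}(\vec x;\vec y).$$ **Kontsevich–Penner model.** Let $\mathcal H_N$ be the space of $N\times N$ Hermitian matrices, and $$\tau_Q=\det(\Lambda)^Q\,\mathcal C_\Lambda^{-1}\int_{\mathcal H_N}d\Phi\,\exp\Bigl(-\operatorname{Tr}\bigl(\tfrac{\Phi^3}{3!}-\tfrac{\Lambda^2\Phi}{2}+Q\log\Phi\bigr)\Bigr),\qquad \mathcal C_\Lambda=e^{\operatorname{Tr}\Lambda^3/3}\int_{\mathcal H_N}dX\,e^{-\operatorname{Tr}(X^2\Lambda)/2},$$ with $Q$ a formal parameter. It is understood as an asymptotic (perturbative) expansion for $\Lambda\to(\infty,\dots,\infty)$: substituting $\Phi=X+\Lambda$, and writing $\langle f\rangle_\Lambda$ for the expectation of $f(X)$ with respect to the normalized Gaussian measure on $\mathcal H_N$ proportional to $e^{-\operatorname{Tr}(X^2\Lambda)/2}dX$,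 $$\tau_Q=\Bigl\langle\exp\operatorname{Tr}\Bigl(-\frac{X^3}{3!}+\sum_{k\ge1}\frac{Q}{k}(-\Lambda^{-1}X)^k\Bigr)\Bigr\rangle_\Lambda,$$ where the exponential is expanded as a power series in $\operatorname{Tr}X^3$ and the $\operatorname{Tr}(-\Lambda^{-1}X)^k$ and the expectation is taken term by term. Each term is a homogeneous rational function of the $\lambda_i$ times a power of $Q$, finitely many in each degree. The claimed equality is an equality of such formal series, degree by degree in $\lambda_1,\dots,\lambda_N$. *)

theory Defs
  imports
    "HOL-Analysis.Analysis"
    "HOL-Combinatorics.Orbits"
    "HOL-Computational_Algebra.Formal_Power_Series"
begin

section \<open>Ribbon graphs\<close>

record 'h ribbon_graph =
  half_edges :: "'h set"
  sigma0 :: "'h \<Rightarrow> 'h"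
  sigma1 :: "'h \<Rightarrow> 'h"
  sigma2 :: "'h \<Rightarrow> 'h"
  bdry_half_edges :: "'h set"

text \<open>A cycle of a permutation is represented by the set of its elements.\<close>

definition cycles_on :: "'h set \<Rightarrow> ('h \<Rightarrow> 'h) \<Rightarrow> 'h set set" where
  "cycles_on H f = (\<lambda>x. orbit f x) ` H"

definition vertices :: "('h, 'z) ribbon_graph_scheme \<Rightarrow> 'h set set" where
  "vertices G = cycles_on (half_edges G) (sigma0 G)"

definition edges :: "('h, 'z) ribbon_graph_scheme \<Rightarrow> 'h set set" where
  "edges G = cycles_on (half_edges G) (sigma1 G)"

definition boundaries :: "('h, 'z) ribbon_graph_scheme \<Rightarrow> 'h set set" where
  "boundaries G = {c \<in> cycles_on (half_edges G) (sigma2 G). c \<subseteq> bdry_half_edges G}"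

definition faces :: "('h, 'z) ribbon_graph_scheme \<Rightarrow> 'h set set" where
  "faces G = {c \<in> cycles_on (half_edges G) (sigma2 G). c \<subseteq> half_edges G - bdry_half_edges G}"

definition ribbon_graph :: "('h, 'z) ribbon_graph_scheme \<Rightarrow> bool" where
  "ribbon_graph G \<longleftrightarrow>
     finite (half_edges G) \<and>
     sigma0 G permutes half_edges G \<and>
     sigma1 G permutes half_edges G \<and>
     sigma2 G permutes half_edges G \<and>
     (\<forall>x\<in>half_edges G. sigma1 G x \<noteq> x \<and> sigma1 G (sigma1 G x) = x) \<and>
     sigma2 G = inv (sigma0 G) \<circ> sigma1 G \<and>
     bdry_half_edges G \<subseteq> half_edges G \<and>
     (\<forall>x\<in>bdry_half_edges G. sigma2 G x \<in> bdry_half_edges G \<and> sigma1 G x \<notin> bdry_half_edges G) \<and>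
     (\<forall>c\<in>vertices G. card c \<noteq> 1 \<and> card c \<noteq> 2)"

inductive_set generated_perms :: "('h \<Rightarrow> 'h) set \<Rightarrow> ('h \<Rightarrow> 'h) set" for S where
  gen_id: "id \<in> generated_perms S"
| gen_mult: "f \<in> S \<Longrightarrow> w \<in> generated_perms S \<Longrightarrow> f \<circ> w \<in> generated_perms S"
| gen_inv: "f \<in> S \<Longrightarrow> w \<in> generated_perms S \<Longrightarrow> inv f \<circ> w \<in> generated_perms S"

definition connected_graph :: "('h, 'z) ribbon_graph_scheme \<Rightarrow> bool" where
  "connected_graph G \<longleftrightarrow>
     (\<forall>x\<in>half_edges G. \<forall>y\<in>half_edges G. \<exists>w\<in>generated_perms {sigma0 G, sigma1 G}. w x = y)"

definition has_type :: "('h, 'z) ribbon_graph_scheme \<Rightarrow> nat \<Rightarrow> nat \<Rightarrow> nat \<Rightarrow> bool" where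
  "has_type G g b n \<longleftrightarrow>
     card (boundaries G) = b \<and> card (faces G) = n \<and>
     int (card (vertices G)) - int (card (edges G)) + int n + int b = 2 - 2 * int g"

text \<open>Every ribbon graph is isomorphic to one whose half-edges are natural numbers.\<close>

definition ribbon_types :: "(nat \<times> nat \<times> nat) set" where
  "ribbon_types = {(g, b, n). n \<ge> 1 \<and>
     (\<exists>G :: nat ribbon_graph. ribbon_graph G \<and> connected_graph G \<and> has_type G g b n)}"

definition trivalent :: "('h, 'z) ribbon_graph_scheme \<Rightarrow> bool" where
  "trivalent G \<longleftrightarrow> (\<forall>c\<in>vertices G. card c = 3)"


section \<open>Marked ribbon graphs\<close>

text \<open>The values of the labels outside the faces, respectively the boundaries, carry no
  information; isomorphisms ignore them.\<close>

record 'h marked_graph = "'h ribbon_graph" +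
  face_label :: "'h set \<Rightarrow> nat"
  bdry_label :: "'h set \<Rightarrow> nat"

definition marked :: "'h marked_graph \<Rightarrow> bool" where
  "marked G \<longleftrightarrow>
     bij_betw (face_label G) (faces G) {1..card (faces G)} \<and>
     bij_betw (bdry_label G) (boundaries G) {1..card (boundaries G)}"

definition marked_iso :: "('h \<Rightarrow> 'k) \<Rightarrow> 'h marked_graph \<Rightarrow> 'k marked_graph \<Rightarrow> bool" where
  "marked_iso f G G' \<longleftrightarrow>
     bij_betw f (half_edges G) (half_edges G') \<and>
     (\<forall>x\<in>half_edges G. f (sigma0 G x) = sigma0 G' (f x) \<and> f (sigma1 G x) = sigma1 G' (f x)) \<and>
     f ` bdry_half_edges G = bdry_half_edges G' \<and>
     (\<forall>c\<in>faces G. face_label G' (f ` c) = face_label G c) \<and>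
     (\<forall>c\<in>boundaries G. bdry_label G' (f ` c) = bdry_label G c)"

definition Aut :: "'h marked_graph \<Rightarrow> ('h \<Rightarrow> 'h) set" where
  "Aut G = {f. f permutes half_edges G \<and> marked_iso f G G}"

text \<open>The top-dimensional cells of the boundary-labelled complex of type \<open>((g,b),n)\<close> are
  indexed by the isomorphism classes of the following graphs.\<close>

definition top_graphs :: "nat \<Rightarrow> nat \<Rightarrow> nat \<Rightarrow> nat marked_graph set" where
  "top_graphs g b n = {G. ribbon_graph G \<and> connected_graph G \<and> has_type G g b n \<and>
     trivalent G \<and> marked G}"

definition top_classes :: "nat \<Rightarrow> nat \<Rightarrow> nat \<Rightarrow> nat marked_graph set set" where
  "top_classes g b n = top_graphs g b n //
     {(G, G'). G \<in> top_graphs g b n \<and> G' \<in> top_graphs g b n \<and> (\<exists>f. marked_iso f G G')}"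


section \<open>Metrics and the two-form\<close>

text \<open>Metrics and tangent vectors are functions on edges. Each half-edge of a cycle of
  \<open>sigma2\<close> accounts for one passage of the cycle along an edge, so that an edge met twice is
  counted twice.\<close>

definition edge_at :: "('h, 'z) ribbon_graph_scheme \<Rightarrow> 'h \<Rightarrow> 'h set" where
  "edge_at G x = orbit (sigma1 G) x"

definition perimeter :: "('h, 'z) ribbon_graph_scheme \<Rightarrow> ('h set \<Rightarrow> real) \<Rightarrow> 'h set \<Rightarrow> real" where
  "perimeter G l c = (\<Sum>x\<in>c. l (edge_at G x))"

definition has_perimeters ::
  "'h marked_graph \<Rightarrow> (nat \<Rightarrow> real) \<Rightarrow> (nat \<Rightarrow> real) \<Rightarrow> ('h set \<Rightarrow> real) \<Rightarrow> bool" where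
  "has_perimeters G x y l \<longleftrightarrow>
     (\<forall>c\<in>faces G. perimeter G l c = x (face_label G c)) \<and>
     (\<forall>c\<in>boundaries G. perimeter G l c = y (bdry_label G c))"

text \<open>The metrics on \<open>G\<close> of given perimeters: an open polytope in an affine space whose
  space of directions is \<open>slice_directions G\<close>.\<close>

definition metric_slice ::
  "'h marked_graph \<Rightarrow> (nat \<Rightarrow> real) \<Rightarrow> (nat \<Rightarrow> real) \<Rightarrow> ('h set \<Rightarrow> real) set" where
  "metric_slice G x y = {l \<in> edges G \<rightarrow>\<^sub>E {0<..}. has_perimeters G x y l}"

definition slice_directions :: "('h, 'z) ribbon_graph_scheme \<Rightarrow> ('h set \<Rightarrow> real) set" where
  "slice_directions G =
     {v \<in> edges G \<rightarrow>\<^sub>E UNIV. \<forall>c\<in>cycles_on (half_edges G) (sigma2 G). perimeter G v c = 0}"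

text \<open>The value of \<open>\<Sum>\<^sub>i\<^sub><\<^sub>j dl\<^sub>i \<and> dl\<^sub>j\<close> at \<open>(v, w)\<close>, where \<open>dl\<^sub>i \<and> dl\<^sub>j\<close> sends \<open>(v, w)\<close> to
  \<open>v\<^sub>i w\<^sub>j - v\<^sub>j w\<^sub>i\<close> and the edges around the cycle are listed from the half-edge \<open>x0\<close> on,
  which stands for the distinguished edge.\<close>

definition omega_from :: "('h, 'z) ribbon_graph_scheme \<Rightarrow> 'h set \<Rightarrow> 'h \<Rightarrow>
    ('h set \<Rightarrow> real) \<Rightarrow> ('h set \<Rightarrow> real) \<Rightarrow> real" where
  "omega_from G c x0 v w =
     (let e = (\<lambda>i. edge_at G ((sigma2 G ^^ i) x0)) in
        \<Sum>j<card c. \<Sum>i<j. v (e i) * w (e j) - v (e j) * w (e i))"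

definition Omega :: "('h, 'z) ribbon_graph_scheme \<Rightarrow>
    ('h set \<Rightarrow> real) \<Rightarrow> ('h set \<Rightarrow> real) \<Rightarrow> real" where
  "Omega G v w =
     1/2 * (\<Sum>c\<in>cycles_on (half_edges G) (sigma2 G). omega_from G c (SOME x. x \<in> c) v w)"

text \<open>The value of \<open>\<Omega>\<^sup>d / d!\<close> (wedge power) at the vectors \<open>v 0, \<dots>, v (2 * d - 1)\<close>, in the
  normalisation of the wedge product used above.\<close>

definition Omega_power :: "('h, 'z) ribbon_graph_scheme \<Rightarrow> nat \<Rightarrow>
    (nat \<Rightarrow> 'h set \<Rightarrow> real) \<Rightarrow> real" where
  "Omega_power G d v =
     (\<Sum>p | p permutes {..<2*d}.
        of_int (sign p) * (\<Prod>i<d. Omega G (v (p (2*i))) (v (p (2*i+1))))) / (2 ^ d * fact d)"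


section \<open>Volumes\<close>

definition slice_basis :: "('h, 'z) ribbon_graph_scheme \<Rightarrow> nat \<Rightarrow> (nat \<Rightarrow> 'h set \<Rightarrow> real) \<Rightarrow> bool" where
  "slice_basis G m v \<longleftrightarrow>
     (\<forall>i<m. v i \<in> slice_directions G) \<and>
     (\<forall>w\<in>slice_directions G. \<exists>!t. t \<in> {..<m} \<rightarrow>\<^sub>E UNIV \<and>
        (\<forall>e\<in>edges G. w e = (\<Sum>i<m. t i * v i e)))"

text \<open>The integral of \<open>\<Omega>\<^sup>d / d!\<close> over \<open>metric_slice G x y\<close>, in an affine chart of the
  slice whose origin is a point \<open>l0\<close> with the given perimeters and whose axes are a basis \<open>v\<close>
  of the directions. In this chart the form is constant, and the absolute value expresses that
  the cell is oriented by \<open>\<Omega>\<^sup>d\<close>. The result does not depend on the choice of \<open>l0\<close> and \<open>v\<close>.\<close>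

definition cell_volume ::
  "'h marked_graph \<Rightarrow> nat \<Rightarrow> (nat \<Rightarrow> real) \<Rightarrow> (nat \<Rightarrow> real) \<Rightarrow> real" where
  "cell_volume G d x y =
     (let v = (SOME v. slice_basis G (2*d) v);
          l0 = (SOME l0. has_perimeters G x y l0)
      in \<bar>Omega_power G d v\<bar> *
         measure (\<Pi>\<^sub>M i\<in>{..<2*d}. lborel)
           {t \<in> {..<2*d} \<rightarrow>\<^sub>E UNIV.
              (\<lambda>e\<in>edges G. l0 e + (\<Sum>i<2*d. t i * v i e)) \<in> metric_slice G x y})"

text \<open>As usual for orbifold integrals, a cell is weighted by the order of the full automorphism
  group, including the automorphisms that act trivially on the metrics. For the types of
  connected ribbon graphs with \<open>n \<ge> 1\<close> one has \<open>3 * g + n + b \<ge> 3\<close>; for all others the sum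
  is empty. Cells of non-trivalent graphs have smaller dimension and do not contribute.\<close>

definition Vol :: "nat \<Rightarrow> nat \<Rightarrow> nat \<Rightarrow> (nat \<Rightarrow> real) \<Rightarrow> (nat \<Rightarrow> real) \<Rightarrow> real" where
  "Vol g b n x y = 1 / fact b *
     (\<Sum>C\<in>top_classes g b n.
        let G = (SOME G. G \<in> C) in cell_volume G (3*g + n + b - 3) x y / real (card (Aut G)))"

definition W :: "nat \<Rightarrow> nat \<Rightarrow> nat \<Rightarrow> (nat \<Rightarrow> real) \<Rightarrow> real" where
  "W g b n lam =
     (LINT (x, y) | ((\<Pi>\<^sub>M i\<in>{1..n}. lborel) \<Otimes>\<^sub>M (\<Pi>\<^sub>M i\<in>{1..b}. lborel)).
        indicator (({1..n} \<rightarrow>\<^sub>E {0<..}) \<times> ({1..b} \<rightarrow>\<^sub>E {0<..})) (x, y) *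
        (exp (- (\<Sum>i=1..n. lam i * x i)) * Vol g b n x y))"


section \<open>The Kontsevich--Penner model\<close>

text \<open>\<open>M \<mapsto> (M + M\<^sup>T)/2 + \<i> (M - M\<^sup>T)/2\<close> is a linear isometry from real matrices
  onto Hermitian matrices with the norm \<open>Tr (X\<^sup>2)\<close>; it transports Lebesgue measure.\<close>

definition hermitian_of :: "real^'n^'n \<Rightarrow> complex^'n^'n" where
  "hermitian_of M = (\<chi> i j. Complex ((M$i$j + M$j$i) / 2) ((M$i$j - M$j$i) / 2))"

definition hermitian_lebesgue :: "(complex^'n^'n) measure" where
  "hermitian_lebesgue = distr lborel borel hermitian_of"

definition diag_matrix :: "real^'n \<Rightarrow> complex^'n^'n" where
  "diag_matrix lam = (\<chi> i j. if i = j then of_real (lam $ i) else 0)"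

text \<open>The power \<open>^\<close> on vectors acts componentwise, hence a separate matrix power.\<close>

definition mat_power :: "complex^'n^'n \<Rightarrow> nat \<Rightarrow> complex^'n^'n" where
  "mat_power A k = ((**) A ^^ k) (mat 1)"

definition gauss_weight :: "real^'n \<Rightarrow> complex^'n^'n \<Rightarrow> complex" where
  "gauss_weight lam X = exp (- trace (X ** X ** diag_matrix lam) / 2)"

definition gauss_expectation :: "real^'n \<Rightarrow> (complex^'n^'n \<Rightarrow> complex) \<Rightarrow> complex" where
  "gauss_expectation lam f =
     (LINT X|hermitian_lebesgue. f X * gauss_weight lam X) /
     (LINT X|hermitian_lebesgue. gauss_weight lam X)"

text \<open>Formal series are elements of \<open>complex fps fps\<close>. The inner variable is \<open>Q\<close>. The outer
  variable \<open>s\<close> records degrees: the coefficient of \<open>s ^ m\<close> is the part homogeneous of degree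
  \<open>- m / 2\<close> in \<open>\<lambda>\<close>. It arises from replacing \<open>\<Lambda>\<close> by \<open>\<Lambda> / s\<^sup>2\<close> and substituting \<open>X \<mapsto> s X\<close>,
  which preserves the Gaussian measure and turns \<open>Tr X\<^sup>3\<close> into \<open>s\<^sup>3 Tr X\<^sup>3\<close> and \<open>\<Lambda>\<^sup>-\<^sup>1 X\<close> into
  \<open>s\<^sup>3 \<Lambda>\<^sup>-\<^sup>1 X\<close>.\<close>

definition formal_exp :: "complex fps fps \<Rightarrow> complex fps fps" where
  "formal_exp f = Abs_fps (\<lambda>k. fps_const (fps_nth (fps_exp 1) k)) oo f"

definition formal_ln :: "complex fps fps \<Rightarrow> complex fps fps" where
  "formal_ln f = Abs_fps (\<lambda>k. fps_const (fps_nth (fps_ln 1) k)) oo (f - 1)"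

definition Q_monom :: "complex \<Rightarrow> nat \<Rightarrow> complex fps" where
  "Q_monom a b = fps_const a * fps_X ^ b"

definition kp_exponent :: "real^'n \<Rightarrow> complex^'n^'n \<Rightarrow> complex fps fps" where
  "kp_exponent lam X =
     fps_const (Q_monom (- trace (mat_power X 3) / fact 3) 0) * fps_X ^ 3 +
     (Abs_fps (\<lambda>k. if k = 0 then 0 else
        Q_monom (trace (mat_power (- (matrix_inv (diag_matrix lam) ** X)) k) / of_nat k) 1)
      oo fps_X ^ 3)"

definition tau :: "real^'n \<Rightarrow> complex fps fps" where
  "tau lam = Abs_fps (\<lambda>m. Abs_fps (\<lambda>b.
     gauss_expectation lam (\<lambda>X. fps_nth (fps_nth (formal_exp (kp_exponent lam X)) m) b)))"

definition free_energy :: "real^'n \<Rightarrow> complex fps fps" where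
  "free_energy lam = formal_ln (tau lam)"

text \<open>A function of degree \<open>- D\<close> in \<open>\<lambda>\<close> is placed in degree \<open>2 * D\<close> of the variable \<open>s\<close>. For
  \<open>W g b n\<close> one has \<open>D = 6 * g + 3 * n + 3 * b - 6\<close>, the number of edges of a trivalent
  graph; the subtraction does not truncate on \<open>ribbon_types\<close>.\<close>

definition W_degree :: "nat \<Rightarrow> nat \<Rightarrow> nat \<Rightarrow> nat" where
  "W_degree g b n = 6*g + 3*n + 3*b - 6"

definition homogeneous_neg :: "nat \<Rightarrow> nat \<Rightarrow> ((nat \<Rightarrow> real) \<Rightarrow> real) \<Rightarrow> bool" where
  "homogeneous_neg n D f \<longleftrightarrow>
     (\<forall>mu. \<forall>c>0. (\<forall>i\<in>{1..n}. mu i > 0) \<longrightarrow> f (\<lambda>i. c * mu i) = f mu / c ^ D)"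

end

theory Submission
  imports Defs "HOL-Probability.Probability" "HOL-Real_Asymp.Real_Asymp"
begin

text \<open>Both sides are generating functions of the same labelled combinatorial objects. On the volume
  side, the symplectic volume of a trivalent cell is constant relative to Lebesgue measure and the perimeters: the
  Pfaffian of \<open>\<Omega>\<close> against the determinant of a chart of metrics equals \<open>2 ^ (|V| / 2)\<close>. Hence the Laplace
  transform of a cell is \<open>2 ^ (|V| / 2)\<close> times a product over the edges of \<open>1 / (\<lambda> f + \<lambda> f')\<close>, where \<open>f\<close> and
  \<open>f'\<close> are the faces on the two sides of the edge and boundaries contribute \<open>0\<close>; orbit counting turns the sum
  over isomorphism classes into a sum over graphs with labelled half-edges.

  On the matrix side, the vertices \<open>Tr X\<^sup>3\<close> and \<open>Q Tr (- \<Lambda>\<^sup>-\<^sup>1 X)\<^sup>k\<close> are themselves sums over maps with loose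
  half-edges: a single trivalent vertex, and a boundary cycle of length \<open>k\<close> all of whose edges
  border a face, which produces the factors \<open>1 / \<lambda>\<close>. Wick's theorem glues the loose half-edges in
  pairs, and the exponential formula replaces arbitrary maps by connected ones, which is the
  passage from \<open>\<tau>\<close> to its logarithm.\<close>

section \<open>Determinants over finite index sets\<close>

text \<open>The exponent of the matrix model and its free energy are sums over the same objects, the
  coloured maps, and differ only in two parameters: the weight \<open>y\<close> of an edge between
  two faces and the matrix \<open>X\<close> on loose half-edges. At \<open>y = 0\<close> the
  connected maps are the single vertices and the wheels that make up the exponent; at
  \<open>y = 1\<close> and \<open>X = 0\<close> they are the closed graphs. One exponential formula
  therefore serves both exp and ln, and Wick's theorem leads from the first choice of parameters to
  the second. Constants are spread over half-edges: the covariance of matrix entries is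
  \<open>2 / (lam i + lam j)\<close>, and the \<open>sqrt 2\<close> per vertex that compensates it
  is also the symplectic constant \<open>2 ^ (|V| / 2)\<close>. Volumes are defined through
  arbitrary choices of basis, base point and starting half-edge, so only the ratio of the Pfaffian
  to a chart determinant is computed, and only up to sign. A sum over types captures every connected
  map only if each map has a genus; this is proved by building up the edge involution one
  transposition at a time.\<close>

definition idet :: "'i set => ('i => 'i => real) => real" where
 "idet I m = (\<Sum>p | p permutes I. of_int (sign p) * (\<Prod>i\<in>I. m i (p i)))"

lemma idet_cong:
 assumes "I = J" "!!i j. i : J ==> j : J ==> m i j = m' i j"
 shows "idet I m = idet J m'" unfolding idet_def using assms
 by (auto intro!: sum.cong arg_cong2[of _ _ _ _ "(*)"] prod.cong simp: permutes_in_image)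

lemma sign_compose_permutes:
 assumes "finite I" "p permutes I" "q permutes I"
 shows "sign (p \<circ> q) = sign p * sign q" using assms by (intro sign_compose) (auto simp: permutation_permutes)

lemma sign_inv_permutes: "finite I ==> p permutes I ==> sign (inv p) = sign p"
 by (intro sign_inverse) (auto simp: permutation_permutes)

lemma idet_transpose:
 assumes "finite I"
 shows "idet I (%i j. m j i) = idet I m"
proof -
 have "idet I m = (\<Sum>p | p permutes I. of_int (sign (inv p)) * (\<Prod>i\<in>I. m i (inv p i)))"
  unfolding idet_def by (subst sum_permutations_inverse) simp
 also have "... = (\<Sum>p | p permutes I. of_int (sign p) * (\<Prod>i\<in>I. m (p i) i))"
 proof (intro sum.cong arg_cong2[of _ _ _ _ "(*)"])
  fix p assume "p : {p. p permutes I}"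
  then have p: "p permutes I" by simp
  show "real_of_int (sign (inv p)) = real_of_int (sign p)" using sign_inv_permutes[OF assms p] by simp
  show "(\<Prod>i\<in>I. m i (inv p i)) = (\<Prod>i\<in>I. m (p i) i)" by (subst prod.permute[OF p]) (simp add: permutes_inverses[OF p])
 qed auto
 finally show ?thesis unfolding idet_def by simp
qed

lemma idet_permute_rows:
 assumes "finite I" "q permutes I"
 shows "idet I (%i. m (q i)) = of_int (sign q) * idet I m"
proof -
 have "idet I m = (\<Sum>p | p permutes I. of_int (sign (p \<circ> inv q)) * (\<Prod>i\<in>I. m i ((p \<circ> inv q) i)))" unfolding idet_def
  by (rule sum_permutations_compose_right[OF permutes_inv[OF assms(2)]])
 also have "... = (\<Sum>p | p permutes I. of_int (sign q) * (of_int (sign p) * (\<Prod>i\<in>I. m (q i) (p i))))"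
 proof (intro sum.cong)
  fix p assume "p : {p. p permutes I}"
  then have p: "p permutes I" by simp
  have "(\<Prod>i\<in>I. m i ((p \<circ> inv q) i)) = (\<Prod>i\<in>I. m (q i) (p i))"
   by (subst prod.permute[OF assms(2)]) (simp add: permutes_inverses[OF assms(2)])
  moreover have "sign (p \<circ> inv q) = sign p * sign q"
   using sign_compose_permutes[OF assms(1) p permutes_inv[OF assms(2)]] sign_inv_permutes[OF assms] by simp
  ultimately show "real_of_int (sign (p \<circ> inv q)) * (\<Prod>i\<in>I. m i ((p \<circ> inv q) i)) =
    of_int (sign q) * (of_int (sign p) * (\<Prod>i\<in>I. m (q i) (p i)))" by simp
 qed auto
 also have "... = of_int (sign q) * idet I (%i. m (q i))" unfolding idet_def by (simp add: sum_distrib_left)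
 finally have eq: "idet I m = of_int (sign q) * idet I (%i. m (q i))" .
 have "of_int (sign q) * idet I m = of_int (sign q * sign q) * idet I (%i. m (q i))"
  unfolding eq of_int_mult by (simp only: mult.assoc)
 then show ?thesis by (simp only: sign_idempotent of_int_1 mult_1_left)
qed

lemma idet_identical_rows:
 assumes "finite I" "i : I" "j : I" "i ~= j" "!!k. k : I ==> m i k = m j k"
 shows "idet I m = 0"
proof -
 have "idet I m = idet I (%k. m (Transposition.transpose i j k))"
 proof (rule idet_cong)
  fix k l assume "k : I" "l : I"
  then show "m k l = m (Transposition.transpose i j k) l" using assms(5)[of l] by (cases "k = i"; cases "k = j") auto
 qed simp
 also have "... = - idet I m" using assms by (subst idet_permute_rows) (auto simp: permutes_swap_id sign_swap_id)
 finally show ?thesis by simp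
qed

text \<open>Expanding a product of sums over a common finite index set runs over all choice
  functions. In an alternating expression the choices with a repetition cancel, which is the
  hypothesis \<open>zero\<close>, and an injective self-map of a finite set is a
  permutation.\<close>

lemma sum_PiE_permutes:
 fixes f :: "('i => 'i) => 'a :: comm_monoid_add"
 assumes "finite I" and zero: "!!g. g : I \<rightarrow>\<^sub>E I ==> \<not> inj_on g I ==> f g = 0"
 shows "(\<Sum>g\<in>I \<rightarrow>\<^sub>E I. f g) = (\<Sum>p | p permutes I. f (restrict p I))"
proof -
 have "(\<Sum>g\<in>I \<rightarrow>\<^sub>E I. f g) = (\<Sum>g\<in>(%p. restrict p I) ` {p. p permutes I}. f g)"
 proof (rule sum.mono_neutral_right)
  show "(%p. restrict p I) ` {p. p permutes I} \<subseteq> I \<rightarrow>\<^sub>E I" by (auto simp: permutes_in_image)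
  show "\<forall>g\<in>(I \<rightarrow>\<^sub>E I) - (%p. restrict p I) ` {p. p permutes I}. f g = 0"
  proof
   fix g assume g: "g : (I \<rightarrow>\<^sub>E I) - (%p. restrict p I) ` {p. p permutes I}"
   have "\<not> inj_on g I"
   proof
    assume inj: "inj_on g I"
    then have "g ` I = I" using g assms(1) by (intro endo_inj_surj) auto
    then have "(%i. if i : I then g i else i) permutes I"
     using inj by (intro bij_imp_permutes) (auto simp: bij_betw_def inj_on_def)
    moreover have "g = restrict (%i. if i : I then g i else i) I" using g by (auto simp: fun_eq_iff restrict_def)
    ultimately show False using g by blast
   qed
   then show "f g = 0" using g zero by blast
  qed
 qed (use assms(1) in \<open>auto intro: finite_PiE\<close>)
 also have "... = (\<Sum>p | p permutes I. f (restrict p I))"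
 proof (subst sum.reindex)
  show "inj_on (%p. restrict p I) {p. p permutes I}"
  proof (rule inj_onI, simp)
   fix p q assume pq: "p permutes I" "q permutes I" "restrict p I = restrict q I"
   show "p = q"
   proof
    fix x show "p x = q x" using pq(1,2) fun_cong[OF pq(3), of x] by (cases "x : I") (simp_all add: permutes_not_in)
   qed
  qed
 qed simp
 finally show ?thesis .
qed

text \<open>After expansion over choice functions \<open>g\<close>, the second factor becomes the
  determinant \<open>?D g\<close> of a matrix with rows selected by \<open>g\<close>. It vanishes
  when a row is selected twice and otherwise is \<open>idet I n\<close> times the sign of
  \<open>g\<close>.\<close>

lemma idet_mult:
 assumes "finite I"
 shows "idet I (%i k. \<Sum>j\<in>I. m i j * n j k) = idet I m * idet I n"
proof -
 let ?D = "%g. idet I (%i. n (g i))"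
 have "idet I (%i k. \<Sum>j\<in>I. m i j * n j k) =
   (\<Sum>p | p permutes I. of_int (sign p) * (\<Sum>g\<in>I \<rightarrow>\<^sub>E I. \<Prod>i\<in>I. m i (g i) * n (g i) (p i)))"
  unfolding idet_def using assms by (intro sum.cong refl) (simp add: prod_sum_PiE)
 also have "... = (\<Sum>g\<in>I \<rightarrow>\<^sub>E I. \<Sum>p | p permutes I. of_int (sign p) * (\<Prod>i\<in>I. m i (g i) * n (g i) (p i)))"
  by (subst sum.swap) (simp add: sum_distrib_left)
 also have "... = (\<Sum>g\<in>I \<rightarrow>\<^sub>E I. (\<Prod>i\<in>I. m i (g i)) * ?D g)"
  unfolding idet_def by (simp add: sum_distrib_left prod.distrib algebra_simps)
 also have "... = (\<Sum>p | p permutes I. (\<Prod>i\<in>I. m i (restrict p I i)) * ?D (restrict p I))"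
 proof (rule sum_PiE_permutes[OF assms])
  fix g assume "g : I \<rightarrow>\<^sub>E I" "\<not> inj_on g I"
  then obtain i j where "i : I" "j : I" "i ~= j" "g i = g j" by (auto simp: inj_on_def)
  then have "?D g = 0" using assms by (intro idet_identical_rows[of I i j]) auto
  then show "(\<Prod>i\<in>I. m i (g i)) * ?D g = 0" by simp
 qed
 also have "... = (\<Sum>p | p permutes I. (\<Prod>i\<in>I. m i (p i)) * ?D p)"
  by (auto intro!: sum.cong arg_cong2[of _ _ _ _ "(*)"] idet_cong prod.cong)
 also have "... = (\<Sum>p | p permutes I. (\<Prod>i\<in>I. m i (p i)) * (of_int (sign p) * idet I n))"
  using assms by (intro sum.cong) (auto simp: idet_permute_rows)
 also have "... = idet I m * idet I n"
  unfolding idet_def[of I m] by (simp add: sum_distrib_left sum_distrib_right algebra_simps)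
 finally show ?thesis .
qed

lemma permutes_split:
 assumes "p permutes A \<union> B" "A \<inter> B = {}" "p ` A \<subseteq> A" "finite A"
 shows "\<exists>q r. q permutes A \<and> r permutes B \<and> p = q \<circ> r"
proof -
 have pA: "p ` A = A" using assms by (intro endo_inj_surj) (auto intro: inj_on_subset[OF permutes_inj_on])
 let ?q = "%x. if x : A then p x else x" and ?r = "%x. if x : B then p x else x"
 have inj: "inj p" using assms(1) by (rule permutes_inj)
 have pB: "p ` B = B"
 proof -
  have "p ` B = p ` (A \<union> B - A)" using assms(2) by (intro arg_cong[where f = "(`) p"]) blast
  also have "... = p ` (A \<union> B) - p ` A" using inj by (rule image_set_diff)
  also have "... = B" unfolding pA permutes_image[OF assms(1)] using assms(2) by blast
  finally show ?thesis .
 qed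
 have "?q permutes A" using pA inj by (intro bij_imp_permutes) (auto simp: bij_betw_def inj_on_def inj_def)
 moreover have "?r permutes B" using pB inj by (intro bij_imp_permutes) (auto simp: bij_betw_def inj_on_def inj_def)
 moreover have "p = ?q \<circ> ?r"
 proof
  fix x show "p x = (?q \<circ> ?r) x" using assms pB by (cases "x : B") (auto simp: permutes_not_in)
 qed
 ultimately show ?thesis by blast
qed

text \<open>A permutation that moves some element of \<open>A\<close> into \<open>B\<close> picks a
  zero entry. The others preserve \<open>A\<close>, hence by finiteness also \<open>B\<close>, and
  factor uniquely with multiplicative sign.\<close>

lemma idet_block:
 assumes fin: "finite A" "finite B" and disj: "A \<inter> B = {}"
  and zero: "!!i j. i : A ==> j : B ==> m i j = 0"
 shows "idet (A \<union> B) m = idet A m * idet B m"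
proof -
 let ?f = "%p. of_int (sign p) * (\<Prod>i\<in>A \<union> B. m i (p i))"
 let ?S = "{p. p permutes A} \<times> {p. p permutes B}"
 have comp: "q \<circ> r permutes A \<union> B" if "q permutes A" "r permutes B" for q r
  by (rule permutes_compose) (use that in \<open>auto intro: permutes_subset\<close>)
 have val: "q (r x) = (if x : A then q x else r x)" if "q permutes A" "r permutes B" for q r x
  using that disj permutes_in_image[OF that(2), of x] by (cases "x : B"; cases "r x : A") (auto simp: permutes_not_in)
 have "idet (A \<union> B) m = sum ?f ((%(q, r). q \<circ> r) ` ?S)" unfolding idet_def
 proof (rule sum.mono_neutral_right)
  show "\<forall>p\<in>{p. p permutes A \<union> B} - (%(q, r). q \<circ> r) ` ?S. ?f p = 0"
  proof
   fix p assume p: "p : {p. p permutes A \<union> B} - (%(q, r). q \<circ> r) ` ?S"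
   have "\<not> p ` A \<subseteq> A"
   proof
    assume "p ` A \<subseteq> A"
    with p fin disj permutes_split[of p A B] show False by auto
   qed
   then obtain i where "i : A" "p i ~: A" by auto
   moreover from this have "p i : B" using p permutes_in_image[of p "A \<union> B" i] by auto
   ultimately have "(\<Prod>i\<in>A \<union> B. m i (p i)) = 0" using fin zero by (intro prod_zero) auto
   then show "?f p = 0" by simp
  qed
 qed (use fin comp in \<open>auto intro: finite_permutations\<close>)
 also have "... = (\<Sum>(q, r)\<in>?S. ?f (q \<circ> r))"
 proof (subst sum.reindex)
  show "inj_on (%(q, r). q \<circ> r) ?S"
  proof (rule inj_onI, clarsimp)
   fix q r q' r' assume p: "q permutes A" "r permutes B" "q' permutes A" "r' permutes B"
    and eq: "q \<circ> r = q' \<circ> r'"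
   have *: "q (r x) = q' (r' x)" for x using fun_cong[OF eq, of x] by simp
   have "q x = q' x" for x
    using *[of x] val[OF p(1,2)] val[OF p(3,4)] p by (cases "x : A") (auto simp: permutes_not_in)
   moreover have "r x = r' x" for x using *[of x] val[OF p(1,2)] val[OF p(3,4)] p disj
    by (cases "x : B"; cases "x : A") (auto simp: permutes_not_in)
   ultimately show "q = q' \<and> r = r'" by auto
  qed
 qed (auto intro!: sum.cong)
 also have "... = (\<Sum>(q, r)\<in>?S. (of_int (sign q) * (\<Prod>i\<in>A. m i (q i))) * (of_int (sign r) * (\<Prod>i\<in>B. m i (r i))))"
 proof (intro sum.cong refl, clarsimp)
  fix q r assume p: "q permutes A" "r permutes B"
  have "(\<Prod>i\<in>A \<union> B. m i (q (r i))) = (\<Prod>i\<in>A. m i (q i)) * (\<Prod>i\<in>B. m i (r i))"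
   using fin disj val[OF p] by (subst prod.union_disjoint) (auto intro!: arg_cong2[of _ _ _ _ "(*)"] prod.cong)
  moreover have "sign (q \<circ> r) = sign q * sign r"
   by (rule sign_compose_permutes[of "A \<union> B"]) (use fin p in \<open>auto intro: permutes_subset\<close>)
  ultimately show "real_of_int (sign (q \<circ> r)) * (\<Prod>i\<in>A \<union> B. m i (q (r i))) =
    (of_int (sign q) * (\<Prod>i\<in>A. m i (q i))) * (of_int (sign r) * (\<Prod>i\<in>B. m i (r i)))" by simp
 qed
 also have "... = idet A m * idet B m" unfolding idet_def by (simp add: sum_product sum.cartesian_product)
 finally show ?thesis .
qed

lemma idet_empty [simp]: "idet {} m = 1"
proof -
 have "{p. p permutes ({} :: 'a set)} = {id}" by simp
 then show ?thesis by (simp add: idet_def)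
qed

lemma idet_singleton [simp]: "idet {i} m = m i i"
proof -
 have "{p. p permutes {i}} = {id}" by simp
 then show ?thesis by (simp add: idet_def)
qed

text \<open>A row of minimal rank is zero off the diagonal and splits off as a block of size one.
  Ties in the rank are allowed and force zeros in both directions, so that a two-valued rank is
  enough for most uses below.\<close>

lemma idet_triangular:
 fixes r :: "'i => nat"
 assumes "finite I" "!!i j. i : I ==> j : I ==> i ~= j ==> r i \<le> r j ==> m i j = 0"
 shows "idet I m = (\<Prod>i\<in>I. m i i)" using assms
proof (induction I rule: finite_psubset_induct)
 case (psubset I)
 show ?case
 proof (cases "I = {}")
  case True
  show ?thesis unfolding True by simp
 next
  case False
  then obtain i where i: "i : I" "!!j. j : I ==> r i \<le> r j"
   using ex_min_if_finite[of "r ` I"] psubset.hyps(1) finite_imageI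
   by (metis (mono_tags) arg_min_if_finite(1) arg_min_least)
  have "idet I m = idet ({i} \<union> (I - {i})) m" using i by (simp add: insert_absorb)
  also have "... = idet {i} m * idet (I - {i}) m" using i psubset by (intro idet_block) auto
  also have "idet (I - {i}) m = (\<Prod>j\<in>I - {i}. m j j)" using i psubset.prems by (intro psubset.IH) auto
  also have "idet {i} m * ... = (\<Prod>i\<in>I. m i i)" using i psubset by (simp add: prod.remove)
  finally show ?thesis .
 qed
qed

lemma idet_diagonal:
 assumes "finite I" "!!i j. i : I ==> j : I ==> i ~= j ==> m i j = 0"
 shows "idet I m = (\<Prod>i\<in>I. m i i)" by (rule idet_triangular[where r = "%_. 0"]) (use assms in blast)+

lemma idet_reindex:
 assumes "bij_betw f J I" "finite J"
 shows "idet J (%i j. m (f i) (f j)) = idet I m"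
proof -
 have inj: "inj_on f J" and im: "f ` J = I" using assms(1) by (auto simp: bij_betw_def)
 have eq: "map_permutation J f = (%p x. if x : I then f (p (inv_into J f x)) else x)"
  unfolding map_permutation_def restrict_id_def im by (simp add: fun_eq_iff)
 have bij: "bij_betw (map_permutation J f) {p. p permutes J} {p. p permutes I}"
  unfolding eq by (rule bij_betw_permutations[OF assms(1)])
 have "idet I m = (\<Sum>p | p permutes J. of_int (sign (map_permutation J f p)) * (\<Prod>i\<in>I. m i (map_permutation J f p i)))"
  unfolding idet_def by (rule sum.reindex_bij_betw[OF bij, symmetric])
 also have "... = idet J (%i j. m (f i) (f j))" unfolding idet_def
 proof (intro sum.cong refl arg_cong2[of _ _ _ _ "(*)"])
  fix p assume "p : {p. p permutes J}"
  then have p: "p permutes J" by simp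
  show "real_of_int (sign (map_permutation J f p)) = real_of_int (sign p)"
   using sign_map_permutation[OF inj p assms(2)] by simp
  have "(\<Prod>i\<in>I. m i (map_permutation J f p i)) = (\<Prod>i\<in>J. m (f i) (map_permutation J f p (f i)))"
   by (rule prod.reindex_bij_betw[OF assms(1), symmetric])
  also have "... = (\<Prod>i\<in>J. m (f i) (f (p i)))" using inj im unfolding eq by (intro prod.cong) auto
  finally show "(\<Prod>i\<in>I. m i (map_permutation J f p i)) = (\<Prod>i\<in>J. m (f i) (f (p i)))" .
 qed
 finally show ?thesis by simp
qed

section \<open>Pfaffians\<close>

text \<open>Each division of the indices into unordered pairs is listed by
  \<open>2 ^ d * fact d\<close> permutations, with equal contributions when \<open>A\<close> is
  skew; hence this is the usual Pfaffian. It has the shape of \<open>Omega_power\<close> on a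
  basis.\<close>

definition pfaff :: "nat => (nat => nat => real) => real" where
 "pfaff d A = (\<Sum>p | p permutes {..<2*d}.
   of_int (sign p) * (\<Prod>i<d. A (p (2*i)) (p (2*i+1)))) / (2 ^ d * fact d)"

text \<open>Symplectic Gram-Schmidt: as long as some entry is nonzero, one hyperbolic pair is
  subtracted and two indices drop out. The bound \<open>2 * d\<close> allows \<open>d\<close> steps,
  and a form that becomes zero early is padded with zero pairs.\<close>

lemma darboux_decomposition:
 fixes A :: "'i => 'i => real"
 assumes "finite I" "card I \<le> 2 * d" "!!i j. i : I ==> j : I ==> A j i = - A i j"
 shows "\<exists>a b. \<forall>i\<in>I. \<forall>j\<in>I. A i j = (\<Sum>k<d. a k i * b k j - b k i * a k j)" using assms
proof (induction d arbitrary: I A)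
 case 0
 then show ?case by simp
next
 case (Suc d)
 show ?case
 proof (cases "\<forall>i\<in>I. \<forall>j\<in>I. A i j = 0")
  case True
  then show ?thesis by (intro exI[of _ "%_ _. 0"]) auto
 next
  case False
  then obtain i0 j0 where ij: "i0 : I" "j0 : I" "A i0 j0 ~= 0" by auto
  have diag: "A i i = 0" if "i : I" for i using Suc.prems(3)[of i i] that by simp
  have ne: "i0 ~= j0" using ij diag by auto
  \<comment> \<open>Normalised so that \<open>al i0 = 0\<close> and \<open>al j0 = 1\<close>: the
    pair reproduces the rows \<open>i0\<close> and \<open>j0\<close> of \<open>A\<close>, and
    \<open>A'\<close> vanishes there.\<close>
  define al where "al i = A i0 i / A i0 j0" for i
  define be where "be i = A j0 i" for i
  define A' where "A' i j = A i j - (al i * be j - be i * al j)" for i j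
  have sk: "A' j i = - A' i j" if "i : I" "j : I" for i j using Suc.prems(3)[OF that] by (simp add: A'_def)
  have card: "card (I - {i0, j0}) \<le> 2 * d" using Suc.prems(1,2) ij ne by (simp add: card_Diff_subset)
  have "\<exists>a b. \<forall>i\<in>I - {i0, j0}. \<forall>j\<in>I - {i0, j0}. A' i j = (\<Sum>k<d. a k i * b k j - b k i * a k j)"
  proof (rule Suc.IH)
   show "A' j i = - A' i j" if "i : I - {i0, j0}" "j : I - {i0, j0}" for i j using sk[of i j] that by simp
  qed (use Suc.prems(1) card in simp_all)
  then obtain a b where ab: "!!i j. i : I - {i0, j0} ==> j : I - {i0, j0} ==>
    A' i j = (\<Sum>k<d. a k i * b k j - b k i * a k j)" by blast
  \<comment> \<open>The forms supplied by induction are known only off \<open>i0\<close> and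
    \<open>j0\<close>; this cut-off makes them vanish there, in agreement with
    \<open>A'\<close>.\<close>
  define r where "r i = (if i : {i0, j0} then 0 else 1 :: real)" for i
  define a' where "a' k i = (if k < d then r i * a k i else al i)" for k i
  define b' where "b' k i = (if k < d then r i * b k i else be i)" for k i
  have row: "A' i0 j = 0" "A' j0 j = 0" if "j : I" for j
   using ij that diag[OF ij(1)] diag[OF ij(2)] Suc.prems(3)[OF ij(1,2)] by (auto simp: A'_def al_def be_def)
  have "A i j = (\<Sum>k<Suc d. a' k i * b' k j - b' k i * a' k j)" if "i : I" "j : I" for i j
  proof -
   have "A' i j = (\<Sum>k<d. a' k i * b' k j - b' k i * a' k j)"
   proof (cases "i : {i0, j0} \<or> j : {i0, j0}")
    case True
    then have "A' i j = 0" using row[OF that(1)] row[OF that(2)] sk[OF that] by auto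
    moreover have "(\<Sum>k<d. a' k i * b' k j - b' k i * a' k j) = 0"
     using True by (intro sum.neutral) (auto simp: a'_def b'_def r_def)
    ultimately show ?thesis by simp
   next
    case False
    then show ?thesis using ab[of i j] that by (simp add: a'_def b'_def r_def)
   qed
   then show ?thesis by (simp add: A'_def a'_def b'_def)
  qed
  then show ?thesis by blast
 qed
qed

lemma prod_lessThan_double: "(\<Prod>r<2*d. f r) = (\<Prod>i<d. f (2*i) * f (2*i+1))" for f :: "nat => 'a :: comm_monoid_mult"
 by (induction d) (auto simp: algebra_simps)

text \<open>Exchanging the two members of pair \<open>m\<close> is an odd permutation of the
  summation index, so the subtracted term sums to minus the original one. Each antisymmetrised pair
  contributes a factor 2; the induction treats the pairs one at a time.\<close>

lemma alternating_sum_pairs: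
 fixes f :: "nat => nat => nat => real"
 assumes "m \<le> d"
 shows "(\<Sum>p | p permutes {..<2*d}. of_int (sign p) *
   (\<Prod>i<d. if i < m then f i (p (2*i)) (p (2*i+1)) - f i (p (2*i+1)) (p (2*i)) else f i (p (2*i)) (p (2*i+1)))) =
  2 ^ m * (\<Sum>p | p permutes {..<2*d}. of_int (sign p) * (\<Prod>i<d. f i (p (2*i)) (p (2*i+1))))" using assms
proof (induction m)
 case (Suc m)
 let ?S = "{p. p permutes {..<2*d}}"
 define g where "g p i = (if i < m then f i (p (2*i)) (p (2*i+1)) - f i (p (2*i+1)) (p (2*i)) else f i (p (2*i)) (p (2*i+1)))"
  for p :: "nat => nat" and i
 define h where "h p i = (if i < Suc m then f i (p (2*i)) (p (2*i+1)) - f i (p (2*i+1)) (p (2*i)) else f i (p (2*i)) (p (2*i+1)))"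
  for p :: "nat => nat" and i
 define t where "t = Transposition.transpose (2*m) (2*m+1)"
 have t: "t permutes {..<2*d}" unfolding t_def by (rule permutes_swap_id) (use Suc.prems in simp_all)
 have ts: "sign t = -1" unfolding t_def by (simp add: sign_swap_id)
 have m: "m : {..<d}" using Suc.prems by simp
 have split: "(\<Prod>i<d. h p i) = (\<Prod>i<d. g p i) - (\<Prod>i<d. g (p \<circ> t) i)" for p
 proof -
  have off: "g (p \<circ> t) i = g p i" "h p i = g p i" if "i ~= m" for i
  proof -
   have "2 * i ~= 2 * m + 1" "2 * i + 1 ~= 2 * m" by presburger+
   then have "t (2*i) = 2*i" "t (2*i+1) = 2*i+1" using that unfolding t_def by (simp_all add: transpose_apply_other)
   then show "g (p \<circ> t) i = g p i" by (simp add: g_def)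
   show "h p i = g p i" using that by (simp add: g_def h_def)
  qed
  have on: "h p m = g p m - g (p \<circ> t) m" by (simp add: t_def g_def h_def)
  have "(\<Prod>i\<in>{..<d} - {m}. h p i) = (\<Prod>i\<in>{..<d} - {m}. g p i)" by (rule prod.cong) (use off in simp_all)
  moreover have "(\<Prod>i\<in>{..<d} - {m}. g (p \<circ> t) i) = (\<Prod>i\<in>{..<d} - {m}. g p i)" by (rule prod.cong) (use off in simp_all)
  ultimately show ?thesis unfolding prod.remove[OF finite_lessThan m] on by (simp add: left_diff_distrib)
 qed
 have "(\<Sum>p\<in>?S. of_int (sign p) * (\<Prod>i<d. h p i)) =
   (\<Sum>p\<in>?S. of_int (sign p) * (\<Prod>i<d. g p i)) - (\<Sum>p\<in>?S. of_int (sign p) * (\<Prod>i<d. g (p \<circ> t) i))"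
  unfolding split by (simp add: right_diff_distrib sum_subtractf)
 also have "(\<Sum>p\<in>?S. of_int (sign p) * (\<Prod>i<d. g (p \<circ> t) i)) =
   - (\<Sum>p\<in>?S. of_int (sign (p \<circ> t)) * (\<Prod>i<d. g (p \<circ> t) i))" unfolding sum_negf[symmetric]
  by (intro sum.cong refl) (use sign_compose_permutes[OF finite_lessThan _ t] ts in simp)
 also have "(\<Sum>p\<in>?S. of_int (sign (p \<circ> t)) * (\<Prod>i<d. g (p \<circ> t) i)) =
   (\<Sum>p\<in>?S. of_int (sign p) * (\<Prod>i<d. g p i))" by (rule sum_permutations_compose_right[OF t, symmetric])
 finally show ?case using Suc unfolding g_def h_def by simp
qed simp

text \<open>In Darboux form \<open>A\<close> is the transpose of \<open>C\<close> times the standard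
  symplectic matrix \<open>J\<close> times \<open>C\<close>. The alternating sum in the Pfaffian
  reassembles into the determinant of \<open>C\<close>, and the determinant of \<open>A\<close> is
  that of \<open>J\<close> times its square. Only the absolute value of the determinant of
  \<open>J\<close> enters.\<close>

lemma pfaff_square:
 assumes "!!i j. i < 2 * d ==> j < 2 * d ==> A j i = - A i j"
 shows "(pfaff d A)\<^sup>2 = \<bar>idet {..<2*d} A\<bar>"
proof -
 have "\<exists>a b. \<forall>i\<in>{..<2*d}. \<forall>j\<in>{..<2*d}. A i j = (\<Sum>k<d. a k i * b k j - b k i * a k j)"
  by (rule darboux_decomposition) (simp, simp, rule assms, simp_all)
 then obtain a b where ab: "!!i j. i < 2 * d ==> j < 2 * d ==> A i j = (\<Sum>k<d. a k i * b k j - b k i * a k j)"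
  unfolding Ball_def lessThan_iff by blast
 define C where "C g r j = (if even r then a (g (r div 2)) j else b (g (r div 2)) j)" for g :: "nat => nat" and r j :: nat
 define D where "D g = idet {..<2*d} (C g)" for g
 have D_sum: "D g = (\<Sum>p | p permutes {..<2*d}. of_int (sign p) * (\<Prod>i<d. a (g i) (p (2*i)) * b (g i) (p (2*i+1))))" for g
  unfolding D_def idet_def by (simp add: prod_lessThan_double C_def)
 \<comment> \<open>Two pairs of rows are exchanged by two transpositions, an even permutation, so
   the order of the Darboux pairs does not affect the determinant.\<close>
 have D_swap: "D (g \<circ> Transposition.transpose x y) = D g" if "x < d" "y < d" for g x y
 proof (cases "x = y")
  case False
  define q1 where "q1 = Transposition.transpose (2*x) (2*y)"
  define q2 where "q2 = Transposition.transpose (2*x+1) (2*y+1)"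
  have q: "q1 permutes {..<2*d}" "q2 permutes {..<2*d}"
   unfolding q1_def q2_def by (rule permutes_swap_id; use that in simp)+
  have "C (g \<circ> Transposition.transpose x y) = (%r. C g ((q1 \<circ> q2) r))"
  proof (intro ext)
   fix r j :: nat
   show "C (g \<circ> Transposition.transpose x y) r j = C g ((q1 \<circ> q2) r) j"
   proof (cases "even r")
    case True
    then obtain i where r: "r = 2 * i" by blast
    have "q2 r = r" unfolding q2_def r by (rule transpose_apply_other) presburger+
    moreover have "q1 r = 2 * Transposition.transpose x y i"
     unfolding q1_def r by (auto simp: Transposition.transpose_def)
    ultimately show ?thesis by (simp add: C_def r)
   next
    case odd: False
    then obtain i where r: "r = 2 * i + 1" using oddE by blast
    have "q2 r = 2 * Transposition.transpose x y i + 1" unfolding q2_def r by (auto simp: Transposition.transpose_def)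
    moreover have "q1 (2 * k + 1) = 2 * k + 1" for k unfolding q1_def by (rule transpose_apply_other) presburger+
    ultimately show ?thesis by (simp add: C_def r)
   qed
  qed
  then have "D (g \<circ> Transposition.transpose x y) = of_int (sign (q1 \<circ> q2)) * D g"
   unfolding D_def using idet_permute_rows[OF finite_lessThan permutes_compose[OF q(2,1)], of "C g"] by simp
  also have "sign (q1 \<circ> q2) = 1"
   using sign_compose_permutes[OF finite_lessThan q] False by (simp add: q1_def q2_def sign_swap_id)
  finally show ?thesis by (simp only: of_int_1 mult_1_left)
 qed simp
 have D_perm: "D g = D id" if "g permutes {..<d}" for g using finite_lessThan that
 proof (induction rule: permutes_rev_induct)
  case (swap x y p)
  then show ?case using D_swap[of x y p] by (simp only: lessThan_iff)
 qed (rule refl)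
 have D_cong: "D g = D g'" if "!!i. i < d ==> g i = g' i" for g g'
  unfolding D_sum using that by (intro sum.cong refl) simp
 have "(\<Sum>p | p permutes {..<2*d}. of_int (sign p) * (\<Prod>i<d. A (p (2*i)) (p (2*i+1)))) =
   (\<Sum>p | p permutes {..<2*d}. of_int (sign p) *
    (\<Sum>g\<in>{..<d} \<rightarrow>\<^sub>E {..<d}. \<Prod>i<d. a (g i) (p (2*i)) * b (g i) (p (2*i+1)) - b (g i) (p (2*i)) * a (g i) (p (2*i+1))))"
 proof (intro sum.cong refl arg_cong2[of _ _ _ _ "(*)"])
  fix p assume "p : {p. p permutes {..<2*d}}"
  then have p: "p i < 2 * d \<longleftrightarrow> i < 2 * d" for i using permutes_in_image[of p "{..<2*d}" i] by simp
  have "(\<Prod>i<d. A (p (2*i)) (p (2*i+1))) = (\<Prod>i<d. \<Sum>k<d. a k (p (2*i)) * b k (p (2*i+1)) - b k (p (2*i)) * a k (p (2*i+1)))"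
   by (intro prod.cong refl ab) (simp_all add: p)
  then show "(\<Prod>i<d. A (p (2*i)) (p (2*i+1))) = (\<Sum>g\<in>{..<d} \<rightarrow>\<^sub>E {..<d}. \<Prod>i<d. a (g i) (p (2*i)) * b (g i) (p (2*i+1)) - b (g i) (p (2*i)) * a (g i) (p (2*i+1)))"
   by (simp add: prod_sum_PiE)
 qed
 also have "... = (\<Sum>g\<in>{..<d} \<rightarrow>\<^sub>E {..<d}. \<Sum>p | p permutes {..<2*d}. of_int (sign p) *
    (\<Prod>i<d. a (g i) (p (2*i)) * b (g i) (p (2*i+1)) - b (g i) (p (2*i)) * a (g i) (p (2*i+1))))"
  unfolding sum_distrib_left by (rule sum.swap)
 also have "... = (\<Sum>g\<in>{..<d} \<rightarrow>\<^sub>E {..<d}. 2 ^ d * D g)"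
 proof (intro sum.cong refl)
  fix g
  show "(\<Sum>p | p permutes {..<2*d}. of_int (sign p) *
    (\<Prod>i<d. a (g i) (p (2*i)) * b (g i) (p (2*i+1)) - b (g i) (p (2*i)) * a (g i) (p (2*i+1)))) = 2 ^ d * D g"
  proof -
   have *: "(\<Prod>i<d. a (g i) (p (2*i)) * b (g i) (p (2*i+1)) - b (g i) (p (2*i)) * a (g i) (p (2*i+1))) =
     (\<Prod>i<d. if i < d then a (g i) (p (2*i)) * b (g i) (p (2*i+1)) - a (g i) (p (2*i+1)) * b (g i) (p (2*i))
       else a (g i) (p (2*i)) * b (g i) (p (2*i+1)))" for p by (intro prod.cong refl) (simp add: mult.commute)
   show ?thesis
    unfolding * D_sum by (rule alternating_sum_pairs[of d d "%i x y. a (g i) x * b (g i) y", OF order_refl])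
  qed
 qed
 also have "... = (\<Sum>g | g permutes {..<d}. 2 ^ d * D (restrict g {..<d}))"
 proof (rule sum_PiE_permutes)
  fix g assume g: "g : {..<d} \<rightarrow>\<^sub>E {..<d}" "\<not> inj_on g {..<d}"
  then obtain i j where "i < d" "j < d" "i ~= j" "g i = g j" by (auto simp: inj_on_def)
  then have "D g = 0" unfolding D_def by (intro idet_identical_rows[of _ "2*i" "2*j"]) (auto simp: C_def)
  then show "2 ^ d * D g = 0" by simp
 qed simp
 also have "... = (\<Sum>g | g permutes {..<d}. 2 ^ d * D id)"
 proof (intro sum.cong refl)
  fix g assume "g : {g. g permutes {..<d}}"
  then show "2 ^ d * D (restrict g {..<d}) = 2 ^ d * D id" using D_perm[of g] D_cong[of "restrict g {..<d}" g] by simp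
 qed
 also have "... = fact d * (2 ^ d * D id)" by (simp add: card_permutations[of "{..<d}" d])
 finally have pf: "pfaff d A = D id" unfolding pfaff_def by simp
 \<comment> \<open>The standard symplectic matrix. Its square is minus the identity, which has
   determinant \<open>1\<close> in even dimension, so its own determinant is \<open>1\<close> or
   \<open>-1\<close>.\<close>
 define J where "J r s = (if even r \<and> s = r + 1 then 1 else if odd r \<and> s = r - 1 then -1 else 0 :: real)" for r s :: nat
 have pairs: "(\<Sum>r<2*d. f r) = (\<Sum>k<d. f (2*k) + f (2*k+1))" for f :: "nat => real"
  by (induction d) (auto simp: algebra_simps)
 have Jsum: "(\<Sum>s<2*d. J r s * f s) = (if even r then f (r + 1) else - f (r - 1))" if "r < 2*d" for r and f :: "nat => real"
 proof (cases "even r")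
  case True
  then have "r + 1 < 2 * d" using that by presburger
  then show ?thesis using True by (simp add: J_def if_distrib[of "%x. x * _"] sum.delta cong: if_cong)
 next
  case False
  then have "r - 1 < 2 * d" using that by simp
  then show ?thesis using False by (simp add: J_def if_distrib[of "%x. x * _"] sum.delta cong: if_cong)
 qed
 have "idet {..<2*d} J * idet {..<2*d} J = idet {..<2*d} (%r s. \<Sum>t<2*d. J r t * J t s)"
  by (rule idet_mult[symmetric]) simp
 also have "... = idet {..<2*d} (%r s. if r = s then -1 else 0)"
 proof (rule idet_cong)
  fix r s assume rs: "r : {..<2*d}" "s : {..<2*d}"
  then have "(\<Sum>t<2*d. J r t * J t s) = (if even r then J (r + 1) s else - J (r - 1) s)" by (intro Jsum) simp
  also have "... = (if r = s then -1 else 0)" by (cases "even r") (auto simp: J_def elim!: oddE)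
  finally show "(\<Sum>t<2*d. J r t * J t s) = (if r = s then -1 else 0)" .
 qed simp
 also have "... = 1" by (subst idet_diagonal) auto
 finally have "(idet {..<2*d} J)\<^sup>2 = 1" by (simp add: power2_eq_square)
 then have J1: "\<bar>idet {..<2*d} J\<bar> = 1" unfolding power2_eq_1_iff by auto
 have "idet {..<2*d} A = idet {..<2*d} (%i j. \<Sum>r<2*d. C id r i * (\<Sum>s<2*d. J r s * C id s j))"
 proof (rule idet_cong)
  fix i j assume ij: "i : {..<2*d}" "j : {..<2*d}"
  have "(\<Sum>r<2*d. C id r i * (\<Sum>s<2*d. J r s * C id s j)) =
    (\<Sum>r<2*d. C id r i * (if even r then C id (r + 1) j else - C id (r - 1) j))"
   by (intro sum.cong refl) (simp add: Jsum)
  also have "... = (\<Sum>k<d. a k i * b k j - b k i * a k j)" unfolding pairs by (intro sum.cong refl) (simp add: C_def)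
  finally show "A i j = (\<Sum>r<2*d. C id r i * (\<Sum>s<2*d. J r s * C id s j))" using ab ij by simp
 qed simp
 also have "... = idet {..<2*d} (%i r. C id r i) * idet {..<2*d} (%r j. \<Sum>s<2*d. J r s * C id s j)"
  by (rule idet_mult) simp
 also have "... = D id * (idet {..<2*d} J * D id)"
  unfolding D_def by (simp only: idet_transpose[OF finite_lessThan, of _ "C id"] idet_mult[OF finite_lessThan])
 finally show ?thesis using J1 by (simp add: pf abs_mult power2_eq_square)
qed

section \<open>Affine changes of variables in finite products of Lebesgue measure\<close>

interpretation lb: product_sigma_finite "%_. lborel :: real measure" ..

abbreviation lebn :: "'i set => ('i => real) measure" where
 "lebn I \<equiv> PiM I (%_. lborel)"

lemma nn_integral_lebn_reindex:
 assumes g: "bij_betw g I J" and I: "finite I" and f: "f : borel_measurable (lebn I)"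
 shows "(\<integral>\<^sup>+x. f (\<lambda>i\<in>I. x (g i)) \<partial>lebn J) = (\<integral>\<^sup>+x. f x \<partial>lebn I)"
proof -
 have J: "finite J" using bij_betw_finite[OF g] I by simp
 have gJ: "g i : J" if "i : I" for i using g that by (auto simp: bij_betw_def)
 have meas: "(%x. \<lambda>i\<in>I. x (g i)) : measurable (lebn J) (lebn I)"
  using gJ by (intro measurable_restrict) (auto intro: measurable_component_singleton)
 have "distr (lebn J) (lebn I) (%x. \<lambda>i\<in>I. x (g i)) = lebn I"
 proof (rule lb.PiM_eqI[OF I])
  fix A :: "'a => real set" assume A: "!!i. i : I ==> A i : sets lborel"
  let ?h = "inv_into I g"
  have h: "?h j : I" "g (?h j) = j" if "j : J" for j
   using g that by (auto simp: bij_betw_def inv_into_into f_inv_into_f)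
  have hg: "?h (g i) = i" if "i : I" for i using g that by (simp add: bij_betw_def)
  have "(%x. \<lambda>i\<in>I. x (g i)) -` Pi\<^sub>E I A \<inter> space (lebn J) = Pi\<^sub>E J (%j. A (?h j))"
  proof (intro set_eqI iffI)
   fix x assume x: "x : (%x. \<lambda>i\<in>I. x (g i)) -` Pi\<^sub>E I A \<inter> space (lebn J)"
   show "x : Pi\<^sub>E J (%j. A (?h j))"
   proof (rule PiE_I)
    fix j assume j: "j : J"
    have "(\<lambda>i\<in>I. x (g i)) : Pi\<^sub>E I A" using x by simp
    from PiE_mem[OF this h(1)[OF j]] show "x j : A (?h j)" using h[OF j] by simp
   qed (use x in \<open>auto simp: space_PiM PiE_def extensional_def\<close>)
  next
   fix x assume x: "x : Pi\<^sub>E J (%j. A (?h j))"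
   have "x (g i) : A i" if "i : I" for i using PiE_mem[OF x gJ[OF that]] hg[OF that] by simp
   then show "x : (%x. \<lambda>i\<in>I. x (g i)) -` Pi\<^sub>E I A \<inter> space (lebn J)"
    using x by (auto simp: space_PiM PiE_def extensional_def)
  qed
  then have "emeasure (distr (lebn J) (lebn I) (%x. \<lambda>i\<in>I. x (g i))) (Pi\<^sub>E I A) = emeasure (lebn J) (Pi\<^sub>E J (%j. A (?h j)))"
   using A I by (subst emeasure_distr[OF meas]) (auto intro!: sets_PiM_I_finite)
  also have "... = (\<Prod>j\<in>J. emeasure lborel (A (?h j)))" using J A h by (intro lb.emeasure_PiM) auto
  also have "... = (\<Prod>i\<in>I. emeasure lborel (A i))"
   using hg by (subst prod.reindex_bij_betw[OF g, symmetric]) (simp cong: prod.cong)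
  finally show "emeasure (distr (lebn J) (lebn I) (%x. \<lambda>i\<in>I. x (g i))) (Pi\<^sub>E I A) = (\<Prod>i\<in>I. emeasure lborel (A i))" .
 qed simp
 then have "(\<integral>\<^sup>+x. f x \<partial>lebn I) = (\<integral>\<^sup>+x. f x \<partial>distr (lebn J) (lebn I) (%x. \<lambda>i\<in>I. x (g i)))" by simp
 also have "... = (\<integral>\<^sup>+x. f (\<lambda>i\<in>I. x (g i)) \<partial>lebn J)" by (rule nn_integral_distr) (use meas f in simp_all)
 finally show ?thesis by simp
qed

definition affine_map :: "'i set => ('i => 'i => real) => ('i => real) => ('i => real) => 'i => real" where
 "affine_map I m b x = (\<lambda>i\<in>I. (\<Sum>j\<in>I. m i j * x j) + b i)"

lemma measurable_affine_map [measurable]: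
 "affine_map I m b : measurable (lebn I) (lebn I)" unfolding affine_map_def[abs_def] by measurable

text \<open>Schur complement: the unipotent matrix \<open>C\<close> subtracts multiples of column
  \<open>i0\<close> from the others and thereby clears row \<open>i0\<close> apart from the
  pivot.\<close>

lemma idet_pivot:
 assumes I: "finite I" "i0 ~: I" and m0: "m i0 i0 ~= 0"
 shows "idet (insert i0 I) m = m i0 i0 * idet I (%i j. m i j - m i i0 * m i0 j / m i0 i0)"
proof -
 let ?J = "insert i0 I"
 define C where "C i j = (if i = j then 1 else if i = i0 then - m i0 j / m i0 i0 else 0)" for i j
 have "idet ?J C = (\<Prod>i\<in>?J. C i i)"
  by (rule idet_triangular[where r = "%i. if i = i0 then 1 else 0"]) (use I in \<open>auto simp: C_def\<close>)
 then have C1: "idet ?J C = 1" by (simp add: C_def)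
 have mC: "(\<Sum>k\<in>?J. m i k * C k j) = (if j = i0 then m i i0 else m i j - m i i0 * m i0 j / m i0 i0)" if "j : ?J" for i j
 proof -
  have "(\<Sum>k\<in>?J. m i k * C k j) = m i i0 * C i0 j + (\<Sum>k\<in>I. m i k * C k j)" using I by simp
  also have "(\<Sum>k\<in>I. m i k * C k j) = (\<Sum>k\<in>I. if k = j then m i j else 0)"
   using I by (intro sum.cong) (auto simp: C_def)
  also have "... = (if j : I then m i j else 0)" using I by simp
  finally show ?thesis using that I by (auto simp: C_def)
 qed
 have "idet ?J m = idet ?J m * idet ?J C" using C1 by simp
 also have "... = idet ?J (%i j. \<Sum>k\<in>?J. m i k * C k j)" using I by (intro idet_mult[symmetric]) simp
 also have "... = idet ({i0} \<union> I) (%i j. if j = i0 then m i i0 else m i j - m i i0 * m i0 j / m i0 i0)"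
  by (rule idet_cong) (use mC in auto)
 also have "... = m i0 i0 * idet I (%i j. if j = i0 then m i i0 else m i j - m i i0 * m i0 j / m i0 i0)"
  using I m0 by (subst idet_block) auto
 also have "idet I (%i j. if j = i0 then m i i0 else m i j - m i i0 * m i0 j / m i0 i0) =
   idet I (%i j. m i j - m i i0 * m i0 j / m i0 i0)" by (rule idet_cong) (use I in auto)
 finally show ?thesis .
qed

text \<open>With the other coordinates fixed, coordinate \<open>i0\<close> of the image is an affine
  function of \<open>y\<close> with slope \<open>d\<close>. Substituting it first leaves, on
  \<open>I\<close>, an affine map whose matrix is the Schur complement. Its translation part depends
  on the value \<open>u\<close> just substituted, which is why the induction hypothesis must hold
  for every \<open>b\<close>.\<close>

lemma nn_integral_affine_map_pivot:
 assumes I: "finite I" "i0 ~: I" and f: "f : borel_measurable (lebn (insert i0 I))"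
  and m0: "m i0 i0 ~= 0" and det: "idet (insert i0 I) m ~= 0"
  and IH: "!!f m b. f : borel_measurable (lebn I) ==> idet I m ~= 0 ==>
   (\<integral>\<^sup>+x. f (affine_map I m b x) \<partial>lebn I) = ennreal (1 / \<bar>idet I m\<bar>) * (\<integral>\<^sup>+x. f x \<partial>lebn I)"
 shows "(\<integral>\<^sup>+x. f (affine_map (insert i0 I) m b x) \<partial>lebn (insert i0 I)) =
  ennreal (1 / \<bar>idet (insert i0 I) m\<bar>) * (\<integral>\<^sup>+x. f x \<partial>lebn (insert i0 I))"
proof -
 let ?J = "insert i0 I"
 define d where "d = m i0 i0"
 define m' where "m' i j = m i j - m i i0 * m i0 j / m i0 i0" for i j
 define b' where "b' u i = m i i0 / d * u + (b i - m i i0 * b i0 / d)" for u i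
 define s where "s x = (\<Sum>j\<in>I. m i0 j * x j) + b i0" for x :: "'a => real"
 define h where "h x = f ((affine_map I m' (b' (x i0)) x)(i0 := x i0))" for x
 have d: "d ~= 0" using m0 by (simp add: d_def)
 have det': "idet ?J m = d * idet I m'" unfolding d_def m'_def using idet_pivot[OF I, of m] m0 by simp
 have upd: "(%x. (affine_map I m' (b' (x i0)) x)(i0 := x i0)) : measurable (lebn ?J) (lebn ?J)"
 proof -
  have "(%x. (affine_map I m' (b' (x i0)) x)(i0 := x i0)) =
    (%x. \<lambda>i\<in>?J. if i = i0 then x i0 else (\<Sum>j\<in>I. m' i j * x j) + b' (x i0) i)"
   using I by (auto simp: affine_map_def fun_eq_iff)
  also have "... : measurable (lebn ?J) (lebn ?J)" unfolding b'_def by measurable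
  finally show ?thesis .
 qed
 have hm: "h : borel_measurable (lebn ?J)" unfolding h_def[abs_def] using measurable_compose[OF upd f] by simp
 have split: "f (affine_map ?J m b (x(i0 := y))) = h (x(i0 := s x + d * y))" for x y
 proof -
  have off: "(\<Sum>j\<in>I. c j * (if j = i0 then z else x j)) = (\<Sum>j\<in>I. c j * x j)" for c z using I by (intro sum.cong) auto
  have "affine_map ?J m b (x(i0 := y)) =
    (affine_map I m' (b' (s x + d * y)) (x(i0 := s x + d * y)))(i0 := s x + d * y)"
  proof
   fix i
   consider "i = i0" | "i : I" "i ~= i0" | "i ~: ?J" using I by auto
   then show "affine_map ?J m b (x(i0 := y)) i =
    ((affine_map I m' (b' (s x + d * y)) (x(i0 := s x + d * y)))(i0 := s x + d * y)) i"
   proof cases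
    case 1
    then show ?thesis using I by (simp add: affine_map_def off s_def d_def)
   next
    case 2
    have "(\<Sum>j\<in>I. m' i j * x j) = (\<Sum>j\<in>I. m i j * x j) - m i i0 / d * (\<Sum>j\<in>I. m i0 j * x j)"
     by (simp add: m'_def d_def left_diff_distrib sum_subtractf sum_distrib_left mult.assoc)
    moreover have "m i i0 / d * (s x + d * y) = m i i0 / d * (\<Sum>j\<in>I. m i0 j * x j) + m i i0 * b i0 / d + m i i0 * y"
     using d by (simp add: s_def distrib_left)
    ultimately show ?thesis using 2 I by (simp add: affine_map_def off b'_def)
   qed (auto simp: affine_map_def)
  qed
  then show ?thesis unfolding h_def by simp
 qed
 have fT: "(%x. f (affine_map ?J m b x)) : borel_measurable (lebn ?J)"
  using measurable_compose[OF measurable_affine_map f] by simp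
 have "(\<integral>\<^sup>+x. f (affine_map ?J m b x) \<partial>lebn ?J) = (\<integral>\<^sup>+x. \<integral>\<^sup>+y. h (x(i0 := s x + d * y)) \<partial>lborel \<partial>lebn I)"
  using I fT by (subst lb.product_nn_integral_insert) (simp_all add: split)
 also have "... = (\<integral>\<^sup>+x. ennreal (1 / \<bar>d\<bar>) * (\<integral>\<^sup>+u. h (x(i0 := u)) \<partial>lborel) \<partial>lebn I)"
 proof (intro nn_integral_cong)
  fix x assume x: "x : space (lebn I)"
  have hx: "(%u. h (x(i0 := u))) : borel_measurable borel"
  proof -
   have "(%u. x(i0 := u)) : measurable lborel (lebn ?J)" using x I by (intro measurable_fun_upd[of ?J I]) auto
   from measurable_compose[OF this hm] show ?thesis by simp
  qed
  have "(\<integral>\<^sup>+u. h (x(i0 := u)) \<partial>lborel) = ennreal \<bar>d\<bar> * (\<integral>\<^sup>+y. h (x(i0 := s x + d * y)) \<partial>lborel)"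
   by (rule nn_integral_real_affine[OF hx d])
  then have "ennreal (1 / \<bar>d\<bar>) * (\<integral>\<^sup>+u. h (x(i0 := u)) \<partial>lborel) =
    ennreal (1 / \<bar>d\<bar> * \<bar>d\<bar>) * (\<integral>\<^sup>+y. h (x(i0 := s x + d * y)) \<partial>lborel)"
   by (subst ennreal_mult) (auto simp: mult.assoc)
  then show "(\<integral>\<^sup>+y. h (x(i0 := s x + d * y)) \<partial>lborel) = ennreal (1 / \<bar>d\<bar>) * (\<integral>\<^sup>+u. h (x(i0 := u)) \<partial>lborel)"
   using d by simp
 qed
 also have "... = ennreal (1 / \<bar>d\<bar>) * (\<integral>\<^sup>+x. \<integral>\<^sup>+u. h (x(i0 := u)) \<partial>lborel \<partial>lebn I)"
 proof (rule nn_integral_cmult)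
  have "(%(x, u). h (x(i0 := u))) : borel_measurable (lebn I \<Otimes>\<^sub>M lborel)"
   using measurable_compose[OF measurable_add_dim hm] by (simp add: case_prod_beta')
  then show "(%x. \<integral>\<^sup>+u. h (x(i0 := u)) \<partial>lborel) : borel_measurable (lebn I)"
   by (simp add: lborel.borel_measurable_nn_integral)
 qed
 also have "(\<integral>\<^sup>+x. \<integral>\<^sup>+u. h (x(i0 := u)) \<partial>lborel \<partial>lebn I) = (\<integral>\<^sup>+u. \<integral>\<^sup>+x. h (x(i0 := u)) \<partial>lebn I \<partial>lborel)"
  using lb.product_nn_integral_insert[OF I hm] lb.product_nn_integral_insert_rev[OF I hm] by simp
 also have "... = (\<integral>\<^sup>+u. ennreal (1 / \<bar>idet I m'\<bar>) * (\<integral>\<^sup>+x. f (x(i0 := u)) \<partial>lebn I) \<partial>lborel)"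
 proof (intro nn_integral_cong)
  fix u :: real
  have fu: "(%x. f (x(i0 := u))) : borel_measurable (lebn I)"
  proof -
   have "(%x. x(i0 := u)) : measurable (lebn I) (lebn ?J)" using I by (intro measurable_fun_upd[of ?J I]) auto
   from measurable_compose[OF this f] show ?thesis .
  qed
  have "(\<integral>\<^sup>+x. h (x(i0 := u)) \<partial>lebn I) = (\<integral>\<^sup>+x. f ((affine_map I m' (b' u) x)(i0 := u)) \<partial>lebn I)"
  proof (intro nn_integral_cong)
   fix x
   have "affine_map I m' (b' u) (x(i0 := u)) = affine_map I m' (b' u) x"
    using I by (auto simp: affine_map_def fun_eq_iff intro!: sum.cong)
   then show "h (x(i0 := u)) = f ((affine_map I m' (b' u) x)(i0 := u))" by (simp add: h_def)
  qed
  also have "... = ennreal (1 / \<bar>idet I m'\<bar>) * (\<integral>\<^sup>+x. f (x(i0 := u)) \<partial>lebn I)"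
   using det det' by (intro IH[OF fu]) auto
  finally show "(\<integral>\<^sup>+x. h (x(i0 := u)) \<partial>lebn I) = ennreal (1 / \<bar>idet I m'\<bar>) * (\<integral>\<^sup>+x. f (x(i0 := u)) \<partial>lebn I)" .
 qed
 also have "... = ennreal (1 / \<bar>idet I m'\<bar>) * (\<integral>\<^sup>+u. \<integral>\<^sup>+x. f (x(i0 := u)) \<partial>lebn I \<partial>lborel)"
 proof (rule nn_integral_cmult)
  have "(%(u, x). f (x(i0 := u))) : borel_measurable (lborel \<Otimes>\<^sub>M lebn I)"
   using measurable_compose[OF measurable_compose[OF measurable_pair_swap' measurable_add_dim] f]
   by (simp add: case_prod_beta')
  then show "(%u. \<integral>\<^sup>+x. f (x(i0 := u)) \<partial>lebn I) : borel_measurable lborel"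
   using sigma_finite_measure.borel_measurable_nn_integral[OF lb.sigma_finite[OF I(1)], of "%u x. f (x(i0 := u))" lborel] by simp
 qed
 also have "(\<integral>\<^sup>+u. \<integral>\<^sup>+x. f (x(i0 := u)) \<partial>lebn I \<partial>lborel) = (\<integral>\<^sup>+x. f x \<partial>lebn ?J)"
  using lb.product_nn_integral_insert_rev[OF I f] by simp
 finally show ?thesis unfolding det' by (simp add: abs_mult ennreal_mult'[symmetric] mult.assoc[symmetric])
qed

theorem nn_integral_affine_map:
 assumes "finite I" "f : borel_measurable (lebn I)" "idet I m ~= 0"
 shows "(\<integral>\<^sup>+x. f (affine_map I m b x) \<partial>lebn I) = ennreal (1 / \<bar>idet I m\<bar>) * (\<integral>\<^sup>+x. f x \<partial>lebn I)" using assms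
proof (induction I arbitrary: f m b rule: finite_induct)
 case empty
 show ?case by (simp add: PiM_empty affine_map_def nn_integral_count_space_finite)
next
 case (insert i0 I)
 let ?J = "insert i0 I"
 obtain j0 where j0: "j0 : ?J" "m i0 j0 ~= 0"
 proof -
  have "\<exists>j\<in>?J. m i0 j ~= 0"
  proof (rule ccontr)
   assume "\<not> (\<exists>j\<in>?J. m i0 j ~= 0)"
   then have zero: "m i0 j = 0" if "j : ?J" for j using that by blast
   have "idet ?J m = 0" unfolding idet_def
   proof (intro sum.neutral ballI)
    fix p assume "p : {p. p permutes ?J}"
    then have "p i0 : ?J" using permutes_in_image[of p ?J i0] by simp
    from zero[OF this] have "(\<Prod>i\<in>?J. m i (p i)) = 0" using insert.hyps(1) by (intro prod_zero bexI[of _ i0]) auto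
    then show "of_int (sign p) * (\<Prod>i\<in>?J. m i (p i)) = 0" by simp
   qed
   with insert.prems show False by simp
  qed
  then show ?thesis using that by blast
 qed
 \<comment> \<open>The diagonal entry may vanish, but some entry of row \<open>i0\<close> does not;
   exchanging two columns only renames integration variables.\<close>
 define t where "t = Transposition.transpose i0 j0"
 define m' where "m' i j = m i (t j)" for i j
 have t: "t permutes ?J" unfolding t_def by (rule permutes_swap_id) (use j0 in auto)
 have fJ: "finite ?J" using insert.hyps by simp
 have det: "\<bar>idet ?J m'\<bar> = \<bar>idet ?J m\<bar>"
 proof -
  have "idet ?J m' = idet ?J (%i j. m j (t i))" unfolding m'_def by (rule idet_transpose[OF fJ, symmetric])
  also have "... = of_int (sign t) * idet ?J (%i j. m j i)" by (rule idet_permute_rows[OF fJ t])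
  also have "idet ?J (%i j. m j i) = idet ?J m" by (rule idet_transpose[OF fJ])
  finally show ?thesis by (cases t rule: sign_cases) (auto simp: abs_mult)
 qed
 have perm: "affine_map ?J m b (\<lambda>i\<in>?J. x (t i)) = affine_map ?J m' b x" for x
 proof -
  have "(\<Sum>j\<in>?J. m i j * (\<lambda>i\<in>?J. x (t i)) j) = (\<Sum>j\<in>?J. m' i j * x j)" for i
  proof -
   have tt: "t (t j) = j" for j by (simp add: t_def)
   have "(\<Sum>j\<in>?J. m' i j * x j) = (\<Sum>j\<in>?J. m i (t (t j)) * x (t j))" unfolding m'_def by (subst sum.permute[OF t]) simp
   also have "... = (\<Sum>j\<in>?J. m i j * (\<lambda>i\<in>?J. x (t i)) j)"
    by (intro sum.cong refl) (simp only: tt restrict_apply if_True)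
   finally show ?thesis by simp
  qed
  then show ?thesis unfolding affine_map_def by (simp only:)
 qed
 have "(\<integral>\<^sup>+x. f (affine_map ?J m b x) \<partial>lebn ?J) = (\<integral>\<^sup>+x. f (affine_map ?J m b (\<lambda>i\<in>?J. x (t i))) \<partial>lebn ?J)"
  by (rule nn_integral_lebn_reindex[symmetric, OF permutes_imp_bij[OF t] fJ])
    (rule measurable_compose[OF measurable_affine_map insert.prems(1)])
 also have "... = (\<integral>\<^sup>+x. f (affine_map ?J m' b x) \<partial>lebn ?J)" unfolding perm ..
 also have "... = ennreal (1 / \<bar>idet ?J m'\<bar>) * (\<integral>\<^sup>+x. f x \<partial>lebn ?J)"
 proof (rule nn_integral_affine_map_pivot[OF insert.hyps insert.prems(1)])
  show "m' i0 i0 ~= 0" using j0 by (simp add: m'_def t_def)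
  show "idet ?J m' ~= 0" using det insert.prems(2) by auto
 qed (rule insert.IH)
 finally show ?case unfolding det .
qed

section \<open>Cubic maps\<close>

text \<open>Here \<open>a\<close> turns around vertices and \<open>s\<close> crosses edges. Since 3
  is prime, \<open>a_ne\<close> together with \<open>a_cube\<close> says that all vertices have
  exactly three half-edges.\<close>

locale cubic_map =
 fixes H :: "'h set" and a s :: "'h => 'h"
 assumes finite_H: "finite H"
  and a_perm: "a permutes H" and s_perm: "s permutes H"
  and a_ne: "x : H ==> a x ~= x" and a_cube: "x : H ==> a (a (a x)) = x"
  and s_ne: "x : H ==> s x ~= x" and s_s: "x : H ==> s (s x) = x"
begin

definition fc :: "'h => 'h" where "fc = inv a \<circ> s"

abbreviation cyc :: "'h => 'h set" where "cyc \<equiv> orbit fc"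

text \<open>The same choice as the starting half-edge in \<open>Omega\<close>. It depends on the
  cycle alone, so base points can stand for cycles as matrix indices.\<close>

definition bs :: "'h => 'h" where "bs h = (SOME x. x : cyc h)"

lemma a_H [simp]: "a x : H \<longleftrightarrow> x : H" using a_perm by (rule permutes_in_image)
lemma s_H [simp]: "s x : H \<longleftrightarrow> x : H" using s_perm by (rule permutes_in_image)

lemma inv_a: "inv a = (%x. a (a x))"
proof
 fix x
 have "a (a (a x)) = x" using a_cube[of x] a_perm by (cases "x : H") (auto simp: permutes_not_in)
 then show "inv a x = a (a x)" using permutes_inj[OF a_perm] by (metis inv_f_f)
qed

lemma fc_alt: "fc x = a (a (s x))" by (simp add: fc_def inv_a)

lemma fc_perm: "fc permutes H" unfolding fc_def by (rule permutes_compose[OF s_perm permutes_inv[OF a_perm]])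

lemma fc_H [simp]: "fc x : H \<longleftrightarrow> x : H" using fc_perm by (rule permutes_in_image)

lemma fc_permutation: "permutation fc" using fc_perm finite_H by (auto simp: permutation_permutes)

lemma self_cyc [simp]: "x : cyc x" by (rule permutation_self_in_orbit[OF fc_permutation])

lemma cyc_fc [simp]: "cyc (fc x) = cyc x" by (rule permutation_orbit_step[OF fc_permutation])

lemma cyc_eq: "y : cyc x ==> cyc y = cyc x" by (rule orbit_cyclic_eq3[OF cyclic_on_orbit'[OF fc_permutation]])

lemma cyc_subset: "x : H ==> cyc x \<subseteq> H" by (rule permutes_orbit_subset[OF fc_perm])

lemma finite_cyc: "finite (cyc x)" by (rule finite_orbit) simp

lemma bs_cyc: "bs h : cyc h" unfolding bs_def by (rule someI[of _ h]) simp

lemma cyc_bs [simp]: "cyc (bs h) = cyc h" by (rule cyc_eq[OF bs_cyc])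

lemma bs_bs [simp]: "bs (bs h) = bs h" by (simp add: bs_def[of "bs h"]) (simp add: bs_def)

lemma bs_fc [simp]: "bs (fc h) = bs h" by (simp add: bs_def)

lemma bs_H [simp]: "h : H ==> bs h : H" using bs_cyc cyc_subset by blast

lemma cyc_eq_iff_bs: "cyc h = cyc h' \<longleftrightarrow> bs h = bs h'" by (metis bs_def cyc_bs)

lemma mem_cyc_iff: "y : cyc x \<longleftrightarrow> bs y = bs x" by (metis cyc_eq cyc_eq_iff_bs self_cyc)

lemma sum_over_cycles:
 fixes f :: "'h => real"
 shows "(\<Sum>h\<in>H. f h) = (\<Sum>c\<in>cyc ` H. \<Sum>h\<in>c. f h)"
proof -
 have "(\<Sum>c\<in>cyc ` H. \<Sum>h\<in>c. f h) = (\<Sum>h\<in>\<Union>(cyc ` H). f h)"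
 proof (rule sum.Union_disjoint[symmetric, unfolded o_def])
  show "\<forall>A\<in>cyc ` H. finite A" using finite_cyc by auto
  show "\<forall>A\<in>cyc ` H. \<forall>B\<in>cyc ` H. A ~= B --> A \<inter> B = {}" using cyc_eq by blast
 qed
 also have "\<Union>(cyc ` H) = H" using cyc_subset by force
 finally show ?thesis ..
qed

lemma sum_cyc_fc: "(\<Sum>h\<in>cyc x. f (fc h)) = (\<Sum>h\<in>cyc x. f h)" for f :: "'h => real"
proof (rule sum.reindex_bij_betw)
 have inj: "inj_on fc (cyc x)" using permutes_inj[OF fc_perm] by (rule inj_on_subset) simp
 moreover have "fc ` cyc x \<subseteq> cyc x" by (auto intro: orbit.step)
 ultimately show "bij_betw fc (cyc x) (cyc x)" using endo_inj_surj[OF finite_cyc] by (auto simp: bij_betw_def)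
qed

definition pos :: "'h => nat" where "pos h = funpow_dist fc (bs h) h"

lemma funpow_pos: "(fc ^^ pos h) (bs h) = h" unfolding pos_def by (rule funpow_dist_prop) (simp add: mem_cyc_iff)

lemma pos_bs [simp]: "pos (bs h) = 0" unfolding pos_def by (rule funpow_dist_0) simp

lemma pos_fc: assumes "fc h ~= bs h" shows "pos (fc h) = Suc (pos h)"
proof -
 let ?b = "bs h"
 have "pos (fc h) \<le> Suc (pos h)" unfolding pos_def[of "fc h"] funpow_dist_def bs_fc
  by (rule Least_le) (simp add: funpow_pos)
 moreover have "pos h < pos (fc h)"
 proof -
  have eq: "(fc ^^ pos (fc h)) ?b = fc h" using funpow_pos[of "fc h"] by simp
  then obtain i where i: "pos (fc h) = Suc i" using assms by (cases "pos (fc h)") auto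
  then have "fc ((fc ^^ i) ?b) = fc h" using eq by simp
  then have "(fc ^^ i) ?b = h" using permutes_inj[OF fc_perm] by (simp add: inj_eq)
  then have "pos h \<le> i" unfolding pos_def funpow_dist_def by (rule Least_le)
  then show ?thesis using i by simp
 qed
 ultimately show ?thesis by simp
qed

section \<open>Determinants that produce the factor 2 per vertex\<close>

lemma idet_vertex:
 assumes "x ~= y" "y ~= z" "x ~= z"
  and "!!h k. m h k = (if k = h then 1 else 0) + (if k = p h then 1 else (0::real))"
  and "p x = z" "p y = x" "p z = y"
 shows "idet {x, y, z} m = 2"
proof -
 have "idet (insert x {y, z}) m = m x x * idet {y, z} (%i j. m i j - m i x * m x j / m x x)"
  by (rule idet_pivot) (use assms in auto)
 also have "idet (insert y {z}) (%i j. m i j - m i x * m x j / m x x) = 2" by (subst idet_pivot) (use assms in auto)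
 finally show ?thesis using assms(4)[of x x] assms(1-3,5-7) by simp
qed

text \<open>On one vertex \<open>1 + \<rho>\<close> is the circulant of a 3-cycle, with eigenvalues
  \<open>1 + \<zeta>\<close> over the cube roots of unity, whose product is \<open>2\<close>;
  distinct vertices do not interact. The induction is over unions \<open>K\<close> of vertices,
  removed one by one.\<close>

lemma idet_rho:
 "idet H (%h k. (if k = h then 1 else 0) + (if k = a (a h) then 1 else 0)) = 2 ^ (card H div 3)"
proof -
 let ?m = "%h k. (if k = h then 1 else 0) + (if k = a (a h) then 1 else (0::real))"
 have "idet K ?m = 2 ^ (card K div 3)" if "finite K" "K \<subseteq> H" "!!x. x : K ==> a x : K" for K using that
 proof (induction K rule: finite_psubset_induct)
  case (psubset K)
  show ?case
  proof (cases "K = {}")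
   case True
   then show ?thesis by simp
  next
   case False
   then obtain x where x: "x : K" by auto
   define T where "T = {x, a x, a (a x)}"
   have xH: "x : H" using x psubset.prems by auto
   have inj: "a u = a v \<longleftrightarrow> u = v" for u v using permutes_inj[OF a_perm] by (simp add: inj_eq)
   have ne: "x ~= a x" "a x ~= a (a x)" "x ~= a (a x)"
    using a_ne[OF xH] a_ne[of "a x"] a_cube[OF xH] xH inj by (metis a_H)+
   have TK: "T \<subseteq> K" using x psubset.prems(2) by (auto simp: T_def)
   have cT: "card T = 3" using ne by (simp add: T_def)
   have clos: "a y : K - T" if "y : K - T" for y
    using that psubset.prems inj a_cube[OF xH] unfolding T_def by (auto; metis)
   have "idet K ?m = idet (T \<union> (K - T)) ?m" using TK by (simp add: Un_absorb1)
   also have "... = idet T ?m * idet (K - T) ?m"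
   proof (rule idet_block)
    fix i j assume "i : T" "j : K - T"
    then show "?m i j = 0" using a_cube[OF xH] by (auto simp: T_def)
   qed (use psubset.hyps in \<open>auto simp: T_def\<close>)
   also have "idet T ?m = 2"
    unfolding T_def using ne a_cube[OF xH] by (intro idet_vertex[where p = "%h. a (a h)"]) auto
   also have "idet (K - T) ?m = 2 ^ (card (K - T) div 3)"
   proof (rule psubset.IH)
    show "K - T \<subset> K" using x by (auto simp: T_def)
   qed (use psubset.prems clos in auto)
   also have "card (K - T) = card K - 3" using TK psubset.hyps cT by (simp add: card_Diff_subset finite_subset)
   also have "card K \<ge> 3" using card_mono[OF psubset.hyps TK] cT by simp
   then have "2 * 2 ^ ((card K - 3) div 3) = (2 :: real) ^ (card K div 3)" by (simp add: le_div_geq flip: power_Suc)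
   finally show ?thesis .
  qed
 qed
 from this[of H] show ?thesis using finite_H by simp
qed

text \<open>The difference operator along cycles is singular, since it kills functions that are
  constant on cycles. The columns \<open>S k\<close> at base points restore invertibility: adding up
  the rows of a cycle telescopes the differences and leaves just a \<open>1\<close> at the base
  point.\<close>

lemma idet_difference:
 fixes S :: "'h => 'h => real"
 assumes S: "!!k h. k : H ==> bs k = k ==> h : H ==> (\<Sum>x\<in>cyc h. S k x) = (if k = bs h then 1 else 0)"
 shows "\<bar>idet H (%h k. (if k = fc h then 1 else 0) - (if k = h then 1 else 0) + (if bs k = k then S k h else 0))\<bar> = 1"
proof -
 let ?m = "%h k. (if k = fc h then 1 else 0) - (if k = h then 1 else 0) + (if bs k = k then S k h else 0)"
 \<comment> \<open>\<open>?R\<close> replaces the row of the last half-edge of every cycle, the one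
   before the base point, by the sum of the rows of that cycle.\<close>
 let ?R = "%h k. if fc h = bs h then (if k : cyc h then 1 else 0) else (if k = h then 1 else (0 :: real))"
 define M where "M h k = (if fc h = bs h then (if k = fc h then 1 else 0) else ?m h k)" for h k
 have last_unique: "h = k" if "fc h = bs h" "fc k = bs k" "k : cyc h" for h k
 proof -
  have "fc h = fc k" using that by (simp add: mem_cyc_iff)
  then show ?thesis using permutes_inj[OF fc_perm] by (simp add: inj_eq)
 qed
 have "idet H ?R = (\<Prod>h\<in>H. ?R h h)"
 proof (rule idet_triangular[where r = "%h. if fc h = bs h then 1 else 0", OF finite_H])
  fix i j assume ij: "i ~= j" "(if fc i = bs i then 1 else 0) \<le> (if fc j = bs j then 1 else (0::nat))"
  show "?R i j = 0"
  proof (cases "fc i = bs i")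
   case True
   then have "fc j = bs j" using ij(2) by (simp split: if_splits)
   then have "j ~: cyc i" using last_unique[OF True] ij(1) by blast
   then show ?thesis using True by simp
  next
   case False
   then show ?thesis using ij(1) by simp
  qed
 qed
 then have R1: "idet H ?R = 1" by (simp cong: if_cong)
 have RM: "(\<Sum>x\<in>H. ?R h x * ?m x k) = M h k" if hk: "h : H" "k : H" for h k
 proof (cases "fc h = bs h")
  case True
  have "(\<Sum>x\<in>H. ?R h x * ?m x k) = (\<Sum>x\<in>H. if x : cyc h then ?m x k else 0)" using True by (intro sum.cong) auto
  also have "... = (\<Sum>x\<in>cyc h. ?m x k)"
   using finite_H cyc_subset[OF hk(1)] by (simp add: sum.inter_restrict[symmetric] Int_absorb1)
  also have "... = (\<Sum>x\<in>cyc h. if k = fc x then 1 else 0) - (\<Sum>x\<in>cyc h. if k = x then 1 else 0)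
    + (\<Sum>x\<in>cyc h. if bs k = k then S k x else 0)" by (simp add: sum.distrib sum_subtractf)
  also have "(\<Sum>x\<in>cyc h. if k = fc x then 1 else (0::real)) = (\<Sum>x\<in>cyc h. if k = x then 1 else 0)" by (rule sum_cyc_fc)
  also have "(\<Sum>x\<in>cyc h. if bs k = k then S k x else 0) = (if k = bs h then 1 else 0)"
   using S[OF hk(2) _ hk(1)] by (cases "bs k = k") auto
  finally show ?thesis using True by (simp add: M_def)
 next
  case False
  have "(\<Sum>x\<in>H. ?R h x * ?m x k) = (\<Sum>x\<in>H. if x = h then ?m h k else 0)" using False by (intro sum.cong) auto
  then show ?thesis using finite_H hk False by (simp add: M_def)
 qed
 have "idet H ?m = idet H ?R * idet H ?m" using R1 by simp
 also have "... = idet H (%h k. \<Sum>x\<in>H. ?R h x * ?m x k)" by (rule idet_mult[OF finite_H, symmetric])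
 also have "... = idet H M" by (rule idet_cong) (use RM in auto)
 finally have m_M: "idet H ?m = idet H M" .
 let ?f = "inv fc"
 have f: "?f permutes H" by (rule permutes_inv[OF fc_perm])
 have fcf: "fc (?f x) = x" for x using permutes_inverses(1)[OF fc_perm] .
 have bsf: "bs (?f x) = bs x" for x by (metis bs_fc fcf)
 have posf: "pos (?f x) < pos x" if "bs x ~= x" for x using pos_fc[of "?f x"] that by (simp add: fcf bsf)
 have pos0: "pos x > 0" if "bs x ~= x" for x using posf[OF that] by simp
 \<comment> \<open>After row \<open>h\<close> has moved to position \<open>fc h\<close>, every
   nonzero off-diagonal entry sits in a column of smaller \<open>pos\<close>.\<close>
 have "idet H (%h k. M (?f h) k) = (\<Prod>h\<in>H. M (?f h) h)"
 proof (rule idet_triangular[where r = pos, OF finite_H])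
  fix h k assume "h : H" "k : H" and ne: "h ~= k" and le: "pos h \<le> pos k"
  show "M (?f h) k = 0"
  proof (cases "bs h = h")
   case True
   then show ?thesis using ne by (simp add: M_def fcf bsf)
  next
   case False
   have "k ~= ?f h" using posf[OF False] le by auto
   moreover have "bs k ~= k" using pos0[OF False] le by (metis pos_bs not_le)
   ultimately show ?thesis using False ne by (simp add: M_def fcf bsf)
  qed
 qed
 also have "... = 1"
 proof (rule prod.neutral, rule ballI)
  fix h assume "h : H"
  show "M (?f h) h = 1"
  proof (cases "bs h = h")
   case True
   then show ?thesis by (simp add: M_def fcf bsf)
  next
   case False
   then have "h ~= ?f h" using posf[OF False] by auto
   then show ?thesis using False by (auto simp: M_def fcf bsf)
  qed
 qed
 finally have "of_int (sign ?f) * idet H M = 1" using idet_permute_rows[OF finite_H f, of M] by simp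
 then have "\<bar>idet H M\<bar> = 1" by (cases ?f rule: sign_cases) auto
 then show ?thesis using m_M by simp
qed

text \<open>One half-edge of every edge: the choice is made from the unordered pair, so the two
  halves agree on it.\<close>

definition H1 :: "'h set" where "H1 = {h : H. (SOME x. x : {h, s h}) = h}"

lemma H1_H: "H1 \<subseteq> H" by (auto simp: H1_def)

lemma s_H1: "h : H ==> s h : H1 \<longleftrightarrow> h ~: H1"
proof -
 assume h: "h : H"
 let ?x = "SOME x. x : {h, s h}"
 have x: "?x : {h, s h}" by (rule someI[of _ h]) simp
 have "{s h, s (s h)} = {h, s h}" using s_s[OF h] by auto
 then have "s h : H1 \<longleftrightarrow> ?x = s h" using h unfolding H1_def mem_Collect_eq by (simp only: s_H) simp
 moreover have "h : H1 \<longleftrightarrow> ?x = h" using h unfolding H1_def by blast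
 ultimately show ?thesis using x s_ne[OF h] by (metis insertE singletonD)
qed

lemma card_H1: "card H = 2 * card H1" and card_H2: "card (H - H1) = card H1"
proof -
 have "bij_betw s H1 (H - H1)" by (rule bij_betw_byWitness[where f' = s]) (use s_H1 s_s H1_H in auto)
 then show c: "card (H - H1) = card H1" using bij_betw_same_card by fastforce
 show "card H = 2 * card H1" using c card_Un_disjoint[of H1 "H - H1"] H1_H finite_H finite_subset[OF H1_H finite_H]
  by (simp add: Un_absorb1)
qed

lemma finite_H1: "finite H1" using finite_subset[OF H1_H finite_H] .

lemma sum_H1:
 fixes f :: "'h => real"
 assumes "!!h. h : H ==> f (s h) = f h"
 shows "(\<Sum>h\<in>H. f h) = 2 * (\<Sum>h\<in>H1. f h)"
proof -
 have "bij_betw s H1 (H - H1)" by (rule bij_betw_byWitness[where f' = s]) (use s_H1 s_s H1_H in auto)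
 then have "(\<Sum>h\<in>H - H1. f h) = (\<Sum>h\<in>H1. f (s h))" by (rule sum.reindex_bij_betw[symmetric])
 also have "... = (\<Sum>h\<in>H1. f h)" using assms H1_H by (intro sum.cong) auto
 finally show ?thesis using sum.subset_diff[OF H1_H finite_H, of f] by simp
qed

text \<open>Subtracting row \<open>s h\<close> from row \<open>h\<close> outside \<open>H1\<close>
  separates invariant from anti-invariant functions: the columns of \<open>H1\<close> become zero in
  those rows, and the remaining block there is \<open>c\<close> times the identity.\<close>

lemma idet_lift:
 fixes Q :: "'h => 'h => real"
 assumes inv: "!!h j. h : H ==> j : H1 ==> Q (s h) j = Q h j"
  and anti: "!!h j. h : H - H1 ==> j : H - H1 ==> Q h j - Q (s h) j = (if h = j then c else 0)"
 shows "idet H Q = c ^ card H1 * idet H1 Q"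
proof -
 let ?R = "%h k. (if k = h then 1 else 0) - (if h ~: H1 \<and> k = s h then 1 else (0::real))"
 define M where "M h k = (if h : H1 then Q h k else Q h k - Q (s h) k)" for h k
 have H: "H = H1 \<union> (H - H1)" using H1_H by auto
 have "idet H ?R = (\<Prod>h\<in>H. ?R h h)"
 proof (rule idet_triangular[where r = "%h. if h : H1 then 0 else 1", OF finite_H])
  fix i j assume "i : H" "i ~= j" "(if i : H1 then 0 else 1) \<le> (if j : H1 then 0 else (1::nat))"
  then show "?R i j = 0" using s_H1[of i] by (auto split: if_splits)
 qed
 also have "... = 1" using s_ne by (intro prod.neutral) force
 finally have R1: "idet H ?R = 1" .
 have "(\<Sum>x\<in>H. ?R h x * Q x k) = M h k" if "h : H" for h k
 proof -
  have "(\<Sum>x\<in>H. ?R h x * Q x k) = (\<Sum>x\<in>H. (if x = h then Q h k else 0) - (if x = s h then (if h : H1 then 0 else Q (s h) k) else 0))"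
   by (intro sum.cong) auto
  also have "... = M h k" using finite_H that by (simp add: sum_subtractf M_def)
  finally show ?thesis .
 qed
 then have "idet H M = idet H (%h k. \<Sum>x\<in>H. ?R h x * Q x k)" by (intro idet_cong) auto
 also have "... = idet H ?R * idet H Q" by (rule idet_mult[OF finite_H])
 finally have "idet H Q = idet H M" using R1 by simp
 also have "... = idet ((H - H1) \<union> H1) M" using H by (simp add: Un_commute)
 also have "... = idet (H - H1) M * idet H1 M"
  by (rule idet_block) (use finite_H finite_H1 inv H1_H in \<open>auto simp: M_def\<close>)
 also have "idet (H - H1) M = (\<Prod>h\<in>H - H1. M h h)" by (rule idet_diagonal) (use finite_H anti in \<open>auto simp: M_def\<close>)
 also have "... = c ^ card H1" using anti by (simp add: M_def card_H2)
 also have "idet H1 M = idet H1 Q" by (rule idet_cong) (auto simp: M_def)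
 finally show ?thesis .
qed

text \<open>The identity behind Kontsevich's constant: with \<open>(\<rho> V) h = V (inv a h)\<close> and \<open>(\<delta> V) h = V (fc h) - V h\<close>
 one has \<open>s (1 + \<rho>) = \<delta> + (1 + s)\<close> as operators on functions of half-edges, where \<open>1 + \<rho>\<close> has
 determinant \<open>2\<close> for every vertex.\<close>

lemma idet_primitive:
 fixes N W S :: "'h => 'h => real"
 assumes S: "!!k h. k : H ==> bs k = k ==> h : H ==> (\<Sum>x\<in>cyc h. S k x) = (if k = bs h then 1 else 0)"
  and S_inv: "!!k h. k : H ==> bs k = k ==> h : H ==> S k (s h) = S k h"
  and N_inv: "!!j h. j : H1 ==> h : H ==> N j (s h) = N j h"
  and WN: "!!j h. j : H1 ==> h : H ==>
   W j (fc h) - W j h + (\<Sum>k\<in>H. if bs k = k then S k h * W j k else 0) = N j h"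
 shows "\<bar>idet H1 (%h j. W j h + W j (a (a h)))\<bar> = 2 ^ (card H div 3) * \<bar>idet H1 (%h j. N j h)\<bar>"
  and "!!j h. j : H1 ==> h : H ==> W j (s h) + W j (a (a (s h))) = W j h + W j (a (a h))"
proof -
 \<comment> \<open>The columns outside \<open>H1\<close> are filled by preimages of the
   anti-invariant functions \<open>z j\<close>. Because the rotation has order three,
   \<open>(1 - \<rho> + \<rho>^2) / 2\<close> inverts \<open>1 + \<rho>\<close>, which explains the
   second branch of \<open>V\<close>.\<close>
 define z where "z j h = (if h = j then 1 else 0) - (if h = s j then 1 else (0 :: real))" for j h
 define V where "V h j = (if j : H1 then W j h else (z j h - z j (a (a h)) + z j (a h)) / 2)" for h j
 define Y where "Y h j = V h j + V (a (a h)) j" for h j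
 define Q where "Q h j = V (fc h) j - V h j + (\<Sum>k\<in>H. if bs k = k then S k h * V k j else 0)" for h j
 have Y2: "Y h j = z j h" if "h : H" "j ~: H1" for h j
  using that a_cube[of h] by (simp add: Y_def V_def add_divide_distrib[symmetric])
 have YQ: "Q h j = Y (s h) j - V (s h) j - V h j + (\<Sum>k\<in>H. if bs k = k then S k h * V k j else 0)" for h j
  by (simp add: Q_def Y_def fc_alt)
 have Q_diff: "Q (s h) j - Q h j = Y h j - Y (s h) j" if "h : H" for h j
 proof -
  have "(\<Sum>k\<in>H. if bs k = k then S k (s h) * V k j else 0) = (\<Sum>k\<in>H. if bs k = k then S k h * V k j else 0)"
   using S_inv that by (intro sum.cong) auto
  then show ?thesis unfolding YQ by (simp add: s_s[OF that])
 qed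
 have Q1: "Q h j = N j h" if "h : H" "j : H1" for h j
  using WN[OF that(2,1)] that by (simp add: Q_def V_def cong: if_cong)
 have Y_inv: "Y (s h) j = Y h j" if "h : H" "j : H1" for h j using Q_diff[of h j] Q1 N_inv that by simp
 then show "!!j h. j : H1 ==> h : H ==> W j (s h) + W j (a (a (s h))) = W j h + W j (a (a h))"
  by (simp add: Y_def V_def)
 have z2: "z j h - z j (s h) = (if h = j then 2 else 0)" if "h : H - H1" "j : H - H1" for h j
 proof -
  have "h ~= s j" "s h ~= j" using that s_H1[of h] s_H1[of j] by auto
  moreover have "s h = s j \<longleftrightarrow> h = j" using that s_s by (metis DiffD1)
  ultimately show ?thesis by (simp add: z_def)
 qed
 \<comment> \<open>Two square matrices on \<open>H\<close> are now compared: \<open>Y\<close> is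
   \<open>1 + \<rho>\<close> applied to \<open>V\<close>, and \<open>Q\<close> is the corrected
   difference operator applied to \<open>V\<close>. Both reduce to their blocks on \<open>H1\<close>
   with factors of equal absolute value, which cancel.\<close>
 have f1: "idet H Q = (-2) ^ card H1 * idet H1 Q"
 proof (rule idet_lift)
  show "Q (s h) j = Q h j" if "h : H" "j : H1" for h j using Q1 N_inv that by simp
  show "Q h j - Q (s h) j = (if h = j then -2 else 0)" if "h : H - H1" "j : H - H1" for h j
   using Q_diff[of h j] Y2[of h j] Y2[of "s h" j] z2[OF that] that by auto
 qed
 have f2: "idet H Y = 2 ^ card H1 * idet H1 Y" by (rule idet_lift) (use Y_inv Y2 z2 in auto)
 have f3: "idet H Y = 2 ^ (card H div 3) * idet H V"
 proof -
  have "idet H Y = idet H (%h j. \<Sum>k\<in>H. ((if k = h then 1 else 0) + (if k = a (a h) then 1 else 0)) * V k j)"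
  proof (rule idet_cong)
   fix h j assume "h : H"
   have "(\<Sum>k\<in>H. ((if k = h then 1 else 0) + (if k = a (a h) then 1 else 0)) * V k j) =
     (\<Sum>k\<in>H. (if k = h then V h j else 0) + (if k = a (a h) then V (a (a h)) j else 0))" by (intro sum.cong) auto
   then show "Y h j = (\<Sum>k\<in>H. ((if k = h then 1 else 0) + (if k = a (a h) then 1 else 0)) * V k j)"
    using \<open>h : H\<close> finite_H by (simp add: sum.distrib Y_def)
  qed simp
  then show ?thesis by (simp only: idet_mult[OF finite_H] idet_rho)
 qed
 have f4: "\<bar>idet H Q\<bar> = \<bar>idet H V\<bar>"
 proof -
  let ?m = "%h k. (if k = fc h then 1 else 0) - (if k = h then 1 else 0) + (if bs k = k then S k h else 0)"
  have "idet H Q = idet H (%h j. \<Sum>k\<in>H. ?m h k * V k j)"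
  proof (rule idet_cong)
   fix h j assume "h : H"
   have "(\<Sum>k\<in>H. ?m h k * V k j) =
     (\<Sum>k\<in>H. (if k = fc h then V (fc h) j else 0) - (if k = h then V h j else 0) + (if bs k = k then S k h * V k j else 0))"
    by (intro sum.cong) (auto simp: algebra_simps)
   then show "Q h j = (\<Sum>k\<in>H. ?m h k * V k j)" using \<open>h : H\<close> finite_H by (simp add: sum.distrib sum_subtractf Q_def)
  qed simp
  then show ?thesis using idet_difference[OF S] by (simp only: idet_mult[OF finite_H] abs_mult mult_1_left)
 qed
 have f5: "idet H1 Q = idet H1 (%h j. N j h)" by (rule idet_cong) (use Q1 H1_H in auto)
 have f6: "idet H1 Y = idet H1 (%h j. W j h + W j (a (a h)))" by (rule idet_cong) (auto simp: Y_def V_def)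
 have "2 ^ card H1 * \<bar>idet H1 Y\<bar> = \<bar>idet H Y\<bar>" by (simp add: f2 abs_mult)
 also have "... = 2 ^ (card H div 3) * \<bar>idet H Q\<bar>" by (simp add: f3 f4 abs_mult)
 also have "... = 2 ^ card H1 * (2 ^ (card H div 3) * \<bar>idet H1 Q\<bar>)" by (simp add: f1 abs_mult power_abs)
 finally show "\<bar>idet H1 (%h j. W j h + W j (a (a h)))\<bar> = 2 ^ (card H div 3) * \<bar>idet H1 (%h j. N j h)\<bar>"
  by (simp add: f5 f6)
qed

section \<open>Primitives along cycles and the two-form on half-edges\<close>

definition prim :: "('h => real) => 'h => real" where
 "prim v h = (\<Sum>i<pos h. v ((fc ^^ i) (bs h)))"

lemma prim_bs [simp]: "prim v (bs h) = 0" by (simp add: prim_def)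

text \<open>Only the last step of a cycle is in question: there the primitive falls back to
  \<open>0\<close>, which is consistent because the total around the cycle vanishes.\<close>

lemma prim_fc:
 assumes "(\<Sum>x\<in>cyc h. v x) = 0"
 shows "prim v (fc h) = prim v h + v h"
proof -
 have Suc: "(\<Sum>i<Suc (pos h). v ((fc ^^ i) (bs h))) = prim v h + v h" by (simp add: prim_def funpow_pos)
 show ?thesis
 proof (cases "fc h = bs h")
  case False
  then show ?thesis using Suc by (simp add: prim_def pos_fc)
 next
  case True
  let ?f = "%i. (fc ^^ i) (bs h)"
  have "(fc ^^ Suc (pos h)) (bs h) = bs h" using True by (simp add: funpow_pos)
  then have "cyc (bs h) = {?f m | m. m < Suc (pos h)}" by (rule orbit_altdef_bounded) simp
  then have im: "cyc h = ?f ` {..<Suc (pos h)}" by auto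
  have "inj_on ?f {0..funpow_dist fc (bs h) h}" by (rule inj_on_funpow_dist) (simp add: mem_cyc_iff)
  then have "inj_on ?f {..<Suc (pos h)}" by (rule inj_on_subset) (auto simp: pos_def)
  then have "(\<Sum>x\<in>cyc h. v x) = (\<Sum>i<Suc (pos h). v (?f i))" unfolding im by (subst sum.reindex) simp_all
  then show ?thesis using Suc assms True by simp
 qed
qed

lemma cyc_enum:
 "bij_betw (%i. (fc ^^ i) x) {..<card (cyc x)} (cyc x)" "(fc ^^ card (cyc x)) x = x"
proof -
 let ?n = "funpow_dist1 fc x x"
 have im: "cyc x = (%i. (fc ^^ i) x) ` {0..<?n}" by (rule orbit_conv_funpow_dist1) simp
 have inj: "inj_on (%i. (fc ^^ i) x) {0..<?n}" by (rule inj_on_funpow_dist1) simp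
 have card: "card (cyc x) = ?n" using card_image[OF inj] im by simp
 show "bij_betw (%i. (fc ^^ i) x) {..<card (cyc x)} (cyc x)"
  using im inj unfolding card by (simp add: bij_betw_def atLeast0LessThan)
 show "(fc ^^ card (cyc x)) x = x" unfolding card by (rule funpow_dist1_prop) simp
qed

text \<open>Abel summation. The correction with \<open>V 0 + V m\<close> depends on \<open>w\<close>
  only through its total, so it disappears for directions with zero perimeters.\<close>

lemma alternating_partial_sums:
 fixes v w V :: "nat => real"
 assumes V: "!!i. V (Suc i) = V i + v i"
 shows "(\<Sum>j<m. \<Sum>i<j. v i * w j - v j * w i) =
  (\<Sum>i<m. (V i + V (Suc i)) * w i) - (V 0 + V m) * (\<Sum>i<m. w i)"
proof (induction m)
 case (Suc m)
 have "(\<Sum>i<m. v i) = V m - V 0" by (induction m) (auto simp: V)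
 then have "(\<Sum>i<m. v i * w m - v m * w i) = (V m - V 0) * w m - v m * (\<Sum>i<m. w i)"
  by (simp add: sum_subtractf flip: sum_distrib_left sum_distrib_right)
 then show ?case using Suc by (simp add: V algebra_simps)
qed simp

text \<open>As \<open>w\<close> has total zero, no trace of the starting point \<open>x\<close>
  remains on the right. This is the independence of the two-form from the distinguished edges;
  moreover any primitive \<open>V\<close> of \<open>v\<close> may be used.\<close>

lemma alternating_cycle_sum:
 fixes v w V :: "'h => real"
 assumes V: "!!h. h : cyc x ==> V (fc h) = V h + v h" and w: "(\<Sum>h\<in>cyc x. w h) = 0"
 shows "(\<Sum>j<card (cyc x). \<Sum>i<j. v ((fc ^^ i) x) * w ((fc ^^ j) x) - v ((fc ^^ j) x) * w ((fc ^^ i) x)) =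
  (\<Sum>h\<in>cyc x. (V h + V (fc h)) * w h)"
proof -
 have V': "V ((fc ^^ Suc i) x) = V ((fc ^^ i) x) + v ((fc ^^ i) x)" for i
  using V[OF funpow_in_orbit[OF self_cyc]] by simp
 have reindex: "(\<Sum>i<card (cyc x). f ((fc ^^ i) x)) = (\<Sum>h\<in>cyc x. f h)" for f :: "'h => real"
  by (rule sum.reindex_bij_betw[OF cyc_enum(1)])
 have "(\<Sum>j<card (cyc x). \<Sum>i<j. v ((fc ^^ i) x) * w ((fc ^^ j) x) - v ((fc ^^ j) x) * w ((fc ^^ i) x)) =
   (\<Sum>i<card (cyc x). (V ((fc ^^ i) x) + V ((fc ^^ Suc i) x)) * w ((fc ^^ i) x)) -
   (V ((fc ^^ 0) x) + V ((fc ^^ card (cyc x)) x)) * (\<Sum>i<card (cyc x). w ((fc ^^ i) x))"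
  by (rule alternating_partial_sums) (rule V')
 then show ?thesis using reindex[of "%h. (V h + V (fc h)) * w h"] reindex[of w] w by simp
qed

text \<open>The two-form after summation by parts, with the contributions from both sides of an edge
  collected into one term per edge.\<close>

definition om :: "('h => real) => ('h => real) => real" where
 "om v w = (\<Sum>h\<in>H1. (prim v h + prim v (a (a h))) * w h)"

text \<open>Replacing \<open>h\<close> by \<open>s h\<close> turns \<open>fc h\<close> into \<open>a (a h)\<close>.\<close>

lemma sum_fc_invariant:
 fixes f w :: "'h => real"
 assumes "!!h. h : H ==> w (s h) = w h"
 shows "(\<Sum>h\<in>H. f (fc h) * w h) = (\<Sum>h\<in>H. f (a (a h)) * w h)"
proof -
 have "(\<Sum>h\<in>H. f (fc h) * w h) = (\<Sum>h\<in>H. f (fc (s h)) * w (s h))" by (subst sum.permute[OF s_perm]) simp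
 also have "... = (\<Sum>h\<in>H. f (a (a h)) * w h)" using assms by (intro sum.cong) (auto simp: fc_alt s_s)
 finally show ?thesis .
qed

text \<open>On both halves of an edge, \<open>prim v h + prim v (a (a h))\<close> equals
  \<open>prim v h + prim v (s h) + v h\<close>, which is symmetric. The sum over \<open>H\<close> is
  therefore twice the one over \<open>H1\<close>.\<close>

lemma om_eq:
 assumes v: "!!h. h : H ==> v (s h) = v h" "!!h. h : H ==> (\<Sum>x\<in>cyc h. v x) = 0"
  and w: "!!h. h : H ==> w (s h) = w h"
 shows "om v w = 1/2 * (\<Sum>h\<in>H. (prim v h + prim v (fc h)) * w h)"
proof -
 have fc: "prim v (fc h) = prim v h + v h" if "h : H" for h using prim_fc v(2) that by blast
 have U: "prim v (s h) + prim v (a (a (s h))) = prim v h + prim v (a (a h))" if h: "h : H" for h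
  using fc[OF h] fc[of "s h"] v(1)[OF h] h by (simp add: fc_alt s_s)
 have "(\<Sum>h\<in>H. (prim v h + prim v (fc h)) * w h) = (\<Sum>h\<in>H. (prim v h + prim v (a (a h))) * w h)"
  using sum_fc_invariant[of w "prim v"] w by (simp add: distrib_right sum.distrib)
 also have "... = 2 * om v w" unfolding om_def by (rule sum_H1) (use U w in simp)
 finally show ?thesis by simp
qed

text \<open>The matrix of the form on the directions \<open>v i\<close> is enlarged to a square one
  on \<open>H1\<close> by the perimeter directions \<open>S c\<close>, whose partners are the
  indicator functions of cycles, the kernel of the difference operator. Against these the
  \<open>v i\<close> pair to zero and the \<open>S c\<close> to the identity, so the determinant
  does not change. The large matrix factors into \<open>N\<close> and \<open>Y\<close>, and
  \<open>idet_primitive\<close> expresses the determinant of \<open>Y\<close> through that of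
  \<open>N\<close> again.\<close>

lemma idet_om:
 fixes S :: "'h set => 'h => real" and v :: "nat => 'h => real"
 assumes S_inv: "!!c h. c : cyc ` H ==> h : H ==> S c (s h) = S c h"
  and S: "!!c c'. c : cyc ` H ==> c' : cyc ` H ==> (\<Sum>x\<in>c'. S c x) = (if c = c' then 1 else 0)"
  and v_inv: "!!i h. i < m ==> h : H ==> v i (s h) = v i h"
  and v: "!!i c. i < m ==> c : cyc ` H ==> (\<Sum>x\<in>c. v i x) = 0"
  and g: "bij_betw g H1 (cyc ` H <+> {..<m})"
 shows "\<bar>idet {..<m} (%i j. om (v i) (v j))\<bar> =
  2 ^ (card H div 3) * (idet H1 (%h j. case g j of Inl c => S c h | Inr i => v i h))\<^sup>2"
proof -
 define N where "N j h = (case g j of Inl c => S c h | Inr i => v i h)" for j h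
 define W where "W j h = (case g j of Inl c => if h : c then 1 else 0 | Inr i => prim (v i) h)" for j h
 define Y where "Y h j = W j h + W j (a (a h))" for h j
 define A where "A = {j : H1. \<exists>i. g j = Inr i}"
 have g_cases: "(\<exists>h\<in>H. g j = Inl (cyc h)) \<or> (\<exists>i<m. g j = Inr i)" if "j : H1" for j
  using bij_betwE[OF g] that by (auto simp: Plus_def)
 have g_inj: "g i = g j ==> i = j" if "i : H1" "j : H1" for i j using g that by (auto simp: bij_betw_def inj_on_def)
 have vcyc: "(\<Sum>x\<in>cyc h. v i x) = 0" if "i < m" "h : H" for i h using v that by blast
 have prim: "prim (v i) (fc h) = prim (v i) h + v i h" if "i < m" "h : H" for i h using prim_fc vcyc that by blast
 have dY: "\<bar>idet H1 Y\<bar> = 2 ^ (card H div 3) * \<bar>idet H1 (%h j. N j h)\<bar>" unfolding Y_def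
 proof (rule idet_primitive(1)[where S = "%k. S (cyc k)"])
  fix k h assume "k : H" "bs k = k" "h : H"
  then show "(\<Sum>x\<in>cyc h. S (cyc k) x) = (if k = bs h then 1 else 0)"
   using S[OF imageI imageI, of k h] by (simp add: cyc_eq_iff_bs)
 next
  fix j h assume j: "j : H1" and h: "h : H"
  show "W j (fc h) - W j h + (\<Sum>k\<in>H. if bs k = k then S (cyc k) h * W j k else 0) = N j h" using g_cases[OF j]
  proof
   assume "\<exists>x\<in>H. g j = Inl (cyc x)"
   then obtain x where x: "x : H" "g j = Inl (cyc x)" by auto
   have "(\<Sum>k\<in>H. if bs k = k then S (cyc k) h * W j k else 0) = (\<Sum>k\<in>H. if k = bs x then S (cyc x) h else 0)"
    using x by (intro sum.cong) (auto simp: W_def mem_cyc_iff)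
   also have "... = S (cyc x) h" using x finite_H by simp
   finally show ?thesis using x by (simp add: W_def N_def mem_cyc_iff)
  next
   assume "\<exists>i<m. g j = Inr i"
   then obtain i where i: "i < m" "g j = Inr i" by auto
   have "(\<Sum>k\<in>H. if bs k = k then S (cyc k) h * W j k else 0) = 0"
    using i by (intro sum.neutral) (auto simp: W_def, metis prim_bs)
   then show ?thesis using i prim[OF i(1) h] by (simp add: W_def N_def)
  qed
  show "N j (s h) = N j h" using g_cases[OF j] h S_inv v_inv by (auto simp: N_def)
 qed (use S_inv in auto)
 \<comment> \<open>The pairing of coordinate functions with primitives; between two directions it is
   the two-form with its arguments exchanged.\<close>
 define T where "T i j = (\<Sum>h\<in>H1. N i h * Y h j)" for i j
 have T_cycle: "T i j = (\<Sum>h\<in>cyc x. N i h)" if i: "i : H1" and j: "j : H1" and x: "x : H" "g j = Inl (cyc x)" for i j x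
 proof -
  have N_inv: "N i (s h) = N i h" if "h : H" for h using g_cases[OF i] that S_inv v_inv by (auto simp: N_def)
  let ?f = "%h. if h : cyc x then 1 else (0::real)"
  have Y: "Y h j = ?f h + ?f (a (a h))" for h using x by (simp add: Y_def W_def)
  have Y_inv: "Y (s h) j = Y h j" if h: "h : H" for h
  proof -
   have "?f (a (a (s h))) = ?f h" by (simp add: fc_alt[symmetric] mem_cyc_iff)
   moreover have "?f (s h) = ?f (a (a h))" using bs_fc[of "s h"] s_s[OF h] by (simp add: fc_alt mem_cyc_iff)
   ultimately show ?thesis unfolding Y by simp
  qed
  have "2 * T i j = (\<Sum>h\<in>H. N i h * Y h j)" unfolding T_def by (rule sum_H1[symmetric]) (use N_inv Y_inv in simp)
  also have "... = (\<Sum>h\<in>H. ?f h * N i h) + (\<Sum>h\<in>H. ?f (a (a h)) * N i h)"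
   unfolding Y by (simp add: sum.distrib distrib_left mult.commute)
  also have "(\<Sum>h\<in>H. ?f (a (a h)) * N i h) = (\<Sum>h\<in>H. ?f (fc h) * N i h)"
   by (rule sum_fc_invariant[symmetric]) (rule N_inv)
  also have "... = (\<Sum>h\<in>H. ?f h * N i h)" by (simp add: mem_cyc_iff)
  also have "(\<Sum>h\<in>H. ?f h * N i h) = (\<Sum>h\<in>cyc x. N i h)"
  proof -
   have "(\<Sum>h\<in>H. ?f h * N i h) = (\<Sum>h\<in>H. if h : cyc x then N i h else 0)" by (intro sum.cong) auto
   also have "... = (\<Sum>h\<in>cyc x. N i h)"
    using finite_H cyc_subset[OF x(1)] by (simp add: sum.inter_restrict[symmetric] Int_absorb1)
   finally show ?thesis .
  qed
  finally show ?thesis by simp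
 qed
 have T0: "T i j = 0" if ij: "i : A" "j : H1 - A" for i j
 proof -
  obtain x where x: "x : H" "g j = Inl (cyc x)" using g_cases[of j] ij unfolding A_def by blast
  obtain k where k: "k < m" "g i = Inr k" using g_cases[of i] ij by (auto simp: A_def)
  show ?thesis using T_cycle[of i j x] x k ij vcyc[OF k(1) x(1)] by (simp add: A_def N_def)
 qed
 have T1: "T i j = (if i = j then 1 else 0)" if ij: "i : H1 - A" "j : H1 - A" for i j
 proof -
  obtain x where x: "x : H" "g j = Inl (cyc x)" using g_cases[of j] ij unfolding A_def by blast
  obtain y where y: "y : H" "g i = Inl (cyc y)" using g_cases[of i] ij unfolding A_def by blast
  have "T i j = (if cyc y = cyc x then 1 else 0)"
   using T_cycle[of i j x] x y ij S[OF imageI imageI, of y x] by (simp add: N_def)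
  moreover have "cyc y = cyc x \<longleftrightarrow> i = j" using g_inj[of i j] x y ij by auto
  ultimately show ?thesis by simp
 qed
 have gA: "bij_betw (%j. projr (g j)) A {..<m}"
 proof (rule bij_betwI')
  fix i j assume "i : A" "j : A"
  then show "projr (g i) = projr (g j) \<longleftrightarrow> i = j" using g_inj by (auto simp: A_def)
 next
  fix j assume "j : A"
  then show "projr (g j) : {..<m}" using g_cases[of j] by (auto simp: A_def)
 next
  fix i assume "i : {..<m}"
  then have "Inr i : cyc ` H <+> {..<m}" by (rule InrI)
  then have "Inr i : g ` H1" using g by (simp add: bij_betw_def)
  then obtain j where "j : H1" "g j = Inr i" by force
  then show "\<exists>j\<in>A. i = projr (g j)" by (intro bexI[of _ j]) (auto simp: A_def)
 qed
 have finA: "finite A" "finite (H1 - A)" and A_H1: "A \<union> (H1 - A) = H1" using finite_H1 by (auto simp: A_def)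
 have "idet {..<m} (%i j. om (v i) (v j)) = idet {..<m} (%i j. om (v j) (v i))"
  by (rule idet_transpose[symmetric]) simp
 also have "... = idet A (%i j. om (v (projr (g j))) (v (projr (g i))))"
  by (rule idet_reindex[OF gA finA(1), symmetric])
 also have "... = idet A T"
 proof (rule idet_cong)
  fix i j assume "i : A" "j : A"
  then show "om (v (projr (g j))) (v (projr (g i))) = T i j"
   by (auto simp: A_def om_def T_def N_def Y_def W_def mult.commute)
 qed simp
 also have "... = idet A T * idet (H1 - A) T" using T1 finA by (subst (2) idet_diagonal) auto
 also have "... = idet H1 T" using idet_block[of A "H1 - A" T] finA T0 A_H1 by simp
 also have "... = idet H1 N * idet H1 Y" unfolding T_def[abs_def] by (rule idet_mult[OF finite_H1])
 also have "idet H1 N = idet H1 (%h j. N j h)" by (rule idet_transpose[OF finite_H1, symmetric])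
 finally show ?thesis using dY by (simp add: abs_mult N_def power2_eq_square)
qed

end

section \<open>Bases adapted to independent functionals\<close>

text \<open>Gaussian elimination: \<open>u\<close> is a basis indexed by \<open>I\<close>, with dual
  basis \<open>u'\<close>, in which the functionals \<open>p k\<close> become the coordinate
  functions \<open>r k\<close>. A further functional has a nonzero coefficient at an index not yet
  used, since otherwise it would depend on the earlier ones.\<close>

lemma dual_basis:
 fixes p :: "'k => 'i => real"
 assumes "finite F" "finite I"
  and indep: "\<forall>q. (\<forall>i\<in>I. (\<Sum>k\<in>F. q k * p k i) = 0) --> (\<forall>k\<in>F. q k = 0)"
 shows "\<exists>r u u'. inj_on r F \<and> r ` F \<subseteq> I \<and>
  (\<forall>i\<in>I. \<forall>i'\<in>I. (\<Sum>j\<in>I. u j i * u' j i') = (if i = i' then 1 else 0)) \<and>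
  (\<forall>j\<in>I. \<forall>j'\<in>I. (\<Sum>i\<in>I. u' j i * u j' i) = (if j = j' then 1 else 0)) \<and>
  (\<forall>k\<in>F. \<forall>j\<in>I. (\<Sum>i\<in>I. p k i * u j i) = (if j = r k then 1 else 0))" using assms(1) indep
proof (induction F rule: finite_induct)
 case empty
 define d where "d i j = (if i = j then 1 else (0::real))" for i j :: 'i
 have d1: "(\<Sum>j\<in>I. d i j * d i' j) = (if i = i' then 1 else 0)" if "i : I" for i i'
 proof -
  have "(\<Sum>j\<in>I. d i j * d i' j) = (\<Sum>j\<in>I. if i = j then d i' i else 0)" by (intro sum.cong) (simp_all add: d_def)
  then show ?thesis using assms(2) that by (simp add: d_def)
 qed
 have d2: "(\<Sum>i\<in>I. d i j * d i j') = (if j = j' then 1 else 0)" if "j : I" for j j'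
 proof -
  have "(\<Sum>i\<in>I. d i j * d i j') = (\<Sum>i\<in>I. if i = j then d j j' else 0)" by (intro sum.cong) (simp_all add: d_def)
  then show ?thesis using assms(2) that by (simp add: d_def)
 qed
 show ?case by (intro exI[of _ "%_. undefined"] exI[of _ "%j i. d i j"] conjI ballI)
    (simp_all add: d1 d2)
next
 case (insert k0 F)
 have "\<forall>q. (\<forall>i\<in>I. (\<Sum>k\<in>F. q k * p k i) = 0) --> (\<forall>k\<in>F. q k = 0)"
 proof (intro allI impI)
  fix q assume q: "\<forall>i\<in>I. (\<Sum>k\<in>F. q k * p k i) = 0"
  have "\<forall>k\<in>insert k0 F. (q(k0 := 0)) k = 0"
  proof (rule insert.prems[THEN spec, THEN mp], rule ballI)
   fix i assume "i : I"
   have "(\<Sum>k\<in>F. (q(k0 := 0)) k * p k i) = (\<Sum>k\<in>F. q k * p k i)" using insert.hyps(2) by (intro sum.cong) auto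
   then show "(\<Sum>k\<in>insert k0 F. (q(k0 := 0)) k * p k i) = 0" using q \<open>i : I\<close> insert.hyps by simp
  qed
  then show "\<forall>k\<in>F. q k = 0" using insert.hyps(2) by (metis fun_upd_apply insertCI)
 qed
 from insert.IH[OF this] obtain r u u' where
  r: "inj_on r F" "r ` F \<subseteq> I"
  and ih: "\<forall>i\<in>I. \<forall>i'\<in>I. (\<Sum>j\<in>I. u j i * u' j i') = (if i = i' then 1 else 0)"
   "\<forall>j\<in>I. \<forall>j'\<in>I. (\<Sum>i\<in>I. u' j i * u j' i) = (if j = j' then 1 else 0)"
   "\<forall>k\<in>F. \<forall>j\<in>I. (\<Sum>i\<in>I. p k i * u j i) = (if j = r k then 1 else 0)" by (elim exE conjE) (rule that)
 note uu' = ih(1)[rule_format] and u'u = ih(2)[rule_format] and pu = ih(3)[rule_format]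
 define P where "P j = (\<Sum>i\<in>I. p k0 i * u j i)" for j
 have Pu': "(\<Sum>j\<in>I. P j * u' j i) = p k0 i" if "i : I" for i
 proof -
  have "(\<Sum>j\<in>I. P j * u' j i) = (\<Sum>j\<in>I. \<Sum>i'\<in>I. p k0 i' * (u j i' * u' j i))"
   by (simp add: P_def sum_distrib_right mult.assoc)
  also have "... = (\<Sum>i'\<in>I. p k0 i' * (\<Sum>j\<in>I. u j i' * u' j i))" by (subst sum.swap) (simp add: sum_distrib_left)
  also have "... = (\<Sum>i'\<in>I. if i' = i then p k0 i else 0)" using uu' that by (intro sum.cong) auto
  also have "... = p k0 i" using assms(2) that by simp
  finally show ?thesis .
 qed
 have "\<exists>j0\<in>I - r ` F. P j0 ~= 0"
 proof (rule ccontr)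
  assume "\<not> ?thesis"
  then have P0: "P j = 0" if "j : I" "j ~: r ` F" for j using that by auto
  have pk: "(\<Sum>j\<in>I. (if j = r k then 1 else 0) * u' j i) = p k i" if "k : F" "i : I" for k i
  proof -
   have "(\<Sum>j\<in>I. (if j = r k then 1 else 0) * u' j i) = (\<Sum>j\<in>I. (\<Sum>i'\<in>I. p k i' * u j i') * u' j i)"
    using pu that by (intro sum.cong) auto
   also have "... = (\<Sum>j\<in>I. \<Sum>i'\<in>I. p k i' * (u j i' * u' j i))" by (simp add: sum_distrib_right mult.assoc)
   also have "... = (\<Sum>i'\<in>I. p k i' * (\<Sum>j\<in>I. u j i' * u' j i))" by (subst sum.swap) (simp add: sum_distrib_left)
   also have "... = (\<Sum>i'\<in>I. if i' = i then p k i else 0)" using uu' that by (intro sum.cong) auto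
   also have "... = p k i" using assms(2) that by simp
   finally show ?thesis .
  qed
  have u'r: "u' (r k) i = p k i" if "k : F" "i : I" for k i
  proof -
   have "(\<Sum>j\<in>I. (if j = r k then 1 else 0) * u' j i) = (\<Sum>j\<in>I. if j = r k then u' (r k) i else 0)"
    by (intro sum.cong) auto
   also have "... = u' (r k) i" using r that assms(2) by (auto simp: image_subset_iff)
   finally show ?thesis using pk[OF that] by simp
  qed
  \<comment> \<open>The coefficients that would express \<open>p k0\<close> by the earlier
    functionals, with \<open>p k0\<close> itself moved to the same side.\<close>
  define q where "q k = (if k = k0 then -1 else P (r k))" for k
  have "\<forall>k\<in>insert k0 F. q k = 0"
  proof (rule insert.prems[THEN spec, THEN mp], rule ballI)
   fix i assume i: "i : I"
   have "p k0 i = (\<Sum>j\<in>r ` F. P j * u' j i)"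
    unfolding Pu'[OF i, symmetric] by (rule sum.mono_neutral_right) (use assms(2) r P0 in auto)
   also have "... = (\<Sum>k\<in>F. P (r k) * p k i)" using r u'r i by (subst sum.reindex) auto
   also have "... = (\<Sum>k\<in>F. q k * p k i)" using insert.hyps(2) by (intro sum.cong) (auto simp: q_def)
   finally show "(\<Sum>k\<in>insert k0 F. q k * p k i) = 0" using insert.hyps by (simp add: q_def)
  qed
  then show False by (auto simp: q_def)
 qed
 then obtain j0 where j0: "j0 : I" "j0 ~: r ` F" "P j0 ~= 0" by auto
 \<comment> \<open>Rescaling \<open>u j0\<close> to value 1 under \<open>p k0\<close> and
   subtracting multiples of it from the others keeps the earlier functionals in place, as they
   vanish on \<open>u j0\<close>.\<close>
 define w where "w j i = (if j = j0 then u j0 i / P j0 else u j i - P j / P j0 * u j0 i)" for j i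
 define w' where "w' j i = (if j = j0 then p k0 i else u' j i)" for j i
 define r' where "r' = r(k0 := j0)"
 have sum_w: "(\<Sum>i\<in>I. f i * w j i) = (if j = j0 then (\<Sum>i\<in>I. f i * u j0 i) / P j0
   else (\<Sum>i\<in>I. f i * u j i) - P j / P j0 * (\<Sum>i\<in>I. f i * u j0 i))" for f j
  by (simp add: w_def right_diff_distrib sum_subtractf sum_distrib_left sum_divide_distrib mult_ac)
 have Pw: "(\<Sum>i\<in>I. p k0 i * w j i) = (if j = j0 then 1 else 0)" for j
  unfolding sum_w using j0(3) by (simp add: P_def[symmetric])
 have 1: "(\<Sum>j\<in>I. w j i * w' j i') = (if i = i' then 1 else 0)" if "i : I" "i' : I" for i i'
 proof -
  have split: "(\<Sum>j\<in>I. f j) = f j0 + (\<Sum>j\<in>I - {j0}. f j)" for f :: "'i => real"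
   using j0(1) assms(2) by (simp add: sum.remove)
  have "(\<Sum>j\<in>I - {j0}. w j i * w' j i') = (\<Sum>j\<in>I - {j0}. u j i * u' j i') - u j0 i / P j0 * (\<Sum>j\<in>I - {j0}. P j * u' j i')"
  proof -
   have "(\<Sum>j\<in>I - {j0}. w j i * w' j i') = (\<Sum>j\<in>I - {j0}. u j i * u' j i' - u j0 i / P j0 * (P j * u' j i'))"
    by (intro sum.cong) (simp_all add: w_def w'_def algebra_simps)
   then show ?thesis by (simp only: sum_subtractf sum_distrib_left)
  qed
  also have "(\<Sum>j\<in>I - {j0}. P j * u' j i') = p k0 i' - P j0 * u' j0 i'"
   using Pu'[OF that(2)] split[of "%j. P j * u' j i'"] by simp
  also have "(\<Sum>j\<in>I - {j0}. u j i * u' j i') = (if i = i' then 1 else 0) - u j0 i * u' j0 i'"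
   using uu'[OF that] split[of "%j. u j i * u' j i'"] by simp
  finally show ?thesis using split[of "%j. w j i * w' j i'"] j0(3) by (simp add: w_def w'_def right_diff_distrib)
 qed
 have 2: "(\<Sum>i\<in>I. w' j i * w j' i) = (if j = j' then 1 else 0)" if "j : I" "j' : I" for j j'
 proof (cases "j = j0")
  case True
  then show ?thesis using Pw[of j'] by (simp add: w'_def eq_commute)
 next
  case False
  then have "(\<Sum>i\<in>I. w' j i * w j' i) = (\<Sum>i\<in>I. u' j i * w j' i)" by (simp add: w'_def)
  also have "... = (if j = j' then 1 else 0)" unfolding sum_w u'u[OF that] u'u[OF that(1) j0(1)] using False by simp
  finally show ?thesis .
 qed
 have 3: "(\<Sum>i\<in>I. p k i * w j i) = (if j = r' k then 1 else 0)" if "k : insert k0 F" "j : I" for k j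
 proof (cases "k = k0")
  case True
  then show ?thesis using Pw by (simp add: r'_def)
 next
  case False
  then have k: "k : F" using that by simp
  then have "r k ~= j0" using j0(2) by auto
  then show ?thesis unfolding sum_w pu[OF k that(2)] pu[OF k j0(1)] using False by (simp add: r'_def)
 qed
 have 4: "inj_on r' (insert k0 F)" "r' ` insert k0 F \<subseteq> I"
  using r j0(1,2) insert.hyps(2) by (auto simp: r'_def inj_on_def)
 show ?case by (intro exI[of _ r'] exI[of _ w] exI[of _ w'] conjI ballI 4 1 2 3)
qed

section \<open>Volumes of the top-dimensional cells\<close>

context cubic_map
begin

lemma card_orbit_a: assumes x: "x : H" shows "card (orbit a x) = 3"
proof -
 have "(a ^^ 3) x = x" using a_cube[OF x] by (simp add: numeral_3_eq_3)
 then have "orbit a x = {(a ^^ m) x | m. m < 3}" by (rule orbit_altdef_bounded) simp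
 also have "... = (%m. (a ^^ m) x) ` {..<3}" by auto
 also have "{..<3::nat} = {0, 1, 2}" by auto
 finally have "orbit a x = {x, a x, a (a x)}" by (simp add: numeral_2_eq_2)
 moreover have "a x ~= x" "a (a x) ~= a x" "a (a x) ~= x" using a_ne[OF x] a_ne[of "a x"] a_cube[OF x] x by auto
 ultimately show ?thesis by auto
qed

lemma card_vertices: "card H = 3 * card (cycles_on H a)"
proof -
 have perm: "permutation a" using a_perm finite_H permutation_permutes by blast
 have "\<Union>(cycles_on H a) = H"
  unfolding cycles_on_def using permutes_orbit_subset[OF a_perm] permutation_self_in_orbit[OF perm] by blast
 moreover have "3 * card (cycles_on H a) = card (\<Union>(cycles_on H a))"
 proof (rule card_partition)
  fix c c' assume "c : cycles_on H a" "c' : cycles_on H a" and ne: "c ~= c'"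
  then obtain x y where xy: "c = orbit a x" "c' = orbit a y" by (auto simp: cycles_on_def)
  show "c \<inter> c' = {}"
  proof (rule ccontr)
   assume "c \<inter> c' ~= {}"
   then obtain z where "z : orbit a x" "z : orbit a y" unfolding xy by blast
   then have "orbit a z = orbit a x" "orbit a z = orbit a y"
    using orbit_cyclic_eq3[OF cyclic_on_orbit[OF a_perm finite_H]] by blast+
   then show False using ne xy by simp
  qed
 qed (use finite_H calculation card_orbit_a in \<open>auto simp: cycles_on_def\<close>)
 ultimately show ?thesis by simp
qed

end

lemma orbit_card_3:
 assumes "permutation f" "card (orbit f x) = 3"
 shows "f x ~= x" "f (f (f x)) = x"
proof -
 have self: "x : orbit f x" by (rule permutation_self_in_orbit[OF assms(1)])
 show "f x ~= x"
 proof
  assume "f x = x"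
  then have "orbit f x = {x}" by (simp add: orbit_eq_singleton_iff)
  then show False using assms(2) by simp
 qed
 have "card (orbit f x) = funpow_dist1 f x x"
  using card_image[OF inj_on_funpow_dist1[OF self]] orbit_conv_funpow_dist1[OF self] by simp
 then have "(f ^^ 3) x = x" using funpow_dist1_prop[OF self] assms(2) by simp
 then show "f (f (f x)) = x" by (simp add: numeral_3_eq_3)
qed

section \<open>Edges, perimeters and charts of a trivalent graph\<close>

locale trivalent_ribbon =
 fixes G :: "('h, 'z) ribbon_graph_scheme"
 assumes ribbon: "ribbon_graph G" and triv: "trivalent G"
begin

abbreviation H where "H \<equiv> half_edges G"

lemma perms: "finite H" "sigma0 G permutes H" "sigma1 G permutes H" "sigma2 G = inv (sigma0 G) \<circ> sigma1 G"
 using ribbon by (auto simp: ribbon_graph_def)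

lemma card_vertex: "x : H ==> card (orbit (sigma0 G) x) = 3"
 using triv by (auto simp: trivalent_def vertices_def cycles_on_def)

sublocale cubic_map H "sigma0 G" "sigma1 G"
proof
 have perm: "permutation (sigma0 G)" using perms by (auto simp: permutation_permutes)
 show "sigma0 G x ~= x" "sigma0 G (sigma0 G (sigma0 G x)) = x" if "x : H" for x
  using orbit_card_3[OF perm card_vertex[OF that]] by simp_all
qed (use perms ribbon in \<open>auto simp: ribbon_graph_def\<close>)

lemma fc_sigma2: "sigma2 G = fc" by (simp add: perms(4) fc_def)

lemma cycles_eq: "cycles_on H (sigma2 G) = cyc ` H" by (simp add: cycles_on_def fc_sigma2)

abbreviation E where "E \<equiv> edges G"
abbreviation C where "C \<equiv> cyc ` H"

lemma edge_at_eq: assumes "x : H" shows "edge_at G x = {x, sigma1 G x}"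
proof -
 have "(sigma1 G ^^ 2) x = x" using s_s[OF assms] by (simp add: numeral_2_eq_2)
 then have "edge_at G x = {(sigma1 G ^^ m) x | m. m < 2}" unfolding edge_at_def by (rule orbit_altdef_bounded) simp
 then have "edge_at G x = (%m. (sigma1 G ^^ m) x) ` {..<2}" by (simp add: image_def) blast
 also have "{..<2::nat} = {0, 1}" by auto
 finally show ?thesis by simp
qed

lemma edges_eq: "E = edge_at G ` H" by (simp add: edges_def cycles_on_def edge_at_def[abs_def])

lemma edge_at_s [simp]: "x : H ==> edge_at G (sigma1 G x) = edge_at G x" by (auto simp: edge_at_eq s_s)

lemma edge_at_eq_iff: "x : H ==> y : H ==> edge_at G x = edge_at G y \<longleftrightarrow> x = y \<or> x = sigma1 G y"
 by (auto simp: edge_at_eq doubleton_eq_iff s_s)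

lemma edge_at_E [simp]: "x : H ==> edge_at G x : E" by (simp add: edges_eq)

lemma bij_edge_at: "bij_betw (edge_at G) H1 E"
proof -
 have "inj_on (edge_at G) H1" using H1_H edge_at_eq_iff s_H1 by (intro inj_onI) (metis subsetD)
 moreover have "edge_at G ` H1 = E"
 proof
  show "E \<subseteq> edge_at G ` H1"
  proof
   fix e assume "e : E"
   then obtain x where x: "x : H" "e = edge_at G x" by (auto simp: edges_eq)
   show "e : edge_at G ` H1"
   proof (cases "x : H1")
    case False
    then have "sigma1 G x : H1" using s_H1[OF x(1)] by simp
    then show ?thesis using x by (metis edge_at_s imageI)
   qed (use x in auto)
  qed
 qed (use H1_H in auto)
 ultimately show ?thesis by (simp add: bij_betw_def)
qed

lemma finite_E: "finite E" using perms(1) by (simp add: edges_eq)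

lemma finite_C: "finite C" using perms(1) by simp

lemma card_E: "card H = 2 * card E" using card_H1 bij_betw_same_card[OF bij_edge_at] by simp

lemma card_V: "card H = 3 * card (vertices G)" unfolding vertices_def by (rule card_vertices)

lemma perimeter_alt:
 assumes "c : C"
 shows "perimeter G w c = (\<Sum>e\<in>E. (\<Sum>x\<in>c. if edge_at G x = e then 1 else 0) * w e)"
proof -
 have cH: "c \<subseteq> H" using assms cyc_subset by auto
 have "(\<Sum>e\<in>E. (\<Sum>x\<in>c. if edge_at G x = e then 1 else 0) * w e) =
   (\<Sum>x\<in>c. \<Sum>e\<in>E. (if edge_at G x = e then 1 else 0) * w e)" unfolding sum_distrib_right by (rule sum.swap)
 also have "... = (\<Sum>x\<in>c. w (edge_at G x))"
 proof (intro sum.cong refl)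
  fix x assume "x : c"
  have "(\<Sum>e\<in>E. (if edge_at G x = e then 1 else 0) * w e) = (\<Sum>e\<in>E. if edge_at G x = e then w e else 0)"
   by (intro sum.cong) auto
  then show "(\<Sum>e\<in>E. (if edge_at G x = e then 1 else 0) * w e) = w (edge_at G x)" using \<open>x : c\<close> cH finite_E by auto
 qed
 finally show ?thesis by (simp add: perimeter_def)
qed

text \<open>A linear relation between perimeters gives opposite coefficients to the two sides of
  every edge. Going once around a vertex crosses three edges, so each coefficient equals its own
  negative: odd valence makes the perimeters independent.\<close>

lemma perimeters_independent:
 assumes q: "!!e. e : E ==> (\<Sum>c\<in>C. q c * (\<Sum>x\<in>c. if edge_at G x = e then 1 else 0)) = (0::real)"
  and c: "c : C"
 shows "q c = 0"
proof -
 have s: "q (cyc (sigma1 G x)) = - q (cyc x)" if x: "x : H" for x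
 proof -
  have "0 = (\<Sum>c\<in>C. q c * (\<Sum>y\<in>c. if edge_at G y = edge_at G x then 1 else 0))" using q x by simp
  also have "... = (\<Sum>c\<in>C. \<Sum>y\<in>c. q (cyc y) * (if edge_at G y = edge_at G x then 1 else 0))"
   unfolding sum_distrib_left using cyc_eq by (intro sum.cong refl) auto
  also have "... = (\<Sum>y\<in>H. q (cyc y) * (if edge_at G y = edge_at G x then 1 else 0))"
   by (rule sum_over_cycles[symmetric])
  also have "... = (\<Sum>y\<in>H. (if y = x then q (cyc x) else 0) + (if y = sigma1 G x then q (cyc (sigma1 G x)) else 0))"
   using s_ne x by (intro sum.cong) (auto simp: edge_at_eq_iff)
  also have "... = q (cyc x) + q (cyc (sigma1 G x))" using perms(1) x by (simp add: sum.distrib)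
  finally show ?thesis by simp
 qed
 have a: "q (cyc (sigma0 G (sigma0 G x))) = - q (cyc x)" if x: "x : H" for x
  using cyc_fc[of "sigma1 G x"] s[OF x] by (simp add: fc_alt s_s[OF x])
 obtain x where x: "x : H" "c = cyc x" using c by auto
 have "q (cyc x) = - q (cyc x)"
  using a[OF x(1)] a[of "sigma0 G (sigma0 G x)"] a[of "sigma0 G x"] x(1) a_cube[OF x(1)] by simp
 then show ?thesis using x by simp
qed

lemma adapted_basis:
 obtains r u u' where "inj_on r C" "r ` C \<subseteq> E"
  "!!e e'. e : E ==> e' : E ==> (\<Sum>j\<in>E. u j e * u' j e') = (if e = e' then 1 else (0::real))"
  "!!j j'. j : E ==> j' : E ==> (\<Sum>e\<in>E. u' j e * u j' e) = (if j = j' then 1 else 0)"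
  "!!c j. c : C ==> j : E ==> perimeter G (u j) c = (if j = r c then 1 else 0)"
proof -
 let ?p = "%c e. \<Sum>x\<in>c. if edge_at G x = e then 1 else (0::real)"
 have ind: "\<forall>q. (\<forall>e\<in>E. (\<Sum>c\<in>C. q c * ?p c e) = 0) --> (\<forall>c\<in>C. q c = 0)" using perimeters_independent by blast
 from dual_basis[OF finite_C finite_E ind] obtain r u u' where b: "inj_on r C" "r ` C \<subseteq> E"
  "\<forall>e\<in>E. \<forall>e'\<in>E. (\<Sum>j\<in>E. u j e * u' j e') = (if e = e' then 1 else (0::real))"
  "\<forall>j\<in>E. \<forall>j'\<in>E. (\<Sum>e\<in>E. u' j e * u j' e) = (if j = j' then 1 else 0)"
  "\<forall>c\<in>C. \<forall>j\<in>E. (\<Sum>e\<in>E. ?p c e * u j e) = (if j = r c then 1 else 0)" by (elim exE conjE) (rule that)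
 show thesis
 proof (rule that[of r u u', OF b(1,2)])
  show "perimeter G (u j) c = (if j = r c then 1 else 0)" if "c : C" "j : E" for c j
   unfolding perimeter_alt[OF that(1)] by (rule b(5)[rule_format, OF that])
 qed (rule b(3,4)[rule_format], assumption+)+
qed

text \<open>The perimeter map is onto; \<open>S c\<close> is a variation that moves the perimeter of
  \<open>c\<close> alone. These supply the chart directions transverse to a slice.\<close>

lemma perimeter_right_inverse:
 obtains S where "!!c c'. c : C ==> c' : C ==> perimeter G (S c) c' = (if c = c' then 1 else 0)"
proof -
 obtain r u u' where *: "inj_on r C" "r ` C \<subseteq> E"
  and "!!e e'. e : E ==> e' : E ==> (\<Sum>j\<in>E. u j e * u' j e') = (if e = e' then 1 else (0::real))"
  and "!!j j'. j : E ==> j' : E ==> (\<Sum>e\<in>E. u' j e * u j' e) = (if j = j' then 1 else 0)"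
  and pu: "!!c j. c : C ==> j : E ==> perimeter G (u j) c = (if j = r c then 1 else 0)"
  by (rule adapted_basis, rule that)
 have "perimeter G (u (r c)) c' = (if c = c' then 1 else 0)" if "c : C" "c' : C" for c c'
 proof -
  have "r c : E" using *(2) that by blast
  moreover have "r c = r c' \<longleftrightarrow> c = c'" using *(1) that by (rule inj_on_eq_iff)
  ultimately show ?thesis using pu[OF that(2), of "r c"] by simp
 qed
 then show thesis using that[of "%c. u (r c)"] by blast
qed

lemma perimeter_cong:
 assumes "c : C" "!!e. e : E ==> w e = w' e" shows "perimeter G w c = perimeter G w' c"
 unfolding perimeter_alt[OF assms(1)] using assms(2) by (intro sum.cong) auto

lemma perimeter_sum: "perimeter G (%e. \<Sum>i\<in>I. t i * w i e) c = (\<Sum>i\<in>I. t i * perimeter G (w i) c)"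
 unfolding perimeter_def sum_distrib_left by (rule sum.swap)

lemma perimeter_diff: "perimeter G (%e. w e - w' e) c = perimeter G w c - perimeter G w' c"
 by (simp add: perimeter_def sum_subtractf)

lemma perimeter_add: "perimeter G (%e. w e + w' e) c = perimeter G w c + perimeter G w' c"
 by (simp add: perimeter_def sum.distrib)

lemma slice_directions_eq: "slice_directions G = {v : E \<rightarrow>\<^sub>E UNIV. \<forall>c\<in>C. perimeter G v c = 0}"
 by (simp add: slice_directions_def cycles_eq)

text \<open>In a basis adapted to the perimeters, the slice directions are spanned by the vectors
  whose index is not claimed by any cycle. This gives meaning to the \<open>SOME\<close> basis in
  \<open>cell_volume\<close>.\<close>

lemma slice_basis_exists:
 assumes card: "card E = card C + m"
 shows "\<exists>v. slice_basis G m v"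
proof -
 obtain r u u' where r: "inj_on r C" "r ` C \<subseteq> E"
  and uu': "!!e e'. e : E ==> e' : E ==> (\<Sum>j\<in>E. u j e * u' j e') = (if e = e' then 1 else (0::real))"
  and u'u: "!!j j'. j : E ==> j' : E ==> (\<Sum>e\<in>E. u' j e * u j' e) = (if j = j' then 1 else 0)"
  and pu: "!!c j. c : C ==> j : E ==> perimeter G (u j) c = (if j = r c then 1 else 0)"
  by (rule adapted_basis, rule that)
 have "card (E - r ` C) = m" using card_image[OF r(1)] card r(2) finite_C by (simp add: card_Diff_subset)
 then obtain h where h: "bij_betw h {..<m} (E - r ` C)"
  using ex_bij_betw_nat_finite[of "E - r ` C"] finite_E by (auto simp: atLeast0LessThan)
 have hE: "h i : E" "h i ~: r ` C" if "i < m" for i using bij_betwE[OF h] that by auto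
 have exp: "w e = (\<Sum>j\<in>E. (\<Sum>e'\<in>E. u' j e' * w e') * u j e)" if "e : E" for w e
 proof -
  have "(\<Sum>j\<in>E. (\<Sum>e'\<in>E. u' j e' * w e') * u j e) = (\<Sum>j\<in>E. \<Sum>e'\<in>E. w e' * (u j e * u' j e'))"
   by (simp add: sum_distrib_left sum_distrib_right mult_ac)
  also have "... = (\<Sum>e'\<in>E. w e' * (\<Sum>j\<in>E. u j e * u' j e'))" by (subst sum.swap) (simp add: sum_distrib_left)
  also have "... = (\<Sum>e'\<in>E. if e = e' then w e' else 0)" using uu' that by (intro sum.cong) auto
  finally show ?thesis using that finite_E by simp
 qed
 define v where "v i = restrict (u (h i)) E" for i
 have "slice_basis G m v" unfolding slice_basis_def
 proof (intro conjI allI impI ballI)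
  fix i assume i: "i < m"
  have "perimeter G (v i) c = 0" if "c : C" for c
  proof -
   have "perimeter G (v i) c = perimeter G (u (h i)) c" by (rule perimeter_cong[OF that]) (simp add: v_def)
   then show ?thesis using pu[OF that hE(1)[OF i]] hE(2)[OF i] that by auto
  qed
  then show "v i : slice_directions G" by (auto simp: slice_directions_eq v_def)
 next
  fix w assume w: "w : slice_directions G"
  define t where "t j = (\<Sum>e\<in>E. u' j e * w e)" for j
  have t0: "t (r c) = 0" if c: "c : C" for c
  proof -
   have "0 = perimeter G w c" using w c by (auto simp: slice_directions_eq)
   also have "... = perimeter G (%e. \<Sum>j\<in>E. t j * u j e) c"
    by (rule perimeter_cong[OF c]) (simp add: t_def exp[symmetric])
   also have "... = (\<Sum>j\<in>E. t j * perimeter G (u j) c)" by (rule perimeter_sum)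
   also have "... = (\<Sum>j\<in>E. if j = r c then t j else 0)" using pu c by (intro sum.cong) auto
   also have "... = t (r c)" using r(2) c finite_E by auto
   finally show ?thesis by simp
  qed
  have w_eq: "w e = (\<Sum>i<m. t (h i) * v i e)" if e: "e : E" for e
  proof -
   have "w e = (\<Sum>j\<in>E. t j * u j e)" using exp[OF e] by (simp add: t_def)
   also have "... = (\<Sum>j\<in>E - r ` C. t j * u j e)" by (rule sum.mono_neutral_right) (use finite_E t0 in auto)
   also have "... = (\<Sum>i<m. t (h i) * u (h i) e)" by (rule sum.reindex_bij_betw[OF h, symmetric])
   finally show ?thesis using e by (simp add: v_def)
  qed
  show "\<exists>!t. t : {..<m} \<rightarrow>\<^sub>E UNIV \<and> (\<forall>e\<in>E. w e = (\<Sum>i<m. t i * v i e))"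
  proof (rule ex1I[of _ "\<lambda>i\<in>{..<m}. t (h i)"])
   show "(\<lambda>i\<in>{..<m}. t (h i)) : {..<m} \<rightarrow>\<^sub>E UNIV \<and> (\<forall>e\<in>E. w e = (\<Sum>i<m. (\<lambda>i\<in>{..<m}. t (h i)) i * v i e))"
    using w_eq by auto
  next
   fix t' assume t': "t' : {..<m} \<rightarrow>\<^sub>E UNIV \<and> (\<forall>e\<in>E. w e = (\<Sum>i<m. t' i * v i e))"
   have "t' k = t (h k)" if k: "k < m" for k
   proof -
    have "t (h k) = (\<Sum>e\<in>E. u' (h k) e * (\<Sum>i<m. t' i * u (h i) e))"
     unfolding t_def using t' by (intro sum.cong) (auto simp: v_def)
    also have "... = (\<Sum>e\<in>E. \<Sum>i<m. t' i * (u' (h k) e * u (h i) e))" by (simp add: sum_distrib_left mult_ac)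
    also have "... = (\<Sum>i<m. t' i * (\<Sum>e\<in>E. u' (h k) e * u (h i) e))" by (subst sum.swap) (simp add: sum_distrib_left)
    also have "... = (\<Sum>i<m. if i = k then t' i else 0)"
    proof (intro sum.cong refl)
     fix i assume "i : {..<m}"
     then have "h k = h i \<longleftrightarrow> i = k" using h k by (auto simp: bij_betw_def inj_on_def)
     then show "t' i * (\<Sum>e\<in>E. u' (h k) e * u (h i) e) = (if i = k then t' i else 0)"
      using u'u[OF hE(1)[OF k] hE(1), of i] \<open>i : {..<m}\<close> by simp
    qed
    also have "... = t' k" using k by simp
    finally show ?thesis by simp
   qed
   then show "t' = (\<lambda>i\<in>{..<m}. t (h i))" using t' by (auto simp: fun_eq_iff PiE_def extensional_def restrict_def)
  qed
 qed
 then show ?thesis by blast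
qed

text \<open>Each cycle is summed by parts; since directions have zero perimeters, the arbitrary
  starting half-edge in \<open>Omega\<close> drops out.\<close>

lemma Omega_om:
 assumes v: "v : slice_directions G" and w: "w : slice_directions G"
 shows "Omega G v w = om (%h. v (edge_at G h)) (%h. w (edge_at G h))"
proof -
 let ?v = "%h. v (edge_at G h)" and ?w = "%h. w (edge_at G h)"
 have zero: "(\<Sum>x\<in>cyc h. ?v x) = 0" "(\<Sum>x\<in>cyc h. ?w x) = 0" if "h : H" for h
  using v w that by (auto simp: slice_directions_eq perimeter_def)
 have "omega_from G c (SOME x. x : c) v w = (\<Sum>h\<in>c. (prim ?v h + prim ?v (fc h)) * ?w h)" if c: "c : C" for c
 proof -
  obtain h where h: "h : H" "c = cyc h" using c by auto
  let ?x = "SOME x. x : c"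
  have xc: "?x : c" using h by (intro someI[of "%x. x : c" h]) simp
  have xH: "?x : H" using xc cyc_subset[OF h(1)] h(2) by blast
  have cx: "c = cyc ?x" using xc h(2) cyc_eq by metis
  have "(\<Sum>j<card (cyc ?x). \<Sum>i<j. ?v ((fc ^^ i) ?x) * ?w ((fc ^^ j) ?x) - ?v ((fc ^^ j) ?x) * ?w ((fc ^^ i) ?x)) =
    (\<Sum>h\<in>cyc ?x. (prim ?v h + prim ?v (fc h)) * ?w h)"
  proof (rule alternating_cycle_sum)
   show "prim ?v (fc y) = prim ?v y + ?v y" if "y : cyc ?x" for y
    using zero(1)[of y] cyc_subset[OF xH] that by (intro prim_fc) auto
  qed (rule zero(2)[OF xH])
  then show ?thesis unfolding omega_from_def Let_def fc_sigma2 using cx by simp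
 qed
 then have "Omega G v w = 1/2 * (\<Sum>c\<in>C. \<Sum>h\<in>c. (prim ?v h + prim ?v (fc h)) * ?w h)"
  unfolding Omega_def cycles_eq by simp
 also have "... = 1/2 * (\<Sum>h\<in>H. (prim ?v h + prim ?v (fc h)) * ?w h)" by (simp only: sum_over_cycles)
 also have "... = om ?v ?w" using zero by (intro om_eq[symmetric]) auto
 finally show ?thesis .
qed

text \<open>The chart from perimeters and slice coordinates to edge lengths, with its columns
  renamed by edges through \<open>g\<close> so that its determinant is taken over a single index
  set.\<close>

definition chart_matrix :: "('h set => 'h set => real) => (nat => 'h set => real) => ('h set => 'h set + nat) => 'h set => 'h set => real" where
 "chart_matrix S v g e e' = (case g e' of Inl c => S c e | Inr i => v i e)"

text \<open>Squares avoid the sign of the Pfaffian. The Gram matrix of \<open>Omega\<close> on the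
  slice basis is that of \<open>om\<close>, whose determinant contains the square of the chart
  determinant; nothing about the particular \<open>S\<close>, \<open>v\<close> or \<open>g\<close>
  remains in the ratio.\<close>

lemma Omega_power_chart:
 assumes S: "!!c c'. c : C ==> c' : C ==> perimeter G (S c) c' = (if c = c' then 1 else 0)"
  and v: "slice_basis G (2 * d) v"
  and g: "bij_betw g E (C <+> {..<2 * d})"
 shows "idet E (chart_matrix S v g) ~= 0"
  and "(Omega_power G d v)\<^sup>2 = 2 ^ (card H div 3) * (idet E (chart_matrix S v g))\<^sup>2"
proof -
 have vK: "v i : slice_directions G" if "i < 2 * d" for i using v that by (simp add: slice_basis_def)
 have vp: "perimeter G (v i) c = 0" if "i < 2 * d" "c : C" for i c
  using vK[OF that(1)] that(2) by (auto simp: slice_directions_eq)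
 have "\<exists>T. \<forall>e\<in>E. \<forall>e'\<in>E. (\<Sum>j\<in>E. chart_matrix S v g e j * T j e') = (if e = e' then 1 else 0)"
 proof -
  have "\<exists>t. \<forall>e\<in>E. (if e = e' then 1 else 0) = (\<Sum>j\<in>E. chart_matrix S v g e j * t j)" if "e' : E" for e'
  proof -
   let ?d = "%e. if e = e' then 1 else (0::real)"
   \<comment> \<open>The unit vector of the edge \<open>e'\<close>, corrected by the
     \<open>S c\<close> to have zero perimeters. Its expansion in \<open>v\<close>, together with
     the corrections, is column \<open>e'\<close> of a right inverse.\<close>
   define w where "w = (\<lambda>e\<in>E. ?d e - (\<Sum>c\<in>C. perimeter G ?d c * S c e))"
   have "perimeter G w c = 0" if c: "c : C" for c
   proof -
    have "perimeter G w c = perimeter G (%e. ?d e - (\<Sum>c\<in>C. perimeter G ?d c * S c e)) c"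
     by (rule perimeter_cong[OF c]) (simp add: w_def)
    also have "... = perimeter G ?d c - (\<Sum>c'\<in>C. perimeter G ?d c' * perimeter G (S c') c)"
     by (simp only: perimeter_diff perimeter_sum)
    also have "(\<Sum>c'\<in>C. perimeter G ?d c' * perimeter G (S c') c) = (\<Sum>c'\<in>C. if c' = c then perimeter G ?d c' else 0)"
     using S c by (intro sum.cong) auto
    also have "... = perimeter G ?d c" using finite_C c by simp
    finally show ?thesis by simp
   qed
   then have "w : slice_directions G" by (auto simp: slice_directions_eq w_def)
   then obtain t where t: "\<forall>e\<in>E. w e = (\<Sum>i<2*d. t i * v i e)" using v unfolding slice_basis_def by blast
   define tt where "tt k = (case k of Inl c => perimeter G ?d c | Inr i => t i)" for k
   have "?d e = (\<Sum>j\<in>E. chart_matrix S v g e j * tt (g j))" if e: "e : E" for e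
   proof -
    have "(\<Sum>j\<in>E. chart_matrix S v g e j * tt (g j)) = (\<Sum>k\<in>C <+> {..<2*d}. (case k of Inl c => S c e | Inr i => v i e) * tt k)"
     unfolding chart_matrix_def
     by (rule sum.reindex_bij_betw[OF g, of "%k. (case k of Inl c => S c e | Inr i => v i e) * tt k"])
    also have "... = (\<Sum>c\<in>C. S c e * perimeter G ?d c) + (\<Sum>i<2*d. v i e * t i)"
     using finite_C by (subst sum.Plus) (auto simp: tt_def)
    also have "(\<Sum>i<2*d. v i e * t i) = w e" using t e by (simp add: mult.commute)
    finally show ?thesis using e by (simp add: w_def mult.commute)
   qed
   then show ?thesis by (intro exI[of _ "%j. tt (g j)"]) auto
  qed
  then have "\<forall>e'. \<exists>t. e' : E --> (\<forall>e\<in>E. (if e = e' then 1 else 0) = (\<Sum>j\<in>E. chart_matrix S v g e j * t j))" by blast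
  then obtain t where "\<forall>e'. e' : E --> (\<forall>e\<in>E. (if e = e' then 1 else 0) = (\<Sum>j\<in>E. chart_matrix S v g e j * t e' j))"
   using choice by metis
  then show ?thesis by (intro exI[of _ "%j e'. t e' j"]) auto
 qed
 then obtain T where T: "\<forall>e\<in>E. \<forall>e'\<in>E. (\<Sum>j\<in>E. chart_matrix S v g e j * T j e') = (if e = e' then 1 else 0)" ..
 have "idet E (chart_matrix S v g) * idet E T = idet E (%e e'. \<Sum>j\<in>E. chart_matrix S v g e j * T j e')"
  by (rule idet_mult[OF finite_E, symmetric])
 also have "... = idet E (%e e'. if e = e' then 1 else 0)" by (rule idet_cong) (use T in auto)
 also have "... = 1" using finite_E by (subst idet_diagonal) auto
 finally show "idet E (chart_matrix S v g) ~= 0" by auto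
 let ?S = "%c h. S c (edge_at G h)" and ?v = "%i h. v i (edge_at G h)"
 have "Omega_power G d v = pfaff d (%i j. Omega G (v i) (v j))" by (simp add: Omega_power_def pfaff_def)
 then have "(Omega_power G d v)\<^sup>2 = \<bar>idet {..<2*d} (%i j. Omega G (v i) (v j))\<bar>"
 proof (simp only:, intro pfaff_square)
  fix i j
  have "omega_from G c x (v j) (v i) = - omega_from G c x (v i) (v j)" for c x
   by (simp add: omega_from_def Let_def sum_subtractf mult.commute)
  then show "Omega G (v j) (v i) = - Omega G (v i) (v j)" by (simp add: Omega_def sum_negf)
 qed
 also have "idet {..<2*d} (%i j. Omega G (v i) (v j)) = idet {..<2*d} (%i j. om (?v i) (?v j))"
  by (rule idet_cong) (use vK Omega_om in auto)
 also have "\<bar>...\<bar> = 2 ^ (card H div 3) * (idet H1 (%h j. case g (edge_at G j) of Inl c => ?S c h | Inr i => ?v i h))\<^sup>2"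
 proof (rule idet_om)
  show "(\<Sum>x\<in>c'. ?S c x) = (if c = c' then 1 else 0)" if "c : C" "c' : C" for c c'
   using S[OF that] by (simp add: perimeter_def)
  show "(\<Sum>x\<in>c. ?v i x) = 0" if "i < 2 * d" "c : C" for i c using vp[OF that] by (simp add: perimeter_def)
  show "bij_betw (%j. g (edge_at G j)) H1 (C <+> {..<2 * d})"
   using bij_betw_trans[OF bij_edge_at g] by (simp add: o_def)
 qed simp_all
 also have "idet H1 (%h j. case g (edge_at G j) of Inl c => ?S c h | Inr i => ?v i h) =
   idet H1 (%h j. chart_matrix S v g (edge_at G h) (edge_at G j))" by (simp add: chart_matrix_def)
 also have "... = idet E (chart_matrix S v g)" by (rule idet_reindex[OF bij_edge_at finite_H1])
 finally show "(Omega_power G d v)\<^sup>2 = 2 ^ (card H div 3) * (idet E (chart_matrix S v g))\<^sup>2" .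
qed

end

section \<open>Lebesgue integrals in split and translated coordinates\<close>

lemma case_sum_lebn:
 "(%(x, y). case_sum x y) : measurable (lebn A \<Otimes>\<^sub>M lebn B) (lebn (A <+> B))"
proof (rule measurable_PiM_single')
 fix k assume "k : A <+> B"
 then consider (1) i where "i : A" "k = Inl i" | (2) i where "i : B" "k = Inr i" by auto
 then show "(%p. (case p of (x, y) => case_sum x y) k) : measurable (lebn A \<Otimes>\<^sub>M lebn B) lborel"
 proof cases
  case (1 i)
  then have "(%p. fst p i) : measurable (lebn A \<Otimes>\<^sub>M lebn B) lborel"
   by (intro measurable_compose[OF measurable_fst] measurable_component_singleton)
  then show ?thesis using 1 by (simp add: case_prod_beta')
 next
  case (2 i)
  then have "(%p. snd p i) : measurable (lebn A \<Otimes>\<^sub>M lebn B) lborel"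
   by (intro measurable_compose[OF measurable_snd] measurable_component_singleton)
  then show ?thesis using 2 by (simp add: case_prod_beta')
 qed
next
 show "(%(x, y). case_sum x y) : space (lebn A \<Otimes>\<^sub>M lebn B) \<rightarrow> (\<Pi>\<^sub>E i\<in>A <+> B. space lborel)"
  by (auto simp: space_pair_measure space_PiM PiE_def extensional_def split: sum.splits)
qed

lemma nn_integral_lebn_Plus:
 assumes fin: "finite A" "finite B" and f: "f : borel_measurable (lebn (A <+> B))"
 shows "(\<integral>\<^sup>+u. f u \<partial>lebn (A <+> B)) = (\<integral>\<^sup>+x. \<integral>\<^sup>+y. f (case_sum x y) \<partial>lebn B \<partial>lebn A)"
proof -
 interpret B: sigma_finite_measure "lebn B" by (rule lb.sigma_finite[OF fin(2)])
 let ?g = "%(x, y). case_sum x y"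
 have "distr (lebn A \<Otimes>\<^sub>M lebn B) (lebn (A <+> B)) ?g = lebn (A <+> B)"
 proof (rule lb.PiM_eqI)
  fix X :: "'a + 'b => real set" assume X: "!!i. i : A <+> B ==> X i : sets lborel"
  have XA: "Pi\<^sub>E A (%i. X (Inl i)) : sets (lebn A)" and XB: "Pi\<^sub>E B (%i. X (Inr i)) : sets (lebn B)"
   using X[OF InlI] X[OF InrI] fin by (auto intro!: sets_PiM_I_finite)
  have "?g -` Pi\<^sub>E (A <+> B) X \<inter> space (lebn A \<Otimes>\<^sub>M lebn B) = Pi\<^sub>E A (%i. X (Inl i)) \<times> Pi\<^sub>E B (%i. X (Inr i))"
   by (force simp: space_pair_measure space_PiM PiE_def extensional_def Pi_def split: sum.splits)
  then have "emeasure (distr (lebn A \<Otimes>\<^sub>M lebn B) (lebn (A <+> B)) ?g) (Pi\<^sub>E (A <+> B) X) =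
    emeasure (lebn A \<Otimes>\<^sub>M lebn B) (Pi\<^sub>E A (%i. X (Inl i)) \<times> Pi\<^sub>E B (%i. X (Inr i)))"
   using X fin by (subst emeasure_distr[OF case_sum_lebn]) (auto intro!: sets_PiM_I_finite)
  also have "... = (\<Prod>i\<in>A. emeasure lborel (X (Inl i))) * (\<Prod>i\<in>B. emeasure lborel (X (Inr i)))"
   using XA XB X[OF InlI] X[OF InrI] fin by (subst B.emeasure_pair_measure_Times) (auto simp: lb.emeasure_PiM)
  also have "... = (\<Prod>i\<in>A <+> B. emeasure lborel (X i))" using fin by (simp add: prod.Plus)
  finally show "emeasure (distr (lebn A \<Otimes>\<^sub>M lebn B) (lebn (A <+> B)) ?g) (Pi\<^sub>E (A <+> B) X) =
   (\<Prod>i\<in>A <+> B. emeasure lborel (X i))" .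
 qed (use fin in auto)
 then have "(\<integral>\<^sup>+u. f u \<partial>lebn (A <+> B)) = (\<integral>\<^sup>+u. f u \<partial>distr (lebn A \<Otimes>\<^sub>M lebn B) (lebn (A <+> B)) ?g)" by simp
 also have "... = (\<integral>\<^sup>+p. f (?g p) \<partial>(lebn A \<Otimes>\<^sub>M lebn B))" by (rule nn_integral_distr) (use case_sum_lebn f in simp_all)
 also have "... = (\<integral>\<^sup>+x. \<integral>\<^sup>+y. f (?g (x, y)) \<partial>lebn B \<partial>lebn A)"
  by (rule B.nn_integral_fst[symmetric]) (rule measurable_compose[OF case_sum_lebn f])
 finally show ?thesis by simp
qed

lemma emeasure_lebn_translate:
 assumes "finite I" and A: "A : sets (lebn I)"
 shows "emeasure (lebn I) {x : space (lebn I). (\<lambda>i\<in>I. x i + b i) : A} = emeasure (lebn I) A"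
proof -
 let ?m = "%i j. if i = j then 1 else (0::real)"
 have aff: "affine_map I ?m b x = (\<lambda>i\<in>I. x i + b i)" for x
 proof -
  have "(\<Sum>j\<in>I. ?m i j * x j) = (if i : I then x i else 0)" for i
  proof -
   have "(\<Sum>j\<in>I. ?m i j * x j) = (\<Sum>j\<in>I. if i = j then x j else 0)" by (intro sum.cong) auto
   then show ?thesis using assms(1) by simp
  qed
  then show ?thesis by (auto simp: affine_map_def fun_eq_iff)
 qed
 have d: "idet I ?m = 1" using assms(1) by (subst idet_diagonal) auto
 have meas: "{x : space (lebn I). (\<lambda>i\<in>I. x i + b i) : A} : sets (lebn I)"
  using measurable_sets[OF measurable_affine_map A, of ?m b] by (simp add: aff vimage_def Int_def conj_commute)
 have "emeasure (lebn I) A = (\<integral>\<^sup>+x. indicator A x \<partial>lebn I)" using A by simp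
 also have "... = (\<integral>\<^sup>+x. indicator A (affine_map I ?m b x) \<partial>lebn I)"
  using nn_integral_affine_map[OF assms(1), of "indicator A" ?m b] A d by simp
 also have "... = (\<integral>\<^sup>+x. indicator {x : space (lebn I). (\<lambda>i\<in>I. x i + b i) : A} x \<partial>lebn I)"
  by (intro nn_integral_cong) (auto simp: aff indicator_def)
 also have "... = emeasure (lebn I) {x : space (lebn I). (\<lambda>i\<in>I. x i + b i) : A}" using meas by simp
 finally show ?thesis by simp
qed

lemma nn_integral_exp_positive:
 assumes "(\<mu>::real) > 0"
 shows "(\<integral>\<^sup>+x. ennreal (exp (- \<mu> * x)) * indicator {0<..} x \<partial>lborel) = ennreal (1 / \<mu>)"
proof -
 have "(\<integral>\<^sup>+x. ennreal (exp (- \<mu> * x)) * indicator {0<..} x \<partial>lborel) =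
   (\<integral>\<^sup>+x. ennreal (exp (- \<mu> * x)) * indicator {0..} x \<partial>lborel)"
  by (rule nn_integral_cong_AE) (use AE_lborel_singleton[of "0::real"] in \<open>auto simp: indicator_def\<close>)
 also have "... = ennreal (0 - (- exp (- \<mu> * 0) / \<mu>))"
 proof (rule nn_integral_FTC_atLeast[where F = "%x. - exp (- \<mu> * x) / \<mu>"])
  show "((%x. - exp (- \<mu> * x) / \<mu>) has_real_derivative exp (- \<mu> * x)) (at x)" for x
   using assms by (auto intro!: derivative_eq_intros)
  show "((%x. - exp (- \<mu> * x) / \<mu>) \<longlongrightarrow> 0) at_top" using assms by real_asymp
 qed auto
 finally show ?thesis by simp
qed

text \<open>A nonnegative function of finite integral is finite almost everywhere. This allows
  \<open>measure\<close>, which reads infinite mass as \<open>0\<close>, to replace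
  \<open>emeasure\<close> in the volumes of slices.\<close>

lemma has_bochner_integral_enn2real:
 assumes J: "J : borel_measurable M" and int: "(\<integral>\<^sup>+p. J p \<partial>M) = ennreal r" and r: "r \<ge> 0"
 shows "has_bochner_integral M (%p. enn2real (J p)) r"
proof (rule has_bochner_integral_nn_integral)
 have "AE p in M. J p ~= \<infinity>" by (rule nn_integral_PInf_AE[OF J]) (simp add: int)
 then have "(\<integral>\<^sup>+p. ennreal (enn2real (J p)) \<partial>M) = (\<integral>\<^sup>+p. J p \<partial>M)" by (intro nn_integral_cong_AE) (auto simp: less_top)
 then show "(\<integral>\<^sup>+p. ennreal (enn2real (J p)) \<partial>M) = ennreal r" using int by simp
qed (use J r in auto)

context trivalent_ribbon
begin

text \<open>Boundary half-edges are closed under \<open>sigma2\<close>, so a cycle that meets them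
  lies entirely inside them.\<close>

lemma faces_boundaries: "faces G \<union> boundaries G = C" "faces G \<inter> boundaries G = {}"
proof -
 have B: "fc x : bdry_half_edges G" if "x : bdry_half_edges G" for x
  using ribbon that unfolding ribbon_graph_def fc_sigma2 by blast
 have BH: "bdry_half_edges G \<subseteq> H" using ribbon by (simp add: ribbon_graph_def)
 have sub: "cyc x \<subseteq> bdry_half_edges G" if "x : bdry_half_edges G" for x
 proof
  fix y assume "y : cyc x"
  then show "y : bdry_half_edges G" using that B by induct auto
 qed
 have "c \<subseteq> H - bdry_half_edges G \<or> c \<subseteq> bdry_half_edges G" if c: "c : C" for c
 proof -
  obtain x where x: "x : H" "c = cyc x" using c by auto
  show ?thesis
  proof (cases "c \<inter> bdry_half_edges G = {}")
   case True
   then show ?thesis using cyc_subset[OF x(1)] x(2) by blast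
  next
   case False
   then obtain y where y: "y : c" "y : bdry_half_edges G" by auto
   then have "c = cyc y" using x(2) cyc_eq by metis
   then show ?thesis using sub[OF y(2)] by simp
  qed
 qed
 then show "faces G \<union> boundaries G = C" by (auto simp: faces_def boundaries_def cycles_eq)
 show "faces G \<inter> boundaries G = {}"
 proof (rule ccontr)
  assume "\<not> ?thesis"
  then obtain x where "x : H" "cyc x \<subseteq> H - bdry_half_edges G" "cyc x \<subseteq> bdry_half_edges G"
   by (auto simp: faces_def boundaries_def cycles_eq)
  then show False using self_cyc[of x] by blast
 qed
qed

end

text \<open>The Laplace variable of the face on the side of \<open>x\<close>. Boundary sides get
  \<open>0\<close> because \<open>W\<close> integrates over the boundary perimeters without an
  exponential factor.\<close>

definition half_edge_weight :: "'h marked_graph => (nat => real) => 'h => real" where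
 "half_edge_weight G lam x =
   (if x : bdry_half_edges G then 0 else lam (face_label G (orbit (sigma2 G) x)))"

text \<open>By \<open>card_E_C\<close> the slices have dimension \<open>2 * d\<close>, the number of
  edges minus the number of cycles.\<close>

locale marked_trivalent = trivalent_ribbon G for G :: "'h marked_graph" +
 fixes n b d :: nat
 assumes mk: "marked G" and cf: "card (faces G) = n" and cb: "card (boundaries G) = b"
  and card_E_C: "card E = n + b + 2 * d"
begin

lemma finite_fb: "finite (faces G)" "finite (boundaries G)" using finite_C faces_boundaries(1) by (metis finite_Un)+

lemma face_bij: "bij_betw (face_label G) (faces G) {1..n}"
 and bdry_bij: "bij_betw (bdry_label G) (boundaries G) {1..b}" using mk cf cb by (auto simp: marked_def)

lemma card_C: "card C = n + b"
 using card_Un_disjoint[OF finite_fb faces_boundaries(2)] faces_boundaries(1) cf cb by simp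

definition cycle_index :: "'h set => nat + nat" where
 "cycle_index c = (if c : faces G then Inl (face_label G c) else Inr (bdry_label G c))"

lemma cycle_index_bij: "bij_betw cycle_index C ({1..n} <+> {1..b})"
proof -
 have "bij_betw (%c. Inl (face_label G c)) (faces G) (Inl ` {1..n})"
  using bij_betw_trans[OF face_bij, of Inl "Inl ` {1..n}"] by (simp add: o_def bij_betw_def)
 then have 1: "bij_betw cycle_index (faces G) (Inl ` {1..n})"
  by (rule bij_betw_cong[THEN iffD1, rotated]) (simp add: cycle_index_def)
 have "bij_betw (%c. Inr (bdry_label G c)) (boundaries G) (Inr ` {1..b})"
  using bij_betw_trans[OF bdry_bij, of Inr "Inr ` {1..b}"] by (simp add: o_def bij_betw_def)
 then have 2: "bij_betw cycle_index (boundaries G) (Inr ` {1..b})"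
  by (rule bij_betw_cong[THEN iffD1, rotated]) (use faces_boundaries(2) in \<open>auto simp: cycle_index_def\<close>)
 show ?thesis using bij_betw_combine[OF 1 2] faces_boundaries(1) by (auto simp: Plus_def)
qed

lemma has_perimeters_alt:
 "has_perimeters G x y l \<longleftrightarrow> (\<forall>c\<in>C. perimeter G l c = case_sum x y (cycle_index c))"
 using faces_boundaries unfolding has_perimeters_def cycle_index_def
 by (auto 4 3 simp: faces_boundaries(1)[symmetric])

text \<open>By Fubini and the linear chart, integrating over the perimeters and over a slice is one
  integration over all metrics, where the exponential becomes a product over edges. The Jacobian of
  the chart and the Pfaffian combine to a constant.\<close>

lemma cell_volume_integral:
 assumes lam: "!!i. i : {1..n} ==> lam i > 0"
 shows "has_bochner_integral (lebn {1..n} \<Otimes>\<^sub>M lebn {1..b})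
   (%(x, y). indicator (({1..n} \<rightarrow>\<^sub>E {0<..}) \<times> ({1..b} \<rightarrow>\<^sub>E {0<..})) (x, y) *
    (exp (- (\<Sum>i=1..n. lam i * x i)) * cell_volume G d x y))
   (sqrt (2 ^ (card H div 3)) * (\<Prod>e\<in>E. 1 / (\<Sum>h\<in>e. half_edge_weight G lam h)))"
proof -
 obtain S where S: "!!c c'. c : C ==> c' : C ==> perimeter G (S c) c' = (if c = c' then 1 else 0)"
  by (rule perimeter_right_inverse, rule that)
 define v where "v = (SOME v. slice_basis G (2*d) v)"
 have v: "slice_basis G (2*d) v" unfolding v_def by (rule someI_ex[OF slice_basis_exists]) (simp add: card_E_C card_C)
 have "card E = card (C <+> {..<2*d})" using card_E_C card_C finite_C by (simp add: card_Plus)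
 then obtain g where g: "bij_betw g E (C <+> {..<2*d})"
  using finite_same_card_bij[of E "C <+> {..<2*d}"] finite_E finite_C by auto
 define N where "N = chart_matrix S v g"
 have N0: "idet E N ~= 0" and N2: "(Omega_power G d v)\<^sup>2 = 2 ^ (card H div 3) * (idet E N)\<^sup>2"
  unfolding N_def by (rule Omega_power_chart[OF S v g]; assumption)+
 have const: "\<bar>Omega_power G d v\<bar> / \<bar>idet E N\<bar> = sqrt (2 ^ (card H div 3))"
 proof -
  have "\<bar>Omega_power G d v\<bar> = sqrt (2 ^ (card H div 3)) * \<bar>idet E N\<bar>"
   unfolding real_sqrt_abs[symmetric] N2 by (simp add: real_sqrt_mult)
  then show ?thesis using N0 by simp
 qed
 let ?w = "half_edge_weight G lam"
 define mu where "mu e = (\<Sum>h\<in>e. ?w h)" for e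
 let ?K = "({1..n} <+> {1..b}) <+> {..<2*d}"
 define lo where "lo z e = (\<Sum>c\<in>C. z (cycle_index c) * S c e)" for z :: "nat + nat => real" and e
 define L where "L z t e = lo z e + (\<Sum>i<2*d. t i * v i e)" for z t e
 \<comment> \<open>The exponential weight in terms of edge lengths together with the positivity of a
   metric; being a product over edges, it integrates factor by factor.\<close>
 define Psi where "Psi l = (\<Prod>e\<in>E. ennreal (exp (- mu e * l e)) * indicator {0<..} (l e))" for l :: "'h set => real"
 have w_face: "?w x > 0" if x: "x : H" "x ~: bdry_half_edges G" for x
 proof -
  have "cyc x ~: boundaries G" using self_cyc[of x] x unfolding boundaries_def by blast
  then have "cyc x : faces G" using faces_boundaries(1) x(1) by blast
  then have "face_label G (cyc x) : {1..n}" using bij_betwE[OF face_bij] by blast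
  then show ?thesis using lam x by (simp add: half_edge_weight_def fc_sigma2)
 qed
 have w_nonneg: "?w x \<ge> 0" if "x : H" for x
  using w_face[OF that] by (cases "x : bdry_half_edges G") (auto simp: half_edge_weight_def)
 have mu_edge: "mu (edge_at G x) = ?w x + ?w (sigma1 G x)" if "x : H" for x
  using s_ne[OF that] by (simp add: mu_def edge_at_eq[OF that])
 \<comment> \<open>An edge cannot have boundaries on both sides, so at least one side contributes a
   positive weight; with weight zero the integral over the length of the edge would diverge.\<close>
 have mu_pos: "mu e > 0" if e: "e : E" for e
 proof -
  obtain x where x: "x : H" "e = edge_at G x" using e by (auto simp: edges_eq)
  show ?thesis
  proof (cases "x : bdry_half_edges G")
   case True
   then have "sigma1 G x ~: bdry_half_edges G" using ribbon by (simp add: ribbon_graph_def)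
   then show ?thesis using w_face[of "sigma1 G x"] w_nonneg[OF x(1)] x by (simp add: mu_edge)
  next
   case False
   then show ?thesis using w_face[of x] w_nonneg[of "sigma1 G x"] x by (simp add: mu_edge)
  qed
 qed
 \<comment> \<open>Exchange of summation: edges weighted by both of their sides, or sides grouped by
   the cycles they belong to.\<close>
 have mu_sum: "(\<Sum>e\<in>E. mu e * l e) = (\<Sum>i=1..n. lam i * x i)"
  if "!!c. c : C ==> perimeter G l c = case_sum x y (cycle_index c)" for l x y
 proof -
  have "(\<Sum>e\<in>E. mu e * l e) = (\<Sum>h\<in>H1. (?w h + ?w (sigma1 G h)) * l (edge_at G h))"
   using H1_H by (subst sum.reindex_bij_betw[OF bij_edge_at, symmetric]) (auto intro!: sum.cong simp: mu_edge)
  also have "2 * ... = (\<Sum>h\<in>H. (?w h + ?w (sigma1 G h)) * l (edge_at G h))"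
   by (rule sum_H1[symmetric]) (simp add: s_s add.commute)
  also have "... = (\<Sum>h\<in>H. ?w h * l (edge_at G h)) + (\<Sum>h\<in>H. ?w (sigma1 G h) * l (edge_at G (sigma1 G h)))"
   by (simp add: sum.distrib distrib_right)
  also have "(\<Sum>h\<in>H. ?w (sigma1 G h) * l (edge_at G (sigma1 G h))) = (\<Sum>h\<in>H. ?w h * l (edge_at G h))"
   by (rule sum.permute[OF s_perm, unfolded o_def, symmetric])
  also have "(\<Sum>h\<in>H. ?w h * l (edge_at G h)) = (\<Sum>c\<in>C. \<Sum>h\<in>c. ?w h * l (edge_at G h))" by (rule sum_over_cycles)
  also have "... = (\<Sum>c\<in>faces G. \<Sum>h\<in>c. ?w h * l (edge_at G h)) + (\<Sum>c\<in>boundaries G. \<Sum>h\<in>c. ?w h * l (edge_at G h))"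
   unfolding faces_boundaries(1)[symmetric] by (rule sum.union_disjoint[OF finite_fb faces_boundaries(2)])
  also have "(\<Sum>c\<in>boundaries G. \<Sum>h\<in>c. ?w h * l (edge_at G h)) = 0"
   by (intro sum.neutral ballI) (auto simp: boundaries_def half_edge_weight_def)
  also have "(\<Sum>c\<in>faces G. \<Sum>h\<in>c. ?w h * l (edge_at G h)) = (\<Sum>c\<in>faces G. lam (face_label G c) * x (face_label G c))"
  proof (intro sum.cong refl)
   fix c assume c: "c : faces G"
   then have cC: "c : C" using faces_boundaries(1) by blast
   have "?w h = lam (face_label G c)" if "h : c" for h
   proof -
    have "cyc h = c" using cC that cyc_eq by auto
    then show ?thesis using c that by (auto simp: half_edge_weight_def faces_def fc_sigma2)
   qed
   then have "(\<Sum>h\<in>c. ?w h * l (edge_at G h)) = lam (face_label G c) * perimeter G l c"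
    by (simp add: perimeter_def sum_distrib_left)
   then show "(\<Sum>h\<in>c. ?w h * l (edge_at G h)) = lam (face_label G c) * x (face_label G c)"
    using that[OF cC] c by (simp add: cycle_index_def)
  qed
  also have "... = (\<Sum>i=1..n. lam i * x i)" by (rule sum.reindex_bij_betw[OF face_bij])
  finally show ?thesis by simp
 qed
 have per_lo: "perimeter G (lo z) c = z (cycle_index c)" if "c : C" for z c
 proof -
  have "perimeter G (lo z) c = (\<Sum>c'\<in>C. z (cycle_index c') * perimeter G (S c') c)"
   unfolding lo_def by (rule perimeter_sum)
  also have "... = (\<Sum>c'\<in>C. if c' = c then z (cycle_index c') else 0)" using S that by (intro sum.cong) auto
  finally show ?thesis using that finite_C by simp
 qed
 have per_v: "perimeter G (v i) c = 0" if "i < 2 * d" "c : C" for i c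
  using v that by (auto simp: slice_basis_def slice_directions_eq)
 have per_shift: "perimeter G (%e. l e + (\<Sum>i<2*d. t i * v i e)) c = perimeter G l c" if "c : C" for l t c
 proof -
  have "(\<Sum>i<2*d. t i * perimeter G (v i) c) = 0" using per_v that by (intro sum.neutral) auto
  then show ?thesis by (simp add: perimeter_add perimeter_sum)
 qed
 have per_L: "perimeter G (L z t) c = z (cycle_index c)" if "c : C" for z t c
  unfolding L_def per_shift[OF that] by (rule per_lo[OF that])
 have Psi_meas: "Psi : borel_measurable (lebn E)" unfolding Psi_def[abs_def] by measurable
 have Psi_int: "(\<integral>\<^sup>+l. Psi l \<partial>lebn E) = ennreal (\<Prod>e\<in>E. 1 / mu e)"
 proof -
  have "(\<integral>\<^sup>+l. Psi l \<partial>lebn E) = (\<Prod>e\<in>E. \<integral>\<^sup>+x. ennreal (exp (- mu e * x)) * indicator {0<..} x \<partial>lborel)"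
   unfolding Psi_def[abs_def]
   by (rule lb.product_nn_integral_prod[OF finite_E, of "%e x. ennreal (exp (- mu e * x)) * indicator {0<..} x"]) simp
  also have "... = (\<Prod>e\<in>E. ennreal (1 / mu e))" using mu_pos by (intro prod.cong refl nn_integral_exp_positive)
  also have "... = ennreal (\<Prod>e\<in>E. 1 / mu e)" using mu_pos by (intro prod_ennreal) (simp add: less_imp_le)
  finally show ?thesis .
 qed
 have Psi_cong: "Psi l = Psi l'" if "!!e. e : E ==> l e = l' e" for l l'
  unfolding Psi_def using that by (intro prod.cong) auto
 define J where "J z = (\<integral>\<^sup>+t. Psi (restrict (L z t) E) \<partial>lebn {..<2*d})" for z
 have L_meas: "(%p. restrict (L (fst p) (snd p)) E) : measurable (lebn ({1..n} <+> {1..b}) \<Otimes>\<^sub>M lebn {..<2*d}) (lebn E)"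
 proof (rule measurable_restrict)
  fix e assume "e : E"
  have [measurable]: "(%p. fst p k) : measurable (lebn ({1..n} <+> {1..b}) \<Otimes>\<^sub>M lebn {..<2*d}) borel"
   if "k : {1..n} <+> {1..b}" for k
   using measurable_compose[OF measurable_fst measurable_component_singleton[OF that, where M = "%_. lborel"]]
   by (simp only: measurable_lborel1)
  have [measurable]: "(%p. snd p k) : measurable (lebn ({1..n} <+> {1..b}) \<Otimes>\<^sub>M lebn {..<2*d}) borel"
   if "k : {..<2*d}" for k
   using measurable_compose[OF measurable_snd measurable_component_singleton[OF that, where M = "%_. lborel"]]
   by (simp only: measurable_lborel1)
  show "(%p. L (fst p) (snd p) e) : measurable (lebn ({1..n} <+> {1..b}) \<Otimes>\<^sub>M lebn {..<2*d}) lborel"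
   unfolding L_def lo_def measurable_lborel1 using bij_betwE[OF cycle_index_bij]
   by (intro borel_measurable_add borel_measurable_sum borel_measurable_times) auto
 qed
 have PL_meas: "(%p. Psi (restrict (L (fst p) (snd p)) E)) : borel_measurable (lebn ({1..n} <+> {1..b}) \<Otimes>\<^sub>M lebn {..<2*d})"
  by (rule measurable_compose[OF L_meas Psi_meas])
 have J_meas: "J : borel_measurable (lebn ({1..n} <+> {1..b}))" unfolding J_def[abs_def]
  using sigma_finite_measure.borel_measurable_nn_integral[OF lb.sigma_finite, of "{..<2*d}" "%z t. Psi (restrict (L z t) E)" "lebn ({1..n} <+> {1..b})"] PL_meas
  by (simp add: case_prod_beta')
 have J_int: "(\<integral>\<^sup>+z. J z \<partial>lebn ({1..n} <+> {1..b})) = ennreal (1 / \<bar>idet E N\<bar> * (\<Prod>e\<in>E. 1 / mu e))"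
 proof -
  define k where "k = map_sum cycle_index id \<circ> g"
  have k: "bij_betw k E ?K"
  proof -
   have "bij_betw (map_sum cycle_index id) (C <+> {..<2*d}) ?K"
   proof (rule bij_betwI')
    have inj: "cycle_index c = cycle_index c' \<longleftrightarrow> c = c'" if "c : C" "c' : C" for c c'
     using cycle_index_bij that unfolding bij_betw_def by (metis inj_on_eq_iff)
    show "map_sum cycle_index id x = map_sum cycle_index id y \<longleftrightarrow> x = y"
     if "x : C <+> {..<2*d}" "y : C <+> {..<2*d}" for x y using that inj by (elim PlusE) simp_all
    show "map_sum cycle_index id x : ?K" if "x : C <+> {..<2*d}" for x
     using that by (elim PlusE) (simp_all only: map_sum.simps id_apply InlI[OF bij_betwE[OF cycle_index_bij, rule_format]] InrI)
    show "\<exists>x\<in>C <+> {..<2*d}. y = map_sum cycle_index id x" if y: "y : ?K" for y using y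
    proof (rule PlusE)
     fix z assume z: "z : {1..n} <+> {1..b}" "y = Inl z"
     then obtain c where "c : C" "z = cycle_index c" using cycle_index_bij unfolding bij_betw_def by (metis imageE)
     then show ?thesis using z(2) by (intro bexI[of _ "Inl c"]) (simp_all add: InlI)
    next
     fix z assume "z : {..<2*d}" "y = Inr z"
     then show ?thesis by (intro bexI[of _ "Inr z"]) (simp_all add: InrI)
    qed
   qed
   then show ?thesis unfolding k_def by (rule bij_betw_trans[OF g])
  qed
  have aff: "affine_map E N (%_. 0) (\<lambda>e\<in>E. u (k e)) = restrict (L (u \<circ> Inl) (u \<circ> Inr)) E" for u
  proof -
   have "(\<Sum>e'\<in>E. N e e' * u (k e')) = L (u \<circ> Inl) (u \<circ> Inr) e" for e
   proof -
    have "(\<Sum>e'\<in>E. N e e' * u (k e')) =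
      (\<Sum>e'\<in>E. (case g e' of Inl c => S c e | Inr i => v i e) * u (map_sum cycle_index id (g e')))"
     by (simp add: N_def chart_matrix_def k_def)
    also have "... = (\<Sum>j\<in>C <+> {..<2*d}. (case j of Inl c => S c e | Inr i => v i e) * u (map_sum cycle_index id j))"
     by (rule sum.reindex_bij_betw[OF g])
    also have "... = L (u \<circ> Inl) (u \<circ> Inr) e"
     using finite_C by (subst sum.Plus) (auto simp: L_def lo_def mult.commute)
    finally show ?thesis .
   qed
   then show ?thesis by (auto simp: affine_map_def fun_eq_iff)
  qed
  have "(\<integral>\<^sup>+z. J z \<partial>lebn ({1..n} <+> {1..b})) =
    (\<integral>\<^sup>+u. Psi (restrict (L (u \<circ> Inl) (u \<circ> Inr)) E) \<partial>lebn ?K)"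
  proof -
   have fin: "finite ({1..n} <+> {1..b})" "finite {..<2*d}" by auto
   have "(%u. Psi (affine_map E N (%_. 0) (\<lambda>e\<in>E. u (k e)))) : borel_measurable (lebn ?K)"
   proof (rule measurable_compose[OF _ Psi_meas])
    have "(%u. \<lambda>e\<in>E. u (k e)) : measurable (lebn ?K) (lebn E)"
     using bij_betwE[OF k] by (intro measurable_restrict measurable_component_singleton) auto
    then show "(%u. affine_map E N (%_. 0) (\<lambda>e\<in>E. u (k e))) : measurable (lebn ?K) (lebn E)"
     by (rule measurable_compose[OF _ measurable_affine_map])
   qed
   from nn_integral_lebn_Plus[OF fin this] show ?thesis unfolding aff J_def by (simp add: o_def)
  qed
  also have "... = (\<integral>\<^sup>+u. Psi (affine_map E N (%_. 0) (\<lambda>e\<in>E. u (k e))) \<partial>lebn ?K)" unfolding aff ..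
  also have "... = (\<integral>\<^sup>+u. Psi (affine_map E N (%_. 0) u) \<partial>lebn E)"
   by (rule nn_integral_lebn_reindex[OF k finite_E]) (rule measurable_compose[OF measurable_affine_map Psi_meas])
  also have "... = ennreal (1 / \<bar>idet E N\<bar>) * (\<integral>\<^sup>+l. Psi l \<partial>lebn E)"
   by (rule nn_integral_affine_map[OF finite_E Psi_meas N0])
  also have "... = ennreal (1 / \<bar>idet E N\<bar> * (\<Prod>e\<in>E. 1 / mu e))"
   unfolding Psi_int using mu_pos by (intro ennreal_mult[symmetric] prod_nonneg) (auto simp: less_imp_le)
  finally show ?thesis .
 qed
 define Jp where "Jp = (%(x, y). J (case_sum x y))"
 have Jp_meas: "Jp : borel_measurable (lebn {1..n} \<Otimes>\<^sub>M lebn {1..b})"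
  using measurable_compose[OF case_sum_lebn J_meas] by (simp add: Jp_def case_prod_beta')
 have Jp_int: "(\<integral>\<^sup>+p. Jp p \<partial>(lebn {1..n} \<Otimes>\<^sub>M lebn {1..b})) = ennreal (1 / \<bar>idet E N\<bar> * (\<Prod>e\<in>E. 1 / mu e))"
 proof -
  have "(\<integral>\<^sup>+p. Jp p \<partial>(lebn {1..n} \<Otimes>\<^sub>M lebn {1..b})) = (\<integral>\<^sup>+x. \<integral>\<^sup>+y. Jp (x, y) \<partial>lebn {1..b} \<partial>lebn {1..n})"
   using sigma_finite_measure.nn_integral_fst[OF lb.sigma_finite Jp_meas] by simp
  also have "... = (\<integral>\<^sup>+z. J z \<partial>lebn ({1..n} <+> {1..b}))"
   using nn_integral_lebn_Plus[OF _ _ J_meas] by (simp add: Jp_def)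
  finally show ?thesis using J_int by simp
 qed
 let ?P = "%x y. {t : space (lebn {..<2*d}). \<forall>e\<in>E. 0 < L (case_sum x y) t e}"
 have P_meas: "?P x y : sets (lebn {..<2*d})" for x y
 proof -
  have "(%t. L (case_sum x y) t e) : borel_measurable (lebn {..<2*d})" for e unfolding L_def by measurable
  then show ?thesis using finite_E by (intro sets.sets_Collect_finite_All) (auto intro: borel_measurable_less)
 qed
 have Jp_eq: "Jp (x, y) = ennreal (exp (- (\<Sum>i=1..n. lam i * x i))) * emeasure (lebn {..<2*d}) (?P x y)" for x y
 proof -
  have "Psi (restrict (L (case_sum x y) t) E) = ennreal (exp (- (\<Sum>i=1..n. lam i * x i))) * indicator (?P x y) t"
   if t: "t : space (lebn {..<2*d})" for t
  proof -
   have "Psi (restrict (L (case_sum x y) t) E) = Psi (L (case_sum x y) t)" by (rule Psi_cong) simp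
   also have "... = (\<Prod>e\<in>E. ennreal (exp (- mu e * L (case_sum x y) t e))) * (\<Prod>e\<in>E. indicator {0<..} (L (case_sum x y) t e))"
    by (simp add: Psi_def prod.distrib)
   also have "(\<Prod>e\<in>E. ennreal (exp (- mu e * L (case_sum x y) t e))) = ennreal (exp (\<Sum>e\<in>E. - mu e * L (case_sum x y) t e))"
    using finite_E by (simp add: prod_ennreal exp_sum)
   also have "(\<Sum>e\<in>E. - mu e * L (case_sum x y) t e) = - (\<Sum>i=1..n. lam i * x i)"
    using mu_sum[of "L (case_sum x y) t" x y] per_L by (simp add: sum_negf)
   also have "(\<Prod>e\<in>E. indicator {0<..} (L (case_sum x y) t e)) = (indicator (?P x y) t :: ennreal)"
   proof (cases "t : ?P x y")
    case True
    then show ?thesis by (auto intro!: prod.neutral)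
   next
    case False
    then obtain e where "e : E" "\<not> 0 < L (case_sum x y) t e" using t by auto
    then have "(\<Prod>e\<in>E. indicator {0<..} (L (case_sum x y) t e)) = (0::ennreal)"
     using finite_E by (intro prod_zero bexI[of _ e]) auto
    moreover have "indicator (?P x y) t = (0::ennreal)" using False by (rule indicator_simps(2))
    ultimately show ?thesis by (simp only:)
   qed
   finally show ?thesis .
  qed
  then have "Jp (x, y) = (\<integral>\<^sup>+t. ennreal (exp (- (\<Sum>i=1..n. lam i * x i))) * indicator (?P x y) t \<partial>lebn {..<2*d})"
   unfolding Jp_def J_def by (simp cong: nn_integral_cong)
  then show ?thesis using P_meas by (simp add: nn_integral_cmult_indicator)
 qed
 \<comment> \<open>Any metric has positive perimeters, so a nonempty slice already lies over
   positive perimeters and the indicator in \<open>W\<close> changes nothing.\<close>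
 have P_pos: "x : {1..n} \<rightarrow>\<^sub>E {0<..} \<and> y : {1..b} \<rightarrow>\<^sub>E {0<..}"
  if ne: "?P x y ~= {}" and xy: "x : space (lebn {1..n})" "y : space (lebn {1..b})" for x y
 proof -
  obtain t where t: "\<forall>e\<in>E. 0 < L (case_sum x y) t e" using ne by auto
  have pos: "case_sum x y k > 0" if k: "k : {1..n} <+> {1..b}" for k
  proof -
   obtain c where c: "c : C" "k = cycle_index c" using cycle_index_bij k unfolding bij_betw_def by (metis imageE)
   then obtain h where h: "h : H" "c = cyc h" by auto
   have "0 < (\<Sum>h'\<in>cyc h. L (case_sum x y) t (edge_at G h'))"
    using t cyc_subset[OF h(1)] by (intro sum_pos finite_cyc orbit_nonempty) auto
   then have "0 < perimeter G (L (case_sum x y) t) c" by (simp add: perimeter_def h(2))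
   then show ?thesis using per_L[OF c(1)] c(2) by simp
  qed
  have "x i > 0" if "i : {1..n}" for i using pos[OF InlI[OF that]] by simp
  moreover have "y i > 0" if "i : {1..b}" for i using pos[OF InrI[OF that]] by simp
  ultimately show ?thesis using xy by (auto simp: space_PiM PiE_def)
 qed
 \<comment> \<open>The origin chosen by \<open>SOME\<close> differs from \<open>lo\<close> by a
   slice direction, so the two parameter regions are translates of each other.\<close>
 have vol: "cell_volume G d x y = \<bar>Omega_power G d v\<bar> * measure (lebn {..<2*d}) (?P x y)" for x y
 proof -
  define l0 where "l0 = (SOME l0. has_perimeters G x y l0)"
  have l0: "has_perimeters G x y l0"
   unfolding l0_def by (rule someI[of _ "lo (case_sum x y)"]) (simp add: has_perimeters_alt per_lo)
  define w where "w = (\<lambda>e\<in>E. l0 e - lo (case_sum x y) e)"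
  have "perimeter G w c = 0" if c: "c : C" for c
  proof -
   have "perimeter G w c = perimeter G (%e. l0 e - lo (case_sum x y) e) c"
    by (rule perimeter_cong[OF c]) (simp add: w_def)
   then show ?thesis using bspec[OF l0[unfolded has_perimeters_alt] c] per_lo[OF c] by (simp add: perimeter_diff)
  qed
  then have "w : slice_directions G" by (auto simp: slice_directions_eq w_def)
  then obtain s where s: "\<forall>e\<in>E. w e = (\<Sum>i<2*d. s i * v i e)" using v unfolding slice_basis_def by blast
  have l0_eq: "l0 e + (\<Sum>i<2*d. t i * v i e) = L (case_sum x y) (\<lambda>i\<in>{..<2*d}. t i + s i) e" if "e : E" for t e
  proof -
   have "l0 e = lo (case_sum x y) e + (\<Sum>i<2*d. s i * v i e)" using bspec[OF s that] that by (simp add: w_def)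
   then show ?thesis by (simp add: L_def distrib_right sum.distrib)
  qed
  have per: "has_perimeters G x y (\<lambda>e\<in>E. l0 e + (\<Sum>i<2*d. t i * v i e))" for t unfolding has_perimeters_alt
  proof
   fix c assume c: "c : C"
   have "perimeter G (\<lambda>e\<in>E. l0 e + (\<Sum>i<2*d. t i * v i e)) c = perimeter G (%e. l0 e + (\<Sum>i<2*d. t i * v i e)) c"
    by (rule perimeter_cong[OF c]) simp
   then show "perimeter G (\<lambda>e\<in>E. l0 e + (\<Sum>i<2*d. t i * v i e)) c = case_sum x y (cycle_index c)"
    using bspec[OF l0[unfolded has_perimeters_alt] c] per_shift[OF c] by simp
  qed
  have "{t : {..<2*d} \<rightarrow>\<^sub>E UNIV. (\<lambda>e\<in>E. l0 e + (\<Sum>i<2*d. t i * v i e)) : metric_slice G x y} =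
    {t : space (lebn {..<2*d}). (\<lambda>i\<in>{..<2*d}. t i + s i) : ?P x y}"
   using per l0_eq by (auto simp: metric_slice_def space_PiM PiE_def Pi_def)
  then have "measure (lebn {..<2*d}) {t : {..<2*d} \<rightarrow>\<^sub>E UNIV. (\<lambda>e\<in>E. l0 e + (\<Sum>i<2*d. t i * v i e)) : metric_slice G x y} =
    measure (lebn {..<2*d}) (?P x y)"
   unfolding measure_def by (simp only: emeasure_lebn_translate[OF finite_lessThan P_meas])
  then show ?thesis unfolding cell_volume_def Let_def v_def[symmetric] l0_def[symmetric] by simp
 qed
 have "has_bochner_integral (lebn {1..n} \<Otimes>\<^sub>M lebn {1..b}) (%p. \<bar>Omega_power G d v\<bar> * enn2real (Jp p))
   (\<bar>Omega_power G d v\<bar> * (1 / \<bar>idet E N\<bar> * (\<Prod>e\<in>E. 1 / mu e)))"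
  by (intro has_bochner_integral_mult_right has_bochner_integral_enn2real[OF Jp_meas Jp_int])
    (use mu_pos in \<open>auto intro!: mult_nonneg_nonneg prod_nonneg simp: less_imp_le\<close>)
 also have "\<bar>Omega_power G d v\<bar> * (1 / \<bar>idet E N\<bar> * (\<Prod>e\<in>E. 1 / mu e)) = sqrt (2 ^ (card H div 3)) * (\<Prod>e\<in>E. 1 / mu e)"
  unfolding const[symmetric] by simp
 finally have "has_bochner_integral (lebn {1..n} \<Otimes>\<^sub>M lebn {1..b}) (%p. \<bar>Omega_power G d v\<bar> * enn2real (Jp p))
  (sqrt (2 ^ (card H div 3)) * (\<Prod>e\<in>E. 1 / mu e))" .
 moreover have "(case p of (x, y) => indicator (({1..n} \<rightarrow>\<^sub>E {0<..}) \<times> ({1..b} \<rightarrow>\<^sub>E {0<..})) (x, y) *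
    (exp (- (\<Sum>i=1..n. lam i * x i)) * cell_volume G d x y)) = \<bar>Omega_power G d v\<bar> * enn2real (Jp p)"
  if sp: "p : space (lebn {1..n} \<Otimes>\<^sub>M lebn {1..b})" for p
 proof -
  obtain x y where p: "p = (x, y)" "x : space (lebn {1..n})" "y : space (lebn {1..b})"
   using sp by (auto simp: space_pair_measure)
  have "enn2real (Jp p) = exp (- (\<Sum>i=1..n. lam i * x i)) * measure (lebn {..<2*d}) (?P x y)"
   unfolding p(1) Jp_eq by (simp add: enn2real_mult measure_def)
  moreover have "indicator (({1..n} \<rightarrow>\<^sub>E {0<..}) \<times> ({1..b} \<rightarrow>\<^sub>E {0<..})) (x, y) * measure (lebn {..<2*d}) (?P x y) =
    measure (lebn {..<2*d}) (?P x y)"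
  proof (cases "?P x y = {}")
   case True
   show ?thesis unfolding True by simp
  next
   case False
   have "(x, y) : ({1..n} \<rightarrow>\<^sub>E {0<..}) \<times> ({1..b} \<rightarrow>\<^sub>E {0<..})"
    using P_pos[OF False p(2,3)] by (simp only: mem_Times_iff fst_conv snd_conv)
   then show ?thesis by (simp only: indicator_simps mult_1_left)
  qed
  ultimately show ?thesis unfolding p(1) by (simp add: vol mult_ac)
 qed
 ultimately show ?thesis unfolding mu_def by (subst has_bochner_integral_cong[OF refl _ refl])
qed

end

section \<open>Coloured maps\<close>

text \<open>A coloured map on \<open>H\<close> is a triple \<open>(a, t, c)\<close>: the cycles of \<open>a\<close>, of length three, are the
  vertices, the two-element cycles of the involution \<open>t\<close> are edges, and its fixed points are loose
  half-edges. The colour \<open>None\<close> marks boundaries; all other colours are colours of faces.\<close>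

type_synonym ('h, 'n) cmap = "('h => 'h) \<times> ('h => 'h) \<times> ('h => 'n option)"

text \<open>Colours are transported along the sides of edges by \<open>a (a (t x))\<close>, but
  nothing is demanded where a loose half-edge interrupts a side. The last condition forbids edges
  between two boundaries and, for \<open>t x = x\<close>, a boundary colour on a loose
  half-edge.\<close>

definition cmaps :: "'h set => ('h, 'n) cmap set" where
 "cmaps H = {(a, t, c). a permutes H \<and> (\<forall>x\<in>H. a x ~= x \<and> a (a (a x)) = x) \<and>
   t permutes H \<and> (\<forall>x\<in>H. t (t x) = x) \<and> c : H \<rightarrow>\<^sub>E UNIV \<and>
   (\<forall>x\<in>H. t x ~= x --> c (a (a (t x))) = c x) \<and> (\<forall>x\<in>H. c x = None --> c (t x) ~= None)}"

definition cconn :: "'h set => ('h, 'n) cmap => bool" where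
 "cconn H m = (case m of (a, t, c) =>
   H ~= {} \<and> (\<forall>K. K \<subseteq> H \<and> K ~= {} \<and> a ` K \<subseteq> K \<and> t ` K \<subseteq> K --> K = H))"

definition edge_sets :: "'h set => ('h => 'h) => 'h set set" where
 "edge_sets H t = (%x. {x, t x}) ` {x : H. t x ~= x}"

definition bdry_cycles :: "'h set => ('h, 'n) cmap => 'h set set" where
 "bdry_cycles H m = (case m of (a, t, c) => orbit (%x. a (a (t x))) ` {x : H. c x = None})"

definition lam_opt :: "('n => real) => 'n option => real" where
 "lam_opt lam o' = (case o' of None => 0 | Some i => lam i)"

definition entry_opt :: "('n => 'n => complex) => 'n option => 'n option => complex" where
 "entry_opt X o1 o2 = (case (o1, o2) of (Some i, Some j) => X i j | _ => 0)"

text \<open>The factor \<open>y\<close> is charged to edges with faces on both sides. At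
  \<open>y = 0\<close> only the edges along boundaries survive, those already contained in the
  vertices of the matrix model; at \<open>y = 1\<close> every edge has its propagator.\<close>

definition edge_weight :: "complex => ('n => real) => ('h => 'n option) => 'h set => complex" where
 "edge_weight y lam c e = (if None : c ` e then 1 else y) / of_real (\<Sum>z\<in>e. lam_opt lam (c z))"

text \<open>For \<open>X = 0\<close> a single loose half-edge annihilates the weight, so that the
  same function also counts closed graphs.\<close>

definition cweight :: "complex => ('n => 'n => complex) => ('n => real) => 'h set => ('h, 'n) cmap => complex fps" where
 "cweight y X lam H m = (case m of (a, t, c) =>
   Q_monom ((\<Prod>x | x : H \<and> t x = x. entry_opt X (c x) (c (a (a x)))) * (\<Prod>e\<in>edge_sets H t. edge_weight y lam c e))
    (card (bdry_cycles H m)))"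

lemma cmapsD:
 assumes "(a, t, c) : cmaps H"
 shows "a permutes H" "t permutes H" "!!x. x : H ==> a x ~= x" "!!x. x : H ==> a (a (a x)) = x"
  "!!x. x : H ==> t (t x) = x" "c : H \<rightarrow>\<^sub>E UNIV"
  "!!x. x : H ==> t x ~= x ==> c (a (a (t x))) = c x" "!!x. x : H ==> c x = None ==> c (t x) ~= None"
 using assms by (auto simp: cmaps_def)

lemma finite_cmaps: "finite H ==> finite (cmaps H :: ('h, 'n::finite) cmap set)"
proof -
 assume H: "finite H"
 have "cmaps H \<subseteq> {p. p permutes H} \<times> {p. p permutes H} \<times> (H \<rightarrow>\<^sub>E (UNIV :: 'n option set))" by (auto simp: cmaps_def)
 moreover have "finite ({p. p permutes H} \<times> {p. p permutes H} \<times> (H \<rightarrow>\<^sub>E (UNIV :: 'n option set)))"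
  using H by (intro finite_cartesian_product finite_permutations finite_PiE) auto
 ultimately show ?thesis by (rule finite_subset)
qed

lemma Q_monom_mult: "Q_monom a m * Q_monom b n = Q_monom (a * b) (m + n)"
 by (simp add: Q_monom_def power_add mult_ac flip: fps_const_mult)

subsection \<open>Relabelling\<close>

text \<open>Outside \<open>H'\<close> the permutations are the identity and the colouring is
  undefined, the normal form demanded by \<open>cmaps\<close>. The inverse bijection
  \<open>g\<close> is a separate argument, which keeps composition and inversion symmetric.\<close>

definition relabel :: "'k set => ('h => 'k) => ('k => 'h) => ('h, 'n) cmap => ('k, 'n) cmap" where
 "relabel H' f g m = (case m of (a, t, c) =>
   ((%z. if z : H' then f (a (g z)) else z), (%z. if z : H' then f (t (g z)) else z), (\<lambda>z\<in>H'. c (g z))))"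

locale relabelling =
 fixes H :: "'h set" and H' :: "'k set" and f :: "'h => 'k" and g :: "'k => 'h"
 assumes f_in: "!!x. x : H ==> f x : H'" and g_in: "!!z. z : H' ==> g z : H"
  and gf: "!!x. x : H ==> g (f x) = x" and fg: "!!z. z : H' ==> f (g z) = z"
begin

lemma sym: "relabelling H' H g f" by unfold_locales (auto simp: f_in g_in gf fg)

lemma f_inj: "inj_on f H" using gf by (metis inj_onI)

lemma f_image: "f ` H = H'" using f_in g_in fg by force

lemma conj_permutes:
 assumes "p permutes H"
 shows "(%z. if z : H' then f (p (g z)) else z) permutes H'"
proof (rule bij_imp_permutes)
 have p: "p x : H \<longleftrightarrow> x : H" for x using permutes_in_image[OF assms] .
 have inv: "inv p x : H \<longleftrightarrow> x : H" for x using permutes_in_image[OF permutes_inv[OF assms]] .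
 show "bij_betw (%z. if z : H' then f (p (g z)) else z) H' H'"
  by (rule bij_betw_byWitness[where f' = "%z. f (inv p (g z))"])
    (auto simp: f_in g_in gf fg p inv permutes_inverses[OF assms])
qed auto

lemma relabel_cmaps:
 assumes "m : cmaps H" shows "relabel H' f g m : cmaps H'"
proof -
 obtain a t c where m: "m = (a, t, c)" by (cases m)
 note D = cmapsD[OF assms[unfolded m]]
 have [simp]: "a x : H \<longleftrightarrow> x : H" "t x : H \<longleftrightarrow> x : H" for x
  using permutes_in_image[OF D(1)] permutes_in_image[OF D(2)] by auto
 define a' where "a' = (%z. if z : H' then f (a (g z)) else z)"
 define t' where "t' = (%z. if z : H' then f (t (g z)) else z)"
 define c' where "c' = (\<lambda>z\<in>H'. c (g z))"
 have r: "relabel H' f g m = (a', t', c')" by (simp add: relabel_def m a'_def t'_def c'_def)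
 have ga: "g (a' z) = a (g z)" and gt: "g (t' z) = t (g z)" and aH: "a' z : H'" and tH: "t' z : H'"
  and cg: "c' z = c (g z)" if "z : H'" for z using that by (simp_all add: a'_def t'_def c'_def f_in g_in gf)
 have eqI: "z = w" if "g z = g w" "z : H'" "w : H'" for z w using that fg by metis
 have "a' permutes H'" "t' permutes H'" unfolding a'_def t'_def using D(1,2) by (simp_all add: conj_permutes)
 moreover have "a' z ~= z" if "z : H'" for z using ga[OF that] D(3)[OF g_in[OF that]] by auto
 moreover have "a' (a' (a' z)) = z" if "z : H'" for z by (rule eqI) (simp_all add: ga aH that D(4) g_in)
 moreover have "t' (t' z) = z" if "z : H'" for z by (rule eqI) (simp_all add: gt tH that D(5) g_in)
 moreover have "c' : H' \<rightarrow>\<^sub>E UNIV" by (simp add: c'_def)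
 moreover have "c' (a' (a' (t' z))) = c' z" if z: "z : H'" and ne: "t' z ~= z" for z
 proof -
  have "t (g z) ~= g z" using ne gt[OF z] eqI[OF _ tH[OF z] z] by auto
  then show ?thesis using D(7)[OF g_in[OF z]] z by (simp add: cg ga gt aH tH)
 qed
 moreover have "c' (t' z) ~= None" if z: "z : H'" and "c' z = None" for z
  using D(8)[OF g_in[OF z]] that by (simp add: cg gt tH)
 ultimately show ?thesis unfolding r cmaps_def by blast
qed

lemma relabel_relabel:
 assumes "m : cmaps H" shows "relabel H g f (relabel H' f g m) = m"
proof -
 obtain a t c where m: "m = (a, t, c)" by (cases m)
 note D = cmapsD[OF assms[unfolded m]]
 have [simp]: "a x : H \<longleftrightarrow> x : H" "t x : H \<longleftrightarrow> x : H" for x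
  using permutes_in_image[OF D(1)] permutes_in_image[OF D(2)] by auto
 show ?thesis
  using D(6) by (auto simp: m relabel_def fun_eq_iff f_in gf permutes_not_in[OF D(1)] permutes_not_in[OF D(2)] PiE_def extensional_def)
qed

lemma relabel_cconn:
 assumes m: "m : cmaps H" and conn: "cconn H m" shows "cconn H' (relabel H' f g m)"
proof -
 obtain a t c where m': "m = (a, t, c)" by (cases m)
 note D = cmapsD[OF m[unfolded m']]
 have [simp]: "a x : H \<longleftrightarrow> x : H" "t x : H \<longleftrightarrow> x : H" for x
  using permutes_in_image[OF D(1)] permutes_in_image[OF D(2)] by auto
 have ne: "H' ~= {}" using conn f_image by (auto simp: cconn_def m')
 have main: "K = H'" if K: "K \<subseteq> H'" "K ~= {}" "!!z. z : K ==> f (a (g z)) : K" "!!z. z : K ==> f (t (g z)) : K" for K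
 proof -
  have "g ` K \<subseteq> H" using K(1) g_in by auto
  moreover have "a (g z) : g ` K" "t (g z) : g ` K" if "z : K" for z
  proof -
   have "z : H'" using that K(1) by auto
   then have "a (g z) = g (f (a (g z)))" "t (g z) = g (f (t (g z)))" using g_in gf by auto
   then show "a (g z) : g ` K" "t (g z) : g ` K" using K(3,4) that by blast+
  qed
  ultimately have "g ` K = H" using conn K(2) unfolding cconn_def m' by (simp add: image_subset_iff)
  then show ?thesis using K(1) f_image fg by (metis (no_types, lifting) image_cong image_ident image_image subset_iff)
 qed
 show ?thesis unfolding cconn_def relabel_def m' prod.case
 proof (intro conjI allI impI ne)
  fix K assume K: "K \<subseteq> H' \<and> K ~= {} \<and> (%z. if z : H' then f (a (g z)) else z) ` K \<subseteq> K \<and>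
   (%z. if z : H' then f (t (g z)) else z) ` K \<subseteq> K"
  have "f (a (g z)) : K \<and> f (t (g z)) : K" if "z : K" for z
  proof -
   have "z : H'" using K that by blast
   moreover have "(if z : H' then f (a (g z)) else z) : K" "(if z : H' then f (t (g z)) else z) : K"
    using K that by blast+
   ultimately show ?thesis by simp
  qed
  then show "K = H'" using K by (intro main) blast+
 qed
qed

lemma relabel_weight:
 assumes m: "m : cmaps H" shows "cweight y X lam H' (relabel H' f g m) = cweight y X lam H m"
proof -
 obtain a t c where m': "m = (a, t, c)" by (cases m)
 note D = cmapsD[OF m[unfolded m']]
 have [simp]: "a x : H \<longleftrightarrow> x : H" "t x : H \<longleftrightarrow> x : H" for x
  using permutes_in_image[OF D(1)] permutes_in_image[OF D(2)] by auto
 define a' where "a' = (%z. if z : H' then f (a (g z)) else z)"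
 define t' where "t' = (%z. if z : H' then f (t (g z)) else z)"
 define c' where "c' = (\<lambda>z\<in>H'. c (g z))"
 have r: "relabel H' f g m = (a', t', c')" by (simp add: relabel_def m' a'_def t'_def c'_def)
 have at: "a' (f x) = f (a x)" "t' (f x) = f (t x)" "c' (f x) = c x" if "x : H" for x
  using that by (auto simp: a'_def t'_def c'_def f_in gf)
 have inj: "f x = f y \<longleftrightarrow> x = y" if "x : H" "y : H" for x y using that gf by metis
 have fixp: "{z. z : H' \<and> t' z = z} = f ` {x. x : H \<and> t x = x}"
  unfolding f_image[symmetric] using at inj by (auto simp: image_iff)
 have "(\<Prod>z | z : H' \<and> t' z = z. entry_opt X (c' z) (c' (a' (a' z)))) =
   (\<Prod>x | x : H \<and> t x = x. entry_opt X (c x) (c (a (a x))))"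
  unfolding fixp by (subst prod.reindex) (auto intro: inj_on_subset[OF f_inj] simp: at intro!: prod.cong)
 moreover have "(\<Prod>e\<in>edge_sets H' t'. edge_weight y lam c' e) = (\<Prod>e\<in>edge_sets H t. edge_weight y lam c e)"
 proof -
  have "edge_sets H' t' = (`) f ` edge_sets H t"
  proof -
   have "{z : H'. t' z ~= z} = f ` {x : H. t x ~= x}"
    unfolding f_image[symmetric] using at inj by (auto simp: image_iff)
   then show ?thesis by (auto simp: edge_sets_def image_image at)
  qed
  moreover have sub: "e \<subseteq> H" if "e : edge_sets H t" for e using that by (auto simp: edge_sets_def)
  then have "inj_on ((`) f) (edge_sets H t)" by (intro inj_onI) (metis f_inj inj_on_image_eq_iff)
  moreover have "edge_weight y lam c' (f ` e) = edge_weight y lam c e" if "e : edge_sets H t" for e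
  proof -
   have "(\<Sum>z\<in>f ` e. lam_opt lam (c' z)) = (\<Sum>x\<in>e. lam_opt lam (c' (f x)))"
    using sub[OF that] by (intro sum.reindex_cong[of f]) (auto intro: inj_on_subset[OF f_inj])
   also have "... = (\<Sum>x\<in>e. lam_opt lam (c x))" using sub[OF that] at by (intro sum.cong) auto
   moreover have "c' ` f ` e = c ` e" using sub[OF that] at(3) by (force simp: image_image)
   ultimately show ?thesis by (simp add: edge_weight_def)
  qed
  ultimately show ?thesis by (simp add: prod.reindex)
 qed
 moreover have "card (bdry_cycles H' (a', t', c')) = card (bdry_cycles H (a, t, c))"
 proof -
  let ?p = "%x. a (a (t x))" and ?p' = "%x. a' (a' (t' x))"
  have orb: "orbit ?p' (f x) = f ` orbit ?p x \<and> orbit ?p x \<subseteq> H" if "x : H" for x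
  proof -
   have pw: "(?p' ^^ k) (f x) = f ((?p ^^ k) x) \<and> (?p ^^ k) x : H" for k using that by (induction k) (auto simp: at)
   then show ?thesis unfolding orbit_altdef by (auto simp: image_def)
  qed
  have N: "{z : H'. c' z = None} = f ` {x : H. c x = None}"
   unfolding f_image[symmetric] using at by (auto simp: image_iff)
  have "bdry_cycles H' (a', t', c') = (`) f ` bdry_cycles H (a, t, c)"
   unfolding bdry_cycles_def prod.case N image_image using orb by (intro image_cong) auto
  moreover have "inj_on ((`) f) (bdry_cycles H (a, t, c))"
  proof (rule inj_onI)
   fix u v assume "u : bdry_cycles H (a, t, c)" "v : bdry_cycles H (a, t, c)" "f ` u = f ` v"
   moreover then have "u \<subseteq> H" "v \<subseteq> H" using orb by (auto simp: bdry_cycles_def)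
   ultimately show "u = v" using f_inj by (metis inj_on_image_eq_iff)
  qed
  ultimately show ?thesis by (simp add: card_image)
 qed
 ultimately show ?thesis by (simp add: cweight_def r[unfolded m'] m')
qed

lemma sum_relabel:
 assumes "!!m. m : cmaps H ==> P m \<longleftrightarrow> P' (relabel H' f g m)"
 shows "(\<Sum>m | m : cmaps H \<and> P m. cweight y X lam H m) = (\<Sum>m | m : cmaps H' \<and> P' m. cweight y X lam H' m)"
proof -
 interpret r: relabelling H' H g f by (rule sym)
 show ?thesis by (rule sum.reindex_bij_witness[where i = "relabel H g f" and j = "relabel H' f g"])
    (auto simp: relabel_relabel r.relabel_relabel relabel_cmaps r.relabel_cmaps relabel_weight assms)
qed

lemma relabel_cconn_iff:
 assumes "m : cmaps H" shows "cconn H m \<longleftrightarrow> cconn H' (relabel H' f g m)"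
proof -
 interpret r: relabelling H' H g f by (rule sym)
 show ?thesis using relabel_cconn[OF assms] r.relabel_cconn[OF relabel_cmaps[OF assms]] relabel_relabel[OF assms] by auto
qed

end

definition all_sum :: "complex => ('n => 'n => complex) => ('n => real) => 'h set => complex fps" where
 "all_sum y X lam H = (\<Sum>m\<in>cmaps H. cweight y X lam H m)"

definition conn_sum :: "complex => ('n => 'n => complex) => ('n => real) => 'h set => complex fps" where
 "conn_sum y X lam H = (\<Sum>m | m : cmaps H \<and> cconn H m. cweight y X lam H m)"

text \<open>Weights are invariant under bijections of half-edges, so these sums depend on the number
  of half-edges only and can serve as coefficients of a generating function.\<close>

lemma sums_relabel:
 assumes "finite H" "finite H'" "card H = card H'"
 shows "all_sum y X lam H = all_sum y X lam H'" "conn_sum y X lam H = conn_sum y X lam H'"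
proof -
 obtain f where f: "bij_betw f H H'" using finite_same_card_bij assms by blast
 interpret relabelling H H' f "inv_into H f"
  by unfold_locales (use f in \<open>auto simp: bij_betw_def inv_into_into f_inv_into_f\<close>)
 show "all_sum y X lam H = all_sum y X lam H'" using sum_relabel[of "%_. True" "%_. True"] by (simp add: all_sum_def)
 show "conn_sum y X lam H = conn_sum y X lam H'" unfolding conn_sum_def by (rule sum_relabel) (rule relabel_cconn_iff)
qed

subsection \<open>Connected components\<close>

lemma permutes_closed_image:
 assumes "p permutes H" "finite H" "K \<subseteq> H" "p ` K \<subseteq> K"
 shows "p ` K = K" "p ` (H - K) = H - K"
proof -
 have inj: "inj p" using assms(1) by (rule permutes_inj)
 show K: "p ` K = K" by (rule endo_inj_surj) (use assms finite_subset inj_on_subset[OF inj] in auto)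
 show "p ` (H - K) = H - K" using image_set_diff[OF inj, of H K] K permutes_image[OF assms(1)] by simp
qed

definition component :: "'h set => ('h, 'n) cmap => 'h => 'h set" where
 "component H m x = (case m of (a, t, c) => \<Inter>{K. K \<subseteq> H \<and> x : K \<and> a ` K \<subseteq> K \<and> t ` K \<subseteq> K})"

lemma component:
 assumes m: "(a, t, c) : cmaps H" and H: "finite H" and x: "x : H"
 defines "K \<equiv> component H (a, t, c) x"
 shows "K \<subseteq> H" "x : K" "a ` K \<subseteq> K" "t ` K \<subseteq> K"
  "!!L. L \<subseteq> K ==> L ~= {} ==> a ` L \<subseteq> L ==> t ` L \<subseteq> L ==> L = K"
  "!!L. L \<subseteq> H ==> x : L ==> a ` L \<subseteq> L ==> t ` L \<subseteq> L ==> K \<subseteq> L"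
proof -
 note D = cmapsD[OF m]
 have HH: "a ` H \<subseteq> H" "t ` H \<subseteq> H" using permutes_image[OF D(1)] permutes_image[OF D(2)] by auto
 show least: "!!L. L \<subseteq> H ==> x : L ==> a ` L \<subseteq> L ==> t ` L \<subseteq> L ==> K \<subseteq> L"
  unfolding K_def component_def prod.case by blast
 show KH: "K \<subseteq> H" using least[of H] HH x by blast
 show xK: "x : K" unfolding K_def component_def prod.case by blast
 show aK: "a ` K \<subseteq> K" and tK: "t ` K \<subseteq> K" unfolding K_def component_def prod.case by blast+
 show "L = K" if L: "L \<subseteq> K" "L ~= {}" "a ` L \<subseteq> L" "t ` L \<subseteq> L" for L
 proof (cases "x : L")
  case True
  then show ?thesis using least[of L] L KH by blast
 next
  case False
  \<comment> \<open>A closed subset of a finite set has a closed complement, so a nonempty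
    \<open>L\<close> that misses \<open>x\<close> would leave a smaller closed set around
    \<open>x\<close>.\<close>
  have "a ` (K - L) \<subseteq> K - L" "t ` (K - L) \<subseteq> K - L"
  proof -
   have inj: "inj a" "inj t" using D permutes_inj by auto
   have "a ` L = L" "t ` L = L"
    using permutes_closed_image(1)[OF D(1) H] permutes_closed_image(1)[OF D(2) H] L KH by auto
   then show "a ` (K - L) \<subseteq> K - L" "t ` (K - L) \<subseteq> K - L"
    using aK tK image_set_diff[OF inj(1), of K L] image_set_diff[OF inj(2), of K L] by auto
  qed
  then have "K \<subseteq> K - L" using least[of "K - L"] False xK KH by blast
  then show ?thesis using L by blast
 qed
qed

lemma cweight_cong:
 assumes clos: "!!x. x : H ==> a x : H" "!!x. x : H ==> t x : H"
  and eq: "!!x. x : H ==> a' x = a x" "!!x. x : H ==> t' x = t x" "!!x. x : H ==> c' x = c x"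
 shows "cweight y X lam H (a', t', c') = cweight y X lam H (a, t, c)"
proof -
 have "(\<Prod>x | x : H \<and> t' x = x. entry_opt X (c' x) (c' (a' (a' x)))) =
   (\<Prod>x | x : H \<and> t x = x. entry_opt X (c x) (c (a (a x))))" by (rule prod.cong) (auto simp: eq clos)
 moreover have es: "edge_sets H t' = edge_sets H t" unfolding edge_sets_def by (rule image_cong) (auto simp: eq)
 moreover have "(\<Prod>e\<in>edge_sets H t. edge_weight y lam c' e) = (\<Prod>e\<in>edge_sets H t. edge_weight y lam c e)"
 proof (rule prod.cong)
  fix e assume "e : edge_sets H t"
  then have e: "e \<subseteq> H" using clos by (auto simp: edge_sets_def)
  have "c' ` e = c ` e" using e eq by (intro image_cong) auto
  moreover have "(\<Sum>z\<in>e. lam_opt lam (c' z)) = (\<Sum>z\<in>e. lam_opt lam (c z))" using e eq by (intro sum.cong) auto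
  ultimately show "edge_weight y lam c' e = edge_weight y lam c e" by (simp add: edge_weight_def)
 qed simp
 moreover have "bdry_cycles H (a', t', c') = bdry_cycles H (a, t, c)"
 proof -
  have "orbit (%x. a' (a' (t' x))) x = orbit (%x. a (a (t x))) x" if "x : H" for x
   using that by (intro orbit_cong0[of x H]) (auto simp: eq clos)
  then show ?thesis unfolding bdry_cycles_def prod.case using eq by (intro image_cong) auto
 qed
 ultimately show ?thesis by (simp add: cweight_def)
qed

text \<open>Loose half-edges, edges and boundary cycles each lie entirely in one of two disjoint
  closed sets; the exponents of \<open>Q\<close> add.\<close>

lemma cweight_union:
 assumes fin: "finite K" "finite L" and disj: "K \<inter> L = {}"
  and closK: "!!x. x : K ==> a x : K" "!!x. x : K ==> t x : K"
  and closL: "!!x. x : L ==> a x : L" "!!x. x : L ==> t x : L"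
 shows "cweight y X lam (K \<union> L) (a, t, c) = cweight y X lam K (a, t, c) * cweight y X lam L (a, t, c)"
proof -
 have "(\<Prod>x | x : K \<union> L \<and> t x = x. entry_opt X (c x) (c (a (a x)))) =
   (\<Prod>x | x : K \<and> t x = x. entry_opt X (c x) (c (a (a x)))) * (\<Prod>x | x : L \<and> t x = x. entry_opt X (c x) (c (a (a x))))"
  using fin disj by (subst prod.union_disjoint[symmetric]) (auto intro!: prod.cong)
 moreover have "(\<Prod>e\<in>edge_sets (K \<union> L) t. edge_weight y lam c e) =
   (\<Prod>e\<in>edge_sets K t. edge_weight y lam c e) * (\<Prod>e\<in>edge_sets L t. edge_weight y lam c e)"
 proof (subst prod.union_disjoint[symmetric])
  show "edge_sets K t \<inter> edge_sets L t = {}"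
  proof -
   have "e \<subseteq> M \<and> e ~= {}" if "e : edge_sets M t" "!!x. x : M ==> t x : M" for e M
    using that by (auto simp: edge_sets_def)
   then have "e \<subseteq> K \<inter> L \<and> e ~= {}" if "e : edge_sets K t" "e : edge_sets L t" for e
    using that closK(2) closL(2) by (metis Int_greatest)
   then show ?thesis unfolding disj by blast
  qed
 qed (use fin in \<open>auto simp: edge_sets_def intro!: prod.cong\<close>)
 moreover have "card (bdry_cycles (K \<union> L) (a, t, c)) = card (bdry_cycles K (a, t, c)) + card (bdry_cycles L (a, t, c))"
 proof (subst card_Un_disjoint[symmetric])
  let ?p = "%x. a (a (t x))"
  have sub: "orbit ?p x \<subseteq> M" if "x : M" "!!x. x : M ==> a x : M" "!!x. x : M ==> t x : M" for x M
  proof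
   fix z assume "z : orbit ?p x"
   then show "z : M" by induct (auto simp: that)
  qed
  show "bdry_cycles K (a, t, c) \<inter> bdry_cycles L (a, t, c) = {}"
  proof (rule ccontr)
   assume "\<not> ?thesis"
   then obtain x z where "x : K" "z : L" "orbit ?p x = orbit ?p z" by (auto simp: bdry_cycles_def)
   then have "orbit ?p x \<subseteq> K \<inter> L" using sub[of x K] sub[of z L] closK closL by auto
   then show False using disj orbit_nonempty[of ?p x] by auto
  qed
  show "card (bdry_cycles (K \<union> L) (a, t, c)) = card (bdry_cycles K (a, t, c) \<union> bdry_cycles L (a, t, c))"
   by (rule arg_cong[where f = card]) (auto simp: bdry_cycles_def)
 qed (use fin in \<open>auto simp: bdry_cycles_def\<close>)
 ultimately show ?thesis by (simp add: cweight_def Q_monom_mult mult_ac)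
qed

definition join :: "'h set => ('h, 'n) cmap => ('h, 'n) cmap => ('h, 'n) cmap" where
 "join K m1 m2 = (%z. if z : K then fst m1 z else fst m2 z,
   %z. if z : K then fst (snd m1) z else fst (snd m2) z, %z. if z : K then snd (snd m1) z else snd (snd m2) z)"

definition part :: "'h set => ('h, 'n) cmap => ('h, 'n) cmap" where
 "part K m = (%z. if z : K then fst m z else z, %z. if z : K then fst (snd m) z else z, restrict (snd (snd m)) K)"

lemma restricted_permutes:
 assumes "p permutes H" "finite H" "K \<subseteq> H" "p ` K \<subseteq> K"
 shows "(%z. if z : K then p z else z) permutes K"
 using permutes_closed_image(1)[OF assms] inj_on_subset[OF permutes_inj[OF assms(1)], of K]
 by (intro bij_imp_permutes) (auto simp: bij_betw_def inj_on_def)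

lemma part_cmaps:
 assumes m: "(a, t, c) : cmaps H" and H: "finite H" and K: "K \<subseteq> H" "a ` K \<subseteq> K" "t ` K \<subseteq> K"
 shows "part K (a, t, c) : cmaps K"
proof -
 note D = cmapsD[OF m]
 have [simp]: "a x : K" "t x : K" if "x : K" for x using K that by auto
 have xH: "x : H" if "x : K" for x using that K by auto
 define a' where "a' = (%z. if z : K then a z else z)"
 define t' where "t' = (%z. if z : K then t z else z)"
 define c' where "c' = restrict c K"
 have p: "part K (a, t, c) = (a', t', c')" by (simp add: part_def a'_def t'_def c'_def cong: if_cong)
 have eq: "a' z = a z" "t' z = t z" "c' z = c z" if "z : K" for z using that by (simp_all add: a'_def t'_def c'_def)
 have "a' permutes K" "t' permutes K"
  unfolding a'_def t'_def by (rule restricted_permutes[OF D(1) H K(1,2)], rule restricted_permutes[OF D(2) H K(1,3)])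
 moreover have "a' z ~= z" "a' (a' (a' z)) = z" "t' (t' z) = z" if "z : K" for z
  using that D(3-5)[OF xH[OF that]] by (simp_all add: eq)
 moreover have "c' : K \<rightarrow>\<^sub>E UNIV" by (simp add: c'_def)
 moreover have "c' (a' (a' (t' z))) = c' z" if "z : K" "t' z ~= z" for z
  using that D(7)[OF xH[OF that(1)]] by (simp add: eq)
 moreover have "c' (t' z) ~= None" if "z : K" "c' z = None" for z using that D(8)[OF xH[OF that(1)]] by (simp add: eq)
 ultimately show ?thesis unfolding p cmaps_def by blast
qed

lemma join_cmaps:
 assumes m1: "(a1, t1, c1) : cmaps K" and m2: "(a2, t2, c2) : cmaps L" and disj: "K \<inter> L = {}"
 shows "join K (a1, t1, c1) (a2, t2, c2) : cmaps (K \<union> L)"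
proof -
 note D = cmapsD[OF m1] and D' = cmapsD[OF m2]
 have [simp]: "a1 x : K \<longleftrightarrow> x : K" "t1 x : K \<longleftrightarrow> x : K" for x
  using permutes_in_image[OF D(1)] permutes_in_image[OF D(2)] by auto
 have [simp]: "a2 x : L \<longleftrightarrow> x : L" "t2 x : L \<longleftrightarrow> x : L" for x
  using permutes_in_image[OF D'(1)] permutes_in_image[OF D'(2)] by auto
 have L: "x ~: K" if "x : L" for x using that disj by auto
 have comp: "(%z. if z : K then p z else q z) permutes K \<union> L" if p: "p permutes K" and q: "q permutes L" for p q
 proof -
  have "p \<circ> q permutes K \<union> L" by (rule permutes_compose) (use p q in \<open>auto intro: permutes_subset\<close>)
  moreover have "p \<circ> q = (%z. if z : K then p z else q z)"
  proof
   fix z show "(p \<circ> q) z = (if z : K then p z else q z)"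
    using L permutes_in_image[OF q, of z] p q by (cases "z : L") (auto simp: permutes_not_in)
  qed
  ultimately show ?thesis by simp
 qed
 define a where "a = (%z. if z : K then a1 z else a2 z)"
 define t where "t = (%z. if z : K then t1 z else t2 z)"
 define c where "c = (%z. if z : K then c1 z else c2 z)"
 have p: "join K (a1, t1, c1) (a2, t2, c2) = (a, t, c)" by (simp add: join_def a_def t_def c_def cong: if_cong)
 have K: "a z = a1 z" "t z = t1 z" "c z = c1 z" if "z : K" for z using that by (simp_all add: a_def t_def c_def)
 have L': "a z = a2 z" "t z = t2 z" "c z = c2 z" if "z : L" for z
  using L[OF that] by (simp_all add: a_def t_def c_def)
 have "a permutes K \<union> L" "t permutes K \<union> L"
  unfolding a_def t_def by (rule comp[OF D(1) D'(1)], rule comp[OF D(2) D'(2)])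
 moreover have "a z ~= z \<and> a (a (a z)) = z \<and> t (t z) = z" if "z : K \<union> L" for z
  using that D(3-5)[of z] D'(3-5)[of z] by (elim UnE) (simp_all add: K L')
 moreover have "c : K \<union> L \<rightarrow>\<^sub>E UNIV" using D(6) D'(6) by (auto simp: PiE_def extensional_def c_def)
 moreover have "c (a (a (t z))) = c z" if "z : K \<union> L" "t z ~= z" for z
  using that D(7)[of z] D'(7)[of z] by (elim UnE) (simp_all add: K L')
 moreover have "c (t z) ~= None" if "z : K \<union> L" "c z = None" for z
  using that D(8)[of z] D'(8)[of z] by (elim UnE) (simp_all add: K L')
 ultimately show ?thesis unfolding p cmaps_def by blast
qed

lemma cmaps_outside:
 assumes "m : cmaps H" "z ~: H"
 shows "fst m z = z" "fst (snd m) z = z" "snd (snd m) z = undefined"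
 using assms by (auto simp: cmaps_def permutes_not_in PiE_def extensional_def)

lemma part_join:
 assumes "K \<inter> L = {}"
 shows "m1 : cmaps K ==> part K (join K m1 m2) = m1"
  and "m2 : cmaps L ==> part L (join K m1 m2) = m2"
proof -
 assume m: "m1 : cmaps K"
 show "part K (join K m1 m2) = m1" by (intro prod_eqI ext) (simp_all add: part_def join_def cmaps_outside[OF m])
next
 assume m: "m2 : cmaps L"
 have "z ~: K" if "z : L" for z using that assms by auto
 then show "part L (join K m1 m2) = m2" by (intro prod_eqI ext) (simp_all add: part_def join_def cmaps_outside[OF m])
qed

lemma join_part: "m : cmaps H ==> K \<subseteq> H ==> join K (part K m) (part (H - K) m) = m"
 by (intro prod_eqI ext) (auto simp: part_def join_def cmaps_outside)

text \<open>Cutting out the component of a marked half-edge \<open>x\<close> leaves an arbitrary map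
  on the rest, and any such pair can be put together again. Marking \<open>x\<close> makes the
  decomposition unique; it is the combinatorial form of the differential equation behind the
  exponential formula.\<close>

lemma all_sum_decompose:
 fixes X :: "'n::finite => 'n => complex" and H :: "'h set"
 assumes H: "finite H" and x: "x : H"
 shows "all_sum y X lam H = (\<Sum>K | K \<subseteq> H \<and> x : K. conn_sum y X lam K * all_sum y X lam (H - K))"
proof -
 let ?S = "SIGMA K:{K. K \<subseteq> H \<and> x : K}. {m :: ('h, 'n) cmap. m : cmaps K \<and> cconn K m} \<times> (cmaps (H - K) :: ('h, 'n) cmap set)"
 have "(\<Sum>K | K \<subseteq> H \<and> x : K. conn_sum y X lam K * all_sum y X lam (H - K)) =
   (\<Sum>K | K \<subseteq> H \<and> x : K. \<Sum>(m1, m2)\<in>{m. m : cmaps K \<and> cconn K m} \<times> cmaps (H - K). cweight y X lam K m1 * cweight y X lam (H - K) m2)"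
  by (simp add: conn_sum_def all_sum_def sum_product sum.cartesian_product)
 also have "... = (\<Sum>(K, m1, m2)\<in>?S. cweight y X lam K m1 * cweight y X lam (H - K) m2)"
  using H finite_subset by (subst sum.Sigma) (auto intro!: finite_cartesian_product finite_cmaps finite_subset[OF _ finite_cmaps])
 also have "... = (\<Sum>m\<in>cmaps H. cweight y X lam H m)"
 proof (rule sum.reindex_bij_witness[where
    i = "%m. (component H m x, part (component H m x) m, part (H - component H m x) m)" and
    j = "%(K, m1, m2). join K m1 m2"])
  fix u assume "u : ?S"
  then obtain K a1 t1 c1 a2 t2 c2 where u: "u = (K, (a1, t1, c1), (a2, t2, c2))"
   and K: "K \<subseteq> H" "x : K" and m1: "(a1, t1, c1) : cmaps K" and conn: "cconn K (a1, t1, c1)"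
   and m2: "(a2, t2, c2) : cmaps (H - K)" by (cases u) auto
  note D = cmapsD[OF m1] and D' = cmapsD[OF m2]
  have KH: "K \<union> (H - K) = H" using K by auto
  have J: "join K (a1, t1, c1) (a2, t2, c2) : cmaps H" using join_cmaps[OF m1 m2] KH by auto
  then show "(case u of (K, m1, m2) => join K m1 m2) : cmaps H" by (simp add: u)
  define a where "a z = (if z : K then a1 z else a2 z)" for z
  define t where "t z = (if z : K then t1 z else t2 z)" for z
  define c where "c z = (if z : K then c1 z else c2 z)" for z
  have j: "join K (a1, t1, c1) (a2, t2, c2) = (a, t, c)" by (auto simp: join_def a_def t_def c_def)
  note comp = component[OF J[unfolded j] H x]
  have in1: "a1 z : K" "t1 z : K" if "z : K" for z
   using that permutes_in_image[OF D(1)] permutes_in_image[OF D(2)] by auto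
  have in2: "a2 z : H - K" "t2 z : H - K" if "z : H - K" for z
   using that permutes_in_image[OF D'(1)] permutes_in_image[OF D'(2)] by auto
  have "a ` K \<subseteq> K" "t ` K \<subseteq> K" using in1 by (auto simp: a_def t_def)
  then have CK: "component H (a, t, c) x \<subseteq> K" by (intro comp(6)) (use K in auto)
  have "a1 z : component H (a, t, c) x \<and> t1 z : component H (a, t, c) x" if z: "z : component H (a, t, c) x" for z
  proof -
   have "a z = a1 z" "t z = t1 z" using CK z by (auto simp: a_def t_def)
   then show ?thesis using comp(3,4) z by (metis image_subset_iff)
  qed
  then have cl: "a1 ` component H (a, t, c) x \<subseteq> component H (a, t, c) x"
    "t1 ` component H (a, t, c) x \<subseteq> component H (a, t, c) x" by blast+
  have "component H (a, t, c) x ~= {}" using comp(2) by blast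
  then have C: "component H (a, t, c) x = K"
   by (intro conn[unfolded cconn_def prod.case, THEN conjunct2, THEN spec, THEN mp] conjI CK cl)
  have disj: "K \<inter> (H - K) = {}" by blast
  have "part K (a, t, c) = (a1, t1, c1)" "part (H - K) (a, t, c) = (a2, t2, c2)"
   unfolding j[symmetric] by (rule part_join[OF disj], rule m1, rule part_join[OF disj], rule m2)
  then show "(component H (case u of (K, m1, m2) => join K m1 m2) x,
    part (component H (case u of (K, m1, m2) => join K m1 m2) x) (case u of (K, m1, m2) => join K m1 m2),
    part (H - component H (case u of (K, m1, m2) => join K m1 m2) x) (case u of (K, m1, m2) => join K m1 m2)) = u"
   by (simp add: u j C)
  have "cweight y X lam H (a, t, c) = cweight y X lam K (a, t, c) * cweight y X lam (H - K) (a, t, c)"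
  proof -
   have "cweight y X lam (K \<union> (H - K)) (a, t, c) = cweight y X lam K (a, t, c) * cweight y X lam (H - K) (a, t, c)"
    by (rule cweight_union) (use finite_subset[OF K(1) H] H in1 in2 in \<open>auto simp: a_def t_def\<close>)
   then show ?thesis unfolding KH .
  qed
  also have "cweight y X lam K (a, t, c) = cweight y X lam K (a1, t1, c1)"
   by (rule cweight_cong) (use in1 in \<open>auto simp: a_def t_def c_def\<close>)
  also have "cweight y X lam (H - K) (a, t, c) = cweight y X lam (H - K) (a2, t2, c2)"
   by (rule cweight_cong) (use in2 in \<open>auto simp: a_def t_def c_def\<close>)
  finally show "cweight y X lam H (case u of (K, m1, m2) => join K m1 m2) =
    (case u of (K, m1, m2) => cweight y X lam K m1 * cweight y X lam (H - K) m2)" by (simp add: u j)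
 next
  fix m :: "('h, 'n) cmap" assume m: "m : cmaps H"
  obtain a t c where m': "m = (a, t, c)" by (cases m)
  note D = cmapsD[OF m[unfolded m']]
  note comp = component[OF m[unfolded m'] H x]
  let ?K = "component H (a, t, c) x"
  have K': "a ` (H - ?K) \<subseteq> H - ?K" "t ` (H - ?K) \<subseteq> H - ?K"
   using permutes_closed_image(2)[OF D(1) H comp(1,3)] permutes_closed_image(2)[OF D(2) H comp(1,4)] by auto
  have "cconn ?K (part ?K (a, t, c))" unfolding cconn_def part_def prod.case
  proof (intro conjI allI impI)
   show "?K ~= {}" using comp(2) by blast
   fix L assume L: "L \<subseteq> ?K \<and> L ~= {} \<and> (%z. if z : ?K then fst (a, t, c) z else z) ` L \<subseteq> L \<and>
    (%z. if z : ?K then fst (snd (a, t, c)) z else z) ` L \<subseteq> L"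
   have "a z : L \<and> t z : L" if "z : L" for z
   proof -
    have "z : ?K" using L that by blast
    moreover have "(if z : ?K then fst (a, t, c) z else z) : L" "(if z : ?K then fst (snd (a, t, c)) z else z) : L"
     using L that by blast+
    ultimately show ?thesis by simp
   qed
   then have "a ` L \<subseteq> L" "t ` L \<subseteq> L" by blast+
   then show "L = ?K" using L comp(5) by blast
  qed
  then show "(component H m x, part (component H m x) m, part (H - component H m x) m) : ?S"
   using comp(1,2) part_cmaps[OF m[unfolded m'] H comp(1,3,4)] part_cmaps[OF m[unfolded m'] H _ K'] by (auto simp: m')
  show "(case (component H m x, part (component H m x) m, part (H - component H m x) m) of (K, m1, m2) => join K m1 m2) = m"
   using join_part[OF m] comp(1) by (simp add: m')
 qed
 finally show ?thesis by (simp add: all_sum_def)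
qed

section \<open>Exponential generating functions\<close>

context includes fps_syntax
begin

text \<open>Each half-edge carries a factor \<open>th\<close>, and the factorial divides out the
  labelling of half-edges; the coefficients are series in \<open>Q\<close>.\<close>

definition egf :: "complex => (nat => complex fps) => complex fps fps" where
 "egf th F = Abs_fps (%n. fps_const (th ^ n / fact n) * F n)"

lemma sum_Pow_card:
 fixes g :: "nat => 'a :: semiring_1"
 assumes "finite A"
 shows "(\<Sum>K\<in>Pow A. g (card K)) = (\<Sum>k\<le>card A. of_nat (card A choose k) * g k)"
proof -
 have "(\<Sum>K\<in>Pow A. g (card K)) = (\<Sum>k\<le>card A. \<Sum>K\<in>{K : Pow A. card K = k}. g (card K))"
  using assms by (intro sum.group[symmetric]) (auto intro: card_mono)
 also have "... = (\<Sum>k\<le>card A. of_nat (card A choose k) * g k)"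
 proof (intro sum.cong refl)
  fix k
  have "(\<Sum>K\<in>{K : Pow A. card K = k}. g (card K)) = (\<Sum>K\<in>{K. K \<subseteq> A \<and> card K = k}. g k)" by (intro sum.cong) auto
  then show "(\<Sum>K\<in>{K : Pow A. card K = k}. g (card K)) = of_nat (card A choose k) * g k"
   using n_subsets[OF assms, of k] by simp
 qed
 finally show ?thesis .
qed

lemma all_sum_Suc:
 fixes X :: "'n::finite => 'n => complex"
 shows "all_sum y X lam {..<Suc m} =
  (\<Sum>k\<le>m. of_nat (m choose k) * (conn_sum y X lam {..<Suc k} * all_sum y X lam {..<m - k}))"
proof -
 let ?G = "%k. conn_sum y X lam {..<Suc k} * all_sum y X lam {..<m - k}"
 \<comment> \<open>The marked half-edge is the largest one, so its component is given by its other
   half-edges, an arbitrary subset of \<open>{..<m}\<close>.\<close>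
 have "all_sum y X lam {..<Suc m} = (\<Sum>K | K \<subseteq> {..<Suc m} \<and> m : K. conn_sum y X lam K * all_sum y X lam ({..<Suc m} - K))"
  by (rule all_sum_decompose) auto
 also have "... = (\<Sum>K\<in>Pow {..<m}. ?G (card K))"
 proof (rule sum.reindex_bij_witness[where i = "insert m" and j = "%K. K - {m}"])
  fix K assume K: "K : {K. K \<subseteq> {..<Suc m} \<and> m : K}"
  then show "insert m (K - {m}) = K" "K - {m} : Pow {..<m}" by auto
  have fK: "finite K" using K finite_subset by auto
  have cK: "card K = Suc (card (K - {m}))" using K fK by (intro card.remove) auto
  have "card ({..<Suc m} - K) = m - card (K - {m})" using K fK cK by (simp add: card_Diff_subset)
  then show "?G (card (K - {m})) = conn_sum y X lam K * all_sum y X lam ({..<Suc m} - K)"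
   using fK cK by (intro arg_cong2[of _ _ _ _ "(*)"] sums_relabel) auto
 qed auto
 also have "... = (\<Sum>k\<le>m. of_nat (m choose k) * ?G k)" by (subst sum_Pow_card) auto
 finally show ?thesis .
qed

text \<open>Differentiation marks a half-edge, and the recursion for the component of that half-edge
  is a binomial convolution, which is the product of exponential generating functions.\<close>

lemma fps_deriv_egf_all:
 fixes X :: "'n::finite => 'n => complex" and lam :: "'n => real" and y th :: complex
 defines "A \<equiv> egf th (%m. all_sum y X lam {..<m})" and "C \<equiv> egf th (%m. conn_sum y X lam {..<m})"
 shows "fps_deriv A = fps_deriv C * A"
proof (rule fps_ext)
 fix m
 let ?al = "%m. all_sum y X lam {..<m}" and ?ga = "%m. conn_sum y X lam {..<m}"
 have D: "fps_deriv (egf th F) $ m = fps_const (th ^ Suc m / fact m) * F (Suc m)" for F m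
 proof -
  have "fps_deriv (egf th F) $ m = fps_const (of_nat (Suc m) * (th ^ Suc m / fact (Suc m))) * F (Suc m)"
   by (simp add: egf_def fps_of_nat[symmetric] mult.assoc del: of_nat_Suc flip: fps_const_mult)
  also have "of_nat (Suc m) * (th ^ Suc m / fact (Suc m)) = th ^ Suc m / fact m"
   by (simp add: fact_Suc del: of_nat_Suc)
  finally show ?thesis .
 qed
 have "fps_deriv A $ m = fps_const (th ^ Suc m / fact m) * ?al (Suc m)" unfolding A_def by (rule D)
 also have "... = (\<Sum>k\<le>m. fps_const (th ^ Suc m / fact m) * (of_nat (m choose k) * (?ga (Suc k) * ?al (m - k))))"
  unfolding all_sum_Suc sum_distrib_left ..
 also have "... = (\<Sum>k\<le>m. (fps_const (th ^ Suc k / fact k) * ?ga (Suc k)) * (fps_const (th ^ (m - k) / fact (m - k)) * ?al (m - k)))"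
 proof (intro sum.cong refl)
  fix k assume "k : {..m}"
  then have k: "k \<le> m" by simp
  have "th ^ Suc m / fact m * of_nat (m choose k) = (th ^ Suc k / fact k) * (th ^ (m - k) / fact (m - k))"
   using k by (simp add: binomial_fact field_simps flip: power_add)
  then have c: "fps_const (th ^ Suc m / fact m) * of_nat (m choose k) = fps_const (th ^ Suc k / fact k) * fps_const (th ^ (m - k) / fact (m - k))"
   by (simp add: fps_of_nat[symmetric])
  have "fps_const (th ^ Suc m / fact m) * (of_nat (m choose k) * (?ga (Suc k) * ?al (m - k))) =
    (fps_const (th ^ Suc m / fact m) * of_nat (m choose k)) * (?ga (Suc k) * ?al (m - k))" by (simp only: mult.assoc)
  also have "... = (fps_const (th ^ Suc k / fact k) * ?ga (Suc k)) * (fps_const (th ^ (m - k) / fact (m - k)) * ?al (m - k))"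
   unfolding c by (simp only: mult_ac)
  finally show "fps_const (th ^ Suc m / fact m) * (of_nat (m choose k) * (?ga (Suc k) * ?al (m - k))) =
    (fps_const (th ^ Suc k / fact k) * ?ga (Suc k)) * (fps_const (th ^ (m - k) / fact (m - k)) * ?al (m - k))" .
 qed
 also have "... = (fps_deriv C * A) $ m" unfolding fps_mult_nth C_def D by (simp add: A_def egf_def atLeast0AtMost)
 finally show "fps_deriv A $ m = (fps_deriv C * A) $ m" .
qed

lemma fps_linear_ode_unique:
 fixes A B D :: "complex fps fps"
 assumes A: "fps_deriv A = D * A" and B: "fps_deriv B = D * B" and 0: "A $ 0 = B $ 0"
 shows "A = B"
proof (rule fps_ext)
 fix n show "A $ n = B $ n"
 proof (induction n rule: less_induct)
  case (less n)
  show ?case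
  proof (cases n)
   case (Suc m)
   have "fps_deriv A $ m = fps_deriv B $ m" unfolding A B fps_mult_nth using less Suc by (intro sum.cong) auto
   then have "of_nat (Suc m) * A $ n = of_nat (Suc m) * B $ n" using Suc by (simp del: of_nat_Suc)
   then show ?thesis by (simp del: of_nat_Suc)
  qed (use 0 in simp)
 qed
qed

text \<open>By the chain rule \<open>formal_exp C\<close> solves the same linear differential
  equation, whose solution is determined by its constant term.\<close>

lemma formal_exp_eqI:
 fixes A C :: "complex fps fps"
 assumes C: "C $ 0 = 0" and A: "A $ 0 = 1" "fps_deriv A = fps_deriv C * A"
 shows "formal_exp C = A"
proof (rule fps_linear_ode_unique[OF _ A(2)])
 let ?E = "Abs_fps (%k. fps_const (fps_exp (1::complex) $ k))"
 have "fps_deriv ?E = ?E"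
 proof (rule fps_ext)
  fix k
  have "of_nat (Suc k) * fps_const (1 / fact (Suc k) :: complex) = fps_const (1 / fact k)"
   by (simp add: fps_of_nat[symmetric] fact_Suc del: of_nat_Suc)
  then show "fps_deriv ?E $ k = ?E $ k" by (simp del: of_nat_Suc fact_Suc)
 qed
 then show "fps_deriv (formal_exp C) = fps_deriv C * formal_exp C"
  unfolding formal_exp_def by (simp add: fps_compose_deriv[OF C] mult.commute)
 show "formal_exp C $ 0 = A $ 0" by (simp add: formal_exp_def A(1))
qed

text \<open>From \<open>(1 + fps_X) * L' = 1\<close> the derivative of \<open>formal_ln A\<close> is
  the logarithmic derivative of \<open>A\<close>, which is that of \<open>C\<close>; both series
  have constant term zero.\<close>

lemma formal_ln_eqI:
 fixes A C :: "complex fps fps"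
 assumes C: "C $ 0 = 0" and A: "A $ 0 = 1" "fps_deriv A = fps_deriv C * A"
 shows "formal_ln A = C"
proof -
 let ?L = "Abs_fps (%k. fps_const (fps_ln (1::complex) $ k))"
 have A0: "(A - 1) $ 0 = 0" using A(1) by simp
 have L: "(1 + fps_X) * fps_deriv ?L = 1"
 proof (rule fps_ext)
  fix k
  have dL: "fps_deriv ?L $ k = fps_const ((-1) ^ k)" for k
  proof -
   have "of_nat (Suc k) * fps_const ((-1) ^ k / of_nat (Suc k) :: complex) = fps_const ((-1) ^ k)"
    by (simp add: fps_of_nat[symmetric] del: of_nat_Suc)
   then show ?thesis by (simp add: fps_ln_def del: of_nat_Suc)
  qed
  show "((1 + fps_X) * fps_deriv ?L) $ k = 1 $ k"
   by (cases k) (simp_all add: distrib_right dL flip: fps_const_neg del: fps_deriv_nth)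
 qed
 have "((1 + fps_X) oo (A - 1)) * (fps_deriv ?L oo (A - 1)) = 1"
  using arg_cong[OF L, of "%f. f oo (A - 1)"] by (simp add: fps_compose_mult_distrib[OF A0])
 then have "A * (fps_deriv ?L oo (A - 1)) = 1" using A0 by (simp add: fps_compose_add_distrib)
 moreover have "fps_deriv (formal_ln A) = (fps_deriv ?L oo (A - 1)) * fps_deriv A"
  unfolding formal_ln_def by (simp add: fps_compose_deriv[OF A0])
 ultimately have "fps_deriv (formal_ln A) = fps_deriv C" unfolding A(2) by (simp add: mult_ac)
 then have "formal_ln A = fps_const (formal_ln A $ 0 - C $ 0) + C" by (simp only: fps_deriv_eq_iff)
 moreover have "formal_ln A $ 0 = 0" by (simp add: formal_ln_def)
 ultimately show ?thesis using C by simp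
qed

lemma cmaps_empty: "cmaps {} = {(id, id, %_. undefined)}" by (auto simp: cmaps_def)

lemma egf_all_0: "egf th (%m. all_sum y X lam {..<m}) $ 0 = 1"
 by (simp add: egf_def all_sum_def cmaps_empty cweight_def edge_sets_def bdry_cycles_def Q_monom_def)

lemma egf_conn_0: "egf th (%m. conn_sum y X lam {..<m}) $ 0 = 0"
 by (simp add: egf_def conn_sum_def cconn_def case_prod_beta')

theorem egf_exp_ln:
 fixes X :: "'n::finite => 'n => complex" and lam :: "'n => real" and y th :: complex
 defines "A \<equiv> egf th (%m. all_sum y X lam {..<m})" and "C \<equiv> egf th (%m. conn_sum y X lam {..<m})"
 shows "formal_exp C = A" "formal_ln A = C" unfolding A_def C_def
 by (rule formal_exp_eqI formal_ln_eqI; rule egf_conn_0 egf_all_0 fps_deriv_egf_all)+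

end

section \<open>The vertices of the matrix model\<close>

lemma Q_monom_add: "Q_monom (a + b) n = Q_monom a n + Q_monom b n"
 by (simp add: Q_monom_def distrib_right flip: fps_const_add)

lemma Q_monom_sum: "Q_monom (sum f I) n = (\<Sum>i\<in>I. Q_monom (f i) n)"
proof (induction I rule: infinite_finite_induct)
 case (insert i I)
 then show ?case by (simp add: Q_monom_add)
qed (simp_all add: Q_monom_def)

lemma relabelling_bij: "bij_betw f I H ==> relabelling I H f (inv_into I f)"
 by unfold_locales (auto simp: bij_betw_def inv_into_into f_inv_into_f)

text \<open>Maps that are rigid once a half-edge \<open>b\<close> is chosen are counted, with this choice, by all
  bijections from a standard model \<open>std d\<close> whose point \<open>r\<close> goes to \<open>b\<close>.\<close>

lemma relabel_cong:
 assumes m: "m : cmaps H" and r: "relabelling H H' f g" and r': "relabelling H H' f' g'"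
  and eq: "!!x. x : H ==> f x = f' x"
 shows "relabel H' f g m = relabel H' f' g' m"
proof -
 interpret A: relabelling H H' f g by (rule r)
 interpret B: relabelling H H' f' g' by (rule r')
 obtain a t c where m': "m = (a, t, c)" by (cases m)
 note D = cmapsD[OF m[unfolded m']]
 have g: "g z = g' z" if "z : H'" for z using A.gf[OF B.g_in[OF that]] B.fg[OF that] eq[OF B.g_in[OF that]] by simp
 show ?thesis using g A.g_in eq permutes_in_image[OF D(1)] permutes_in_image[OF D(2)]
  by (auto simp: relabel_def m' fun_eq_iff)
qed

lemma sum_rooted_maps:
 fixes std :: "'d => ('i, 'n::finite) cmap" and phi :: "('h, 'n) cmap => 'h => 'i => 'h"
 assumes H: "finite H" and f0: "bij_betw f0 I H" and r: "r : I"
  and std: "!!d. d : D ==> std d : cmaps I"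
  and A: "!!m b. (m, b) : S ==> bij_betw (phi m b) I H \<and> dd m b : D \<and> phi m b r = b \<and>
    relabel H (phi m b) (inv_into I (phi m b)) (std (dd m b)) = m"
  and B: "!!d f m. d : D ==> bij_betw f I H ==> m = relabel H f (inv_into I f) (std d) ==>
    (m, f r) : S \<and> (\<forall>x\<in>I. phi m (f r) x = f x) \<and> dd m (f r) = d"
 shows "(\<Sum>(m, b)\<in>S. cweight y X lam H m) = of_nat (fact (card H)) * (\<Sum>d\<in>D. cweight y X lam I (std d))"
proof -
 let ?g0 = "inv_into I f0"
 \<comment> \<open>A pair \<open>(q, d)\<close> stands for the bijection \<open>q \<circ> f0\<close>
   of the model \<open>std d\<close>: with one reference bijection fixed, all others arise by
   permuting \<open>H\<close>, which accounts for the factor \<open>fact (card H)\<close>.\<close>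
 let ?i = "%(q, d). (relabel H (q \<circ> f0) (inv_into I (q \<circ> f0)) (std d), q (f0 r))"
 let ?j = "%(m, b). (%z. if z : H then phi m b (?g0 z) else z, dd m b)"
 have gf0: "?g0 (f0 x) = x" if "x : I" for x using f0 that by (simp add: bij_betw_def)
 have fg0: "f0 (?g0 z) = z" and gI: "?g0 z : I" if "z : H" for z
  using f0 that by (auto simp: bij_betw_def f_inv_into_f inv_into_into)
 have f0H: "f0 x : H" if "x : I" for x using f0 that by (auto simp: bij_betw_def)
 have relabel_eq: "relabel H f (inv_into I f) m = relabel H f' (inv_into I f') m"
  if m: "m : cmaps I" and f: "bij_betw f I H" and eq: "!!x. x : I ==> f x = f' x" for f f' m
 proof -
  have f': "bij_betw f' I H" using bij_betw_cong[of I f f' H] f eq by simp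
  show ?thesis by (rule relabel_cong[OF m relabelling_bij[OF f] relabelling_bij[OF f'] eq])
 qed
 have qf: "bij_betw (q \<circ> f0) I H" if "q permutes H" for q using bij_betw_trans[OF f0 permutes_imp_bij[OF that]] .
 have "(\<Sum>(m, b)\<in>S. cweight y X lam H m) = (\<Sum>(q, d)\<in>{q. q permutes H} \<times> D. cweight y X lam I (std d))"
 proof (rule sum.reindex_bij_witness[where i = ?i and j = ?j])
  fix s assume s: "s : S"
  obtain m b where mb: "s = (m, b)" by (cases s)
  note a = A[OF s[unfolded mb]]
  let ?q = "%z. if z : H then phi m b (?g0 z) else z"
  have "bij_betw (phi m b \<circ> ?g0) H H" using bij_betw_trans[OF bij_betw_inv_into[OF f0], of "phi m b" H] a by blast
  then have "bij_betw ?q H H" by (rule bij_betw_cong[THEN iffD1, rotated]) simp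
  then have q: "?q permutes H" by (rule bij_imp_permutes) simp
  have eq: "(?q \<circ> f0) x = phi m b x" if "x : I" for x using that by (simp add: f0H gf0)
  have "relabel H (?q \<circ> f0) (inv_into I (?q \<circ> f0)) (std (dd m b)) = m"
   using relabel_eq[OF std qf[OF q], of "dd m b" "phi m b"] a eq by simp
  then show "?i (?j s) = s" using a eq[OF r] by (simp add: mb)
  show "?j s : {q. q permutes H} \<times> D" using q a by (simp add: mb)
  have "cweight y X lam H m = cweight y X lam I (std (dd m b))"
   using relabelling.relabel_weight[OF relabelling_bij, of "phi m b" I H "std (dd m b)"] a std by auto
  then show "(case ?j s of (q, d) => cweight y X lam I (std d)) = (case s of (m, b) => cweight y X lam H m)"
   by (simp add: mb)
 next
  fix u assume u: "u : {q. q permutes H} \<times> D"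
  obtain q d where qd: "u = (q, d)" and q: "q permutes H" and d: "d : D" using u by (cases u) auto
  note b = B[OF d qf[OF q] refl]
  show "?i u : S" using b by (simp add: qd)
  show "?j (?i u) = u"
  proof -
   let ?m = "relabel H (q \<circ> f0) (inv_into I (q \<circ> f0)) (std d)"
   have "(if z : H then phi ?m (q (f0 r)) (?g0 z) else z) = q z" for z
   proof (cases "z : H")
    case True
    then show ?thesis using bspec[OF conjunct1[OF conjunct2[OF b]] gI[OF True]] fg0[OF True] by simp
   next
    case False
    then show ?thesis by (simp add: permutes_not_in[OF q])
   qed
   then show ?thesis using b by (simp add: qd)
  qed
 qed
 also have "... = of_nat (card {q. q permutes H}) * (\<Sum>d\<in>D. cweight y X lam I (std d))"
  by (simp flip: sum.cartesian_product)
 finally show ?thesis using card_permutations[OF refl H] by simp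
qed

text \<open>Names for the three half-edges of a vertex. Along a boundary cycle, \<open>Bd\<close>
  marks the half of a rim edge on the boundary side, \<open>En\<close> the other half of a rim edge,
  and \<open>Le\<close> the leg that stays loose.\<close>

datatype spot = Bd | En | Le

lemma UNIV_spot: "UNIV = {Bd, En, Le}" by (auto intro: spot.exhaust)

instance spot :: finite by standard (simp add: UNIV_spot)

definition proper :: "'h set => ('h, 'n) cmap => bool" where
 "proper H m = (case m of (a, t, c) => \<forall>x\<in>H. t x ~= x --> c x = None \<or> c (t x) = None)"

lemma cweight_not_proper:
 assumes H: "finite H" and "\<not> proper H m"
 shows "cweight 0 X lam H m = 0"
proof -
 obtain a t c x where m: "m = (a, t, c)" and x: "x : H" "t x ~= x" "c x ~= None" "c (t x) ~= None"
  using assms(2) by (cases m) (auto simp: proper_def)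
 have "edge_weight 0 lam c {x, t x} = 0" using x by (auto simp: edge_weight_def)
 moreover have "{x, t x} : edge_sets H t" using x by (auto simp: edge_sets_def)
 moreover have "finite (edge_sets H t)" using H by (simp add: edge_sets_def)
 ultimately have "(\<Prod>e\<in>edge_sets H t. edge_weight 0 lam c e) = 0" by (metis prod_zero)
 then show ?thesis by (simp add: m cweight_def Q_monom_def)
qed

subsection \<open>Trivalent vertices\<close>

fun tri_a :: "spot => spot" where "tri_a Bd = En" | "tri_a En = Le" | "tri_a Le = Bd"

definition tri_std :: "(spot => 'n) => (spot, 'n) cmap" where
 "tri_std d = (tri_a, id, %s. Some (d s))"

lemma tri_a_cube: "tri_a (tri_a (tri_a s)) = s" by (cases s) auto

lemma tri_a_ne: "tri_a s ~= s" by (cases s) auto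

lemma tri_std_cmaps: "tri_std d : cmaps UNIV"
proof -
 have "bij tri_a" by (rule bij_betw_byWitness[where f' = "tri_a \<circ> tri_a"]) (auto simp: tri_a_cube)
 then have "tri_a permutes UNIV" by (intro bij_imp_permutes) auto
 then show ?thesis by (auto simp: tri_std_def cmaps_def tri_a_cube tri_a_ne)
qed

lemma tri_weight:
 "cweight y X lam UNIV (tri_std d) = Q_monom (X (d Bd) (d Le) * X (d En) (d Bd) * X (d Le) (d En)) 0"
proof -
 have "(\<Prod>s\<in>UNIV. f s) = f Bd * f En * f Le" for f :: "spot => complex" by (simp add: UNIV_spot mult.assoc)
 then show ?thesis by (simp add: cweight_def tri_std_def edge_sets_def bdry_cycles_def entry_opt_def)
qed

definition tri_maps :: "'h set => ('h, 'n) cmap set" where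
 "tri_maps H = {m : cmaps H. cconn H m \<and> proper H m \<and> (\<forall>x\<in>H. snd (snd m) x ~= None)}"

fun tri_phi :: "('h, 'n) cmap => 'h => spot => 'h" where
 "tri_phi (a, t, c) x Bd = x" | "tri_phi (a, t, c) x En = a x" | "tri_phi (a, t, c) x Le = a (a x)"

text \<open>Without boundary colours properness forbids every edge, so connectivity leaves one
  vertex, and a root identifies it with the standard one.\<close>

lemma tri_maps_structure:
 assumes m: "(a, t, c) : tri_maps H" and x: "x : H"
 shows "bij_betw (tri_phi (a, t, c) x) UNIV H" "t = id"
proof -
 have cm: "(a, t, c) : cmaps H" and conn: "cconn H (a, t, c)" and pr: "proper H (a, t, c)"
  and col: "!!x. x : H ==> c x ~= None" using m by (auto simp: tri_maps_def)
 note D = cmapsD[OF cm]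
 have aH [simp]: "a y : H \<longleftrightarrow> y : H" and tH: "t y : H \<longleftrightarrow> y : H" for y
  using permutes_in_image[OF D(1)] permutes_in_image[OF D(2)] by auto
 show t: "t = id"
 proof
  fix y show "t y = id y"
   using pr col[of y] col[of "t y"] tH[of y] permutes_not_in[OF D(2), of y] by (auto simp: proper_def)
 qed
 have K: "{x, a x, a (a x)} = H" using x D(4)[OF x] t
  by (intro conn[unfolded cconn_def prod.case, THEN conjunct2, THEN spec, THEN mp]) auto
 have "x ~= a x" "a x ~= a (a x)" using D(3)[OF x] D(3)[of "a x"] x by auto
 moreover have "x ~= a (a x)" using D(4)[OF x] D(3)[OF x] by metis
 ultimately have "inj (tri_phi (a, t, c) x)"
 proof (intro injI)
  fix u v assume ne: "x ~= a x" "a x ~= a (a x)" "x ~= a (a x)" and eq: "tri_phi (a, t, c) x u = tri_phi (a, t, c) x v"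
  show "u = v" using eq ne ne[symmetric] by (cases u; cases v) simp_all
 qed
 then show "bij_betw (tri_phi (a, t, c) x) UNIV H" using K by (simp add: bij_betw_def UNIV_spot)
qed

text \<open>The standard vertex has six labellings by three half-edges and every map has three
  roots, which leaves the factor \<open>2\<close>. The colours of neighbouring corners give the
  entries of a cyclic product.\<close>

lemma sum_tri_maps:
 fixes X :: "'n::finite => 'n => complex" and H :: "'h set"
 assumes H: "finite H"
 shows "card H ~= 3 ==> (tri_maps H :: ('h, 'n) cmap set) = {}"
  and "card H = 3 ==> (\<Sum>m\<in>tri_maps H. cweight 0 X lam H m) = Q_monom (2 * (\<Sum>i\<in>UNIV. \<Sum>j\<in>UNIV. \<Sum>k\<in>UNIV. X i j * X j k * X k i)) 0"
proof -
 have card_spot: "card (UNIV :: spot set) = 3" by (simp add: UNIV_spot)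
 show "(tri_maps H :: ('h, 'n) cmap set) = {}" if "card H ~= 3"
 proof (rule ccontr)
  assume "\<not> ?thesis"
  then obtain a t c where m: "(a, t, c) : (tri_maps H :: ('h, 'n) cmap set)" by (metis ex_in_conv prod_cases3)
  then obtain x where "x : H" by (auto simp: tri_maps_def cconn_def)
  from bij_betw_same_card[OF tri_maps_structure(1)[OF m this]] card_spot that show False by simp
 qed
 assume c3: "card H = 3"
 then obtain f0 where f0: "bij_betw f0 (UNIV :: spot set) H"
  using finite_same_card_bij[of "UNIV :: spot set" H] H card_spot by auto
 let ?S = "tri_maps H \<times> H :: (('h, 'n) cmap \<times> 'h) set"
 have "(\<Sum>(m, b)\<in>?S. cweight 0 X lam H m) = of_nat (fact (card H)) * (\<Sum>d\<in>UNIV. cweight 0 X lam UNIV (tri_std d))"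
 proof (rule sum_rooted_maps[where phi = tri_phi and dd = "%m b s. the (snd (snd m) (tri_phi m b s))" and r = Bd, OF H f0])
  fix m :: "('h, 'n) cmap" and b assume mb: "(m, b) : ?S"
  obtain a t c where m: "m = (a, t, c)" by (cases m)
  have tm: "(a, t, c) : tri_maps H" and b: "b : H" using mb m by auto
  then have cm: "(a, t, c) : cmaps H" and col: "!!x. x : H ==> c x ~= None" by (auto simp: tri_maps_def)
  note D = cmapsD[OF cm] and bij = tri_maps_structure(1)[OF tm b] and t = tri_maps_structure(2)[OF tm b]
  let ?p = "tri_phi (a, t, c) b" and ?g = "inv_into UNIV (tri_phi (a, t, c) b)"
  have pg: "?p (?g z) = z" if "z : H" for z using bij that by (auto simp: bij_betw_def f_inv_into_f)
  have pa: "?p (tri_a s) = a (?p s)" for s using D(4)[OF b] by (cases s) auto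
  have "relabel H ?p ?g (tri_std (%s. the (c (?p s)))) = (a, t, c)"
  proof -
   have "?p (tri_a (?g z)) = a z" if "z : H" for z by (simp only: pa pg[OF that])
   then show ?thesis
    using pg col D(6) by (intro prod_eqI ext) (auto simp: relabel_def tri_std_def t permutes_not_in[OF D(1)] PiE_def extensional_def)
  qed
  then show "bij_betw (tri_phi m b) UNIV H \<and> (%s. the (snd (snd m) (tri_phi m b s))) : UNIV \<and> tri_phi m b Bd = b \<and>
    relabel H (tri_phi m b) (inv_into UNIV (tri_phi m b)) (tri_std (%s. the (snd (snd m) (tri_phi m b s)))) = m"
   using bij by (simp add: m)
 next
  fix d :: "spot => 'n" and f and m :: "('h, 'n) cmap"
  assume f: "bij_betw f UNIV H" and m: "m = relabel H f (inv_into UNIV f) (tri_std d)"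
  interpret relabelling UNIV H f "inv_into UNIV f" by (rule relabelling_bij[OF f])
  let ?g = "inv_into UNIV f"
  define a where "a = (%z. if z : H then f (tri_a (?g z)) else z)"
  define c where "c = (\<lambda>z\<in>H. Some (d (?g z)))"
  have m': "m = (a, id, c)" using fg by (auto simp: m relabel_def tri_std_def a_def c_def fun_eq_iff)
  have af: "a (f s) = f (tri_a s)" and cf: "c (f s) = Some (d s)" for s using f_in gf by (auto simp: a_def c_def)
  have "m : cmaps H" unfolding m by (rule relabel_cmaps[OF tri_std_cmaps])
  moreover have "cconn (UNIV :: spot set) (tri_std d)"
  proof -
   have "K = UNIV" if K: "K ~= {}" "tri_a ` K \<subseteq> K" for K
   proof -
    obtain s where "s : K" using K(1) by auto
    then have "s : K" "tri_a s : K" "tri_a (tri_a s) : K" using K(2) by auto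
    then have "{Bd, En, Le} \<subseteq> K" by (cases s) auto
    then show ?thesis using UNIV_spot by blast
   qed
   then show ?thesis by (simp add: cconn_def tri_std_def)
  qed
  then have "cconn H m" unfolding m using relabel_cconn_iff[OF tri_std_cmaps] by blast
  ultimately have "m : tri_maps H" by (simp add: tri_maps_def proper_def m' c_def)
  moreover have "tri_phi m (f Bd) s = f s" for s by (cases s) (simp_all add: m' af)
  ultimately show "(m, f Bd) : ?S \<and> (\<forall>x\<in>UNIV. tri_phi m (f Bd) x = f x) \<and> (%s. the (snd (snd m) (tri_phi m (f Bd) s))) = d"
   using f_in[of Bd] by (simp add: m' cf)
 qed (simp_all add: tri_std_cmaps)
 also have "(\<Sum>(m, b)\<in>?S. cweight 0 X lam H m) = 3 * (\<Sum>m\<in>tri_maps H. cweight 0 X lam H m)"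
  using c3 by (simp flip: sum.cartesian_product add: sum_distrib_left mult.commute)
 also have "(\<Sum>d\<in>UNIV. cweight 0 X lam UNIV (tri_std d)) = Q_monom (\<Sum>i\<in>UNIV. \<Sum>j\<in>UNIV. \<Sum>k\<in>UNIV. X i j * X j k * X k i) 0"
 proof -
  have "(\<Sum>d\<in>(UNIV :: (spot => 'n) set). X (d Bd) (d Le) * X (d En) (d Bd) * X (d Le) (d En)) =
    (\<Sum>(i, j, k)\<in>UNIV. X i j * X j k * X k i)" by (rule sum.reindex_bij_witness[where j = "%d. (d Bd, d Le, d En)" and
      i = "%(i, j, k). (%s. case s of Bd => i | Le => j | En => k)"])
     (auto simp: fun_eq_iff split: spot.splits)
  also have "... = (\<Sum>i\<in>UNIV. \<Sum>j\<in>UNIV. \<Sum>k\<in>UNIV. X i j * X j k * X k i)"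
   by (simp add: sum.cartesian_product UNIV_Times_UNIV[symmetric] del: UNIV_Times_UNIV)
  finally show ?thesis by (simp only: tri_weight Q_monom_sum[symmetric])
 qed
 finally have "3 * (\<Sum>m\<in>tri_maps H. cweight 0 X lam H m) =
   3 * (2 * Q_monom (\<Sum>i\<in>UNIV. \<Sum>j\<in>UNIV. \<Sum>k\<in>UNIV. X i j * X j k * X k i) 0)" unfolding c3 by (simp add: fact_numeral)
 then have "(\<Sum>m\<in>tri_maps H. cweight 0 X lam H m) = 2 * Q_monom (\<Sum>i\<in>UNIV. \<Sum>j\<in>UNIV. \<Sum>k\<in>UNIV. X i j * X j k * X k i) 0"
  by (rule mult_left_cancel[THEN iffD1, rotated]) simp
 then show "(\<Sum>m\<in>tri_maps H. cweight 0 X lam H m) = Q_monom (2 * (\<Sum>i\<in>UNIV. \<Sum>j\<in>UNIV. \<Sum>k\<in>UNIV. X i j * X j k * X k i)) 0"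
  by (simp add: Q_monom_def numeral_fps_const)
qed


subsection \<open>Boundary cycles\<close>

definition wheel :: "nat => (nat \<times> spot) set" where "wheel k = {..<k} \<times> UNIV"

definition nx :: "nat => nat => nat" where "nx k i = (if Suc i = k then 0 else Suc i)"
definition pv :: "nat => nat => nat" where "pv k i = (if i = 0 then k - 1 else i - 1)"

lemma nx_pv: "i < k ==> nx k i < k" "i < k ==> pv k i < k" "i < k ==> nx k (pv k i) = i" "i < k ==> pv k (nx k i) = i"
 by (auto simp: nx_def pv_def)

text \<open>Vertex \<open>i\<close> of the wheel consists of \<open>(i, En)\<close>,
  \<open>(i, Le)\<close> and \<open>(nx k i, Bd)\<close>; rim edge \<open>i\<close> joins
  \<open>(i, Bd)\<close> to \<open>(i, En)\<close>. For \<open>k = 1\<close> the rim edge is a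
  loop.\<close>

definition wheel_a :: "nat => nat \<times> spot => nat \<times> spot" where
 "wheel_a k x = (if x : wheel k then (case x of (i, Bd) => (pv k i, En) | (i, En) => (i, Le) | (i, Le) => (nx k i, Bd)) else x)"

definition wheel_t :: "nat => nat \<times> spot => nat \<times> spot" where
 "wheel_t k x = (if x : wheel k then (case x of (i, Bd) => (i, En) | (i, En) => (i, Bd) | (i, Le) => (i, Le)) else x)"

text \<open>The inside of the rim is the boundary, and the sector between leg \<open>i\<close> and
  the next leg has colour \<open>d i\<close>.\<close>

definition wheel_c :: "nat => (nat => 'n) => nat \<times> spot => 'n option" where
 "wheel_c k d = (\<lambda>x\<in>wheel k. case x of (i, Bd) => None | (i, En) => Some (d (pv k i)) | (i, Le) => Some (d i))"

definition wheel_std :: "nat => (nat => 'n) => (nat \<times> spot, 'n) cmap" where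
 "wheel_std k d = (wheel_a k, wheel_t k, wheel_c k d)"

lemma wheel_mem [simp]: "(i, s) : wheel k \<longleftrightarrow> i < k" by (simp add: wheel_def)

lemma finite_wheel: "finite (wheel k)" by (simp add: wheel_def)

lemma card_wheel: "card (wheel k) = 3 * k" by (simp add: wheel_def card_cartesian_product UNIV_spot)

lemma wheel_simps [simp]:
 "i < k ==> wheel_a k (i, Bd) = (pv k i, En)" "i < k ==> wheel_a k (i, En) = (i, Le)" "i < k ==> wheel_a k (i, Le) = (nx k i, Bd)"
 "i < k ==> wheel_t k (i, Bd) = (i, En)" "i < k ==> wheel_t k (i, En) = (i, Bd)" "i < k ==> wheel_t k (i, Le) = (i, Le)"
 "i < k ==> wheel_c k d (i, Bd) = None" "i < k ==> wheel_c k d (i, En) = Some (d (pv k i))" "i < k ==> wheel_c k d (i, Le) = Some (d i)"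
 by (simp_all add: wheel_a_def wheel_t_def wheel_c_def)

lemma wheel_cases:
 assumes "x : wheel k"
 obtains i where "i < k" "x = (i, Bd)" | i where "i < k" "x = (i, En)" | i where "i < k" "x = (i, Le)"
 using assms by (cases x) (metis spot.exhaust wheel_mem)

lemma wheel_std_cmaps: "wheel_std k d : cmaps (wheel k)"
proof -
 have a3: "wheel_a k (wheel_a k (wheel_a k x)) = x" and t2: "wheel_t k (wheel_t k x) = x"
  and aw: "wheel_a k x : wheel k" and tw: "wheel_t k x : wheel k" and an: "wheel_a k x ~= x"
  and c1: "wheel_t k x ~= x ==> wheel_c k d (wheel_a k (wheel_a k (wheel_t k x))) = wheel_c k d x"
  and c2: "wheel_c k d x = None ==> wheel_c k d (wheel_t k x) ~= None" if "x : wheel k" for x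
  using that by (cases x rule: wheel_cases; simp add: nx_pv)+
 have "wheel_a k permutes wheel k"
 proof (rule bij_imp_permutes)
  show "bij_betw (wheel_a k) (wheel k) (wheel k)"
   by (rule bij_betw_byWitness[where f' = "%x. wheel_a k (wheel_a k x)"]) (auto simp: a3 aw)
 qed (simp add: wheel_a_def)
 moreover have "wheel_t k permutes wheel k"
 proof (rule bij_imp_permutes)
  show "bij_betw (wheel_t k) (wheel k) (wheel k)"
   by (rule bij_betw_byWitness[where f' = "wheel_t k"]) (auto simp: t2 tw)
 qed (simp add: wheel_t_def)
 moreover have "wheel_c k d : wheel k \<rightarrow>\<^sub>E UNIV" by (simp add: wheel_c_def)
 ultimately show ?thesis unfolding wheel_std_def cmaps_def using a3 t2 an c1 c2 by blast
qed

lemma wheel_face: "((%x. wheel_a k (wheel_a k (wheel_t k x))) ^^ j) (0, Bd) = (j, Bd)" if "j < k" for j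
 using that by (induction j) (auto simp: nx_def)

lemma wheel_cconn: assumes "k > 0" shows "cconn (wheel k) (wheel_std k d)" unfolding cconn_def wheel_std_def prod.case
proof (intro conjI allI impI)
 have "(0, Bd) : wheel k" using assms by simp
 then show "wheel k ~= {}" by blast
 fix K assume "K \<subseteq> wheel k \<and> K ~= {} \<and> wheel_a k ` K \<subseteq> K \<and> wheel_t k ` K \<subseteq> K"
 then have K: "K \<subseteq> wheel k" "K ~= {}" and aK: "!!x. x : K ==> wheel_a k x : K" and tK: "!!x. x : K ==> wheel_t k x : K"
  by blast+
 have step: "(i, Le) : K \<and> (nx k i, Bd) : K \<and> (nx k i, En) : K" if "(i, En) : K" for i
 proof -
  have i: "i < k" using that K(1) by auto
  have 1: "(i, Le) : K" using aK[OF that] i by simp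
  have 2: "(nx k i, Bd) : K" using aK[OF 1] i by simp
  show ?thesis using 1 2 tK[OF 2] i by (simp add: nx_pv)
 qed
 obtain x where x: "x : K" using K(2) by auto
 then have xw: "x : wheel k" using K(1) by auto
 then obtain i where i: "(i, En) : K"
 proof (cases x rule: wheel_cases)
  case (1 i)
  then show ?thesis using aK[OF x] that by auto
 next
  case (2 i)
  then show ?thesis using x that by auto
 next
  case (3 i)
  then have "(nx k i, Bd) : K" using aK[OF x] by simp
  then show ?thesis using tK[of "(nx k i, Bd)"] 3 that by (simp add: nx_pv)
 qed
 have up: "(i + m, En) : K" if "i + m < k" "(i, En) : K" for i m using that(1)
 proof (induction m)
  case (Suc m)
  then show ?case using step[of "i + m"] by (auto simp: nx_def)
 qed (use that in simp)
 have ik: "i < k" using i K(1) by auto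
 have "(k - 1, En) : K" using up[of i "k - 1 - i"] i ik by simp
 then have 0: "(0, En) : K" using step[of "k - 1"] assms by (simp add: nx_def)
 have En: "(j, En) : K" if "j < k" for j using up[of 0 j] 0 that by simp
 have Bd: "(j, Bd) : K" if "j < k" for j using tK[OF En[OF that]] that by simp
 have Le: "(j, Le) : K" if "j < k" for j using step[OF En[OF that]] by simp
 show "K = wheel k"
 proof
  show "wheel k \<subseteq> K"
  proof
   fix x assume "x : wheel k"
   then show "x : K" by (cases x rule: wheel_cases) (use En Bd Le in auto)
  qed
 qed (rule K(1))
qed

lemma wheel_weight:
 assumes "k > 0"
 shows "cweight y X lam (wheel k) (wheel_std k d) = Q_monom (\<Prod>i<k. X (d i) (d (pv k i)) / of_real (lam (d (pv k i)))) 1"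
proof -
 have fixp: "{x : wheel k. wheel_t k x = x} = (%i. (i, Le)) ` {..<k}" (is "?F = _")
 proof (intro set_eqI iffI)
  fix x assume "x : ?F"
  then have "x : wheel k" "wheel_t k x = x" by auto
  then show "x : (%i. (i, Le)) ` {..<k}" by (cases x rule: wheel_cases) auto
 qed auto
 have es: "edge_sets (wheel k) (wheel_t k) = (%i. {(i, Bd), (i, En)}) ` {..<k}" (is "?E = ?R")
 proof
  show "?E \<subseteq> ?R"
  proof
   fix e assume "e : ?E"
   then obtain x where x: "x : wheel k" "wheel_t k x ~= x" "e = {x, wheel_t k x}" by (auto simp: edge_sets_def)
   then show "e : ?R" by (cases x rule: wheel_cases) auto
  qed
  show "?R \<subseteq> ?E"
  proof
   fix e assume "e : ?R"
   then obtain i where "i < k" "e = {(i, Bd), (i, En)}" by auto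
   then show "e : ?E" unfolding edge_sets_def by (intro image_eqI[of _ _ "(i, Bd)"]) auto
  qed
 qed
 have "(\<Prod>x | x : wheel k \<and> wheel_t k x = x. entry_opt X (wheel_c k d x) (wheel_c k d (wheel_a k (wheel_a k x)))) =
   (\<Prod>i<k. X (d i) (d (pv k i)))"
  unfolding fixp by (subst prod.reindex) (auto simp: inj_on_def nx_pv entry_opt_def intro!: prod.cong)
 moreover have "(\<Prod>e\<in>edge_sets (wheel k) (wheel_t k). edge_weight y lam (wheel_c k d) e) = (\<Prod>i<k. 1 / of_real (lam (d (pv k i))))"
  unfolding es by (subst prod.reindex) (auto simp: inj_on_def doubleton_eq_iff edge_weight_def lam_opt_def intro!: prod.cong)
 moreover have "bdry_cycles (wheel k) (wheel_a k, wheel_t k, wheel_c k d) = {orbit (%x. wheel_a k (wheel_a k (wheel_t k x))) (0, Bd)}"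
 proof -
  let ?p = "%x. wheel_a k (wheel_a k (wheel_t k x))"
  have N: "{x : wheel k. wheel_c k d x = None} = (%i. (i, Bd)) ` {..<k}" (is "?N = _")
  proof (intro set_eqI iffI)
   fix x assume "x : ?N"
   then have "x : wheel k" "wheel_c k d x = None" by auto
   then show "x : (%i. (i, Bd)) ` {..<k}" by (cases x rule: wheel_cases) auto
  qed auto
  have "?p ((?p ^^ (k - 1)) (0, Bd)) = (0, Bd)" using wheel_face[of "k - 1" k] assms by (simp add: nx_def)
  then have "(?p ^^ k) (0, Bd) = (0, Bd)" using assms by (cases k) simp_all
  then have self: "(0, Bd) : orbit ?p (0, Bd)" unfolding orbit_altdef using assms by (auto intro: exI[of _ k])
  have orb: "orbit ?p (i, Bd) = orbit ?p (0, Bd)" if "i < k" for i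
  proof -
   have "(i, Bd) : orbit ?p (0, Bd)" using wheel_face[OF that] funpow_in_orbit[OF self, of i] by simp
   then show ?thesis by (rule orbit_cyclic_eq3[rotated]) (use self in \<open>auto simp: cyclic_on_def\<close>)
  qed
  have "(%i. orbit ?p (i, Bd)) ` {..<k} = (%i. orbit ?p (0, Bd)) ` {..<k}"
   by (rule image_cong[OF refl], rule orb) simp
  moreover have "{..<k} ~= {}" using assms by auto
  ultimately show ?thesis unfolding bdry_cycles_def prod.case N image_image by (simp only: image_constant_conv if_False)
 qed
 ultimately show ?thesis by (simp add: cweight_def wheel_std_def prod_dividef)
qed

definition wheel_maps :: "'h set => ('h, 'n) cmap set" where
 "wheel_maps H = {m : cmaps H. cconn H m \<and> proper H m \<and> (\<exists>x\<in>H. snd (snd m) x = None)}"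

fun wheel_phi :: "('h, 'n) cmap => 'h => nat \<times> spot => 'h" where
 "wheel_phi (a, t, c) b (i, Bd) = ((%x. a (a (t x))) ^^ i) b"
| "wheel_phi (a, t, c) b (i, En) = t (((%x. a (a (t x))) ^^ i) b)"
| "wheel_phi (a, t, c) b (i, Le) = a (t (((%x. a (a (t x))) ^^ i) b))"

text \<open>Follow the boundary from \<open>b\<close>: the \<open>B i\<close> are the boundary
  half-edges met, \<open>t (B i)\<close> their other halves, and the third half-edge of each vertex
  must be loose. This set is closed, hence everything by connectivity, and \<open>k\<close> is the
  length of the boundary cycle.\<close>

lemma wheel_maps_structure:
 assumes m: "(a, t, c) : wheel_maps H" and H: "finite H" and b: "b : H" "c b = None"
 defines "p \<equiv> wheel_phi (a, t, c) b"
 shows "\<exists>k>0. bij_betw p (wheel k) H \<and> (\<forall>x\<in>wheel k. p (wheel_a k x) = a (p x) \<and> p (wheel_t k x) = t (p x)) \<and>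
  (\<forall>i<k. c (p (i, Bd)) = None \<and> c (p (i, En)) = c (p (pv k i, Le)) \<and> c (p (i, Le)) ~= None)"
proof -
 have cm: "(a, t, c) : cmaps H" and conn: "cconn H (a, t, c)" and pr: "proper H (a, t, c)"
  using m by (auto simp: wheel_maps_def)
 note D = cmapsD[OF cm]
 have aH [simp]: "a y : H \<longleftrightarrow> y : H" and tH [simp]: "t y : H \<longleftrightarrow> y : H" for y
  using permutes_in_image[OF D(1)] permutes_in_image[OF D(2)] by auto
 let ?s = "%x. a (a (t x))"
 have perm: "permutation ?s"
 proof -
  have "a \<circ> (a \<circ> t) permutes H" by (intro permutes_compose D)
  then show ?thesis using H by (auto simp: permutation_permutes o_def)
 qed
 define B where "B i = (?s ^^ i) b" for i
 have p: "p (i, Bd) = B i" "p (i, En) = t (B i)" "p (i, Le) = a (t (B i))" for i by (simp_all add: p_def B_def)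
 have B: "B i : H" "c (B i) = None" for i
 proof (induction i)
  case (Suc i)
  have "t (B i) ~= B i" using D(8)[OF Suc] Suc by auto
  then have "c (?s (B i)) = c (B i)" using D(7) Suc by blast
  moreover have "B (Suc i) = ?s (B i)" by (simp add: B_def)
  ultimately show "B (Suc i) : H" "c (B (Suc i)) = None" using Suc by simp_all
 qed (use b in \<open>simp_all add: B_def\<close>)
 have tB: "c (t (B i)) ~= None" "t (B i) ~= B i" for i
 proof -
  show "c (t (B i)) ~= None" by (rule D(8)[OF B])
  then show "t (B i) ~= B i" using B(2)[of i] by metis
 qed
 have B_Suc: "B (Suc i) = a (a (t (B i)))" for i by (simp add: B_def)
 have aB: "a (B (Suc i)) = t (B i)" for i unfolding B_Suc using D(4)[of "t (B i)"] B(1)[of i] by simp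
 define k where "k = funpow_dist1 ?s b b"
 have self: "b : orbit ?s b" by (rule permutation_self_in_orbit[OF perm])
 have Bk: "B k = b" unfolding B_def k_def by (rule funpow_dist1_prop[OF self])
 have k0: "k > 0" by (simp add: k_def)
 have Binj: "B i = B j \<longleftrightarrow> i = j" if "i < k" "j < k" for i j
  using inj_on_funpow_dist1[OF self] that unfolding B_def k_def[symmetric] inj_on_def by auto
 have Bnx: "B (nx k i) = B (Suc i)" if "i < k" for i using Bk by (auto simp: nx_def B_def)
 have Bpv: "B i = B (Suc (pv k i))" if "i < k" for i using Bnx[of "pv k i"] that by (simp add: nx_pv)
 have cL: "c (a (t (B i))) = c (t (B (Suc i)))" for i
 proof -
  have "t (t (B (Suc i))) ~= t (B (Suc i))" using tB(2)[of "Suc i"] D(5)[OF B(1)] by auto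
  then have "c (a (a (t (t (B (Suc i)))))) = c (t (B (Suc i)))" using D(7) B(1) by simp
  then show ?thesis by (simp add: D(5)[OF B(1)] aB)
 qed
 have cLe: "c (a (t (B i))) ~= None" for i unfolding cL by (rule tB(1))
 \<comment> \<open>Were this leg part of an edge, properness would make its far side a boundary, and
   transport of colours would give the boundary colour to \<open>t (B i)\<close> as well.\<close>
 have tL: "t (a (t (B i))) = a (t (B i))" for i
 proof (rule ccontr)
  let ?r = "a (t (B i))"
  have rH: "?r : H" using B(1)[of i] by simp
  assume ne: "t ?r ~= ?r"
  then have n: "c (t ?r) = None" using pr rH cLe[of i] by (auto simp: proper_def)
  have "t (t ?r) ~= t ?r" using ne D(5)[OF rH] by auto
  then have "c (a (a (t (t ?r)))) = None" using D(7)[of "t ?r"] n rH by simp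
  moreover have "a (a (t (t ?r))) = t (B i)" using D(5)[OF rH] D(4)[of "t (B i)"] B(1)[of i] by simp
  ultimately show False using tB(1)[of i] by simp
 qed
 have acomm: "p (wheel_a k x) = a (p x)" if "x : wheel k" for x using that
 proof (cases x rule: wheel_cases)
  case (1 i)
  have "a (B i) = t (B (pv k i))" using Bpv[OF 1(1)] aB[of "pv k i"] by metis
  then show ?thesis using 1 by (simp add: p)
 next
  case (3 i)
  then show ?thesis using Bnx[OF 3(1)] by (simp add: p B_Suc)
 qed (simp add: p)
 have tcomm: "p (wheel_t k x) = t (p x)" if "x : wheel k" for x
  using that by (cases x rule: wheel_cases) (simp_all add: p tL D(5)[OF B(1)])
 have inj: "inj_on p (wheel k)"
 proof (rule inj_onI)
  have ainj: "a u = a v \<longleftrightarrow> u = v" and tinj: "t u = t v \<longleftrightarrow> u = v" for u v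
   using permutes_inj[OF D(1)] permutes_inj[OF D(2)] by (auto simp: inj_eq)
  have BE: "B i ~= t (B j)" for i j using B(2)[of i] tB(1)[of j] by metis
  have BL: "B i ~= a (t (B j))" for i j using B(2)[of i] cLe[of j] by metis
  have EL: "t (B i) ~= a (t (B j))" for i j
  proof
   assume "t (B i) = a (t (B j))"
   then have "a (a (t (B i))) = t (B j)" using D(4)[of "t (B j)"] B(1)[of j] by simp
   then show False using BE[of "Suc i" j] B_Suc by simp
  qed
  fix x y assume x: "x : wheel k" and y: "y : wheel k" and e: "p x = p y"
  show "x = y" by (rule wheel_cases[OF x]; rule wheel_cases[OF y])
     (use e BE BL EL BE[symmetric] BL[symmetric] EL[symmetric] in \<open>simp_all add: p Binj ainj tinj\<close>)
 qed
 have img: "p ` wheel k = H"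
 proof (intro conn[unfolded cconn_def prod.case, THEN conjunct2, THEN spec, THEN mp] conjI)
  have wa: "wheel_a k x : wheel k" and wt: "wheel_t k x : wheel k" if "x : wheel k" for x
   using that by (cases x rule: wheel_cases; simp add: nx_pv)+
  show "p ` wheel k \<subseteq> H"
  proof (rule image_subsetI)
   fix x assume "x : wheel k"
   then show "p x : H" by (cases x rule: wheel_cases) (simp_all add: p B(1))
  qed
  have "(0, Bd) : wheel k" using k0 by simp
  then show "p ` wheel k ~= {}" by blast
  show "a ` p ` wheel k \<subseteq> p ` wheel k" using acomm wa by (auto simp: image_iff) (metis)
  show "t ` p ` wheel k \<subseteq> p ` wheel k" using tcomm wt by (auto simp: image_iff) (metis)
 qed
 have "c (p (i, En)) = c (p (pv k i, Le))" if "i < k" for i using cL[of "pv k i"] Bpv[OF that] by (simp add: p)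
 then show ?thesis using k0 inj img acomm tcomm B(2) cLe by (intro exI[of _ k]) (auto simp: bij_betw_def p)
qed

text \<open>Each of the \<open>k\<close> boundary half-edges of a wheel may serve as root; this
  multiplicity is the origin of the \<open>1 / k\<close> in the logarithmic term of the potential.
  The sum over colours is a trace of a \<open>k\<close>-th power.\<close>

lemma sum_wheel_maps:
 fixes X :: "'n::finite => 'n => complex" and H :: "'h set"
 assumes H: "finite H"
 shows "\<not> 3 dvd card H \<or> H = {} ==> (wheel_maps H :: ('h, 'n) cmap set) = {}"
  and "card H = 3 * k ==> k > 0 ==> of_nat k * (\<Sum>m\<in>wheel_maps H. cweight 0 X lam H m) =
   of_nat (fact (card H)) * Q_monom (\<Sum>d\<in>{..<k} \<rightarrow>\<^sub>E UNIV. \<Prod>i<k. X (d i) (d (pv k i)) / of_real (lam (d (pv k i)))) 1"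
proof -
 show "(wheel_maps H :: ('h, 'n) cmap set) = {}" if no: "\<not> 3 dvd card H \<or> H = {}"
 proof (rule ccontr)
  assume "\<not> ?thesis"
  then obtain a t c where m: "(a, t, c) : (wheel_maps H :: ('h, 'n) cmap set)" by (metis ex_in_conv prod_cases3)
  then obtain b where b: "b : H" "c b = None" by (auto simp: wheel_maps_def)
  obtain k where "bij_betw (wheel_phi (a, t, c) b) (wheel k) H" using wheel_maps_structure[OF m H b] by blast
  from bij_betw_same_card[OF this] have "3 dvd card H" by (metis card_wheel dvd_triv_left)
  then show False using no b by blast
 qed
 assume ck: "card H = 3 * k" and k0: "k > 0"
 obtain f0 where f0: "bij_betw f0 (wheel k) H"
  using finite_same_card_bij[of "wheel k" H] H finite_wheel card_wheel ck by auto
 have struct: "bij_betw (wheel_phi (a, t, c) b) (wheel k) H \<and>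
   (\<forall>x\<in>wheel k. wheel_phi (a, t, c) b (wheel_a k x) = a (wheel_phi (a, t, c) b x) \<and> wheel_phi (a, t, c) b (wheel_t k x) = t (wheel_phi (a, t, c) b x)) \<and>
   (\<forall>i<k. c (wheel_phi (a, t, c) b (i, Bd)) = None \<and> c (wheel_phi (a, t, c) b (i, En)) = c (wheel_phi (a, t, c) b (pv k i, Le)) \<and> c (wheel_phi (a, t, c) b (i, Le)) ~= None)"
  if m: "(a, t, c) : (wheel_maps H :: ('h, 'n) cmap set)" and b: "b : H" "c b = None" for a t c b
 proof -
  obtain k' where k': "bij_betw (wheel_phi (a, t, c) b) (wheel k') H"
   "(\<forall>x\<in>wheel k'. wheel_phi (a, t, c) b (wheel_a k' x) = a (wheel_phi (a, t, c) b x) \<and> wheel_phi (a, t, c) b (wheel_t k' x) = t (wheel_phi (a, t, c) b x)) \<and>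
   (\<forall>i<k'. c (wheel_phi (a, t, c) b (i, Bd)) = None \<and> c (wheel_phi (a, t, c) b (i, En)) = c (wheel_phi (a, t, c) b (pv k' i, Le)) \<and> c (wheel_phi (a, t, c) b (i, Le)) ~= None)"
   using wheel_maps_structure[OF m H b] by blast
  have "k' = k" using bij_betw_same_card[OF k'(1)] ck by (simp add: card_wheel)
  then show ?thesis using k' by blast
 qed
 let ?S = "{(m :: ('h, 'n) cmap, b). m : wheel_maps H \<and> b : H \<and> snd (snd m) b = None}"
 let ?d = "%m b. \<lambda>i\<in>{..<k}. the (snd (snd m) (wheel_phi m b (i, Le)))"
 have "(\<Sum>(m, b)\<in>?S. cweight 0 X lam H m) = of_nat (fact (card H)) * (\<Sum>d\<in>{..<k} \<rightarrow>\<^sub>E UNIV. cweight 0 X lam (wheel k) (wheel_std k d))"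
 proof (rule sum_rooted_maps[where phi = wheel_phi and dd = ?d and r = "(0, Bd)", OF H f0])
  fix m :: "('h, 'n) cmap" and b assume mb: "(m, b) : ?S"
  obtain a t c where m: "m = (a, t, c)" by (cases m)
  have wm: "(a, t, c) : wheel_maps H" and b: "b : H" "c b = None" using mb m by auto
  then have cm: "(a, t, c) : cmaps H" by (auto simp: wheel_maps_def)
  note D = cmapsD[OF cm] and st = struct[OF wm b]
  let ?p = "wheel_phi (a, t, c) b" and ?g = "inv_into (wheel k) (wheel_phi (a, t, c) b)"
  have pg: "?p (?g z) = z" and gI: "?g z : wheel k" if "z : H" for z
   using st that by (auto simp: bij_betw_def f_inv_into_f inv_into_into)
  have a: "?p (wheel_a k (?g z)) = a z" and t: "?p (wheel_t k (?g z)) = t z" if "z : H" for z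
   using st gI[OF that] pg[OF that] by auto
  have c: "wheel_c k (?d (a, t, c) b) (?g z) = c z" if z: "z : H" for z
  proof -
   have "wheel_c k (?d (a, t, c) b) x = c (?p x)" if "x : wheel k" for x using that
   proof (cases x rule: wheel_cases)
    case (1 i)
    then show ?thesis using st by (simp del: wheel_phi.simps)
   next
    case (2 i)
    then show ?thesis using st nx_pv(2)[of i k] by (simp del: wheel_phi.simps)
   next
    case (3 i)
    then show ?thesis using st by (simp del: wheel_phi.simps)
   qed
   from this[OF gI[OF z]] show ?thesis unfolding pg[OF z] .
  qed
  have "relabel H ?p ?g (wheel_std k (?d (a, t, c) b)) = (a, t, c)" using a t c D(6) by (intro prod_eqI ext)
     (auto simp del: wheel_phi.simps simp: relabel_def wheel_std_def permutes_not_in[OF D(1)] permutes_not_in[OF D(2)] PiE_def extensional_def)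
  then show "bij_betw (wheel_phi m b) (wheel k) H \<and> ?d m b : {..<k} \<rightarrow>\<^sub>E UNIV \<and> wheel_phi m b (0, Bd) = b \<and>
    relabel H (wheel_phi m b) (inv_into (wheel k) (wheel_phi m b)) (wheel_std k (?d m b)) = m"
   using st by (simp add: m)
 next
  fix d :: "nat => 'n" and f and m :: "('h, 'n) cmap"
  assume d: "d : {..<k} \<rightarrow>\<^sub>E UNIV" and f: "bij_betw f (wheel k) H" and m: "m = relabel H f (inv_into (wheel k) f) (wheel_std k d)"
  interpret relabelling "wheel k" H f "inv_into (wheel k) f" by (rule relabelling_bij[OF f])
  let ?g = "inv_into (wheel k) f"
  define a where "a = (%z. if z : H then f (wheel_a k (?g z)) else z)"
  define t where "t = (%z. if z : H then f (wheel_t k (?g z)) else z)"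
  define c where "c = (\<lambda>z\<in>H. wheel_c k d (?g z))"
  have m': "m = (a, t, c)" by (simp add: m relabel_def wheel_std_def a_def t_def c_def)
  have af: "a (f x) = f (wheel_a k x)" and tf: "t (f x) = f (wheel_t k x)" and cf: "c (f x) = wheel_c k d x" if "x : wheel k" for x
   using f_in[OF that] gf[OF that] by (auto simp: a_def t_def c_def)
  have cm: "m : cmaps H" unfolding m by (rule relabel_cmaps[OF wheel_std_cmaps])
  have conn: "cconn H m" unfolding m using relabel_cconn_iff[OF wheel_std_cmaps] wheel_cconn[OF k0] by blast
  have pr: "proper H m" unfolding proper_def m' prod.case
  proof (intro ballI impI)
   fix z assume z: "z : H" "t z ~= z"
   define x where "x = ?g z"
   have x: "x : wheel k" "z = f x" using z(1) g_in fg by (auto simp: x_def)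
   have tw: "wheel_t k x : wheel k" using x(1) by (cases x rule: wheel_cases) auto
   have "c z = wheel_c k d x" "c (t z) = wheel_c k d (wheel_t k x)" "wheel_t k x ~= x"
    using cf[OF x(1)] tf[OF x(1)] cf[OF tw] x(2) z(2) by auto
   with x(1) show "c z = None \<or> c (t z) = None" by (cases x rule: wheel_cases) auto
  qed
  have 0: "(0, Bd) : wheel k" using k0 by simp
  have B: "((%x. a (a (t x))) ^^ i) (f (0, Bd)) = f (i, Bd)" if "i < k" for i using that
  proof (induction i)
   case (Suc i)
   then show ?case by (simp add: tf af nx_def)
  qed simp
  have phi: "wheel_phi m (f (0, Bd)) x = f x" if "x : wheel k" for x
   using that by (cases x rule: wheel_cases) (simp_all add: m' B tf af)
  have N: "c (f (0, Bd)) = None" using cf[OF 0] k0 by simp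
  have "m : wheel_maps H" using cm conn pr N f_in[OF 0] by (auto simp: wheel_maps_def m')
  moreover have "?d m (f (0, Bd)) = d"
  proof
   fix i show "?d m (f (0, Bd)) i = d i"
    using d phi[of "(i, Le)"] cf[of "(i, Le)"] by (cases "i < k") (auto simp: m' PiE_def extensional_def)
  qed
  ultimately show "(m, f (0, Bd)) : ?S \<and> (\<forall>x\<in>wheel k. wheel_phi m (f (0, Bd)) x = f x) \<and> ?d m (f (0, Bd)) = d"
   using phi N f_in[OF 0] by (simp add: m')
 qed (use k0 in \<open>simp_all add: wheel_std_cmaps\<close>)
 also have "(\<Sum>(m, b)\<in>?S. cweight 0 X lam H m) = of_nat k * (\<Sum>m\<in>wheel_maps H. cweight 0 X lam H m)"
 proof -
  have S: "?S = (SIGMA m:wheel_maps H. {b : H. snd (snd m) b = None})" by auto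
  have "card {b : H. snd (snd m) b = None} = k" if m: "m : (wheel_maps H :: ('h, 'n) cmap set)" for m
  proof -
   obtain a t c where m': "m = (a, t, c)" by (cases m)
   obtain b where b: "b : H" "c b = None" using m by (auto simp: wheel_maps_def m')
   note st = struct[OF m[unfolded m'] b]
   let ?p = "wheel_phi (a, t, c) b"
   have "{b : H. c b = None} = (%i. ?p (i, Bd)) ` {..<k}" (is "?N = _")
   proof (intro set_eqI iffI)
    fix z assume z: "z : ?N"
    then obtain x where x: "x : wheel k" "z = ?p x" using st by (auto simp: bij_betw_def simp del: wheel_phi.simps)
    then show "z : (%i. ?p (i, Bd)) ` {..<k}"
    proof (cases x rule: wheel_cases)
     case (2 i)
     then show ?thesis using st z x nx_pv(2)[of i k] by (auto simp del: wheel_phi.simps)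
    qed (use st z x in \<open>auto simp del: wheel_phi.simps\<close>)
   next
    fix z assume "z : (%i. ?p (i, Bd)) ` {..<k}"
    then obtain i where i: "i < k" "z = ?p (i, Bd)" by auto
    then have "(i, Bd) : wheel k" by simp
    then have "?p (i, Bd) : H" using st bij_betwE by blast
    then show "z : ?N" using st i by (simp del: wheel_phi.simps)
   qed
   moreover have "inj_on (%i. ?p (i, Bd)) {..<k}"
   proof (rule inj_onI)
    fix i j assume "i : {..<k}" "j : {..<k}" "?p (i, Bd) = ?p (j, Bd)"
    moreover have "inj_on ?p (wheel k)" using st by (simp only: bij_betw_def)
    ultimately show "i = j" unfolding inj_on_def by (metis Pair_inject lessThan_iff wheel_mem)
   qed
   ultimately show ?thesis by (simp only: m' snd_conv card_image card_lessThan)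
  qed
  then show ?thesis unfolding S using H finite_subset[OF _ finite_cmaps[OF H], of "wheel_maps H :: ('h, 'n) cmap set"]
   by (subst sum.Sigma[symmetric]) (auto simp: sum_distrib_left wheel_maps_def)
 qed
 also have "(\<Sum>d\<in>{..<k} \<rightarrow>\<^sub>E UNIV. cweight 0 X lam (wheel k) (wheel_std k d)) =
   Q_monom (\<Sum>d\<in>{..<k} \<rightarrow>\<^sub>E UNIV. \<Prod>i<k. X (d i) (d (pv k i)) / of_real (lam (d (pv k i)))) 1"
  by (simp only: wheel_weight[OF k0] Q_monom_sum)
 finally show "of_nat k * (\<Sum>m\<in>wheel_maps H. cweight 0 X lam H m) =
   of_nat (fact (card H)) * Q_monom (\<Sum>d\<in>{..<k} \<rightarrow>\<^sub>E UNIV. \<Prod>i<k. X (d i) (d (pv k i)) / of_real (lam (d (pv k i)))) 1" .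
qed

text \<open>At \<open>y = 0\<close> only proper maps have weight, and a connected one either avoids
  the boundary colour or uses it; the two cases are the two kinds of terms in the potential.\<close>

lemma conn_sum_0:
 fixes X :: "'n::finite => 'n => complex" and H :: "'h set"
 assumes H: "finite H"
 shows "conn_sum 0 X lam H = (\<Sum>m\<in>tri_maps H. cweight 0 X lam H m) + (\<Sum>m\<in>wheel_maps H. cweight 0 X lam H m)"
proof -
 have fin: "finite {m :: ('h, 'n) cmap. m : cmaps H \<and> cconn H m}"
  by (rule finite_subset[OF _ finite_cmaps[OF H]]) auto
 have "conn_sum 0 X lam H = (\<Sum>m\<in>tri_maps H \<union> wheel_maps H. cweight 0 X lam H m)" unfolding conn_sum_def
  by (rule sum.mono_neutral_right[OF fin]) (auto simp: tri_maps_def wheel_maps_def intro: cweight_not_proper[OF H])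
 also have "... = (\<Sum>m\<in>tri_maps H. cweight 0 X lam H m) + (\<Sum>m\<in>wheel_maps H. cweight 0 X lam H m)"
  by (rule sum.union_disjoint) (auto simp: tri_maps_def wheel_maps_def intro: finite_subset[OF _ fin])
 finally show ?thesis .
qed

section \<open>Gaussian expectations\<close>

text \<open>Here \<open>w\<close> is the inverse variance, so the density is proportional to
  \<open>exp (- w * x^2 / 2)\<close>.\<close>

definition normal_moment :: "real => nat => real" where
 "normal_moment w e = (\<integral>x. normal_density 0 (1 / sqrt w) x * x ^ e \<partial>lborel)"

lemma integrable_normal_power:
 assumes "w > 0" shows "integrable lborel (%x. normal_density 0 (1 / sqrt w) x * x ^ e)"
 using integrable_normal_moment[of "1 / sqrt w" 0 e] assms by simp

lemma normal_moment_even': "w > 0 ==> normal_moment w (2 * k) = fact (2 * k) / ((2 * w) ^ k * fact k)"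
 using integral_normal_moment_even[of "1 / sqrt w" 0 k] by (simp add: normal_moment_def power_divide)

lemma normal_moment_odd': "w > 0 ==> normal_moment w (2 * k + 1) = 0"
 using integral_normal_moment_odd[of "1 / sqrt w" 0 k] by (simp add: normal_moment_def)

lemma normal_moment_0: "w > 0 ==> normal_moment w 0 = 1" using normal_moment_even'[of w 0] by simp

text \<open>The recursion of Gaussian integration by parts, read off from the closed form of the
  even moments. For \<open>n = 0\<close> the truncated \<open>n - 1\<close> is multiplied by
  zero.\<close>

lemma normal_moment_Suc:
 assumes w: "w > 0" shows "normal_moment w (Suc n) = of_nat n / w * normal_moment w (n - 1)"
proof (cases "even n")
 case True
 then obtain k where n: "n = 2 * k" by blast
 have "normal_moment w (Suc n) = 0" using normal_moment_odd'[OF w, of k] by (simp add: n)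
 moreover have "n = 0 \<or> normal_moment w (n - 1) = 0"
  using normal_moment_odd'[OF w, of "k - 1"] by (cases k) (simp_all add: n)
 ultimately show ?thesis by auto
next
 case False
 then obtain k where n: "n = 2 * k + 1" using oddE by blast
 have "normal_moment w (Suc n) = normal_moment w (2 * Suc k)" by (simp add: n)
 also have "... = of_nat n / w * normal_moment w (2 * k)"
 proof -
  have f: "fact (2 * Suc k) = (2 * (real k + 1)) * ((2 * real k + 1) * fact (2 * k))"
   "fact (Suc k) = (real k + 1) * (fact k :: real)" by (simp_all add: algebra_simps)
  have "((2 * (real k + 1)) * ((2 * real k + 1) * fact (2 * k))) / (2 * w * (2 * w) ^ k * ((real k + 1) * fact k)) =
    (2 * real k + 1) / w * (fact (2 * k) / ((2 * w) ^ k * fact k))" using w by (simp add: divide_simps)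
  then show ?thesis unfolding normal_moment_even'[OF w] f power_Suc n by (simp add: add.commute)
 qed
 finally show ?thesis by (simp add: n)
qed

definition gauss_prod :: "('a::euclidean_space => real) => 'a => real" where
 "gauss_prod w x = (\<Prod>b\<in>Basis. normal_density 0 (1 / sqrt (w b)) (x \<bullet> b))"

text \<open>The factors of a monomial are slots \<open>r\<close> in \<open>R\<close>, each assigned
  a coordinate \<open>k r\<close>; keeping the slots distinct lets pairings of factors appear
  later.\<close>

definition moment :: "('a::euclidean_space => real) => 'r set => ('r => 'a) => real" where
 "moment w R k = (\<Prod>b\<in>Basis. normal_moment (w b) (card {r : R. k r = b}))"

lemma gauss_monomial:
 fixes w :: "'a::euclidean_space => real"
 assumes w: "!!b. b : Basis ==> w b > 0" and R: "finite R" "k : R \<rightarrow> Basis"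
 shows "has_bochner_integral lborel (%x. (\<Prod>r\<in>R. x \<bullet> k r) * gauss_prod w x) (moment w R k)"
proof -
 let ?e = "%b. card {r : R. k r = b}"
 let ?f = "%b x. normal_density 0 (1 / sqrt (w b)) x * x ^ ?e b"
 let ?g = "%f. \<Sum>b\<in>Basis. f b *\<^sub>R b :: 'a"
 have eq: "(\<Prod>r\<in>R. x \<bullet> k r) * gauss_prod w x = (\<Prod>b\<in>Basis. ?f b (x \<bullet> b))" for x :: 'a
 proof -
  have "(\<Prod>r\<in>R. x \<bullet> k r) = (\<Prod>b\<in>Basis. \<Prod>r\<in>{r : R. k r = b}. x \<bullet> k r)" using R by (intro prod.group[symmetric]) auto
  also have "... = (\<Prod>b\<in>Basis. (x \<bullet> b) ^ ?e b)" by (intro prod.cong refl) (simp add: prod_constant)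
  finally show ?thesis by (simp add: gauss_prod_def prod.distrib mult.commute)
 qed
 have gb: "?g f \<bullet> b = f b" if "b : Basis" for f b
  using that by (simp add: inner_sum_left inner_Basis if_distrib sum.delta cong: if_cong)
 have int: "integrable lborel (?f b)" if "b : Basis" for b by (rule integrable_normal_power[OF w[OF that]])
 have meas: "?g : measurable (\<Pi>\<^sub>M b\<in>Basis. lborel) borel" by measurable
 have m2: "(%x::'a. \<Prod>b\<in>Basis. ?f b (x \<bullet> b)) : borel_measurable borel" by measurable
 have cong: "(\<Prod>b\<in>Basis. ?f b (?g f \<bullet> b)) = (\<Prod>b\<in>Basis. ?f b (f b))" for f
 proof (rule prod.cong[OF refl])
  fix b :: 'a assume "b : Basis"
  show "?f b (?g f \<bullet> b) = ?f b (f b)" unfolding gb[OF \<open>b : Basis\<close>] ..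
 qed
 have "integrable (lebn Basis) (%f. \<Prod>b\<in>Basis. ?f b (f b))" by (rule lb.product_integrable_prod[OF finite_Basis int])
 then have "integrable (distr (lebn Basis) borel ?g) (%x. \<Prod>b\<in>Basis. ?f b (x \<bullet> b))"
  by (subst integrable_distr_eq[OF meas m2]) (simp only: cong)
 then have I: "integrable lborel (%x::'a. \<Prod>b\<in>Basis. ?f b (x \<bullet> b))" by (simp only: lborel_eq[where 'a = 'a])
 have "(\<integral>x. (\<Prod>b\<in>Basis. ?f b (x \<bullet> b)) \<partial>(lborel :: 'a measure)) = (\<integral>f. (\<Prod>b\<in>Basis. ?f b (f b)) \<partial>lebn Basis)"
  unfolding lborel_eq[where 'a = 'a] by (subst integral_distr[OF meas m2]) (simp only: cong)
 also have "... = (\<Prod>b\<in>Basis. \<integral>x. ?f b x \<partial>lborel)" by (rule lb.product_integral_prod[OF finite_Basis int])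
 finally show ?thesis using I by (simp add: has_bochner_integral_iff eq moment_def normal_moment_def)
qed

text \<open>The factor in the one-dimensional recursion is the number of other slots with the
  coordinate of \<open>x\<close>. It is read as a choice of a partner \<open>y\<close> for
  \<open>x\<close>.\<close>

lemma moment_rec:
 assumes w: "!!b. b : Basis ==> w b > 0" and R: "finite R" "k : R \<rightarrow> Basis" and x: "x : R"
 shows "moment w R k = (\<Sum>y\<in>R - {x}. (if k y = k x then 1 / w (k x) else 0) * moment w (R - {x, y}) k)"
proof -
 let ?Y = "{y : R - {x}. k y = k x}"
 have kx: "k x : Basis" using R x by auto
 let ?P = "\<Prod>b\<in>Basis - {k x}. normal_moment (w b) (card {r : R. k r = b})"
 have e: "card {r : R. k r = k x} = Suc (card ?Y)"
 proof -
  have "{r : R. k r = k x} = insert x ?Y" using x by auto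
  then show ?thesis using R by simp
 qed
 have "moment w R k = normal_moment (w (k x)) (Suc (card ?Y)) * ?P"
  unfolding moment_def using kx by (subst prod.remove[of _ "k x"]) (auto simp: e)
 also have "... = of_nat (card ?Y) * (1 / w (k x) * (normal_moment (w (k x)) (card ?Y - 1) * ?P))"
  by (simp add: normal_moment_Suc[OF w[OF kx]])
 also have "... = (\<Sum>y\<in>?Y. 1 / w (k x) * moment w (R - {x, y}) k)"
 proof -
  have "moment w (R - {x, y}) k = normal_moment (w (k x)) (card ?Y - 1) * ?P" if y: "y : ?Y" for y
  proof -
   have "{r : R - {x, y}. k r = k x} = ?Y - {y}" by auto
   then have 1: "card {r : R - {x, y}. k r = k x} = card ?Y - 1" using y by simp
   have 2: "card {r : R - {x, y}. k r = b} = card {r : R. k r = b}" if "b ~= k x" for b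
    using y that by (intro arg_cong[where f = card]) auto
   show ?thesis unfolding moment_def prod.remove[OF finite_Basis kx] 1
    by (intro arg_cong2[of _ _ _ _ "(*)"] prod.cong refl) (metis 2 DiffD2 singletonI)
  qed
  then show ?thesis by simp
 qed
 also have "... = (\<Sum>y\<in>R - {x}. (if k y = k x then 1 / w (k x) else 0) * moment w (R - {x, y}) k)"
  using R by (intro sum.mono_neutral_cong_left) auto
 finally show ?thesis .
qed

lemma sum_PiE_insert:
 assumes "x ~: S"
 shows "(\<Sum>k\<in>insert x S \<rightarrow>\<^sub>E B. f k) = (\<Sum>b\<in>B. \<Sum>k\<in>S \<rightarrow>\<^sub>E B. f (k(x := b)))"
proof -
 have "(\<Sum>k\<in>insert x S \<rightarrow>\<^sub>E B. f k) = (\<Sum>(b, k)\<in>B \<times> (S \<rightarrow>\<^sub>E B). f (k(x := b)))"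
  unfolding PiE_insert_eq using inj_combinator[OF assms, of "%_. B"]
  by (subst sum.reindex) (auto simp: case_prod_beta' o_def)
 then show ?thesis by (simp add: sum.cartesian_product)
qed

definition form_moment :: "('a::euclidean_space => real) => ('r => 'a => complex) => 'r set => complex" where
 "form_moment w A R = (\<Sum>k\<in>R \<rightarrow>\<^sub>E Basis. (\<Prod>r\<in>R. A r (k r)) * of_real (moment w R k))"

lemma gauss_forms:
 fixes w :: "'a::euclidean_space => real"
 assumes w: "!!b. b : Basis ==> w b > 0" and R: "finite R"
 shows "has_bochner_integral lborel (%x. (\<Prod>r\<in>R. \<Sum>b\<in>Basis. A r b * of_real (x \<bullet> b)) * of_real (gauss_prod w x)) (form_moment w A R)"
proof -
 have eq: "(\<Prod>r\<in>R. \<Sum>b\<in>Basis. A r b * of_real (x \<bullet> b)) * of_real (gauss_prod w x) =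
   (\<Sum>k\<in>R \<rightarrow>\<^sub>E Basis. (\<Prod>r\<in>R. A r (k r)) * complex_of_real ((\<Prod>r\<in>R. x \<bullet> k r) * gauss_prod w x))" for x :: 'a
  using R by (simp add: prod_sum_PiE prod.distrib sum_distrib_right mult.assoc)
 show ?thesis unfolding eq form_moment_def
  by (intro has_bochner_integral_sum has_bochner_integral_mult_right has_bochner_integral_of_real gauss_monomial[OF w R]) auto
qed

text \<open>By multilinearity the partner rule extends from monomials to products of linear forms,
  with coincidence of coordinates replaced by the covariance of two forms.\<close>

lemma form_moment_rec:
 fixes w :: "'a::euclidean_space => real"
 assumes w: "!!b. b : Basis ==> w b > 0" and R: "finite R" and x: "x : R"
 shows "form_moment w A R = (\<Sum>y\<in>R - {x}. (\<Sum>b\<in>Basis. A x b * A y b / of_real (w b)) * form_moment w A (R - {x, y}))"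
proof -
 let ?c = "%k y. if k y = k x then 1 / w (k x) else 0"
 have "form_moment w A R = (\<Sum>k\<in>R \<rightarrow>\<^sub>E Basis. \<Sum>y\<in>R - {x}. (\<Prod>r\<in>R. A r (k r)) * of_real (?c k y * moment w (R - {x, y}) k))"
  unfolding form_moment_def
 proof (intro sum.cong refl)
  fix k assume "k : R \<rightarrow>\<^sub>E (Basis :: 'a set)"
  then have k: "k : R \<rightarrow> Basis" by auto
  show "(\<Prod>r\<in>R. A r (k r)) * of_real (moment w R k) = (\<Sum>y\<in>R - {x}. (\<Prod>r\<in>R. A r (k r)) * of_real (?c k y * moment w (R - {x, y}) k))"
  proof -
   have "of_real (moment w R k) = (\<Sum>y\<in>R - {x}. complex_of_real (?c k y * moment w (R - {x, y}) k))"
    by (subst moment_rec[OF w R k x]) (simp_all only: of_real_sum)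
   then show ?thesis by (simp only: sum_distrib_left)
  qed
 qed
 also have "... = (\<Sum>y\<in>R - {x}. \<Sum>k\<in>R \<rightarrow>\<^sub>E Basis. (\<Prod>r\<in>R. A r (k r)) * of_real (?c k y * moment w (R - {x, y}) k))"
  by (rule sum.swap)
 also have "... = (\<Sum>y\<in>R - {x}. (\<Sum>b\<in>Basis. A x b * A y b / of_real (w b)) * form_moment w A (R - {x, y}))"
 proof (intro sum.cong refl)
  fix y assume y: "y : R - {x}"
  let ?R = "R - {x, y}"
  have Rxy: "R = insert x (insert y ?R)" and nx: "x ~: insert y ?R" and ny: "y ~: ?R" using x y by auto
  have fR: "finite ?R" using R by simp
  have "(\<Sum>k\<in>R \<rightarrow>\<^sub>E Basis. (\<Prod>r\<in>R. A r (k r)) * of_real (?c k y * moment w ?R k)) =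
    (\<Sum>b\<in>Basis. \<Sum>b'\<in>Basis. \<Sum>k\<in>?R \<rightarrow>\<^sub>E Basis.
     (\<Prod>r\<in>R. A r ((k(y := b', x := b)) r)) * of_real (?c (k(y := b', x := b)) y * moment w ?R (k(y := b', x := b))))"
   by (subst (1) Rxy) (simp only: sum_PiE_insert[OF nx] sum_PiE_insert[OF ny])
  also have "... = (\<Sum>b\<in>Basis. \<Sum>b'\<in>Basis. \<Sum>k\<in>?R \<rightarrow>\<^sub>E Basis.
     (if b' = b then A x b * A y b / of_real (w b) else 0) * ((\<Prod>r\<in>?R. A r (k r)) * of_real (moment w ?R k)))"
  proof (intro sum.cong refl)
   fix b b' k assume "b : (Basis :: 'a set)" "b' : (Basis :: 'a set)"
   have p: "(\<Prod>r\<in>R. A r ((k(y := b', x := b)) r)) = A x b * (A y b' * (\<Prod>r\<in>?R. A r (k r)))"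
   proof -
    have "(\<Prod>r\<in>insert x (insert y ?R). A r ((k(y := b', x := b)) r)) = A x b * (A y b' * (\<Prod>r\<in>?R. A r ((k(y := b', x := b)) r)))"
     using nx ny fR y by (subst prod.insert; simp)+
    also have "(\<Prod>r\<in>?R. A r ((k(y := b', x := b)) r)) = (\<Prod>r\<in>?R. A r (k r))" by (intro prod.cong) auto
    finally show ?thesis unfolding Rxy[symmetric] .
   qed
   have m: "moment w ?R (k(y := b', x := b)) = moment w ?R k"
    unfolding moment_def by (intro prod.cong refl arg_cong2[of _ _ _ _ normal_moment] arg_cong[where f = card]) auto
   show "(\<Prod>r\<in>R. A r ((k(y := b', x := b)) r)) * of_real (?c (k(y := b', x := b)) y * moment w ?R (k(y := b', x := b))) =
     (if b' = b then A x b * A y b / of_real (w b) else 0) * ((\<Prod>r\<in>?R. A r (k r)) * of_real (moment w ?R k))"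
    unfolding p m using y by auto
  qed
  also have "... = (\<Sum>b\<in>Basis. \<Sum>b'\<in>Basis. if b' = b then A x b * A y b / of_real (w b) * form_moment w A ?R else 0)"
   unfolding sum_distrib_left[symmetric] form_moment_def[symmetric] by (intro sum.cong refl) auto
  also have "... = (\<Sum>b\<in>Basis. A x b * A y b / of_real (w b)) * form_moment w A ?R" by (simp add: sum_distrib_right)
  finally show "(\<Sum>k\<in>R \<rightarrow>\<^sub>E Basis. (\<Prod>r\<in>R. A r (k r)) * of_real (?c k y * moment w ?R k)) =
    (\<Sum>b\<in>Basis. A x b * A y b / of_real (w b)) * form_moment w A ?R" .
 qed
 finally show ?thesis .
qed

subsection \<open>Pairings\<close>

definition pairings :: "'r set => ('r => 'r) set" where
 "pairings R = {t. t permutes R \<and> (\<forall>x\<in>R. t x ~= x \<and> t (t x) = x)}"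

text \<open>Slot \<open>r\<close> stands for the matrix entry in row \<open>p r\<close> and column
  \<open>q r\<close>. Paired entries must sit in transposed positions; both index conditions of a
  pair are covered because \<open>x\<close> ranges over all slots.\<close>

definition pairing_value :: "('n => real) => ('r => 'n) => ('r => 'n) => 'r set => ('r => 'r) => complex" where
 "pairing_value lam p q R t = (if \<forall>x\<in>R. q x = p (t x) then \<Prod>e\<in>edge_sets R t. 1 / of_real (\<Sum>z\<in>e. lam (p z)) else 0)"

lemma finite_pairings: "finite R ==> finite (pairings R)"
 by (rule finite_subset[OF _ finite_permutations]) (auto simp: pairings_def)

text \<open>Removing the pair that contains \<open>x\<close> gives the recursion satisfied by
  Gaussian moments of matrix entries.\<close>

lemma sum_pairings_rec:
 fixes p q :: "'r => 'n"
 assumes R: "finite R" and x: "x : R"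
 shows "(\<Sum>t\<in>pairings R. pairing_value lam p q R t) =
  (\<Sum>y\<in>R - {x}. (if q x = p y \<and> q y = p x then 1 / of_real (lam (p x) + lam (p y)) else 0) *
   (\<Sum>t\<in>pairings (R - {x, y}). pairing_value lam p q (R - {x, y}) t))"
proof -
 have "(\<Sum>t\<in>pairings R. pairing_value lam p q R t) = (\<Sum>y\<in>R - {x}. \<Sum>t\<in>{t : pairings R. t x = y}. pairing_value lam p q R t)"
  using R x finite_pairings by (intro sum.group[symmetric]) (auto simp: pairings_def permutes_in_image)
 also have "... = (\<Sum>y\<in>R - {x}. (if q x = p y \<and> q y = p x then 1 / of_real (lam (p x) + lam (p y)) else 0) *
   (\<Sum>t\<in>pairings (R - {x, y}). pairing_value lam p q (R - {x, y}) t))"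
 proof (intro sum.cong refl)
  fix y assume y: "y : R - {x}"
  let ?R = "R - {x, y}"
  let ?i = "%t z. if z = x then y else if z = y then x else t z"
  let ?j = "%t z. if z : ?R then t z else z"
  have val: "pairing_value lam p q R (?i t) = (if q x = p y \<and> q y = p x then 1 / of_real (lam (p x) + lam (p y)) else 0) * pairing_value lam p q ?R t"
   if t: "t : pairings ?R" for t
  proof -
   have tR: "t z : ?R" "t z ~= z" if "z : ?R" for z using t that by (auto simp: pairings_def dest: permutes_in_image)
   have cond: "(\<forall>z\<in>R. q z = p (?i t z)) \<longleftrightarrow> (q x = p y \<and> q y = p x) \<and> (\<forall>z\<in>?R. q z = p (t z))" using x y by auto
   have "edge_sets R (?i t) = insert {x, y} (edge_sets ?R t)"
   proof -
    have "{z : R. ?i t z ~= z} = {x, y} \<union> {z : ?R. t z ~= z}" using x y by auto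
    then have "edge_sets R (?i t) = (%z. {z, ?i t z}) ` {x, y} \<union> (%z. {z, ?i t z}) ` {z : ?R. t z ~= z}"
     unfolding edge_sets_def by (simp only: image_Un)
    also have "(%z. {z, ?i t z}) ` {z : ?R. t z ~= z} = edge_sets ?R t"
     unfolding edge_sets_def by (rule image_cong) auto
    also have "(%z. {z, ?i t z}) ` {x, y} = {{x, y}}" using y by auto
    finally show ?thesis by simp
   qed
   moreover have "{x, y} ~: edge_sets ?R t" by (auto simp: edge_sets_def doubleton_eq_iff)
   moreover have "finite (edge_sets ?R t)" using R by (simp add: edge_sets_def)
   moreover have "(\<Sum>z\<in>{x, y}. lam (p z)) = lam (p x) + lam (p y)" by (subst sum.insert) (use y in auto)
   ultimately have "(\<Prod>e\<in>edge_sets R (?i t). 1 / complex_of_real (\<Sum>z\<in>e. lam (p z))) =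
     1 / of_real (lam (p x) + lam (p y)) * (\<Prod>e\<in>edge_sets ?R t. 1 / complex_of_real (\<Sum>z\<in>e. lam (p z)))"
    by (simp del: of_real_sum)
   then show ?thesis unfolding pairing_value_def cond by simp
  qed
  have "(\<Sum>t\<in>{t : pairings R. t x = y}. pairing_value lam p q R t) = (\<Sum>t\<in>pairings ?R. pairing_value lam p q R (?i t))"
  proof (rule sum.reindex_bij_witness[where i = ?i and j = ?j])
   fix t assume t: "t : {t : pairings R. t x = y}"
   then have tp: "t permutes R" and tt: "!!z. z : R ==> t (t z) = z" and tn: "!!z. z : R ==> t z ~= z" and tx: "t x = y"
    by (auto simp: pairings_def)
   have ty: "t y = x" using tt[OF x] tx by simp
   show ij: "?i (?j t) = t" using tx ty permutes_not_in[OF tp] by (auto simp: fun_eq_iff)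
   have tR: "t z : ?R" if z: "z : ?R" for z
   proof -
    have "t z : R" using z permutes_in_image[OF tp] by simp
    moreover have "t z ~= x" "t z ~= y" using tt[of z] z tx ty by auto
    ultimately show ?thesis by simp
   qed
   have "?j t permutes ?R" by (rule restricted_permutes[OF tp R]) (use tR in auto)
   then show "?j t : pairings ?R" using tt tn tR by (auto simp: pairings_def)
   show "pairing_value lam p q R (?i (?j t)) = pairing_value lam p q R t" unfolding ij ..
  next
   fix t assume t: "t : pairings ?R"
   then have tp: "t permutes ?R" and tt: "!!z. z : ?R ==> t (t z) = z" and tn: "!!z. z : ?R ==> t z ~= z"
    by (auto simp: pairings_def)
   have tR: "t z : ?R \<longleftrightarrow> z : ?R" for z by (rule permutes_in_image[OF tp])
   have txy: "t x = x" "t y = y" using permutes_not_in[OF tp] by auto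
   show "?j (?i t) = t" using permutes_not_in[OF tp] by (auto simp: fun_eq_iff)
   have nt: "t z ~= x" "t z ~= y" if "z ~= x" "z ~= y" for z using that txy permutes_inj[OF tp] by (metis injD)+
   have ii: "?i t (?i t z) = z" if "z : R" for z using that tt[of z] y nt[of z] by auto
   have iR: "?i t z : R" if "z : R" for z using that tR[of z] x y by auto
   have "?i t permutes R"
   proof (rule bij_imp_permutes)
    show "bij_betw (?i t) R R" by (rule bij_betw_byWitness[where f' = "?i t"]) (intro ballI ii image_subsetI iR; assumption)+
    show "?i t z = z" if "z ~: R" for z using that x y permutes_not_in[OF tp, of z] by auto
   qed
   moreover have "?i t z ~= z" if "z : R" for z using that tn[of z] y by auto
   ultimately show "?i t : {t : pairings R. t x = y}" using ii by (auto simp: pairings_def)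
  qed
  also have "... = (if q x = p y \<and> q y = p x then 1 / of_real (lam (p x) + lam (p y)) else 0) * (\<Sum>t\<in>pairings ?R. pairing_value lam p q ?R t)"
   unfolding sum_distrib_left by (rule sum.cong[OF refl val])
  finally show "(\<Sum>t\<in>{t : pairings R. t x = y}. pairing_value lam p q R t) =
    (if q x = p y \<and> q y = p x then 1 / of_real (lam (p x) + lam (p y)) else 0) * (\<Sum>t\<in>pairings ?R. pairing_value lam p q ?R t)" .
 qed
 finally show ?thesis .
qed

lemma sum_pairings_empty: "(\<Sum>t\<in>pairings {}. pairing_value lam p q {} t) = 1"
proof -
 have "pairings ({} :: 'a set) = {id}" by (auto simp: pairings_def)
 then show ?thesis by (simp add: pairing_value_def edge_sets_def)
qed

subsection \<open>Hermitian matrices\<close>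

abbreviation unit_mat :: "'n => 'n => real^'n^'n" where
 "unit_mat i j \<equiv> axis i (axis j 1)"

text \<open>The entry \<open>X $ i $ j\<close> divided by \<open>sqrt 2\<close>, as a complex linear
  form on real matrices. On the diagonal both unit matrices coincide and the numerators add up to
  \<open>1\<close>.\<close>

definition entry_form :: "'n => 'n => real^'n^'n => complex" where
 "entry_form i j b = (Complex (1/2) (1/2) * (if b = unit_mat i j then 1 else 0) +
   Complex (1/2) (-1/2) * (if b = unit_mat j i then 1 else 0)) / of_real (sqrt 2)"

text \<open>Evaluated at unit matrices, where it is \<open>(lam $ i + lam $ j) / 2\<close>, the
  inverse variance of the coordinate \<open>M $ i $ j\<close>. The quadratic expression avoids
  extracting the indices from a basis vector.\<close>

definition mat_weight :: "real^'n => real^'n^'n => real" where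
 "mat_weight lam b = (\<Sum>i\<in>UNIV. \<Sum>j\<in>UNIV. (lam $ i + lam $ j) / 2 * (b $ i $ j)\<^sup>2)"

lemma unit_mat_nth: "unit_mat i j $ k $ l = (if k = i \<and> l = j then 1 else 0)" by (simp add: axis_def)

lemma inner_unit_mat: "M \<bullet> unit_mat i j = M $ i $ j" by (simp add: inner_axis)

lemma Basis_mat: "(Basis :: (real^'n^'n) set) = range (%(i, j). unit_mat i j)" by (auto simp: Basis_vec_def)

lemma unit_mat_eq_iff: "unit_mat i j = unit_mat k l \<longleftrightarrow> i = k \<and> j = l" by (auto simp: axis_eq_axis)

lemma unit_mat_Basis [simp]: "unit_mat i j : Basis" by (auto simp: Basis_mat)

lemma mat_weight_unit: "mat_weight lam (unit_mat i j) = (lam $ i + lam $ j) / 2"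
proof -
 have "mat_weight lam (unit_mat i j) = (\<Sum>k\<in>UNIV. \<Sum>l\<in>UNIV. if k = i then if l = j then (lam $ i + lam $ j) / 2 else 0 else 0)"
  unfolding mat_weight_def unit_mat_nth by (intro sum.cong refl) auto
 also have "... = (\<Sum>k\<in>UNIV. if k = i then (lam $ i + lam $ j) / 2 else 0)" by (intro sum.cong refl) auto
 finally show ?thesis by simp
qed

lemma sum_Basis_mat: "(\<Sum>b\<in>Basis. f b) = (\<Sum>i\<in>UNIV. \<Sum>j\<in>UNIV. f (unit_mat i j))" for f :: "real^'n^'n => 'b::comm_monoid_add"
proof -
 have "inj (%(i, j). unit_mat i j :: real^'n^'n)" by (auto simp: inj_def unit_mat_eq_iff)
 then have "(\<Sum>b\<in>Basis. f b) = (\<Sum>(i, j)\<in>UNIV. f (unit_mat i j))"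
  unfolding Basis_mat by (subst sum.reindex) (auto simp: o_def case_prod_beta')
 then show ?thesis by (simp add: sum.cartesian_product UNIV_Times_UNIV[symmetric] del: UNIV_Times_UNIV)
qed

lemma hermitian_entry:
 "hermitian_of M $ i $ j / of_real (sqrt 2) = (\<Sum>b\<in>Basis. entry_form i j b * of_real (M \<bullet> b))"
proof -
 have "(\<Sum>b\<in>Basis. entry_form i j b * of_real (M \<bullet> b)) =
   (\<Sum>b\<in>Basis. (if b = unit_mat i j then Complex (1/2) (1/2) * of_real (M \<bullet> b) / of_real (sqrt 2) else 0) +
    (if b = unit_mat j i then Complex (1/2) (-1/2) * of_real (M \<bullet> b) / of_real (sqrt 2) else 0))"
  unfolding entry_form_def by (intro sum.cong refl) (auto simp: add_divide_distrib distrib_right)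
 also have "... = (Complex (1/2) (1/2) * of_real (M $ i $ j) + Complex (1/2) (-1/2) * of_real (M $ j $ i)) / of_real (sqrt 2)"
  by (simp add: sum.distrib inner_unit_mat add_divide_distrib)
 also have "Complex (1/2) (1/2) * of_real (M $ i $ j) + Complex (1/2) (-1/2) * of_real (M $ j $ i) = hermitian_of M $ i $ j"
  by (simp add: hermitian_of_def complex_eq_iff add_divide_distrib diff_divide_distrib)
 finally show ?thesis ..
qed

text \<open>The coefficients \<open>(1 + \<i>) / 2\<close> and \<open>(1 - \<i>) / 2\<close> have
  squares that cancel, and twice their product is \<open>1\<close>: an entry correlates only with
  its transpose. The \<open>sqrt 2\<close> in both forms halves the variance
  \<open>2 / (lam $ i + lam $ j)\<close> of the real coordinates.\<close>

lemma entry_form_covariance: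
 fixes lam :: "real^'n"
 shows "(\<Sum>b\<in>Basis. entry_form i j b * entry_form k l b / of_real (mat_weight lam b)) =
  (if j = k \<and> l = i then 1 / of_real (lam $ i + lam $ k) else 0)"
proof -
 let ?al = "Complex (1/2) (1/2)" and ?be = "Complex (1/2) (-1/2)"
 let ?w = "complex_of_real ((lam $ i + lam $ j) / 2)"
 have s2: "complex_of_real (sqrt 2) * complex_of_real (sqrt 2) = 2" by (simp flip: of_real_mult)
 have "(\<Sum>b\<in>Basis. entry_form i j b * entry_form k l b / of_real (mat_weight lam b)) =
   (\<Sum>b\<in>Basis. (if b = unit_mat i j then ?al * entry_form k l b / of_real (sqrt 2) / of_real (mat_weight lam b) else 0) +
    (if b = unit_mat j i then ?be * entry_form k l b / of_real (sqrt 2) / of_real (mat_weight lam b) else 0))"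
  unfolding entry_form_def[of i j] by (intro sum.cong refl) (auto simp: add_divide_distrib distrib_right)
 also have "... = (?al * entry_form k l (unit_mat i j) + ?be * entry_form k l (unit_mat j i)) / of_real (sqrt 2) / ?w"
  by (simp add: sum.distrib mat_weight_unit add_divide_distrib add.commute)
 also have "(?al * entry_form k l (unit_mat i j) + ?be * entry_form k l (unit_mat j i)) / of_real (sqrt 2) =
   ((?al * ?al + ?be * ?be) * (if i = k \<and> j = l then 1 else 0) + (2 * ?al * ?be) * (if j = k \<and> l = i then 1 else 0)) / 2"
 proof -
  have gen: "(al * ((al * P + be * P') / S) + be * ((al * P' + be * P) / S)) / S = ((al * al + be * be) * P + (2 * al * be) * P') / 2"
   if "S * S = 2" for al be P P' S :: complex
  proof -
   have "(al * ((al * P + be * P') / S) + be * ((al * P' + be * P) / S)) / S = ((al * al + be * be) * P + (2 * al * be) * P') / (S * S)"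
    by (simp add: add_divide_distrib algebra_simps)
   then show ?thesis using that by simp
  qed
  have e1: "entry_form k l (unit_mat i j) = (?al * (if i = k \<and> j = l then 1 else 0) + ?be * (if j = k \<and> l = i then 1 else 0)) / of_real (sqrt 2)"
   "entry_form k l (unit_mat j i) = (?al * (if j = k \<and> l = i then 1 else 0) + ?be * (if i = k \<and> j = l then 1 else 0)) / of_real (sqrt 2)"
   unfolding entry_form_def unit_mat_eq_iff by (auto simp only: eq_commute[of i l] conj_commute)
  show ?thesis unfolding e1 by (rule gen[OF s2])
 qed
 also have "?al * ?al + ?be * ?be = 0" by (simp add: complex_eq_iff)
 also have "2 * ?al * ?be = 1" by (simp add: complex_eq_iff)
 finally show ?thesis by (auto simp: field_simps)
qed

text \<open>Both sides obey the same recursion over the partner of a chosen slot and start from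
  \<open>1\<close> on the empty set.\<close>

lemma wick_forms:
 fixes lam :: "real^'n" and p q :: "'r => 'n"
 assumes lam: "!!i. lam $ i > 0" and R: "finite R"
 shows "form_moment (mat_weight lam) (%r. entry_form (p r) (q r)) R = (\<Sum>t\<in>pairings R. pairing_value (%i. lam $ i) p q R t)"
 using R
proof (induction R rule: finite_psubset_induct)
 case (psubset R)
 have w: "mat_weight lam b > 0" if "b : Basis" for b
  using that lam by (auto simp: Basis_mat mat_weight_unit add_pos_pos)
 show ?case
 proof (cases "R = {}")
  case True
  have "form_moment (mat_weight lam) (%r. entry_form (p r) (q r)) {} = 1"
   by (simp add: form_moment_def moment_def normal_moment_0 w)
  then show ?thesis unfolding True sum_pairings_empty .
 next
  case False
  then obtain x where x: "x : R" by auto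
  show ?thesis
  proof (subst form_moment_rec[OF w psubset.hyps x], assumption, subst sum_pairings_rec[OF psubset.hyps x], intro sum.cong refl)
   fix y assume y: "y : R - {x}"
   have "form_moment (mat_weight lam) (%r. entry_form (p r) (q r)) (R - {x, y}) = (\<Sum>t\<in>pairings (R - {x, y}). pairing_value (%i. lam $ i) p q (R - {x, y}) t)"
    by (rule psubset.IH) (use x in auto)
   then show "(\<Sum>b\<in>Basis. entry_form (p x) (q x) b * entry_form (p y) (q y) b / of_real (mat_weight lam b)) *
     form_moment (mat_weight lam) (%r. entry_form (p r) (q r)) (R - {x, y}) =
     (if q x = p y \<and> q y = p x then 1 / of_real (lam $ p x + lam $ p y) else 0) *
     (\<Sum>t\<in>pairings (R - {x, y}). pairing_value (%i. lam $ i) p q (R - {x, y}) t)"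
    unfolding entry_form_covariance by simp
  qed
 qed
qed

text \<open>The trace involves only squared moduli of entries, which are diagonal in the real
  coordinates \<open>M\<close>. The constant \<open>K\<close> collects the Gaussian normalisations
  and cancels in expectations.\<close>

lemma gauss_weight_hermitian:
 fixes lam :: "real^'n"
 assumes lam: "!!i. lam $ i > 0"
 shows "\<exists>K>0. \<forall>M. gauss_weight lam (hermitian_of M) = of_real (K * gauss_prod (mat_weight lam) M)"
proof -
 let ?w = "mat_weight lam"
 have w: "?w b > 0" if "b : Basis" for b using that lam by (auto simp: Basis_mat mat_weight_unit add_pos_pos)
 define K where "K = (\<Prod>b\<in>(Basis :: (real^'n^'n) set). sqrt (2 * pi / ?w b))"
 have K: "K > 0" unfolding K_def using w by (intro prod_pos) auto
 have "gauss_weight lam (hermitian_of M) = of_real (K * gauss_prod ?w M)" for M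
 proof -
  let ?X = "hermitian_of M"
  have "trace (?X ** ?X ** diag_matrix lam) = (\<Sum>i\<in>UNIV. \<Sum>j\<in>UNIV. ?X $ i $ j * ?X $ j $ i * of_real (lam $ i))"
  proof -
   have "(?X ** ?X ** diag_matrix lam) $ i $ i = (\<Sum>j\<in>UNIV. ?X $ i $ j * ?X $ j $ i * of_real (lam $ i))" for i
   proof -
    have "(?X ** ?X ** diag_matrix lam) $ i $ i = (\<Sum>k\<in>UNIV. (?X ** ?X) $ i $ k * (if k = i then of_real (lam $ k) else 0))"
     by (subst matrix_matrix_mult_def) (simp add: diag_matrix_def)
    also have "... = (?X ** ?X) $ i $ i * of_real (lam $ i)" by (simp add: if_distrib[of "%z. _ * z"] cong: if_cong)
    finally show ?thesis by (simp add: matrix_matrix_mult_def sum_distrib_right)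
   qed
   then show ?thesis by (simp add: trace_def)
  qed
  also have "... = (\<Sum>i\<in>UNIV. \<Sum>j\<in>UNIV. of_real (lam $ i * ((M $ i $ j)\<^sup>2 + (M $ j $ i)\<^sup>2) / 2))"
  proof (intro sum.cong refl)
   fix i j
   have "?X $ i $ j * ?X $ j $ i = of_real (((M $ i $ j)\<^sup>2 + (M $ j $ i)\<^sup>2) / 2)"
    by (simp add: hermitian_of_def complex_eq_iff power2_eq_square field_simps)
   then show "?X $ i $ j * ?X $ j $ i * of_real (lam $ i) = of_real (lam $ i * ((M $ i $ j)\<^sup>2 + (M $ j $ i)\<^sup>2) / 2)"
    by (simp add: mult.commute)
  qed
  also have "... = of_real (\<Sum>i\<in>UNIV. \<Sum>j\<in>UNIV. lam $ i * ((M $ i $ j)\<^sup>2 + (M $ j $ i)\<^sup>2) / 2)" by simp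
  also have "(\<Sum>i\<in>UNIV. \<Sum>j\<in>UNIV. lam $ i * ((M $ i $ j)\<^sup>2 + (M $ j $ i)\<^sup>2) / 2) =
    (\<Sum>i\<in>UNIV. \<Sum>j\<in>UNIV. lam $ i * (M $ i $ j)\<^sup>2 / 2) + (\<Sum>i\<in>UNIV. \<Sum>j\<in>UNIV. lam $ i * (M $ j $ i)\<^sup>2 / 2)"
   by (simp add: distrib_left add_divide_distrib sum.distrib)
  also have "(\<Sum>i\<in>UNIV. \<Sum>j\<in>UNIV. lam $ i * (M $ j $ i)\<^sup>2 / 2) = (\<Sum>i\<in>UNIV. \<Sum>j\<in>UNIV. lam $ j * (M $ i $ j)\<^sup>2 / 2)"
   by (rule sum.swap)
  also have "(\<Sum>i\<in>UNIV. \<Sum>j\<in>UNIV. lam $ i * (M $ i $ j)\<^sup>2 / 2) + ... = (\<Sum>i\<in>UNIV. \<Sum>j\<in>UNIV. ?w (unit_mat i j) * (M \<bullet> unit_mat i j)\<^sup>2)"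
   by (simp add: mat_weight_unit inner_unit_mat sum.distrib[symmetric] field_simps)
  also have "... = (\<Sum>b\<in>Basis. ?w b * (M \<bullet> b)\<^sup>2)" by (rule sum_Basis_mat[symmetric])
  finally have tr: "trace (?X ** ?X ** diag_matrix lam) = of_real (\<Sum>b\<in>Basis. ?w b * (M \<bullet> b)\<^sup>2)" .
  have "gauss_weight lam ?X = of_real (exp (\<Sum>b\<in>Basis. - (?w b * (M \<bullet> b)\<^sup>2 / 2)))"
   unfolding gauss_weight_def tr by (simp add: exp_of_real[symmetric] sum_negf sum_divide_distrib)
  also have "exp (\<Sum>b\<in>Basis. - (?w b * (M \<bullet> b)\<^sup>2 / 2)) = (\<Prod>b\<in>Basis. exp (- (?w b * (M \<bullet> b)\<^sup>2 / 2)))"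
   by (rule exp_sum) simp
  also have "... = K * gauss_prod ?w M" unfolding K_def gauss_prod_def prod.distrib[symmetric]
  proof (intro prod.cong refl)
   fix b :: "real^'n^'n" assume "b : Basis"
   then have "?w b > 0" by (rule w)
   then show "exp (- (?w b * (M \<bullet> b)\<^sup>2 / 2)) = sqrt (2 * pi / ?w b) * normal_density 0 (1 / sqrt (?w b)) (M \<bullet> b)"
    by (simp add: normal_density_def power_divide real_sqrt_divide field_simps)
  qed
  finally show ?thesis .
 qed
 then show ?thesis using K by blast
qed

lemma hermitian_of_measurable: "hermitian_of : measurable lborel borel"
proof -
 have "linear (hermitian_of :: real^'n^'n => complex^'n^'n)"
  by (rule linearI) (auto simp: hermitian_of_def vec_eq_iff complex_eq_iff field_simps)
 then have "continuous_on UNIV (hermitian_of :: real^'n^'n => complex^'n^'n)"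
  by (rule linear_continuous_on[OF linear_conv_bounded_linear[THEN iffD1]])
 then have "(hermitian_of :: real^'n^'n => complex^'n^'n) : borel_measurable borel"
  by (rule borel_measurable_continuous_onI)
 then show ?thesis by simp
qed

lemma gauss_expectation_eq:
 fixes lam :: "real^'n"
 assumes lam: "!!i. lam $ i > 0" and f: "f : borel_measurable borel"
 shows "gauss_expectation lam f = (\<integral>M. f (hermitian_of M) * of_real (gauss_prod (mat_weight lam) M) \<partial>lborel)"
proof -
 obtain K where K: "K > 0" and gw: "!!M. gauss_weight lam (hermitian_of M) = of_real (K * gauss_prod (mat_weight lam) M)"
  using gauss_weight_hermitian[of lam] lam by blast
 have w: "mat_weight lam b > 0" if "b : Basis" for b
  using that lam by (auto simp: Basis_mat mat_weight_unit add_pos_pos)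
 have gm: "gauss_weight lam : borel_measurable borel"
 proof -
  have "continuous_on UNIV (%X :: complex^'n^'n. trace (X ** X ** diag_matrix lam))"
   unfolding trace_def matrix_matrix_mult_def by (intro continuous_intros)
  then have "continuous_on UNIV (gauss_weight lam)"
   unfolding gauss_weight_def[abs_def] by (intro continuous_intros) auto
  then show ?thesis by (rule borel_measurable_continuous_onI)
 qed
 have int: "(\<integral>X. h X * gauss_weight lam X \<partial>hermitian_lebesgue) = of_real K * (\<integral>M. h (hermitian_of M) * of_real (gauss_prod (mat_weight lam) M) \<partial>lborel)"
  if h: "h : borel_measurable borel" for h
 proof -
  have "(\<integral>X. h X * gauss_weight lam X \<partial>hermitian_lebesgue) = (\<integral>M. h (hermitian_of M) * gauss_weight lam (hermitian_of M) \<partial>lborel)"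
   unfolding hermitian_lebesgue_def using h gm by (intro integral_distr hermitian_of_measurable) measurable
  also have "... = (\<integral>M. of_real K * (h (hermitian_of M) * of_real (gauss_prod (mat_weight lam) M)) \<partial>lborel)"
   by (simp add: gw mult_ac)
  finally show ?thesis by simp
 qed
 have "has_bochner_integral lborel (%M. gauss_prod (mat_weight lam) M) 1"
  using gauss_monomial[of "mat_weight lam" "{} :: nat set" "%_. undefined"] w by (simp add: moment_def normal_moment_0 w)
 then have "has_bochner_integral lborel (%M. complex_of_real (gauss_prod (mat_weight lam) M)) (of_real 1)"
  by (rule has_bochner_integral_of_real)
 then have one: "(\<integral>M. complex_of_real (gauss_prod (mat_weight lam) M) \<partial>lborel) = 1"
  by (simp add: has_bochner_integral_iff)
 show ?thesis unfolding gauss_expectation_def int[OF f] using int[of "%_. 1"] K one by simp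
qed

theorem wick:
 fixes lam :: "real^'n" and p q :: "'i => 'r => 'n"
 assumes lam: "!!i. lam $ i > 0" and I: "finite I" and R: "!!i. i : I ==> finite (R i)"
 shows "gauss_expectation lam (%X. \<Sum>i\<in>I. c i * (\<Prod>r\<in>R i. X $ p i r $ q i r / of_real (sqrt 2))) =
  (\<Sum>i\<in>I. c i * (\<Sum>t\<in>pairings (R i). pairing_value (%i. lam $ i) (p i) (q i) (R i) t))"
proof -
 let ?w = "mat_weight lam"
 have w: "?w b > 0" if "b : Basis" for b using that lam by (auto simp: Basis_mat mat_weight_unit add_pos_pos)
 have meas: "(%X. \<Sum>i\<in>I. c i * (\<Prod>r\<in>R i. X $ p i r $ q i r / of_real (sqrt 2))) : borel_measurable borel"
  by (intro borel_measurable_continuous_onI continuous_intros) auto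
 have "has_bochner_integral lborel (%M. \<Sum>i\<in>I. c i * ((\<Prod>r\<in>R i. \<Sum>b\<in>Basis. entry_form (p i r) (q i r) b * of_real (M \<bullet> b)) * of_real (gauss_prod ?w M)))
   (\<Sum>i\<in>I. c i * form_moment ?w (%r. entry_form (p i r) (q i r)) (R i))"
  by (intro has_bochner_integral_sum has_bochner_integral_mult_right gauss_forms w R)
 then have "(\<integral>M. (\<Sum>i\<in>I. c i * ((\<Prod>r\<in>R i. \<Sum>b\<in>Basis. entry_form (p i r) (q i r) b * of_real (M \<bullet> b)) * of_real (gauss_prod ?w M))) \<partial>lborel) =
   (\<Sum>i\<in>I. c i * form_moment ?w (%r. entry_form (p i r) (q i r)) (R i))" by (simp add: has_bochner_integral_iff)
 moreover have "(\<Sum>i\<in>I. c i * (\<Prod>r\<in>R i. hermitian_of M $ p i r $ q i r / of_real (sqrt 2))) * of_real (gauss_prod ?w M) =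
   (\<Sum>i\<in>I. c i * ((\<Prod>r\<in>R i. \<Sum>b\<in>Basis. entry_form (p i r) (q i r) b * of_real (M \<bullet> b)) * of_real (gauss_prod ?w M)))" for M
  unfolding hermitian_entry by (simp only: sum_distrib_right mult.assoc)
 ultimately show ?thesis unfolding gauss_expectation_eq[OF lam meas] using R by (simp add: wick_forms[OF lam])
qed

section \<open>The expectation of the generating function of coloured maps\<close>

text \<open>The face permutation maps the boundary-coloured half-edges injectively into themselves,
  hence onto. A boundary colour right after a loose half-edge would thus force one on the loose
  half-edge itself. So loose half-edges have faces on both sides and carry genuine matrix
  entries.\<close>

lemma cmaps_fixed_point:
 assumes m: "(a, t, c) : cmaps H" and H: "finite H" and x: "x : H" "t x = x"
 shows "c x ~= None" "c (a (a x)) ~= None"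
proof -
 note D = cmapsD[OF m]
 show 1: "c x ~= None" using D(8)[OF x(1)] x(2) by auto
 let ?N = "{x : H. c x = None}"
 let ?g = "%x. a (a (t x))"
 have nf: "t y ~= y" if "y : ?N" for y using D(8)[of y] that by auto
 have "?g ` ?N \<subseteq> ?N" using D(7) nf by (auto simp: permutes_in_image[OF D(1)] permutes_in_image[OF D(2)])
 moreover have "inj (a \<circ> a \<circ> t)" by (intro inj_compose permutes_inj[OF D(1)] permutes_inj[OF D(2)])
 then have "inj ?g" by (simp add: comp_def)
 ultimately have img: "?g ` ?N = ?N" using H by (intro endo_inj_surj) (auto intro: inj_on_subset)
 show "c (a (a x)) ~= None"
 proof
  assume "c (a (a x)) = None"
  then have "a (a x) : ?g ` ?N" unfolding img using x by (simp add: permutes_in_image[OF D(1)])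
  then obtain y where y: "y : ?N" "a (a x) = a (a (t y))" by blast
  then have "x = t y" using permutes_inj[OF D(1)] by (metis injD)
  then have "x = y" using D(5)[of y] y(1) x(2) by simp
  then show False using y(1) 1 by simp
 qed
qed

text \<open>Boundary cycles are traced through boundary-coloured half-edges only, so regluing
  elsewhere does not touch them.\<close>

lemma bdry_cycles_cong:
 assumes m: "(a, t, c) : cmaps H" and eq: "!!x. x : H ==> c x = None ==> t' x = t x"
 shows "bdry_cycles H (a, t', c) = bdry_cycles H (a, t, c)"
proof -
 note D = cmapsD[OF m]
 let ?N = "{x : H. c x = None}"
 have nf: "t y ~= y" if "y : ?N" for y using D(8)[of y] that by auto
 have clos: "(%x. a (a (t x))) : ?N \<rightarrow> ?N"
  using D(7) nf by (auto simp: permutes_in_image[OF D(1)] permutes_in_image[OF D(2)])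
 have "orbit (%x. a (a (t' x))) x = orbit (%x. a (a (t x))) x" if "x : ?N" for x
  by (rule orbit_cong0[OF that clos, symmetric]) (use eq in simp)
 then show ?thesis unfolding bdry_cycles_def by simp
qed

lemma involution_permutes:
 assumes "!!x. x : H ==> s x : H" "!!x. x : H ==> s (s x) = x" "!!x. x ~: H ==> s x = x"
 shows "s permutes H" by (rule bij_imp_permutes, rule bij_betw_byWitness[where f' = s]) (use assms in auto)

definition free_maps :: "'h set => ('h, 'n) cmap set" where
 "free_maps H = {(a, t, c) : cmaps H. \<forall>x\<in>H. t x ~= x}"

lemma finite_free_maps: "finite H ==> finite (free_maps H :: ('h, 'n::finite) cmap set)"
 by (rule finite_subset[OF _ finite_cmaps]) (auto simp: free_maps_def)

lemma finite_edge_sets: "finite H ==> finite (edge_sets H t)" by (simp add: edge_sets_def)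

lemma cweight_1:
 assumes H: "finite H" and m: "(a, t, c) : cmaps H"
 shows "cweight 1 (%_ _. 0) lam H (a, t, c) =
  (if \<forall>x\<in>H. t x ~= x then Q_monom (\<Prod>e\<in>edge_sets H t. 1 / of_real (\<Sum>z\<in>e. lam_opt lam (c z))) (card (bdry_cycles H (a, t, c))) else 0)"
proof (cases "\<forall>x\<in>H. t x ~= x")
 case True
 then have e: "{x. x : H \<and> t x = x} = {}" by auto
 show ?thesis unfolding cweight_def prod.case e using True by (simp add: edge_weight_def)
next
 case False
 then obtain x where x: "x : H" "t x = x" by auto
 have "entry_opt (%_ _. 0) (c x) (c (a (a x))) = 0" by (simp add: entry_opt_def split: option.split)
 then have "(\<Prod>x | x : H \<and> t x = x. entry_opt (%_ _. 0) (c x) (c (a (a x)))) = 0" using x H by (intro prod_zero) auto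
 then show ?thesis using False by (auto simp: cweight_def Q_monom_def)
qed

lemma all_sum_1:
 assumes H: "finite H"
 shows "all_sum 1 (%_ _. 0) lam H = (\<Sum>(a, t, c)\<in>(free_maps H :: ('h, 'n::finite) cmap set).
  Q_monom (\<Prod>e\<in>edge_sets H t. 1 / of_real (\<Sum>z\<in>e. lam_opt lam (c z))) (card (bdry_cycles H (a, t, c))))"
 unfolding all_sum_def by (rule sum.mono_neutral_cong_right)
   (use H in \<open>auto simp: free_maps_def cweight_1 finite_cmaps split: if_splits\<close>)

lemma nth_Q_monom: "fps_nth (Q_monom a k) b = (if k = b then a else 0)" by (auto simp: Q_monom_def)

text \<open>The edges of a closed map are of two kinds. Those along a boundary form a proper map
  with legs; those between two faces form a pairing of these legs, and the matching of row and
  column indices is the transport of face colours across the new edges. Wick's theorem therefore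
  sums over closed maps.\<close>

theorem expectation_all_sum:
 fixes lam :: "real^'n" and H :: "'h set"
 assumes lam: "!!i. lam $ i > 0" and H: "finite H"
 shows "gauss_expectation lam (%X. fps_nth (all_sum 0 (%i j. X $ i $ j / of_real (sqrt 2)) (%i. lam $ i) H) b) =
  fps_nth (all_sum 1 (%_ _. 0) (%i. lam $ i) H) b"
proof -
 let ?lm = "%i. lam $ i"
 \<comment> \<open>\<open>?i\<close> cuts the edges between two faces and remembers them as a
   pairing; \<open>?j\<close> glues the pairing back.\<close>
 let ?i = "%(a :: 'h => 'h, s :: 'h => 'h, c :: 'h => 'n option). ((a, %x. if x : H \<and> (c x = None \<or> c (s x) = None) then s x else x, c), %x. if x : H \<and> c x ~= None \<and> c (s x) ~= None then s x else x)"
  and ?j = "%((a :: 'h => 'h, t :: 'h => 'h, c :: 'h => 'n option), r :: 'h => 'h). (a, %x. if t x = x then r x else t x, c)"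
 define I where "I = {m : (cmaps H :: ('h, 'n) cmap set). proper H m \<and> card (bdry_cycles H m) = b}"
 define R where "R m = {x : H. fst (snd m) x = x}" for m :: "('h, 'n) cmap"
 define p where "p m x = the (snd (snd m) x)" for m :: "('h, 'n) cmap" and x
 define q where "q m x = the (snd (snd m) (fst m (fst m x)))" for m :: "('h, 'n) cmap" and x
 define K where "K m = (\<Prod>e\<in>edge_sets H (fst (snd m)). edge_weight 0 ?lm (snd (snd m)) e)" for m :: "('h, 'n) cmap"
 define L where "L t c = (\<Prod>e\<in>edge_sets H t. 1 / complex_of_real (\<Sum>z\<in>e. lam_opt ?lm (c z)))" for t and c :: "'h => 'n option"
 have fin: "finite (cmaps H :: ('h, 'n) cmap set)" by (rule finite_cmaps[OF H])
 then have finI: "finite I" unfolding I_def by simp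
 have "fps_nth (all_sum 0 (%i j. X $ i $ j / of_real (sqrt 2)) ?lm H) b =
   (\<Sum>m\<in>I. K m * (\<Prod>r\<in>R m. X $ p m r $ q m r / of_real (sqrt 2)))" for X :: "complex^'n^'n"
 proof -
  have "fps_nth (all_sum 0 (%i j. X $ i $ j / of_real (sqrt 2)) ?lm H) b =
    (\<Sum>m\<in>cmaps H. fps_nth (cweight 0 (%i j. X $ i $ j / of_real (sqrt 2)) ?lm H m) b)"
   by (simp add: all_sum_def fps_sum_nth)
  also have "... = (\<Sum>m\<in>I. K m * (\<Prod>r\<in>R m. X $ p m r $ q m r / of_real (sqrt 2)))"
  proof (rule sum.mono_neutral_cong_right[OF finite_cmaps[OF H]])
   show "\<forall>m\<in>cmaps H - I. fps_nth (cweight 0 (%i j. X $ i $ j / of_real (sqrt 2)) ?lm H m) b = 0"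
   proof
    fix m assume m: "m : cmaps H - I"
    show "fps_nth (cweight 0 (%i j. X $ i $ j / of_real (sqrt 2)) ?lm H m) b = 0"
     using cweight_not_proper[OF H, of m] m
     by (cases "proper H m"; cases m) (auto simp: I_def cweight_def nth_Q_monom)
   qed
   fix m assume mI: "m : I"
   obtain a t c where m: "m = (a, t, c)" by (cases m)
   have cm: "(a, t, c) : cmaps H" using mI by (simp add: I_def m)
   have "(\<Prod>x | x : H \<and> t x = x. entry_opt (%i j. X $ i $ j / of_real (sqrt 2)) (c x) (c (a (a x)))) =
     (\<Prod>r\<in>R m. X $ p m r $ q m r / of_real (sqrt 2))"
   proof (rule prod.cong)
    fix x assume "x : R m"
    then have x: "x : H" "t x = x" by (auto simp: R_def m)
    show "entry_opt (%i j. X $ i $ j / of_real (sqrt 2)) (c x) (c (a (a x))) = X $ p m x $ q m x / of_real (sqrt 2)"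
     using cmaps_fixed_point[OF cm H x] by (auto simp: entry_opt_def p_def q_def m)
   qed (auto simp: R_def m)
   then show "fps_nth (cweight 0 (%i j. X $ i $ j / of_real (sqrt 2)) ?lm H m) b = K m * (\<Prod>r\<in>R m. X $ p m r $ q m r / of_real (sqrt 2))"
    using mI by (simp add: I_def m cweight_def nth_Q_monom K_def mult.commute)
  qed (auto simp: I_def)
  finally show ?thesis .
 qed
 then have "gauss_expectation lam (%X. fps_nth (all_sum 0 (%i j. X $ i $ j / of_real (sqrt 2)) ?lm H) b) =
   (\<Sum>m\<in>I. K m * (\<Sum>r\<in>pairings (R m). pairing_value ?lm (p m) (q m) (R m) r))"
  using wick[OF lam finI, of R K p q] H by (simp add: R_def)
 also have "... = (\<Sum>(m, r)\<in>(SIGMA m:I. pairings (R m)). K m * pairing_value ?lm (p m) (q m) (R m) r)"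
  using finI H by (simp add: sum_distrib_left sum.Sigma finite_pairings R_def)
 also have "... = (\<Sum>(m, r)\<in>(SIGMA m:I. {r : pairings (R m). \<forall>x\<in>R m. q m x = p m (r x)}). K m * pairing_value ?lm (p m) (q m) (R m) r)"
  using finI H by (intro sum.mono_neutral_right) (auto simp: pairing_value_def finite_pairings R_def split: if_splits)
 also have "... = (\<Sum>(a, t, c)\<in>{(a, t, c) : free_maps H. card (bdry_cycles H (a, t, c)) = b}. L t c)"
 proof (rule sum.reindex_bij_witness[where
    i = ?i
    and j = ?j])
  fix mr assume mr: "mr : (SIGMA m:I. {r : pairings (R m). \<forall>x\<in>R m. q m x = p m (r x)})"
  obtain a t c r where mr': "mr = ((a, t, c), r)" by (metis prod_cases3 prod.collapse)
  let ?m = "(a, t, c)" and ?s = "%x. if t x = x then r x else t x"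
  have cm: "?m : cmaps H" and pr: "proper H ?m" and cb: "card (bdry_cycles H ?m) = b"
   and r: "r : pairings (R ?m)" and rq: "!!x. x : R ?m ==> q ?m x = p ?m (r x)" using mr by (auto simp: mr' I_def)
  note D = cmapsD[OF cm]
  note F = cmaps_fixed_point[OF cm H]
  have Rm: "R ?m = {x : H. t x = x}" by (simp add: R_def)
  have rp: "r permutes R ?m" and rn: "!!x. x : R ?m ==> r x ~= x" and rr: "!!x. x : R ?m ==> r (r x) = x"
   using r by (auto simp: pairings_def)
  have rR: "r x : R ?m" if "x : R ?m" for x using permutes_in_image[OF rp] that by simp
  have col: "c (a (a x)) = c (r x)" if "x : R ?m" for x
   using rq[OF that] F[of x] F(1)[of "r x"] rR[OF that] that by (auto simp: p_def q_def Rm)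
  have tH: "t x : H" if "x : H" for x using permutes_in_image[OF D(2)] that by simp
  have out: "t x = x" "r x = x" if "x ~: H" for x
   using permutes_not_in[OF D(2) that] permutes_not_in[OF rp, of x] that by (auto simp: Rm)
  have sH: "?s x : H" and ss: "?s (?s x) = x" and sn: "?s x ~= x" if x: "x : H" for x
   using tH[OF x] rR[of x] rr[of x] rn[of x] D(5)[OF x] x by (auto simp: Rm)
  have sp: "?s permutes H" by (rule involution_permutes) (use sH ss out in auto)
  have "c (a (a (?s x))) = c x" if x: "x : H" for x
   using D(7)[OF x] col[of "r x"] rR[of x] rr[of x] x by (auto simp: Rm)
  moreover have "c (?s x) ~= None" if "x : H" "c x = None" for x using D(8)[OF that] F(1)[of x] that by auto
  ultimately have sc: "(a, ?s, c) : cmaps H" using D(1,3,4,6) sp ss unfolding cmaps_def by blast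
  have bd: "bdry_cycles H (a, ?s, c) = bdry_cycles H ?m"
  proof (rule bdry_cycles_cong[OF cm])
   fix x assume "x : H" "c x = None"
   then show "?s x = t x" using F(1)[of x] by auto
  qed
  show "(?j mr) : {(a, t, c) : free_maps H. card (bdry_cycles H (a, t, c)) = b}"
   unfolding mr' using sc sn bd cb by (simp add: free_maps_def)
  have nN: "c x ~= None \<and> c (r x) ~= None" if "x : R ?m" for x using F(1)[of x] F(1)[of "r x"] rR[OF that] that by (auto simp: Rm)
  have pN: "c x = None \<or> c (t x) = None" if "x : H" "t x ~= x" for x using pr that by (auto simp: proper_def)
  have "(%x. if x : H \<and> (c x = None \<or> c (?s x) = None) then ?s x else x) = t"
  proof
   fix x show "(if x : H \<and> (c x = None \<or> c (?s x) = None) then ?s x else x) = t x"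
    using nN[of x] pN[of x] out[of x] by (cases "x : H"; cases "t x = x") (auto simp: Rm)
  qed
  moreover have "(%x. if x : H \<and> c x ~= None \<and> c (?s x) ~= None then ?s x else x) = r"
  proof
   fix x
   have "r x = x" if "t x ~= x" using permutes_not_in[OF rp, of x] that by (auto simp: Rm)
   then show "(if x : H \<and> c x ~= None \<and> c (?s x) ~= None then ?s x else x) = r x"
    using nN[of x] pN[of x] out[of x] by (cases "x : H"; cases "t x = x") (auto simp: Rm)
  qed
  ultimately show "?i (?j mr) = mr" unfolding mr' prod.case by simp
  have e1: "edge_sets H ?s = edge_sets H t \<union> edge_sets (R ?m) r"
  proof -
   have "{x : H. ?s x ~= x} = {x : H. t x ~= x} \<union> R ?m" using rn unfolding Rm by auto
   then have "edge_sets H ?s = (%x. {x, ?s x}) ` {x : H. t x ~= x} \<union> (%x. {x, ?s x}) ` R ?m"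
    unfolding edge_sets_def by (simp only: image_Un)
   also have "(%x. {x, ?s x}) ` {x : H. t x ~= x} = edge_sets H t" unfolding edge_sets_def by (rule image_cong) auto
   also have "(%x. {x, ?s x}) ` R ?m = edge_sets (R ?m) r"
    unfolding edge_sets_def by (rule image_cong) (auto simp: rn Rm)
   finally show ?thesis .
  qed
  have e2: "edge_sets H t \<inter> edge_sets (R ?m) r = {}"
  proof -
   have False if "x : H" "t x ~= x" "y : R ?m" "{x, t x} = {y, r y}" for x y
   proof -
    have "x = y \<or> x = r y" using that(4) by blast
    then show False using that rR[OF that(3)] by (auto simp: Rm)
   qed
   then show ?thesis unfolding edge_sets_def by blast
  qed
  have k1: "K ?m = (\<Prod>e\<in>edge_sets H t. 1 / complex_of_real (\<Sum>z\<in>e. lam_opt ?lm (c z)))"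
  proof -
   have "None : c ` e" if "e : edge_sets H t" for e using that pN by (fastforce simp: edge_sets_def image_iff)
   then show ?thesis unfolding K_def by (intro prod.cong) (auto simp: edge_weight_def)
  qed
  have k2: "pairing_value ?lm (p ?m) (q ?m) (R ?m) r = (\<Prod>e\<in>edge_sets (R ?m) r. 1 / complex_of_real (\<Sum>z\<in>e. lam_opt ?lm (c z)))"
  proof -
   have "(\<Sum>z\<in>e. ?lm (p ?m z)) = (\<Sum>z\<in>e. lam_opt ?lm (c z))" if "e : edge_sets (R ?m) r" for e
   proof (rule sum.cong[OF refl])
    fix z assume "z : e"
    then have "z : R ?m" using that rR by (auto simp: edge_sets_def)
    then show "?lm (p ?m z) = lam_opt ?lm (c z)" using nN[of z] by (auto simp: p_def lam_opt_def)
   qed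
   then show ?thesis unfolding pairing_value_def using rq by simp
  qed
  have "L ?s c = K ?m * pairing_value ?lm (p ?m) (q ?m) (R ?m) r" unfolding L_def e1 k1 k2
   by (rule prod.union_disjoint[OF _ _ e2]) (use H in \<open>simp_all add: finite_edge_sets Rm\<close>)
  then show "(%(a, t, c). L t c) (?j mr) =
    (%(m, r). K m * pairing_value ?lm (p m) (q m) (R m) r) mr" unfolding mr' prod.case .
 next
  fix msc assume "msc : {(a, t, c) : (free_maps H :: ('h, 'n) cmap set). card (bdry_cycles H (a, t, c)) = b}"
  then obtain a s c where msc: "msc = (a, s, c)" and cm: "(a, s, c) : cmaps H" and sn: "!!x. x : H ==> s x ~= x"
   and cb: "card (bdry_cycles H (a, s, c)) = b" by (auto simp: free_maps_def)
  note D = cmapsD[OF cm]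
  let ?t = "%x. if x : H \<and> (c x = None \<or> c (s x) = None) then s x else x"
  let ?r = "%x. if x : H \<and> c x ~= None \<and> c (s x) ~= None then s x else x"
  let ?m = "(a, ?t, c)"
  have sH: "s x : H" if "x : H" for x using permutes_in_image[OF D(2)] that by simp
  have tt: "?t (?t x) = x" if "x : H" for x using that sH[OF that] D(5)[OF that] by auto
  have tp: "?t permutes H" by (rule involution_permutes) (use sH tt in auto)
  have tc: "?m : cmaps H"
  proof -
   have "c (a (a (?t x))) = c x" if "x : H" "?t x ~= x" for x using D(7)[OF that(1) sn[OF that(1)]] that(2) by (auto split: if_splits)
   moreover have "c (?t x) ~= None" if "x : H" "c x = None" for x using D(8)[OF that] that by simp
   ultimately show ?thesis using D(1,3,4,6) tp tt unfolding cmaps_def by blast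
  qed
  have bd: "bdry_cycles H ?m = bdry_cycles H (a, s, c)" by (rule bdry_cycles_cong[OF cm]) simp
  have Rm: "R ?m = {x : H. c x ~= None \<and> c (s x) ~= None}" using sn by (auto simp: R_def)
  have rR: "?r x : R ?m" "?r (?r x) = x" "?r x ~= x" if "x : R ?m" for x
   using that sH[of x] D(5)[of x] sn[of x] by (auto simp: Rm)
  have "?r permutes R ?m" by (rule involution_permutes) (use rR in \<open>auto simp: Rm\<close>)
  then have rpair: "?r : pairings (R ?m)" using rR unfolding pairings_def by blast
  have "q ?m x = p ?m (?r x)" if "x : R ?m" for x
  proof -
   have x: "x : H" using that by (simp add: Rm)
   have "c (a (a x)) = c (s x)" using D(7)[OF sH[OF x] sn[OF sH[OF x]]] D(5)[OF x] by simp
   then show ?thesis using that by (simp add: p_def q_def Rm)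
  qed
  moreover have "proper H ?m" by (auto simp: proper_def)
  ultimately show "(?i msc) : (SIGMA m:I. {r : pairings (R m). \<forall>x\<in>R m. q m x = p m (r x)})"
   unfolding msc prod.case I_def using tc bd cb rpair by auto
  have "(%x. if ?t x = x then ?r x else ?t x) = s" using sn permutes_not_in[OF D(2)] by (auto simp: fun_eq_iff)
  then show "?j (?i msc) = msc" unfolding msc prod.case by simp
 qed
 also have "... = fps_nth (all_sum 1 (%_ _. 0) ?lm H) b"
 proof -
  have "fps_nth (all_sum 1 (%_ _. 0) ?lm H) b =
    (\<Sum>(a, t, c)\<in>(free_maps H :: ('h, 'n) cmap set). if card (bdry_cycles H (a, t, c)) = b then L t c else 0)"
   by (simp add: all_sum_1[OF H] fps_sum_nth case_prod_beta' nth_Q_monom L_def cong: if_cong)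
  also have "... = (\<Sum>(a, t, c)\<in>{(a, t, c) : free_maps H. card (bdry_cycles H (a, t, c)) = b}. L t c)"
   using finite_free_maps[OF H] by (intro sum.mono_neutral_cong_right) (auto split: if_splits)
  finally show ?thesis ..
 qed
 finally show ?thesis .
qed

section \<open>The free energy of the Kontsevich--Penner model\<close>

lemma matrix_inv_eqI:
 fixes A B :: "'a::semiring_1^'n^'n"
 assumes "A ** B = mat 1" "B ** A = mat 1"
 shows "matrix_inv A = B"
proof -
 have "A ** matrix_inv A = mat 1 \<and> matrix_inv A ** A = mat 1"
  unfolding matrix_inv_def by (rule someI[of _ B]) (use assms in simp)
 then show ?thesis using assms by (metis matrix_mul_assoc matrix_mul_lid matrix_mul_rid)
qed

lemma inverse_diag_entry:
 fixes lam :: "real^'n"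
 assumes "!!i. lam $ i > 0"
 shows "(matrix_inv (diag_matrix lam) ** X) $ i $ j = X $ i $ j / of_real (lam $ i)"
proof -
 let ?D = "%l. diag_matrix l :: complex^'n^'n"
 have mult: "(?D l ** Y) $ i $ j = of_real (l $ i) * Y $ i $ j" for l Y i j
 proof -
  have "(?D l ** Y) $ i $ j = (\<Sum>k\<in>UNIV. if k = i then of_real (l $ i) * Y $ i $ j else 0)"
   unfolding matrix_matrix_mult_def diag_matrix_def by (simp add: if_distrib[of "%z. z * _"] eq_commute[of i] cong: if_cong)
  then show ?thesis by simp
 qed
 have ne: "lam $ i ~= 0" for i using assms[of i] by simp
 have "matrix_inv (?D lam) = ?D (\<chi> i. 1 / lam $ i)"
  by (rule matrix_inv_eqI; simp only: vec_eq_iff mult; simp add: diag_matrix_def mat_def ne)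
 then show ?thesis by (simp add: mult)
qed

text \<open>Positions are numbered against the direction of the walk, from \<open>d k = i\<close>
  down to \<open>d 0\<close> and then \<open>j\<close>. For closed walks the neighbour of a position
  is then given by \<open>pv\<close>, as in the wheel.\<close>

lemma mat_power_walks:
 "mat_power A (Suc k) $ i $ j =
  (\<Sum>d\<in>{..<Suc k} \<rightarrow>\<^sub>E UNIV. if d k = i then \<Prod>r<Suc k. A $ d r $ (if r = 0 then j else d (r - 1)) else 0)"
proof (induction k arbitrary: i)
 case 0
 have e: "{..<Suc 0} = insert 0 {}" by auto
 have "mat_power A (Suc 0) $ i $ j = A $ i $ j" by (simp add: mat_power_def)
 moreover have "(\<Sum>d\<in>{..<Suc 0} \<rightarrow>\<^sub>E UNIV. if d 0 = i then \<Prod>r<Suc 0. A $ d r $ (if r = 0 then j else d (r - 1)) else 0) =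
   (\<Sum>b\<in>UNIV. if b = i then A $ b $ j else 0)" unfolding e by (subst sum_PiE_insert) (simp_all cong: if_cong)
 ultimately show ?case by simp
next
 case (Suc k)
 have "(\<Sum>d\<in>{..<Suc (Suc k)} \<rightarrow>\<^sub>E UNIV. if d (Suc k) = i then \<Prod>r<Suc (Suc k). A $ d r $ (if r = 0 then j else d (r - 1)) else 0) =
   (\<Sum>b\<in>UNIV. \<Sum>d\<in>{..<Suc k} \<rightarrow>\<^sub>E UNIV. if b = i then A $ i $ d k * (\<Prod>r<Suc k. A $ d r $ (if r = 0 then j else d (r - 1))) else 0)"
 proof -
  have e: "{..<Suc (Suc k)} = insert (Suc k) {..<Suc k}" by auto
  have pe: "(\<Prod>r<Suc (Suc k). A $ ((d(Suc k := b)) r) $ (if r = 0 then j else (d(Suc k := b)) (r - 1))) =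
    A $ b $ d k * (\<Prod>r<Suc k. A $ d r $ (if r = 0 then j else d (r - 1)))" for b d
   unfolding prod.lessThan_Suc[of _ "Suc k"] by (subst mult.commute, intro arg_cong2[of _ _ _ _ "(*)"] prod.cong) auto
  then show ?thesis
   by (subst (1) e, subst sum_PiE_insert, simp) (intro sum.cong refl, simp only: pe fun_upd_same cong: if_cong)
 qed
 also have "... = (\<Sum>b\<in>UNIV. if b = i then \<Sum>d\<in>{..<Suc k} \<rightarrow>\<^sub>E UNIV. A $ i $ d k * (\<Prod>r<Suc k. A $ d r $ (if r = 0 then j else d (r - 1))) else 0)"
  by (intro sum.cong refl) auto
 also have "... = (\<Sum>d\<in>{..<Suc k} \<rightarrow>\<^sub>E UNIV. A $ i $ d k * (\<Prod>r<Suc k. A $ d r $ (if r = 0 then j else d (r - 1))))"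
  by simp
 also have "... = (\<Sum>d\<in>{..<Suc k} \<rightarrow>\<^sub>E UNIV. \<Sum>l\<in>UNIV. if d k = l then A $ i $ l * (\<Prod>r<Suc k. A $ d r $ (if r = 0 then j else d (r - 1))) else 0)"
  by simp
 also have "... = (\<Sum>l\<in>UNIV. A $ i $ l * mat_power A (Suc k) $ l $ j)"
  unfolding Suc.IH sum_distrib_left by (subst sum.swap) (intro sum.cong refl, auto)
 also have "... = mat_power A (Suc (Suc k)) $ i $ j" by (simp add: mat_power_def matrix_matrix_mult_def)
 finally show ?case ..
qed

lemma trace_mat_power:
 assumes "k > 0"
 shows "trace (mat_power A k) = (\<Sum>d\<in>{..<k} \<rightarrow>\<^sub>E UNIV. \<Prod>r<k. A $ d r $ d (pv k r))"
proof -
 obtain n where k: "k = Suc n" using assms by (cases k) auto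
 have "trace (mat_power A k) = (\<Sum>i\<in>UNIV. \<Sum>d\<in>{..<k} \<rightarrow>\<^sub>E UNIV. if d n = i then \<Prod>r<k. A $ d r $ d (pv k r) else 0)"
  unfolding trace_def k mat_power_walks pv_def by (intro sum.cong refl if_cong prod.cong) auto
 also have "... = (\<Sum>d\<in>{..<k} \<rightarrow>\<^sub>E UNIV. \<Sum>i\<in>UNIV. if d n = i then \<Prod>r<k. A $ d r $ d (pv k r) else 0)" by (rule sum.swap)
 finally show ?thesis by simp
qed

lemma prod_pv:
 fixes f :: "nat => 'a::comm_monoid_mult"
 shows "(\<Prod>i<k. f (pv k i)) = (\<Prod>i<k. f i)"
 by (rule prod.reindex_bij_witness[where i = "nx k" and j = "pv k"]) (auto simp: nx_pv)

text \<open>Every half-edge contributes a factor \<open>kp_scale\<close>. Its cube is \<open>- \<surd>2\<close>: a trivalent vertex has weight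
  \<open>- 1\<close>, and the entries of \<open>X / \<surd>2\<close> have covariance \<open>1 / (\<lambda>\<^sub>i + \<lambda>\<^sub>j)\<close>.\<close>

definition kp_scale :: complex where "kp_scale = of_real (- (2 powr (1/6)))"

lemma kp_scale_cube: "kp_scale ^ 3 = - of_real (sqrt 2)"
proof -
 have "(2 powr (1/6)) ^ 3 = sqrt (2::real)" by (simp add: powr_half_sqrt[symmetric] powr_powr flip: powr_numeral)
 then have "kp_scale ^ 3 = of_real (- sqrt 2)"
  unfolding kp_scale_def of_real_power[symmetric] by (simp add: power3_eq_cube)
 then show ?thesis by simp
qed

context includes fps_syntax
begin

lemma nth_compose_X_power:
 fixes A :: "'a::comm_ring_1 fps"
 assumes "k > 0"
 shows "fps_nth (A oo fps_X ^ k) n = (if k dvd n then fps_nth A (n div k) else 0)"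
proof -
 have "fps_nth (A oo fps_X ^ k) n = (\<Sum>i=0..n. if n = k * i then fps_nth A i else 0)"
  unfolding fps_compose_nth by (intro sum.cong refl) (auto simp: fps_X_power_nth simp flip: power_mult)
 also have "... = (if k dvd n then fps_nth A (n div k) else 0)"
 proof (cases "k dvd n")
  case True
  then obtain q where q: "n = k * q" by blast
  have "(\<Sum>i=0..n. if n = k * i then fps_nth A i else 0) = (\<Sum>i=0..n. if i = q then fps_nth A i else 0)"
   using assms q by (intro sum.cong refl) auto
  then show ?thesis using assms q True by (simp add: sum.delta)
 next
  case False
  then have "n ~= k * i" for i by auto
  then show ?thesis using False by simp
 qed
 finally show ?thesis .
qed

text \<open>For a vertex, the cubed scale \<open>- sqrt 2\<close>, three factors
  \<open>1 / sqrt 2\<close> and the count \<open>2\<close> give \<open>- 1 / 3!\<close>. A wheel has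
  \<open>3 * k\<close> half-edges, and \<open>(- sqrt 2) ^ k\<close> against \<open>k\<close>
  factors \<open>1 / sqrt 2\<close> leaves \<open>(- 1) ^ k\<close>, the sign of the
  \<open>k\<close>-th power in the potential. For three half-edges both kinds occur.\<close>

lemma kp_exponent_egf:
 fixes lam :: "real^'n"
 assumes lam: "!!i. lam $ i > 0"
 shows "kp_exponent lam X = egf kp_scale (%m. conn_sum 0 (%i j. X $ i $ j / of_real (sqrt 2)) (%i. lam $ i) {..<m})"
proof (rule fps_ext)
 fix m
 let ?X = "%i j. X $ i $ j / complex_of_real (sqrt 2)" and ?lm = "%i. lam $ i"
 let ?A = "- (matrix_inv (diag_matrix lam) ** X)"
 have s2: "complex_of_real (sqrt 2) * complex_of_real (sqrt 2) = 2" by (simp flip: of_real_mult)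
 have s0: "complex_of_real (sqrt 2) ~= 0" by simp
 let ?T = "\<Sum>m'\<in>(tri_maps {..<m} :: (nat, 'n) cmap set). cweight 0 ?X ?lm {..<m} m'"
 let ?W = "\<Sum>m'\<in>(wheel_maps {..<m} :: (nat, 'n) cmap set). cweight 0 ?X ?lm {..<m} m'"
 have tri: "fps_const (kp_scale ^ m / fact m) * ?T = (if m = 3 then Q_monom (- trace (mat_power X 3) / fact 3) 0 else 0)"
 proof (cases "m = 3")
  case True
  have tr: "trace (mat_power X 3) = (\<Sum>i\<in>UNIV. \<Sum>j\<in>UNIV. \<Sum>k\<in>UNIV. X $ i $ j * X $ j $ k * X $ k $ i)"
  proof -
   have "mat_power X 3 = X ** (X ** X)" by (simp add: mat_power_def numeral_3_eq_3)
   then show ?thesis by (simp add: trace_def matrix_matrix_mult_def sum_distrib_left mult.assoc)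
  qed
  have "?T = Q_monom (2 * (\<Sum>i\<in>UNIV. \<Sum>j\<in>UNIV. \<Sum>k\<in>UNIV. ?X i j * ?X j k * ?X k i)) 0"
   using sum_tri_maps(2)[of "{..<m}" ?X ?lm] True by simp
  also have "(\<Sum>i\<in>UNIV. \<Sum>j\<in>UNIV. \<Sum>k\<in>UNIV. ?X i j * ?X j k * ?X k i) = trace (mat_power X 3) / (2 * of_real (sqrt 2))"
   unfolding tr sum_divide_distrib by (intro sum.cong refl) (simp add: s2[symmetric])
  finally have "fps_const (kp_scale ^ m / fact m) * ?T = Q_monom (kp_scale ^ m / fact m * (2 * (trace (mat_power X 3) / (2 * of_real (sqrt 2))))) 0"
   by (simp add: Q_monom_def)
  also have "kp_scale ^ m / fact m * (2 * (trace (mat_power X 3) / (2 * of_real (sqrt 2)))) = - trace (mat_power X 3) / fact 3"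
   using s0 by (simp add: True kp_scale_cube)
  finally show ?thesis using True by simp
 next
  case False
  then have "(tri_maps {..<m} :: (nat, 'n) cmap set) = {}" by (intro sum_tri_maps(1)) auto
  then show ?thesis using False by simp
 qed
 have wheel: "fps_const (kp_scale ^ m / fact m) * ?W = (if 3 dvd m \<and> m ~= 0 then Q_monom (trace (mat_power ?A (m div 3)) / of_nat (m div 3)) 1 else 0)"
 proof (cases "3 dvd m \<and> m ~= 0")
  case True
  then obtain k where k: "m = 3 * k" "k > 0" by auto
  define S where "S = (\<Sum>d\<in>{..<k} \<rightarrow>\<^sub>E (UNIV :: 'n set). \<Prod>i<k. ?X (d i) (d (pv k i)) / of_real (?lm (d (pv k i))))"
  have "of_nat k * ?W = of_nat (fact m) * Q_monom S 1"
   unfolding S_def using sum_wheel_maps(2)[of "{..<m}" k ?X ?lm] k by simp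
  then have "fps_const (of_nat k) * ?W = fps_const (of_nat (fact m)) * Q_monom S 1" by (simp only: fps_of_nat)
  then have "fps_const (1 / of_nat k) * (fps_const (of_nat k) * ?W) = fps_const (1 / of_nat k) * (fps_const (fact m) * Q_monom S 1)"
   by simp
  then have W: "?W = fps_const (fact m / of_nat k) * Q_monom S 1"
   using k by (simp flip: mult.assoc add: fps_const_mult)
  have tr: "trace (mat_power ?A k) = (- of_real (sqrt 2)) ^ k * S"
  proof -
   have "(\<Prod>i<k. ?A $ d i $ d (pv k i)) = (- of_real (sqrt 2)) ^ k * (\<Prod>i<k. ?X (d i) (d (pv k i)) / of_real (?lm (d (pv k i))))" for d
   proof -
    have "(\<Prod>i<k. ?A $ d i $ d (pv k i)) = (\<Prod>i<k. (- of_real (sqrt 2)) * ?X (d i) (d (pv k i)) * (1 / of_real (?lm (d i))))"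
     using s0 by (intro prod.cong refl) (simp add: inverse_diag_entry[OF lam])
    also have "... = (- of_real (sqrt 2)) ^ k * (\<Prod>i<k. ?X (d i) (d (pv k i))) * (\<Prod>i<k. 1 / of_real (?lm (d i)))"
     by (simp only: prod.distrib prod_constant card_lessThan)
    also have "(\<Prod>i<k. 1 / complex_of_real (?lm (d i))) = (\<Prod>i<k. 1 / of_real (?lm (d (pv k i))))"
     by (rule prod_pv[symmetric])
    finally show ?thesis by (simp only: mult.assoc prod.distrib[symmetric] times_divide_eq_right mult_1_right)
   qed
   then show ?thesis unfolding trace_mat_power[OF k(2)] S_def sum_distrib_left by simp
  qed
  have "fps_const (kp_scale ^ m / fact m) * ?W = Q_monom (kp_scale ^ m / of_nat k * S) 1"
   unfolding W by (simp add: Q_monom_def fps_const_mult flip: mult.assoc)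
  also have "kp_scale ^ m = (- of_real (sqrt 2)) ^ k" unfolding k power_mult kp_scale_cube ..
  finally show ?thesis using True k tr by (simp add: power_mult kp_scale_cube)
 next
  case False
  then have "(wheel_maps {..<m} :: (nat, 'n) cmap set) = {}" by (intro sum_wheel_maps(1)) auto
  then show ?thesis using False by auto
 qed
 have "egf kp_scale (%m. conn_sum 0 ?X ?lm {..<m}) $ m = fps_const (kp_scale ^ m / fact m) * ?T + fps_const (kp_scale ^ m / fact m) * ?W"
  by (simp add: egf_def conn_sum_0 distrib_left)
 also have "... = kp_exponent lam X $ m" unfolding tri wheel kp_exponent_def fps_add_nth fps_mult_left_const_nth
  by (auto simp: nth_compose_X_power fps_X_power_nth)
 finally show "kp_exponent lam X $ m = egf kp_scale (%m. conn_sum 0 ?X ?lm {..<m}) $ m" ..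
qed

lemma gauss_expectation_scale:
 "gauss_expectation lam (%X. c * f X) = c * gauss_expectation lam f" by (simp add: gauss_expectation_def mult.assoc)

text \<open>Under the expectation, the exponential formula at \<open>y = 0\<close> produces all maps
  with legs; taking the expectation glues the legs and changes \<open>y\<close> to
  \<open>1\<close>.\<close>

theorem tau_egf:
 fixes lam :: "real^'n"
 assumes lam: "!!i. lam $ i > 0"
 shows "tau lam = egf kp_scale (%m. all_sum 1 (%_ _. 0) (%i. lam $ i) {..<m})"
proof (rule fps_ext, rule fps_ext)
 fix m b
 have "tau lam $ m $ b = gauss_expectation lam (%X. kp_scale ^ m / fact m *
   fps_nth (all_sum 0 (%i j. X $ i $ j / of_real (sqrt 2)) (%i. lam $ i) {..<m}) b)"
  unfolding tau_def kp_exponent_egf[OF lam] egf_exp_ln(1) by (simp add: egf_def)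
 also have "... = egf kp_scale (%m. all_sum 1 (%_ _. 0) (%i. lam $ i) {..<m}) $ m $ b"
  unfolding gauss_expectation_scale by (simp add: expectation_all_sum[OF lam] egf_def)
 finally show "tau lam $ m $ b = egf kp_scale (%m. all_sum 1 (%_ _. 0) (%i. lam $ i) {..<m}) $ m $ b" .
qed

text \<open>The exponential formula a second time, now read backwards and for closed maps.\<close>

corollary free_energy_egf:
 fixes lam :: "real^'n"
 assumes lam: "!!i. lam $ i > 0"
 shows "free_energy lam = egf kp_scale (%m. conn_sum 1 (%_ _. 0) (%i. lam $ i) {..<m})"
 by (simp add: free_energy_def tau_egf[OF lam] egf_exp_ln)

end

section \<open>The genus\<close>

lemma orbit_subset_closed:
 assumes "x : A" "!!z. z : A ==> f z : A" shows "orbit f x \<subseteq> A"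
proof
 fix y assume "y : orbit f x"
 then show "y : A" by induction (use assms in auto)
qed

text \<open>The arc of the cycle that runs from \<open>p y\<close> to \<open>x\<close> is closed
  under the new permutation, which sends \<open>x\<close> back to \<open>p y\<close>, and this arc
  omits \<open>y\<close>.\<close>

lemma transpose_separates:
 assumes p: "p permutes H" and H: "finite H" and xy: "x ~= y" "y : orbit p x"
 shows "y ~: orbit (p \<circ> Transposition.transpose x y) x"
proof -
 let ?q = "p \<circ> Transposition.transpose x y"
 have perm: "permutation p" using p H permutation_permutes by blast
 have "x : orbit p y" using orbit_swap[OF permutation_self_in_orbit[OF perm] xy(2)] .
 then have ex: "\<exists>k. 0 < k \<and> (p ^^ k) y = x" by (auto simp: orbit_altdef)
 define k where "k = (LEAST k. 0 < k \<and> (p ^^ k) y = x)"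
 have k: "0 < k" "(p ^^ k) y = x" using LeastI_ex[OF ex] by (auto simp: k_def)
 have least: "(p ^^ j) y ~= x" if "0 < j" "j < k" for j
  using not_less_Least[of j "%k. 0 < k \<and> (p ^^ k) y = x"] that by (auto simp: k_def)
 define A where "A = (%j. (p ^^ j) y) ` {1..k}"
 have "y ~: A"
 proof
  assume "y : A"
  then obtain j where j: "1 \<le> j" "j \<le> k" "(p ^^ j) y = y" by (auto simp: A_def)
  have "p ^^ k = (p ^^ (k - j)) \<circ> (p ^^ j)" unfolding funpow_add[symmetric] using j by simp
  then have "(p ^^ (k - j)) ((p ^^ j) y) = x" using k by simp
  then have "(p ^^ (k - j)) y = x" using j by simp
  moreover have "k - j ~= 0" using j k xy(1) by (cases "j = k") auto
  ultimately show False using least[of "k - j"] j by simp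
 qed
 moreover have "orbit ?q x \<subseteq> A"
 proof (rule orbit_subset_closed)
  show "x : A" unfolding A_def using k by (intro image_eqI[of _ _ k]) auto
  fix z assume "z : A"
  then obtain j where j: "1 \<le> j" "j \<le> k" and z: "z = (p ^^ j) y" by (auto simp: A_def)
  have zy: "z ~= y" using \<open>y ~: A\<close> \<open>z : A\<close> by auto
  show "?q z : A"
  proof (cases "z = x")
   case True
   then have "?q z = (p ^^ 1) y" by simp
   then show ?thesis unfolding A_def using k by (intro image_eqI[of _ _ 1]) auto
  next
   case False
   then have "j ~= k" using k z by auto
   then have "j < k" using j by simp
   moreover have "?q z = (p ^^ Suc j) y" using False zy by (simp add: z transpose_apply_other)
   ultimately show ?thesis unfolding A_def by (intro image_eqI[of _ _ "Suc j"]) auto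
  qed
 qed
 ultimately show ?thesis by blast
qed

text \<open>The new permutation leaves \<open>x\<close> along the orbit of \<open>y\<close> and
  leaves \<open>y\<close> along that of \<open>x\<close>, so the two orbits are traversed in
  succession; the other orbits are untouched.\<close>

lemma transpose_merges:
 assumes p: "p permutes H" and H: "finite H" and x: "x : H" and y: "y : H" "y ~: orbit p x"
 shows "card (cycles_on H p) = Suc (card (cycles_on H (p \<circ> Transposition.transpose x y)))"
proof -
 define q where "q = p \<circ> Transposition.transpose x y"
 let ?A = "orbit p x \<union> orbit p y"
 have perm: "permutation p" using p H permutation_permutes by blast
 note self = permutation_self_in_orbit[OF perm]
 have cyc: "orbit p z = orbit p w" if "z : orbit p w" for z w
  using orbit_cyclic_eq3[OF cyclic_on_orbit[OF p H] that] .
 have xy: "x ~: orbit p y" using cyc[of x y] self[of y] y(2) by auto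
 have ne: "x ~= y" using self[of x] y(2) by auto
 have pA: "p z : ?A \<longleftrightarrow> z : ?A" for z using permutation_orbit_step[OF perm] cyc self by (metis Un_iff)
 have qx: "q x = p y" and qy: "q y = p x" and qz: "z ~= x ==> z ~= y ==> q z = p z" for z
  by (auto simp: q_def transpose_apply_other)
 have qA: "q z : ?A \<longleftrightarrow> z : ?A" for z
  using pA[of x] pA[of y] pA[of z] self[of x] self[of y] qx qy qz[of z] by (cases "z = x"; cases "z = y") auto
 have qp: "q permutes H" unfolding q_def by (rule permutes_compose[OF permutes_swap_id[OF x y(1)] p])
 have permq: "permutation q" using qp H permutation_permutes by blast
 note selfq = permutation_self_in_orbit[OF permq]
 have oA: "orbit q x = ?A"
 proof
  show "orbit q x \<subseteq> ?A" by (rule orbit_subset_closed) (use qA self in auto)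
  have 1: "orbit p y \<subseteq> orbit q x"
  proof
   fix z assume "z : orbit p y"
   then show "z : orbit q x"
   proof induction
    case base show ?case using orbit.base[of q x] qx by simp
   next
    case (step z)
    show ?case
    proof (cases "z = y")
     case True then show ?thesis using orbit.base[of q x] qx by simp
    next
     case False
     have "z ~= x" using step.hyps xy by auto
     then show ?thesis using orbit.step[OF step.IH] qz[OF _ False] by simp
    qed
   qed
  qed
  then have yq: "y : orbit q x" using self[of y] by auto
  have 2: "orbit p x \<subseteq> orbit q x"
  proof
   fix z assume "z : orbit p x"
   then show "z : orbit q x"
   proof induction
    case base show ?case using orbit.step[OF yq] qy by simp
   next
    case (step z)
    show ?case
    proof (cases "z = x")
     case True then show ?thesis using orbit.step[OF yq] qy by simp
    next
     case False
     have "z ~= y" using step.hyps y(2) by auto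
     then show ?thesis using orbit.step[OF step.IH] qz[OF False] by simp
    qed
   qed
  qed
  show "?A \<subseteq> orbit q x" using 1 2 by blast
 qed
 have oo: "orbit q z = orbit p z" if "z ~: ?A" for z
 proof (rule orbit_cong0[of z "- ?A", symmetric])
  show "z : - ?A" using that by simp
  show "p : - ?A \<rightarrow> - ?A" using pA by blast
  fix w assume "w : - ?A"
  then show "p w = q w" using self[of x] self[of y] by (intro qz[symmetric]) auto
 qed
 have oA': "orbit q z = ?A" if "z : ?A" for z
  using orbit_cyclic_eq3[OF cyclic_on_orbit[OF qp H], of z x] that oA by simp
 let ?R = "(%z. orbit p z) ` (H - ?A)"
 have AH: "?A \<subseteq> H" using permutes_orbit_subset[OF p] x y(1) by blast
 then have H_split: "(H - ?A) \<union> ?A = H" by auto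
 have fin: "finite ?R" using H by simp
 have "cycles_on H p = ?R \<union> (%z. orbit p z) ` ?A" unfolding cycles_on_def image_Un[symmetric] H_split ..
 also have "(%z. orbit p z) ` ?A = {orbit p x, orbit p y}"
 proof (intro equalityI subsetI)
  fix B assume "B : (%z. orbit p z) ` ?A"
  then obtain z where "z : ?A" "B = orbit p z" by blast
  then show "B : {orbit p x, orbit p y}" using cyc[of z x] cyc[of z y] by blast
 qed (use self[of x] self[of y] in blast)
 finally have c1: "cycles_on H p = insert (orbit p x) (insert (orbit p y) ?R)" by auto
 have "cycles_on H q = (%z. orbit q z) ` (H - ?A) \<union> (%z. orbit q z) ` ?A"
  unfolding cycles_on_def image_Un[symmetric] H_split ..
 also have "(%z. orbit q z) ` (H - ?A) = ?R" by (intro image_cong refl oo) auto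
 also have "(%z. orbit q z) ` ?A = {?A}"
 proof -
  have "(%z. orbit q z) ` ?A = (%z. ?A) ` ?A" by (intro image_cong refl oA')
  then show ?thesis using self[of x] by auto
 qed
 finally have c2: "cycles_on H q = ?R \<union> {?A}" .
 have notin: "B ~: ?R" if "B \<subseteq> ?A" "B ~= {}" for B using that self by blast
 have "orbit p x ~= orbit p y" using self[of y] y(2) by auto
 moreover have "orbit p x ~: ?R" "orbit p y ~: ?R" "?A ~: ?R"
  using notin[of "orbit p x"] notin[of "orbit p y"] notin[of ?A] orbit_nonempty[of p x] orbit_nonempty[of p y] by auto
 ultimately show ?thesis unfolding q_def[symmetric] c1 c2 Un_insert_right Un_empty_right using fin by simp
qed

lemma transpose_cycles:
 assumes p: "p permutes H" and H: "finite H" and xy: "x : H" "y : H" "x ~= y"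
 defines "q \<equiv> p \<circ> Transposition.transpose x y"
 shows "y ~: orbit p x ==> card (cycles_on H p) = Suc (card (cycles_on H q))"
  and "y : orbit p x ==> card (cycles_on H q) = Suc (card (cycles_on H p))"
proof -
 show "y ~: orbit p x ==> card (cycles_on H p) = Suc (card (cycles_on H q))"
  unfolding q_def by (rule transpose_merges[OF p H xy(1,2)])
 assume "y : orbit p x"
 then have "y ~: orbit q x" unfolding q_def by (rule transpose_separates[OF p H xy(3)])
 moreover have "q permutes H" unfolding q_def by (rule permutes_compose[OF permutes_swap_id[OF xy(1,2)] p])
 ultimately have "card (cycles_on H q) = Suc (card (cycles_on H (q \<circ> Transposition.transpose x y)))"
  using H xy by (intro transpose_merges)
 moreover have "q \<circ> Transposition.transpose x y = p" by (simp add: q_def comp_assoc)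
 ultimately show "card (cycles_on H q) = Suc (card (cycles_on H p))" by simp
qed

text \<open>Edges are switched on one by one. Each composes the permutation with a transposition and
  changes the number of cycles by one, which settles the parity. An edge inside a block of
  \<open>P\<close> may raise the number of cycles but also raises the number of edges; an edge
  between two blocks merges two cycles as well as the blocks. Both moves preserve the inequality,
  which starts as an equality.\<close>

lemma euler_bound:
 assumes H: "finite H" and a: "a permutes H" and s: "!!x. x : H ==> s x : H \<and> s x ~= x \<and> s (s x) = x"
  and D: "D \<subseteq> edge_sets H s"
 defines "q \<equiv> %D. a \<circ> (%x. if x : \<Union>D then s x else x)"
 shows "q D permutes H \<and> (\<exists>P. \<Union>P = H \<and> {} ~: P \<and> (\<forall>A\<in>P. \<forall>B\<in>P. A ~= B --> A \<inter> B = {}) \<and>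
   (\<forall>B\<in>P. a ` B \<subseteq> B) \<and> (\<forall>e\<in>D. \<exists>B\<in>P. e \<subseteq> B) \<and>
   card (cycles_on H (q D)) + card (cycles_on H a) \<le> 2 * card P + card D) \<and>
  even (card (cycles_on H (q D)) + card (cycles_on H a) + card D)"
proof -
 have finD: "finite D" using D finite_edge_sets[OF H] finite_subset by blast
 show ?thesis using finD D
 proof (induction D)
  case empty
  have q: "q {} = a" by (auto simp: q_def)
  have perm: "permutation a" using a H permutation_permutes by blast
  note self = permutation_self_in_orbit[OF perm]
  have cyc: "orbit a z = orbit a w" if "z : orbit a w" for z w
   using orbit_cyclic_eq3[OF cyclic_on_orbit[OF a H] that] .
  have "\<Union>(cycles_on H a) = H" using permutes_orbit_subset[OF a] self by (auto simp: cycles_on_def)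
  moreover have "{} ~: cycles_on H a" unfolding cycles_on_def by (metis imageE orbit_nonempty)
  moreover have "A \<inter> B = {}" if "A : cycles_on H a" "B : cycles_on H a" "A ~= B" for A B
   using that cyc by (auto simp: cycles_on_def) blast+
  moreover have "a ` B \<subseteq> B" if "B : cycles_on H a" for B using that by (auto simp: cycles_on_def intro: orbit.step)
  ultimately show ?case unfolding q using a by (intro conjI exI[of _ "cycles_on H a"]) auto
 next
  case (insert e D)
  have D: "D \<subseteq> edge_sets H s" and e: "e : edge_sets H s" using insert.prems by auto
  obtain x where x: "x : H" and ex: "e = {x, s x}" using e by (auto simp: edge_sets_def)
  define y where "y = s x"
  have y: "y : H" "x ~= y" "s y = x" and exy: "e = {x, y}" using s[OF x] ex by (auto simp: y_def)
  note IH = insert.IH[OF D]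
  have qp: "q D permutes H" using IH by (rule conjunct1)
  have ev: "even (card (cycles_on H (q D)) + card (cycles_on H a) + card D)"
   using conjunct2[OF IH] by (rule conjunct2)
  obtain P where PP: "\<Union>P = H \<and> {} ~: P \<and> (\<forall>A\<in>P. \<forall>B\<in>P. A ~= B --> A \<inter> B = {}) \<and>
    (\<forall>B\<in>P. a ` B \<subseteq> B) \<and> (\<forall>e\<in>D. \<exists>B\<in>P. e \<subseteq> B) \<and>
    card (cycles_on H (q D)) + card (cycles_on H a) \<le> 2 * card P + card D"
   using conjunct1[OF conjunct2[OF IH]] by (rule exE)
  have P: "\<Union>P = H" "{} ~: P"
    "\<forall>A\<in>P. \<forall>B\<in>P. A ~= B --> A \<inter> B = {}" "\<forall>B\<in>P. a ` B \<subseteq> B" "\<forall>e\<in>D. \<exists>B\<in>P. e \<subseteq> B"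
    "card (cycles_on H (q D)) + card (cycles_on H a) \<le> 2 * card P + card D" using PP by - (elim conjE, assumption)+
  note P3 = P(3)[rule_format] and P4 = P(4)[rule_format] and P5 = P(5)[rule_format]
  have out: "x ~: \<Union>D" "y ~: \<Union>D"
  proof -
   have "d = e" if d: "d : D" and z: "z : d" "z = x \<or> z = y" for d z
   proof -
    obtain w where w: "w : H" "d = {w, s w}" using d D by (auto simp: edge_sets_def)
    have "z = w \<or> z = s w" using w z(1) by simp
    then have "d = {z, s z}" using w(2) s[OF w(1)] by (elim disjE) (simp_all add: insert_commute)
    moreover have "s x = y" by (simp add: y_def)
    ultimately show ?thesis using z(2) y(3) exy by (elim disjE) (simp_all add: insert_commute)
   qed
   then show "x ~: \<Union>D" "y ~: \<Union>D" using insert.hyps(2) by auto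
  qed
  have qe: "q (insert e D) = q D \<circ> Transposition.transpose x y"
  proof
   fix z show "q (insert e D) z = (q D \<circ> Transposition.transpose x y) z"
   proof -
    have sx: "s x = y" by (simp add: y_def)
    consider "z = x" | "z = y" | "z ~= x" "z ~= y" by blast
    then show ?thesis using sx out y(3) by cases (simp_all add: q_def exy transpose_apply_other)
   qed
  qed
  have qp': "q (insert e D) permutes H" unfolding qe by (rule permutes_compose[OF permutes_swap_id[OF x y(1)] qp])
  note tc = transpose_cycles[OF qp H x y(1,2), folded qe]
  have fP: "finite P" using P(1) H by (metis finite_UnionD)
  have sD: "s z : B" if BP: "B : P" "z : B" and zD: "z : \<Union>D" for B z
  proof -
   obtain d where d: "d : D" "z : d" using zD by auto
   obtain w where w: "w : H" "d = {w, s w}" using d D by (auto simp: edge_sets_def)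
   obtain B' where B': "B' : P" "d \<subseteq> B'" using P5[OF d(1)] by auto
   have "B' = B" using P3[OF B'(1) BP(1)] B'(2) d(2) BP(2) by auto
   moreover have "s z : d" using d(2) w s[OF w(1)] by auto
   ultimately show ?thesis using B' by auto
  qed
  have qB: "q D z : B" if "B : P" "z : B" for B z using P4[OF that(1)] sD[OF that] that by (auto simp: q_def)
  have ev': "even (card (cycles_on H (q (insert e D))) + card (cycles_on H a) + card (insert e D))"
   using tc ev insert.hyps by (cases "y : orbit (q D) x") auto
  obtain Bx where Bx: "Bx : P" "x : Bx" using x P(1) by auto
  obtain By where By: "By : P" "y : By" using y P(1) by auto
  show ?case
  proof (cases "Bx = By")
   case True
   have "card (cycles_on H (q (insert e D))) \<le> Suc (card (cycles_on H (q D)))"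
    using tc by (cases "y : orbit (q D) x") auto
   then have "card (cycles_on H (q (insert e D))) + card (cycles_on H a) \<le> 2 * card P + card (insert e D)"
    using P(6) insert.hyps by simp
   moreover have "\<forall>d\<in>insert e D. \<exists>B\<in>P. d \<subseteq> B" using P5 Bx By True exy by auto
   ultimately show ?thesis using qp' ev' P by (intro conjI exI[of _ P]) auto
  next
   case False
   have "orbit (q D) x \<subseteq> Bx" by (rule orbit_subset_closed) (use Bx qB in auto)
   moreover have "y ~: Bx" using P3[OF Bx(1) By(1) False] By(2) by auto
   ultimately have "y ~: orbit (q D) x" by auto
   then have c: "card (cycles_on H (q D)) = Suc (card (cycles_on H (q (insert e D))))" by (rule tc(1))
   let ?P = "insert (Bx \<union> By) (P - {Bx, By})"
   have cP: "card P = Suc (card ?P)"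
   proof -
    have "Bx \<union> By ~: P - {Bx, By}" using P3[of "Bx \<union> By" Bx] Bx by blast
    moreover have "card P = Suc (Suc (card (P - {Bx, By})))"
     using fP Bx(1) By(1) False by (metis card.remove Diff_insert finite_Diff insert_Diff insert_iff)
    ultimately show ?thesis using fP by simp
   qed
   have "\<Union>?P = H" using P(1) Bx By by auto
   moreover have "{} ~: ?P" using P(2) Bx by auto
   moreover have "A \<inter> B = {}" if "A : ?P" "B : ?P" "A ~= B" for A B
   proof -
    have M: "C \<inter> (Bx \<union> By) = {}" if "C : P - {Bx, By}" for C
     using that P3[OF _ Bx(1), of C] P3[OF _ By(1), of C] by blast
    show ?thesis
    proof (cases "A = Bx \<union> By")
     case True
     then show ?thesis using M[of B] \<open>B : ?P\<close> \<open>A ~= B\<close> by blast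
    next
     case False
     then have "A : P - {Bx, By}" using \<open>A : ?P\<close> by blast
     then show ?thesis using M[of A] P3[of A B] \<open>B : ?P\<close> \<open>A ~= B\<close> by blast
    qed
   qed
   moreover have "a ` B \<subseteq> B" if "B : ?P" for B using that P4 Bx(1) By(1) by auto
   moreover have "\<exists>B\<in>?P. d \<subseteq> B" if "d : insert e D" for d
   proof (cases "d = e")
    case True then show ?thesis using Bx By exy by auto
   next
    case False
    then have "d : D" using that by auto
    then obtain B where "B : P" "d \<subseteq> B" using P5 by blast
    then show ?thesis by (cases "B = Bx \<or> B = By") auto
   qed
   moreover have "card (cycles_on H (q (insert e D))) + card (cycles_on H a) \<le> 2 * card ?P + card (insert e D)"
    using P(6) c cP insert.hyps by simp
   ultimately show ?thesis using qp' ev' by (intro conjI exI[of _ ?P]) auto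
  qed
 qed
qed

text \<open>Connectivity leaves at most one block in the Euler bound, so the Euler characteristic is
  at most \<open>2\<close>; being even, it is \<open>2 - 2 * g\<close> for a natural number
  \<open>g\<close>.\<close>

theorem genus_exists:
 assumes H: "finite H" "H ~= {}" and a: "a permutes H"
  and s: "!!x. x : H ==> s x : H \<and> s x ~= x \<and> s (s x) = x" "!!x. x ~: H ==> s x = x"
  and conn: "!!K. K \<subseteq> H ==> K ~= {} ==> a ` K \<subseteq> K ==> s ` K \<subseteq> K ==> K = H"
 shows "\<exists>g. int (card (cycles_on H a)) - int (card (edge_sets H s)) + int (card (cycles_on H (a \<circ> s))) = 2 - 2 * int g"
proof -
 let ?E = "edge_sets H s"
 have UE: "\<Union>?E = H" using s(1) by (auto simp: edge_sets_def)
 have as: "a \<circ> (%x. if x : \<Union>?E then s x else x) = a \<circ> s" unfolding UE using s(2) by auto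
 note eb = euler_bound[OF H(1) a s(1) order_refl, unfolded as]
 obtain P where PP: "\<Union>P = H \<and> {} ~: P \<and> (\<forall>A\<in>P. \<forall>B\<in>P. A ~= B --> A \<inter> B = {}) \<and>
   (\<forall>B\<in>P. a ` B \<subseteq> B) \<and> (\<forall>e\<in>?E. \<exists>B\<in>P. e \<subseteq> B) \<and>
   card (cycles_on H (a \<circ> s)) + card (cycles_on H a) \<le> 2 * card P + card ?E"
  using conjunct1[OF conjunct2[OF eb]] by (rule exE)
 have P: "\<Union>P = H" "{} ~: P"
   "\<forall>A\<in>P. \<forall>B\<in>P. A ~= B --> A \<inter> B = {}" "\<forall>B\<in>P. a ` B \<subseteq> B" "\<forall>e\<in>?E. \<exists>B\<in>P. e \<subseteq> B"
   "card (cycles_on H (a \<circ> s)) + card (cycles_on H a) \<le> 2 * card P + card ?E" using PP by - (elim conjE, assumption)+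
 have ev: "even (card (cycles_on H (a \<circ> s)) + card (cycles_on H a) + card ?E)"
  using conjunct2[OF eb] by (rule conjunct2)
 have "B = H" if B: "B : P" for B
 proof (rule conn)
  show "B \<subseteq> H" "B ~= {}" "a ` B \<subseteq> B" using B P(1,2,4) by auto
  show "s ` B \<subseteq> B"
  proof (rule image_subsetI)
   fix x assume x: "x : B"
   then have xH: "x : H" using B P(1) by auto
   then have "{x, s x} : ?E" using s(1) by (auto simp: edge_sets_def)
   then obtain B' where B': "B' : P" "{x, s x} \<subseteq> B'" using P(5)[rule_format] by blast
   then have "B' = B" using P(3)[rule_format, OF B'(1) B] x by auto
   then show "s x : B" using B' by auto
  qed
 qed
 then have "P \<subseteq> {H}" by auto
 then have "card P \<le> 1" using card_mono[of "{H}" P] by simp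
 then have le: "card (cycles_on H (a \<circ> s)) + card (cycles_on H a) \<le> 2 + card ?E" using P(6) by simp
 obtain k where k: "card (cycles_on H (a \<circ> s)) + card (cycles_on H a) + card ?E = 2 * k" using ev by blast
 have "int (card (cycles_on H a)) - int (card ?E) + int (card (cycles_on H (a \<circ> s))) = 2 * (int k - int (card ?E))"
  using arg_cong[OF k, of int] by simp
 moreover have "2 * (int k - int (card ?E)) \<le> 2" using le calculation by linarith
 ultimately have "int (card (cycles_on H a)) - int (card ?E) + int (card (cycles_on H (a \<circ> s))) = 2 - 2 * int (nat (1 - (int k - int (card ?E))))"
  by simp
 then show ?thesis by blast
qed

section \<open>Marked graphs as labelled maps\<close>

text \<open>A marked graph is encoded as a coloured map whose colours are cycle labels,
  \<open>Inl\<close> for faces and \<open>Inr\<close> for boundaries. All colours are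
  \<open>Some\<close>, so the tools for coloured maps apply while their condition on boundaries is
  void; the last clause restates it for labels.\<close>

definition lmaps :: "nat => nat => 'h set => ('h, nat + nat) cmap set" where
 "lmaps n b H = {(a, s, l) : free_maps H. cconn H (a, s, l) \<and>
   (\<forall>x\<in>H. \<forall>y\<in>H. l x = l y --> y : orbit (%x. a (a (s x))) x) \<and>
   l ` H = Some ` ({1..n} <+> {1..b}) \<and>
   (\<forall>x\<in>H. \<forall>i j. l x = Some (Inr i) --> l (s x) ~= Some (Inr j))}"

definition lmap_of :: "'h marked_graph => ('h, nat + nat) cmap" where
 "lmap_of G = (sigma0 G, sigma1 G, \<lambda>x\<in>half_edges G.
   let c = orbit (sigma2 G) x in Some (if c : faces G then Inl (face_label G c) else Inr (bdry_label G c)))"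

lemma free_maps_cubic:
 assumes "finite H" "(a, s, c) : free_maps H" shows "cubic_map H a s"
 using assms unfolding free_maps_def by (auto simp: cmaps_def intro!: cubic_map.intro)

definition pick :: "'h set => 'h" where "pick C = (SOME x. x : C)"

lemma (in cubic_map) free_maps_colour:
 assumes m: "(a, s, c) : free_maps H" and x: "x : H" "z : cyc x" shows "c z = c x" using x(2)
proof induction
 have *: "c (fc y) = c y" if "y : H" for y using m that unfolding free_maps_def fc_alt by (auto simp: cmaps_def)
 case base show ?case using *[OF x(1)] .
 case (step z)
 then show ?case using *[of z] cyc_subset[OF x(1)] by auto
qed

lemma (in cubic_map) pick_cyc: "pick (cyc x) : cyc x" unfolding pick_def by (rule someI[of _ x]) simp

lemma (in cubic_map) fc_fun: "(%x. a (a (s x))) = fc" by (rule ext) (simp add: fc_alt)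

lemma (in cubic_map) lmaps_bijections:
 assumes m: "(a, s, l) : lmaps n b H"
 shows "bij_betw (%C. projl (the (l (pick C)))) (cyc ` {x : H. \<exists>i. l x = Some (Inl i)}) {1..n}"
  and "bij_betw (%C. projr (the (l (pick C)))) (cyc ` {x : H. \<exists>i. l x = Some (Inr i)}) {1..b}"
  and "x : H ==> (\<exists>i\<in>{1..n}. l x = Some (Inl i)) \<or> (\<exists>j\<in>{1..b}. l x = Some (Inr j))"
proof -
 note D = m[unfolded lmaps_def mem_Collect_eq prod.case]
 note fm = conjunct1[OF D]
  and inj = conjunct1[OF conjunct2[OF conjunct2[OF D]], rule_format]
  and img = conjunct1[OF conjunct2[OF conjunct2[OF conjunct2[OF D]]]]
 have lp: "l (pick (cyc x)) = l x" if "x : H" for x by (rule free_maps_colour[OF fm that pick_cyc])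
 have cycl: "cyc x = cyc y" if "x : H" "y : H" "l x = l y" for x y
  using inj[OF that] unfolding fc_fun by (simp add: cyc_eq)
 show cases: "(\<exists>i\<in>{1..n}. l x = Some (Inl i)) \<or> (\<exists>j\<in>{1..b}. l x = Some (Inr j))" if "x : H" for x
 proof -
  have "l x : Some ` ({1..n} <+> {1..b})" using img that by blast
  then show ?thesis by auto
 qed
 have gen: "bij_betw (%C. pr (the (l (pick C)))) (cyc ` {x : H. \<exists>i. l x = Some (inj i)}) A"
  if pr: "!!i. pr (inj i) = i" and A: "!!x i. x : H ==> l x = Some (inj i) ==> i : A"
   and A': "!!i. i : A ==> Some (inj i) : l ` H" for pr :: "nat + nat => nat" and inj A unfolding bij_betw_def
 proof
  let ?p = "%C. pr (the (l (pick C)))" and ?F = "cyc ` {x : H. \<exists>i. l x = Some (inj i)}"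
  have p: "?p (cyc x) = i" if "x : H" "l x = Some (inj i)" for x i using lp[OF that(1)] that(2) pr by simp
  show "inj_on ?p ?F"
  proof (rule inj_onI)
   fix C C' assume "C : ?F" "C' : ?F" and e: "?p C = ?p C'"
   then obtain x x' i i' where x: "x : H" "l x = Some (inj i)" "C = cyc x" and x': "x' : H" "l x' = Some (inj i')" "C' = cyc x'"
    by auto
   have "i = i'" using e x x' p by simp
   then show "C = C'" using cycl[OF x(1) x'(1)] x x' by simp
  qed
  show "?p ` ?F = A"
  proof (intro equalityI subsetI)
   fix i assume "i : ?p ` ?F"
   then obtain x j where "x : H" "l x = Some (inj j)" "i = ?p (cyc x)" by auto
   then show "i : A" using A[of x j] p[of x j] by simp
  next
   fix i assume "i : A"
   then obtain x where "x : H" "l x = Some (inj i)" using A'[of i] by auto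
   then show "i : ?p ` ?F" using p[of x i] by (intro image_eqI[of _ _ "cyc x"]) auto
  qed
 qed
 show "bij_betw (%C. projl (the (l (pick C)))) (cyc ` {x : H. \<exists>i. l x = Some (Inl i)}) {1..n}"
  by (rule gen) (use cases img in \<open>fastforce+\<close>)
 show "bij_betw (%C. projr (the (l (pick C)))) (cyc ` {x : H. \<exists>i. l x = Some (Inr i)}) {1..b}"
  by (rule gen) (use cases img in \<open>fastforce+\<close>)
qed

context trivalent_ribbon
begin

lemma bdry_iff: assumes "x : H" shows "x : bdry_half_edges G \<longleftrightarrow> cyc x ~: faces G"
proof -
 have "cyc x : faces G \<union> boundaries G" using faces_boundaries(1) assms by blast
 then show ?thesis using self_cyc[of x] unfolding faces_def boundaries_def by blast
qed

lemma bdry_sigma1: assumes "x : bdry_half_edges G" shows "x : H" "sigma1 G x ~: bdry_half_edges G"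
 using ribbon assms by (auto simp: ribbon_graph_def)

lemma edges_edge_sets: "E = edge_sets H (sigma1 G)"
proof -
 have "{x : H. sigma1 G x ~= x} = H" using s_ne by auto
 then show ?thesis unfolding edges_eq edge_sets_def using edge_at_eq by (auto simp: image_iff)
qed

end

context marked_trivalent
begin

lemma lmap_of_eq: "lmap_of G = (sigma0 G, sigma1 G, \<lambda>x\<in>H. Some (cycle_index (cyc x)))"
 unfolding lmap_of_def cycle_index_def Let_def fc_sigma2 ..

lemma cycle_index_half_edge:
 assumes "x : H"
 shows "cycle_index (cyc x) = (if x : bdry_half_edges G then Inr (bdry_label G (cyc x)) else Inl (face_label G (cyc x)))"
 using bdry_iff[OF assms] by (simp add: cycle_index_def)

lemma lmap_of_lmaps:
 assumes conn: "connected_graph G" and ne: "H ~= {}"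
 shows "lmap_of G : lmaps n b H"
proof -
 let ?l = "\<lambda>x\<in>H. Some (cycle_index (cyc x))"
 have "(sigma0 G, sigma1 G, ?l) : free_maps H"
  unfolding free_maps_def cmaps_def using a_perm s_perm a_ne a_cube s_ne s_s by (auto simp: fc_alt[symmetric])
 moreover have "cconn H (sigma0 G, sigma1 G, ?l)" unfolding cconn_def prod.case
 proof (intro conjI allI impI ne)
  fix K assume K: "K \<subseteq> H \<and> K ~= {} \<and> sigma0 G ` K \<subseteq> K \<and> sigma1 G ` K \<subseteq> K"
  then obtain x where x: "x : K" by auto
  have w: "w x : K" if "w : generated_perms {sigma0 G, sigma1 G}" for w using that
  proof induction
   case gen_id show ?case using x by simp
  next
   case (gen_mult f w) then show ?case using K by auto
  next
   case (gen_inv f w)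
   have wH: "w x : H" using gen_inv.IH K by auto
   have "inv (sigma1 G) (w x) = sigma1 G (w x)" using permutes_inv_eq[OF s_perm] s_s[OF wH] by simp
   moreover have "sigma0 G z : K" "sigma1 G z : K" if "z : K" for z using K that by auto
   ultimately show ?case using gen_inv.hyps gen_inv.IH by (auto simp: inv_a)
  qed
  have xH: "x : H" using x K by auto
  have "y : K" if yH: "y : H" for y
  proof -
   obtain v where "v : generated_perms {sigma0 G, sigma1 G}" "v x = y"
    using bspec[OF bspec[OF conn[unfolded connected_graph_def] xH] yH] by (elim bexE)
   then show ?thesis using w[of v] by simp
  qed
  then show "K = H" using K by auto
 qed
 moreover have "y : orbit (%x. sigma0 G (sigma0 G (sigma1 G x))) x" if "x : H" "y : H" "?l x = ?l y" for x y
 proof -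
  have "cycle_index (cyc x) = cycle_index (cyc y)" using that by simp
  then have "cyc x = cyc y" using cycle_index_bij that(1,2) by (auto simp: bij_betw_def inj_on_def)
  then show ?thesis unfolding fc_fun using self_cyc[of y] by simp
 qed
 moreover have "?l ` H = Some ` ({1..n} <+> {1..b})"
 proof -
  have "?l ` H = Some ` cycle_index ` C" by (auto simp: image_iff)
  then show ?thesis using cycle_index_bij by (simp add: bij_betw_def)
 qed
 moreover have "?l (sigma1 G x) ~= Some (Inr j)" if "x : H" "?l x = Some (Inr i)" for x i j
  using that bdry_sigma1(2)[of x] by (auto simp: cycle_index_half_edge split: if_splits)
 ultimately show ?thesis unfolding lmap_of_eq lmaps_def by blast
qed

end

text \<open>Trivalence and Euler's relation together fix the number of edges as
  \<open>6 * g + 3 * n + 3 * b - 6\<close>. Since \<open>n \<ge> 1\<close> there is a face and hence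
  a half-edge; this positivity shows that neither this subtraction nor
  \<open>3*g + n + b - 3\<close> truncates.\<close>

lemma top_graph_locale:
 assumes G: "G : top_graphs g b n" and n: "n \<ge> 1"
 shows "marked_trivalent G n b (3*g + n + b - 3)" "card (half_edges G) = 2 * W_degree g b n" "half_edges G ~= {}"
proof -
 have G': "ribbon_graph G" "connected_graph G" "has_type G g b n" "trivalent G" "marked G"
  using G by (auto simp: top_graphs_def)
 interpret trivalent_ribbon G using G' by unfold_locales
 have ty: "card (boundaries G) = b" "card (faces G) = n" "int (card (vertices G)) - int (card E) + int n + int b = 2 - 2 * int g"
  using G'(3) by (auto simp: has_type_def)
 have "faces G ~= {}" using ty(2) n by auto
 then show ne: "half_edges G ~= {}" by (auto simp: faces_def cycles_on_def)
 then have pos: "card H > 0" using finite_H by (simp add: card_gt_0_iff)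
 have e: "3 * int (card (vertices G)) = 2 * int (card E)" "int (card H) = 2 * int (card E)"
  using card_V card_E by simp_all
 have E: "int (card E) = 3 * (int n + int b + 2 * int g - 2)" using e ty(3) by presburger
 have "int (card E) > 0" using pos e by linarith
 then have p: "int n + int b + 2 * int g - 2 > 0" using E by presburger
 have q: "3 \<le> 2 * g + n + b" using p by presburger
 have E': "card E + 6 = 3 * n + 3 * b + 6 * g" using E by presburger
 have "card E = n + b + 2 * (3*g + n + b - 3)" using E' q by presburger
 then show "marked_trivalent G n b (3*g + n + b - 3)" using G'(5) ty by unfold_locales auto
 show "card (half_edges G) = 2 * W_degree g b n" unfolding W_degree_def using card_E E' q by presburger
qed

text \<open>A labelled map does not mention the genus; it is recovered from the number of
  half-edges, which together with \<open>n\<close> and \<open>b\<close> fixes the Euler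
  characteristic of a trivalent graph.\<close>

lemma lmaps_realised:
 fixes H :: "nat set"
 assumes H: "finite H" and m: "m : lmaps n b H" and card: "card H = 2 * W_degree g b n"
 shows "\<exists>G\<in>top_graphs g b n. half_edges G = H \<and> lmap_of G = m"
proof -
 obtain a s l where m': "m = (a, s, l)" by (cases m)
 note D = m[unfolded m' lmaps_def mem_Collect_eq prod.case]
 note fm = conjunct1[OF D] and conn = conjunct1[OF conjunct2[OF D]]
  and adj = conjunct2[OF conjunct2[OF conjunct2[OF conjunct2[OF D]]], rule_format]
 interpret cubic_map H a s using free_maps_cubic[OF H fm] .
 note L = lmaps_bijections[OF m[unfolded m']]
 have lfc: "l (fc x) = l x" if "x : H" for x by (rule free_maps_colour[OF fm that orbit.base])
 have lp: "l (pick (cyc x)) = l x" if "x : H" for x by (rule free_maps_colour[OF fm that pick_cyc])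
 let ?B = "{x : H. \<exists>j. l x = Some (Inr j)}"
 define G :: "nat marked_graph" where "G = \<lparr>half_edges = H, sigma0 = a, sigma1 = s, sigma2 = fc, bdry_half_edges = ?B,
  face_label = (%c. projl (the (l (pick c)))), bdry_label = (%c. projr (the (l (pick c))))\<rparr>"
 have Gs [simp]: "half_edges G = H" "sigma0 G = a" "sigma1 G = s" "sigma2 G = fc" "bdry_half_edges G = ?B"
  by (simp_all add: G_def)
 have fl: "face_label G (cyc x) = i" if "x : H" "l x = Some (Inl i)" for x i using lp[OF that(1)] that(2) by (simp add: G_def)
 have bl: "bdry_label G (cyc x) = i" if "x : H" "l x = Some (Inr i)" for x i using lp[OF that(1)] that(2) by (simp add: G_def)
 have triv: "trivalent G" using card_orbit_a by (auto simp: trivalent_def vertices_def cycles_on_def)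
 have "ribbon_graph G" unfolding ribbon_graph_def
 proof (intro conjI ballI)
  show "finite (half_edges G)" "sigma0 G permutes half_edges G" "sigma1 G permutes half_edges G" "sigma2 G permutes half_edges G"
   using H a_perm s_perm fc_perm by simp_all
  show "sigma2 G = inv (sigma0 G) \<circ> sigma1 G" by (simp add: fc_def)
  show "bdry_half_edges G \<subseteq> half_edges G" by auto
  show "sigma1 G x ~= x" "sigma1 G (sigma1 G x) = x" if "x : half_edges G" for x using s_ne s_s that by simp_all
  show "sigma2 G x : bdry_half_edges G" "sigma1 G x ~: bdry_half_edges G" if "x : bdry_half_edges G" for x
   using that lfc[of x] adj[of x] by auto
  show "card c ~= 1" "card c ~= 2" if "c : vertices G" for c using triv that by (auto simp: trivalent_def)
 qed
 then interpret R: trivalent_ribbon G using triv by unfold_locales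
 have "connected_graph G" unfolding connected_graph_def
 proof (intro ballI)
  fix x y assume xy: "x : half_edges G" "y : half_edges G"
  let ?K = "{z : H. \<exists>w\<in>generated_perms {a, s}. w x = z}"
  have step: "f z : ?K" if z: "z : ?K" and f: "f : {a, s}" for f z
  proof -
   obtain w where w: "w : generated_perms {a, s}" "w x = z" "z : H" using z by auto
   then have "f \<circ> w : generated_perms {a, s}" "(f \<circ> w) x = f z" using f by (auto intro: gen_mult)
   moreover have "f z : H" using f w by auto
   ultimately show ?thesis by blast
  qed
  have "x : ?K" using xy by (auto intro!: bexI[of _ id] gen_id)
  then have "?K \<subseteq> H \<and> ?K ~= {} \<and> a ` ?K \<subseteq> ?K \<and> s ` ?K \<subseteq> ?K" using step[of _ a] step[of _ s] by blast
  then have "?K = H" by (rule mp[OF spec[OF conjunct2[OF conn[unfolded cconn_def prod.case]]]])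
  then show "\<exists>w\<in>generated_perms {sigma0 G, sigma1 G}. w x = y" using xy by auto
 qed
 moreover have facesE: "faces G = cyc ` {x : H. \<exists>i. l x = Some (Inl i)}"
 proof -
  have "cyc x : faces G \<longleftrightarrow> (\<exists>i. l x = Some (Inl i))" if "x : H" for x
   using R.bdry_iff[of x] L(3)[OF that] that by (auto simp: R.fc_def fc_def)
  moreover have "faces G \<subseteq> cyc ` H" by (auto simp: faces_def cycles_on_def)
  ultimately show ?thesis by auto
 qed
 have bdE: "boundaries G = cyc ` {x : H. \<exists>i. l x = Some (Inr i)}"
 proof -
  have "cyc x \<subseteq> ?B \<longleftrightarrow> (\<exists>i. l x = Some (Inr i))" if x: "x : H" for x
  proof
   assume "cyc x \<subseteq> ?B"
   then show "\<exists>i. l x = Some (Inr i)" using self_cyc[of x] by blast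
  next
   assume r: "\<exists>i. l x = Some (Inr i)"
   show "cyc x \<subseteq> ?B"
   proof
    fix z assume z: "z : cyc x"
    show "z : ?B" using free_maps_colour[OF fm x z] r cyc_subset[OF x] z by auto
   qed
  qed
  then show ?thesis unfolding boundaries_def cycles_on_def Gs by auto
 qed
 have fb: "bij_betw (face_label G) (faces G) {1..n}" using L(1) unfolding facesE by (simp add: G_def)
 have bb: "bij_betw (bdry_label G) (boundaries G) {1..b}" using L(2) unfolding bdE by (simp add: G_def)
 have cf: "card (faces G) = n" and cb: "card (boundaries G) = b"
  using bij_betw_same_card[OF fb] bij_betw_same_card[OF bb] by simp_all
 then have "marked G" using fb bb by (simp add: marked_def)
 moreover have "has_type G g b n"
 proof -
  \<comment> \<open>A connected map is nonempty, so \<open>W_degree\<close> is positive and its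
    truncated subtraction is the true one.\<close>
  have "card H > 0" using conn H by (auto simp: cconn_def card_gt_0_iff)
  then have "W_degree g b n > 0" using card by simp
  then have W: "int (W_degree g b n) = 6 * int g + 3 * int n + 3 * int b - 6" by (simp add: W_degree_def)
  have "3 * int (card (vertices G)) = 2 * int (W_degree g b n)" "int (card (edges G)) = int (W_degree g b n)"
   using R.card_V R.card_E card by simp_all
  then have "int (card (vertices G)) - int (card (edges G)) + int n + int b = 2 - 2 * int g" using W by linarith
  then show ?thesis using cf cb by (simp add: has_type_def)
 qed
 ultimately have "G : top_graphs g b n" using R.ribbon triv by (simp add: top_graphs_def)
 moreover have "lmap_of G = m"
 proof -
  have "(\<lambda>x\<in>H. let c = cyc x in Some (if c : faces G then Inl (face_label G c) else Inr (bdry_label G c))) = l"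
  proof
   fix x
   show "(\<lambda>x\<in>H. let c = cyc x in Some (if c : faces G then Inl (face_label G c) else Inr (bdry_label G c))) x = l x"
   proof (cases "x : H")
    case True
    have "x : ?B \<longleftrightarrow> cyc x ~: faces G" using R.bdry_iff[of x] True by (simp add: R.fc_def fc_def)
    then show ?thesis using L(3)[OF True] True fl[OF True] bl[OF True] by (auto simp: Let_def)
   next
    case False
    then show ?thesis using fm by (auto simp: free_maps_def cmaps_def)
   qed
  qed
  then show ?thesis by (simp add: lmap_of_def m')
 qed
 ultimately show ?thesis by (intro bexI[of _ G]) simp_all
qed

text \<open>The set of boundary half-edges and both labellings can be read off from the cycle
  labels, because \<open>Inl\<close> and \<open>Inr\<close> tell faces from boundaries. Isomorphisms
  and automorphisms thus become equations between maps.\<close>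

lemma marked_iso_iff:
 assumes G: "G : top_graphs g b n" and G': "G' : top_graphs g b n" and n: "n \<ge> 1"
  and f: "bij_betw f (half_edges G) (half_edges G')"
 shows "marked_iso f G G' \<longleftrightarrow>
  lmap_of G' = relabel (half_edges G') f (inv_into (half_edges G) f) (lmap_of G)"
proof -
 interpret A: marked_trivalent G n b "3*g + n + b - 3" using top_graph_locale[OF G n] by simp
 interpret B: marked_trivalent G' n b "3*g + n + b - 3" using top_graph_locale[OF G' n] by simp
 interpret relabelling A.H B.H f "inv_into A.H f" using relabelling_bij[OF f] .
 let ?g = "inv_into A.H f"
 define conj01 where "conj01 \<longleftrightarrow> (\<forall>x\<in>A.H. f (sigma0 G x) = sigma0 G' (f x) \<and> f (sigma1 G x) = sigma1 G' (f x))"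
 define lab where "lab \<longleftrightarrow> (\<forall>x\<in>A.H. B.cycle_index (B.cyc (f x)) = A.cycle_index (A.cyc x))"
 have "lmap_of G' = relabel B.H f ?g (lmap_of G) \<longleftrightarrow> conj01 \<and> lab"
 proof
  assume eq: "lmap_of G' = relabel B.H f ?g (lmap_of G)"
  note e0 = eq[unfolded A.lmap_of_eq B.lmap_of_eq relabel_def prod.case prod.inject]
  note e = conjunct1[OF e0] conjunct1[OF conjunct2[OF e0]] conjunct2[OF conjunct2[OF e0]]
  have "conj01" unfolding conj01_def e(1,2) by (simp add: f_in gf)
  moreover have "lab" unfolding lab_def
  proof
   fix x assume "x : A.H"
   then show "B.cycle_index (B.cyc (f x)) = A.cycle_index (A.cyc x)"
    using fun_cong[OF e(3), of "f x"] by (simp add: f_in gf)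
  qed
  ultimately show "conj01 \<and> lab" ..
 next
  assume cl: "conj01 \<and> lab"
  have "sigma0 G' z = (if z : B.H then f (sigma0 G (?g z)) else z)" for z
   using cl g_in[of z] fg[of z] permutes_not_in[OF B.a_perm] by (auto simp: conj01_def)
  then have e1: "sigma0 G' = (%z. if z : B.H then f (sigma0 G (?g z)) else z)" by (rule ext)
  have "sigma1 G' z = (if z : B.H then f (sigma1 G (?g z)) else z)" for z
   using cl g_in[of z] fg[of z] permutes_not_in[OF B.s_perm] by (auto simp: conj01_def)
  then have e2: "sigma1 G' = (%z. if z : B.H then f (sigma1 G (?g z)) else z)" by (rule ext)
  have "B.cycle_index (B.cyc z) = A.cycle_index (A.cyc (?g z))" if "z : B.H" for z
   using cl bspec[of A.H _ "?g z"] g_in[OF that] fg[OF that] unfolding lab_def by metis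
  then have e3: "(\<lambda>x\<in>B.H. Some (B.cycle_index (B.cyc x))) = (\<lambda>z\<in>B.H. (\<lambda>x\<in>A.H. Some (A.cycle_index (A.cyc x))) (?g z))"
   by (intro restrict_ext) (simp add: g_in)
  show "lmap_of G' = relabel B.H f ?g (lmap_of G)"
   by (simp only: A.lmap_of_eq B.lmap_of_eq relabel_def prod.case prod.inject) (intro conjI e1 e2 e3)
 qed
 moreover have "marked_iso f G G' \<longleftrightarrow> conj01 \<and> lab"
 proof (cases conj01)
  case False
  then show ?thesis unfolding marked_iso_def conj01_def by blast
 next
  case True
  have cyc: "B.cyc (f x) = f ` A.cyc x" if x: "x : A.H" for x
  proof (rule orbit_inverse[symmetric])
   fix z assume "z : A.cyc x"
   then have z: "z : A.H" using A.cyc_subset[OF x] by auto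
   have c: "sigma0 G' (f z) = f (sigma0 G z)" "sigma1 G' (f z) = f (sigma1 G z)" if "z : A.H" for z
    using True that by (simp_all add: conj01_def)
   show "B.fc (f z) = f (A.fc z)" using z by (simp add: A.fc_alt B.fc_alt c)
  qed simp
  have AC: "A.cycle_index (A.cyc x) = (if x : bdry_half_edges G then Inr (bdry_label G (A.cyc x)) else Inl (face_label G (A.cyc x)))"
   and BC: "B.cycle_index (B.cyc (f x)) = (if f x : bdry_half_edges G' then Inr (bdry_label G' (f ` A.cyc x)) else Inl (face_label G' (f ` A.cyc x)))"
   if "x : A.H" for x
   using A.cycle_index_half_edge[OF that] B.cycle_index_half_edge[OF f_in[OF that]] cyc[OF that] by simp_all
  have cC: "\<exists>x\<in>A.H. c = A.cyc x" if "c : faces G \<union> boundaries G" for c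
   using that unfolding A.faces_boundaries(1) by blast
  have fA: "\<exists>x\<in>A.H. c = A.cyc x \<and> x ~: bdry_half_edges G" if c: "c : faces G" for c
  proof -
   obtain x where x: "x : A.H" "c = A.cyc x" using cC[of c] c by auto
   then show ?thesis using A.bdry_iff[OF x(1)] c by auto
  qed
  have bA: "\<exists>x\<in>A.H. c = A.cyc x \<and> x : bdry_half_edges G" if c: "c : boundaries G" for c
  proof -
   obtain x where x: "x : A.H" "c = A.cyc x" using cC[of c] c by auto
   moreover have "c ~: faces G" using c A.faces_boundaries(2) by auto
   ultimately show ?thesis using A.bdry_iff[OF x(1)] by auto
  qed
  have fA': "A.cyc x : faces G" if "x : A.H" "x ~: bdry_half_edges G" for x using A.bdry_iff[OF that(1)] that by simp
  have bA': "A.cyc x : boundaries G" if "x : A.H" "x : bdry_half_edges G" for x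
   using A.bdry_iff[OF that(1)] that A.faces_boundaries(1) imageI[OF that(1), of A.cyc] by (metis UnE)
  have img: "f ` bdry_half_edges G = bdry_half_edges G' \<longleftrightarrow> (\<forall>x\<in>A.H. x : bdry_half_edges G \<longleftrightarrow> f x : bdry_half_edges G')"
  proof
   assume e: "f ` bdry_half_edges G = bdry_half_edges G'"
   show "\<forall>x\<in>A.H. x : bdry_half_edges G \<longleftrightarrow> f x : bdry_half_edges G'"
   proof
    fix x assume x: "x : A.H"
    show "x : bdry_half_edges G \<longleftrightarrow> f x : bdry_half_edges G'"
     unfolding e[symmetric] using x f_inj A.bdry_sigma1(1) by (auto simp: inj_on_def)
   qed
  next
   assume e: "\<forall>x\<in>A.H. x : bdry_half_edges G \<longleftrightarrow> f x : bdry_half_edges G'"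
   show "f ` bdry_half_edges G = bdry_half_edges G'"
   proof (intro equalityI subsetI)
    fix z assume "z : f ` bdry_half_edges G"
    then show "z : bdry_half_edges G'" using e A.bdry_sigma1(1) by auto
   next
    fix z assume z: "z : bdry_half_edges G'"
    have zH: "z : B.H" using z B.bdry_sigma1(1) by auto
    show "z : f ` bdry_half_edges G" using e g_in[OF zH] fg[OF zH] z by (intro image_eqI[of _ _ "?g z"]) auto
   qed
  qed
  show ?thesis
  proof
   assume iso: "marked_iso f G G'"
   then have b: "\<forall>x\<in>A.H. x : bdry_half_edges G \<longleftrightarrow> f x : bdry_half_edges G'" unfolding marked_iso_def img by blast
   have "lab" unfolding lab_def
   proof
    fix x assume x: "x : A.H"
    show "B.cycle_index (B.cyc (f x)) = A.cycle_index (A.cyc x)"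
     using iso fA'[OF x] bA'[OF x] b x unfolding AC[OF x] BC[OF x] marked_iso_def by auto
   qed
   then show "conj01 \<and> lab" using True by simp
  next
   assume "conj01 \<and> lab"
   then have l: "(if f x : bdry_half_edges G' then Inr (bdry_label G' (f ` A.cyc x)) else Inl (face_label G' (f ` A.cyc x))) =
     (if x : bdry_half_edges G then Inr (bdry_label G (A.cyc x)) else Inl (face_label G (A.cyc x)))" if "x : A.H" for x
    using that AC[OF that] BC[OF that] by (simp add: lab_def)
   have "f ` bdry_half_edges G = bdry_half_edges G'" unfolding img using l by (meson Inl_Inr_False Inr_Inl_False)
   moreover have "face_label G' (f ` c) = face_label G c" if c: "c : faces G" for c
   proof -
    obtain x where x: "x : A.H" "c = A.cyc x" "x ~: bdry_half_edges G" using fA[OF c] by blast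
    show ?thesis using l[OF x(1)] x(3) unfolding x(2) by (cases "f x : bdry_half_edges G'") simp_all
   qed
   moreover have "bdry_label G' (f ` c) = bdry_label G c" if c: "c : boundaries G" for c
   proof -
    obtain x where x: "x : A.H" "c = A.cyc x" "x : bdry_half_edges G" using bA[OF c] by blast
    show ?thesis using l[OF x(1)] x(3) unfolding x(2) by (cases "f x : bdry_half_edges G'") simp_all
   qed
   ultimately show "marked_iso f G G'" using f True unfolding marked_iso_def conj01_def by blast
  qed
 qed
 ultimately show ?thesis by simp
qed

section \<open>Counting isomorphism classes\<close>

lemma card_bijections:
 assumes A: "finite A" and B: "finite B" and c: "card A = card B"
 shows "card {f : A \<rightarrow>\<^sub>E B. bij_betw f A B} = fact (card A)"
proof -
 obtain e where e: "bij_betw e A B" using finite_same_card_bij[OF A B c] by blast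
 have ie: "bij_betw (inv_into A e) B A" by (rule bij_betw_inv_into[OF e])
 have e1: "inv_into A e (e x) = x" if "x : A" for x using bij_betw_inv_into_left[OF e that] .
 have e2: "e (inv_into A e y) = y" if "y : B" for y using bij_betw_inv_into_right[OF e that] .
 have "bij_betw (%q. restrict (e \<circ> q) A) {q. q permutes A} {f : A \<rightarrow>\<^sub>E B. bij_betw f A B}"
 proof (rule bij_betw_byWitness[where f' = "%f x. if x : A then inv_into A e (f x) else x"])
  show "\<forall>q\<in>{q. q permutes A}. (%x. if x : A then inv_into A e (restrict (e \<circ> q) A x) else x) = q"
  proof (intro ballI ext)
   fix q x assume "q : {q. q permutes A}"
   then have q: "q permutes A" by simp
   show "(if x : A then inv_into A e (restrict (e \<circ> q) A x) else x) = q x"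
    using permutes_in_image[OF q, of x] permutes_not_in[OF q, of x] by (simp add: e1)
  qed
  show "\<forall>f\<in>{f : A \<rightarrow>\<^sub>E B. bij_betw f A B}. restrict (e \<circ> (%x. if x : A then inv_into A e (f x) else x)) A = f"
  proof (intro ballI ext)
   fix f x assume "f : {f : A \<rightarrow>\<^sub>E B. bij_betw f A B}"
   then have f: "f : A \<rightarrow>\<^sub>E B" by simp
   show "restrict (e \<circ> (%x. if x : A then inv_into A e (f x) else x)) A x = f x"
    using PiE_mem[OF f, of x] PiE_arb[OF f, of x] by (cases "x : A") (simp_all add: e2)
  qed
  show "(%q. restrict (e \<circ> q) A) ` {q. q permutes A} \<subseteq> {f : A \<rightarrow>\<^sub>E B. bij_betw f A B}"
  proof (rule image_subsetI)
   fix q assume "q : {q. q permutes A}"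
   then have b: "bij_betw (e \<circ> q) A B" using bij_betw_trans[OF permutes_imp_bij e] by blast
   then have "bij_betw (restrict (e \<circ> q) A) A B" by (rule bij_betw_cong[THEN iffD1, rotated]) simp
   moreover have "restrict (e \<circ> q) A : A \<rightarrow>\<^sub>E B" unfolding restrict_PiE_iff by (rule bij_betwE[OF b])
   ultimately show "restrict (e \<circ> q) A : {f : A \<rightarrow>\<^sub>E B. bij_betw f A B}" by blast
  qed
  show "(%f x. if x : A then inv_into A e (f x) else x) ` {f : A \<rightarrow>\<^sub>E B. bij_betw f A B} \<subseteq> {q. q permutes A}"
  proof (rule image_subsetI)
   fix f assume "f : {f : A \<rightarrow>\<^sub>E B. bij_betw f A B}"
   then have "bij_betw (inv_into A e \<circ> f) A A" using bij_betw_trans[OF _ ie] by blast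
   then have "bij_betw (%x. if x : A then inv_into A e (f x) else x) A A"
    by (rule bij_betw_cong[THEN iffD1, rotated]) simp
   then show "(%x. if x : A then inv_into A e (f x) else x) : {q. q permutes A}" by (auto intro: bij_imp_permutes)
  qed
 qed
 from bij_betw_same_card[OF this] show ?thesis using card_permutations[OF refl A] by simp
qed

section \<open>Orbits of maps under relabelling\<close>

lemma relabel_comp:
 assumes r: "relabelling H H' f g" and r': "relabelling H' H'' h k"
 shows "relabelling H H'' (h \<circ> f) (g \<circ> k)"
  and "relabel H'' h k (relabel H' f g m) = relabel H'' (h \<circ> f) (g \<circ> k) m"
proof -
 interpret A: relabelling H H' f g by (rule r)
 interpret B: relabelling H' H'' h k by (rule r')
 show "relabelling H H'' (h \<circ> f) (g \<circ> k)"
  by unfold_locales (simp_all add: A.f_in A.g_in A.gf A.fg B.f_in B.g_in B.gf B.fg)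
 show "relabel H'' h k (relabel H' f g m) = relabel H'' (h \<circ> f) (g \<circ> k) m"
  by (cases m) (simp add: relabel_def restrict_def B.g_in cong: if_cong)
qed

lemma relabelling_id: "relabelling H H id id" by unfold_locales auto

lemma relabel_id: "m : cmaps H ==> relabel H id id m = m"
 using relabelling.relabel_relabel[OF relabelling_id, of m H] relabel_comp(2)[OF relabelling_id relabelling_id, of H m] by simp

definition iso_maps :: "'k set => 'h set => ('h, 'n) cmap => ('k, 'n) cmap set" where
 "iso_maps H' H m = {m'. \<exists>f g. relabelling H H' f g \<and> m' = relabel H' f g m}"

lemma iso_maps_refl: "m : cmaps H ==> m : iso_maps H H m"
 unfolding iso_maps_def using relabelling_id relabel_id by fastforce

lemma iso_maps_sym: "m : cmaps H ==> m' : iso_maps H' H m ==> m : iso_maps H H' m'"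
proof -
 assume m: "m : cmaps H" and "m' : iso_maps H' H m"
 then obtain f g where r: "relabelling H H' f g" and m': "m' = relabel H' f g m" unfolding iso_maps_def by auto
 have "m = relabel H g f m'" unfolding m' by (rule relabelling.relabel_relabel[OF r m, symmetric])
 then show "m : iso_maps H H' m'" unfolding iso_maps_def using relabelling.sym[OF r] by auto
qed

lemma iso_maps_trans: "m' : iso_maps H' H m ==> m'' : iso_maps H'' H' m' ==> m'' : iso_maps H'' H m"
proof -
 assume "m' : iso_maps H' H m" "m'' : iso_maps H'' H' m'"
 then obtain f g h k where r: "relabelling H H' f g" "relabelling H' H'' h k" and "m' = relabel H' f g m" "m'' = relabel H'' h k m'"
  unfolding iso_maps_def by auto
 then have "m'' = relabel H'' (h \<circ> f) (g \<circ> k) m" by (simp only: relabel_comp(2)[OF r])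
 then show "m'' : iso_maps H'' H m" unfolding iso_maps_def using relabel_comp(1)[OF r] by auto
qed

lemma relabelling_bij_betw: "relabelling H H' f g ==> bij_betw f H H'"
proof -
 assume "relabelling H H' f g"
 then interpret relabelling H H' f g .
 show ?thesis using f_inj f_image by (simp add: bij_betw_def)
qed

lemma iso_maps_bij:
 assumes "m : cmaps H"
 shows "iso_maps H' H m = (%f. relabel H' f (inv_into H f) m) ` {f : H \<rightarrow>\<^sub>E H'. bij_betw f H H'}"
proof (intro equalityI subsetI)
 fix m' assume "m' : iso_maps H' H m"
 then obtain f g where r: "relabelling H H' f g" and m': "m' = relabel H' f g m" by (auto simp: iso_maps_def)
 let ?f = "restrict f H"
 have b: "bij_betw ?f H H'" by (rule bij_betw_cong[THEN iffD1, rotated, OF relabelling_bij_betw[OF r]]) simp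
 have "m' = relabel H' ?f (inv_into H ?f) m"
  unfolding m' by (rule relabel_cong[OF assms r relabelling_bij[OF b]]) simp
 moreover have "?f : H \<rightarrow>\<^sub>E H'" using bij_betwE[OF b] by auto
 ultimately show "m' : (%f. relabel H' f (inv_into H f) m) ` {f : H \<rightarrow>\<^sub>E H'. bij_betw f H H'}" using b by blast
next
 fix m' assume "m' : (%f. relabel H' f (inv_into H f) m) ` {f : H \<rightarrow>\<^sub>E H'. bij_betw f H H'}"
 then show "m' : iso_maps H' H m" unfolding iso_maps_def using relabelling_bij by blast
qed

text \<open>Orbit-stabiliser for bijections onto a second set: two bijections with the same image of
  \<open>m\<close> differ by a permutation that fixes \<open>m\<close>, so all fibres have the size
  of the stabiliser.\<close>

lemma card_iso_maps:
 assumes m: "m : cmaps H" and H: "finite H" "finite H'" "card H = card H'"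
 shows "card (iso_maps H' H m) * card {h. h permutes H \<and> relabel H h (inv_into H h) m = m} = fact (card H)"
proof -
 let ?B = "{f : H \<rightarrow>\<^sub>E H'. bij_betw f H H'}" and ?F = "%f. relabel H' f (inv_into H f) m"
 let ?S = "{h. h permutes H \<and> relabel H h (inv_into H h) m = m}"
 have finB: "finite ?B" by (rule finite_subset[OF _ finite_PiE[of H "%_. H'"]]) (use H in auto)
 have fib: "card {f : ?B. ?F f = ?F f1} = card ?S" if f1: "f1 : ?B" for f1
 proof -
  let ?g1 = "inv_into H f1"
  have b1: "bij_betw f1 H H'" using f1 by simp
  interpret R: relabelling H H' f1 ?g1 by (rule relabelling_bij[OF b1])
  have "bij_betw (%h. restrict (f1 \<circ> h) H) ?S {f : ?B. ?F f = ?F f1}"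
  proof (rule bij_betw_byWitness[where f' = "%f x. if x : H then ?g1 (f x) else x"])
   show "\<forall>h\<in>?S. (%x. if x : H then ?g1 (restrict (f1 \<circ> h) H x) else x) = h"
   proof (intro ballI ext)
    fix h x assume "h : ?S"
    then have h: "h permutes H" by simp
    show "(if x : H then ?g1 (restrict (f1 \<circ> h) H x) else x) = h x"
     using permutes_in_image[OF h, of x] permutes_not_in[OF h, of x] by (simp add: R.gf)
   qed
   show "\<forall>f\<in>{f : ?B. ?F f = ?F f1}. restrict (f1 \<circ> (%x. if x : H then ?g1 (f x) else x)) H = f"
   proof (intro ballI ext)
    fix f x assume "f : {f : ?B. ?F f = ?F f1}"
    then have f: "f : H \<rightarrow>\<^sub>E H'" by simp
    show "restrict (f1 \<circ> (%x. if x : H then ?g1 (f x) else x)) H x = f x"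
     using PiE_mem[OF f, of x] PiE_arb[OF f, of x] by (cases "x : H") (simp_all add: R.fg)
   qed
   show "(%h. restrict (f1 \<circ> h) H) ` ?S \<subseteq> {f : ?B. ?F f = ?F f1}"
   proof (rule image_subsetI)
    fix h assume h: "h : ?S"
    then have hb: "bij_betw h H H" by (auto intro: permutes_imp_bij)
    note rc = relabel_comp[OF relabelling_bij[OF hb] R.relabelling_axioms]
    let ?f = "restrict (f1 \<circ> h) H"
    have fb0: "bij_betw (f1 \<circ> h) H H'" using bij_betw_trans[OF hb b1] .
    then have fb: "bij_betw ?f H H'" by (rule bij_betw_cong[THEN iffD1, rotated]) simp
    have fE: "?f : H \<rightarrow>\<^sub>E H'" unfolding restrict_PiE_iff by (rule bij_betwE[OF fb0])
    have "?F ?f = relabel H' (f1 \<circ> h) (inv_into H h \<circ> ?g1) m"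
     by (rule relabel_cong[OF m relabelling_bij[OF fb] rc(1)]) simp
    also have "... = relabel H' f1 ?g1 (relabel H h (inv_into H h) m)" by (rule rc(2)[symmetric])
    also have "relabel H h (inv_into H h) m = m" using h by simp
    finally show "?f : {f : ?B. ?F f = ?F f1}" using fb fE by blast
   qed
   show "(%f x. if x : H then ?g1 (f x) else x) ` {f : ?B. ?F f = ?F f1} \<subseteq> ?S"
   proof (rule image_subsetI)
    fix f assume f: "f : {f : ?B. ?F f = ?F f1}"
    then have fb: "bij_betw f H H'" by simp
    let ?h = "%x. if x : H then ?g1 (f x) else x"
    have gb: "bij_betw ?g1 H' H" by (rule bij_betw_inv_into[OF b1])
    have "bij_betw (?g1 \<circ> f) H H" using bij_betw_trans[OF fb gb] .
    then have hb: "bij_betw ?h H H" by (rule bij_betw_cong[THEN iffD1, rotated]) simp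
    note rc = relabel_comp[OF relabelling_bij[OF fb] R.sym]
    have "relabel H ?h (inv_into H ?h) m = relabel H (?g1 \<circ> f) (inv_into H f \<circ> f1) m"
     by (rule relabel_cong[OF m relabelling_bij[OF hb] rc(1)]) simp
    also have "... = relabel H ?g1 f1 (?F f)" by (rule rc(2)[symmetric])
    also have "?F f = ?F f1" using f by simp
    also have "relabel H ?g1 f1 (?F f1) = m" by (rule R.relabel_relabel[OF m])
    finally show "?h : ?S" using bij_imp_permutes[OF hb] by auto
   qed
  qed
  then show ?thesis using bij_betw_same_card by fastforce
 qed
 have "fact (card H) = (\<Sum>f\<in>?B. 1::nat)" using card_bijections[OF H] by simp
 also have "... = (\<Sum>m'\<in>?F ` ?B. \<Sum>f\<in>{f : ?B. ?F f = m'}. 1)" by (rule sum.image_gen[OF finB])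
 also have "... = (\<Sum>m'\<in>?F ` ?B. card ?S)"
 proof (rule sum.cong[OF refl])
  fix m' assume "m' : ?F ` ?B"
  then obtain f1 where "f1 : ?B" "m' = ?F f1" by blast
  then show "(\<Sum>f\<in>{f : ?B. ?F f = m'}. 1) = card ?S" using fib[of f1] by simp
 qed
 finally show ?thesis unfolding iso_maps_bij[OF m] by simp
qed

lemma lmaps_cmaps: "m : lmaps n b H ==> m : cmaps H" by (cases m) (simp add: lmaps_def free_maps_def)

lemma (in relabelling) relabel_lmaps:
 assumes m: "m : lmaps n b H" shows "relabel H' f g m : lmaps n b H'"
proof -
 obtain a s l where m': "m = (a, s, l)" by (cases m)
 note L = m[unfolded m' lmaps_def mem_Collect_eq prod.case]
 have cm: "(a, s, l) : cmaps H" and ns: "!!x. x : H ==> s x ~= x" using conjunct1[OF L] by (auto simp: free_maps_def)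
 note D = cmapsD[OF cm]
 have aH: "a x : H" and sH: "s x : H" if "x : H" for x
  using permutes_in_image[OF D(1)] permutes_in_image[OF D(2)] that by auto
 define a' where "a' = (%z. if z : H' then f (a (g z)) else z)"
 define s' where "s' = (%z. if z : H' then f (s (g z)) else z)"
 define l' where "l' = (\<lambda>z\<in>H'. l (g z))"
 have r: "relabel H' f g m = (a', s', l')" by (simp add: relabel_def m' a'_def s'_def l'_def)
 have lz: "l' z = l (g z)" and sz: "g (s' z) = s (g z)" "s' z : H'" if "z : H'" for z
  using that by (simp_all add: l'_def s'_def g_in sH gf f_in)
 have "(a', s', l') : cmaps H'" using relabel_cmaps[OF cm] r m' by simp
 moreover have "s' z ~= z" if "z : H'" for z using sz[OF that] ns[OF g_in[OF that]] by auto
 ultimately have "(a', s', l') : free_maps H'" by (auto simp: free_maps_def)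
 moreover have "cconn H' (a', s', l')" using relabel_cconn_iff[OF cm] conjunct1[OF conjunct2[OF L]] r m' by simp
 moreover have "w : orbit (%z. a' (a' (s' z))) z" if z: "z : H'" and w: "w : H'" and e: "l' z = l' w" for z w
 proof -
  let ?p = "%x. a (a (s x))" and ?p' = "%z. a' (a' (s' z))"
  have "g w : orbit ?p (g z)"
   using conjunct1[OF conjunct2[OF conjunct2[OF L]]] g_in[OF z] g_in[OF w] e lz[OF z] lz[OF w] by auto
  moreover have sub: "orbit ?p (g z) \<subseteq> H" by (rule orbit_subset_closed) (auto simp: g_in z aH sH)
  have "x : H ==> ?p' (f x) = f (?p x)" for x by (simp add: a'_def s'_def f_in gf aH sH)
  then have im: "f ` orbit ?p (g z) \<subseteq> orbit ?p' (f (g z))"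
  proof -
   have "f x : orbit ?p' (f (g z))" if "x : orbit ?p (g z)" for x using that
   proof induction
    case base
    have "?p' (f (g z)) = f (?p (g z))" by (simp add: a'_def s'_def f_in gf aH sH g_in z)
    then show ?case using orbit.base[of ?p' "f (g z)"] by simp
   next
    case (step x)
    have "x : H" using step.hyps sub by auto
    then have "?p' (f x) = f (?p x)" by (simp add: a'_def s'_def f_in gf aH sH)
    then show ?case using orbit.step[OF step.IH] by simp
   qed
   then show ?thesis by blast
  qed
  ultimately have "f (g w) : orbit ?p' (f (g z))" by blast
  then show ?thesis by (simp add: fg z w)
 qed
 moreover have "l' ` H' = Some ` ({1..n} <+> {1..b})"
 proof -
  have "l' ` H' = l ` g ` H'" unfolding image_image by (rule image_cong) (auto simp: lz)
  also have "g ` H' = H" using relabelling.f_image[OF sym] .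
  finally show ?thesis using conjunct1[OF conjunct2[OF conjunct2[OF conjunct2[OF L]]]] by simp
 qed
 moreover have "l' (s' z) ~= Some (Inr j)" if "z : H'" "l' z = Some (Inr i)" for z i j
  using conjunct2[OF conjunct2[OF conjunct2[OF conjunct2[OF L]]]] g_in[OF that(1)] that lz sz by simp
 ultimately show ?thesis unfolding r lmaps_def by blast
qed

lemma finite_lmaps: assumes "finite H" shows "finite (lmaps n b H)"
proof -
 have "lmaps n b H \<subseteq> {p. p permutes H} \<times> {p. p permutes H} \<times> (H \<rightarrow>\<^sub>E Some ` ({1..n} <+> {1..b}))"
 proof
  fix m assume m: "m : lmaps n b H"
  obtain a s l where m': "m = (a, s, l)" by (cases m)
  note D = cmapsD[OF lmaps_cmaps[OF m, unfolded m']]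
  have "l ` H = Some ` ({1..n} <+> {1..b})" using m by (simp add: m' lmaps_def)
  then have "l : H \<rightarrow>\<^sub>E Some ` ({1..n} <+> {1..b})" using D(6) unfolding PiE_iff by blast
  then show "m : {p. p permutes H} \<times> {p. p permutes H} \<times> (H \<rightarrow>\<^sub>E Some ` ({1..n} <+> {1..b}))"
   using D(1,2) by (simp add: m')
 qed
 moreover have "finite ({p. p permutes H} \<times> {p. p permutes H} \<times> (H \<rightarrow>\<^sub>E Some ` ({1..n} <+> {1..b})))"
  using assms by (intro finite_cartesian_product finite_permutations finite_PiE) auto
 ultimately show ?thesis by (rule finite_subset)
qed

section \<open>From weighted isomorphism classes to labelled maps\<close>

definition label_weight :: "(nat => real) => nat + nat => real" where
 "label_weight mu = case_sum mu (%_. 0)"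

definition lprod :: "(nat => real) => 'h set => ('h, nat + nat) cmap => real" where
 "lprod mu H m = (case m of (a, s, l) => \<Prod>e\<in>edge_sets H s. 1 / (\<Sum>z\<in>e. lam_opt (label_weight mu) (l z)))"

text \<open>Read off from the invariance of \<open>cweight\<close>: labels are never
  \<open>None\<close>, so the power of \<open>Q\<close> is zero and only the edge product is
  left.\<close>

lemma (in relabelling) lprod_relabel:
 assumes H: "finite H" and m: "m : lmaps n b H"
 shows "lprod mu H' (relabel H' f g m) = lprod mu H m"
proof -
 have w: "cweight 1 (%_ _. 0) (label_weight mu) K m = Q_monom (of_real (lprod mu K m)) 0"
  if K: "finite K" and m: "m : lmaps n b K" for m and K :: "'z set"
 proof -
  obtain a s l where m': "m = (a, s, l)" by (cases m)
  have cm: "(a, s, l) : cmaps K" and ns: "\<forall>x\<in>K. s x ~= x" and img: "l ` K = Some ` ({1..n} <+> {1..b})"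
   using m unfolding m' lmaps_def by (auto simp: free_maps_def)
  have "l x ~= None" if "x : K" for x
  proof -
   have "l x : Some ` ({1..n} <+> {1..b})" using img that by blast
   then show ?thesis by auto
  qed
  then have "{x : K. l x = None} = {}" by auto
  then have "bdry_cycles K (a, s, l) = {}" by (simp add: bdry_cycles_def)
  then show ?thesis using ns by (simp add: m' cweight_1[OF K cm] lprod_def)
 qed
 have H': "finite H'" using H f_image by auto
 have "Q_monom (of_real (lprod mu H' (relabel H' f g m))) 0 = Q_monom (of_real (lprod mu H m)) 0"
  using w[OF H m] w[OF H' relabel_lmaps[OF m]] relabel_weight[OF lmaps_cmaps[OF m]] by metis
 then have "complex_of_real (lprod mu H' (relabel H' f g m)) = of_real (lprod mu H m)"
  using nth_Q_monom[of _ 0 0] by metis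
 then show ?thesis by simp
qed

lemma marked_iso_iso_maps:
 assumes G: "G : top_graphs g b n" and G': "G' : top_graphs g b n" and n: "n \<ge> 1"
 shows "(\<exists>f. marked_iso f G G') \<longleftrightarrow> lmap_of G' : iso_maps (half_edges G') (half_edges G) (lmap_of G)"
proof
 assume "\<exists>f. marked_iso f G G'"
 then obtain f where f: "marked_iso f G G'" by blast
 then have b: "bij_betw f (half_edges G) (half_edges G')" by (simp add: marked_iso_def)
 show "lmap_of G' : iso_maps (half_edges G') (half_edges G) (lmap_of G)"
  unfolding iso_maps_def using marked_iso_iff[OF G G' n b] f relabelling_bij[OF b] by blast
next
 assume a: "lmap_of G' : iso_maps (half_edges G') (half_edges G) (lmap_of G)"
 have cm: "lmap_of G : cmaps (half_edges G)"
  using marked_trivalent.lmap_of_lmaps[OF top_graph_locale(1)[OF G n]] top_graph_locale(3)[OF G n] G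
  by (auto simp: top_graphs_def intro: lmaps_cmaps)
 obtain f where f: "bij_betw f (half_edges G) (half_edges G')"
   "lmap_of G' = relabel (half_edges G') f (inv_into (half_edges G) f) (lmap_of G)"
  using a unfolding iso_maps_bij[OF cm] by blast
 then show "\<exists>f. marked_iso f G G'" using marked_iso_iff[OF G G' n f(1)] by blast
qed

lemma top_graph_lmap:
 assumes G: "G : top_graphs g b n" and n: "n \<ge> 1"
 shows "lmap_of G : lmaps n b (half_edges G)" "finite (half_edges G)"
 using marked_trivalent.lmap_of_lmaps[OF top_graph_locale(1)[OF G n]] top_graph_locale(3)[OF G n] G
 by (auto simp: top_graphs_def ribbon_graph_def)

text \<open>Each class corresponds to an orbit of \<open>fact M / card (Aut G)\<close> maps on
  \<open>{..<M}\<close>, and these orbits form a partition. A representative chosen by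
  \<open>SOME\<close> may live on any set of naturals of the right size, so its map is first
  transported to \<open>{..<M}\<close>. The classes are finitely many because distinct classes have
  distinct orbits inside a finite set.\<close>

theorem class_sum:
 fixes g b n :: nat
 assumes n: "n \<ge> 1"
 defines "M \<equiv> 2 * W_degree g b n"
 shows "finite (top_classes g b n)"
  and "!!C. C : top_classes g b n ==> (SOME G. G : C) : top_graphs g b n"
  and "(\<Sum>C\<in>top_classes g b n. let G = (SOME G. G : C) in lprod mu (half_edges G) (lmap_of G) / real (card (Aut G))) =
   (\<Sum>m\<in>lmaps n b {..<M}. lprod mu {..<M} m) / fact M"
proof -
 let ?S = "top_graphs g b n" and ?N = "{..<M}"
 let ?R = "{(G, G'). G : ?S \<and> G' : ?S \<and> (\<exists>f. marked_iso f G G')}"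
 define rep where "rep C = (SOME G. G : C)" for C :: "nat marked_graph set"
 define T where "T G = iso_maps ?N (half_edges G) (lmap_of G)" for G :: "nat marked_graph"
 note lm = top_graph_lmap[OF _ n]
 note cm = lmaps_cmaps[OF lm(1)]
 have cardH: "card (half_edges G) = card ?N" if "G : ?S" for G
  using top_graph_locale(2)[OF that n] by (simp add: M_def)
 have iso: "(G, G') : ?R \<longleftrightarrow> lmap_of G' : iso_maps (half_edges G') (half_edges G) (lmap_of G)" if "G : ?S" "G' : ?S" for G G'
  using marked_iso_iso_maps[OF that n] that by simp
 have eq: "equiv ?S ?R"
 proof (rule equivI)
  show "?R \<subseteq> ?S \<times> ?S" by auto
  show "refl_on ?S ?R"
  proof (rule refl_onI)
   fix G assume G: "G : ?S"
   show "(G, G) : ?R" by (rule iso[OF G G, THEN iffD2, OF iso_maps_refl[OF cm[OF G]]])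
  qed
  show "sym ?R"
  proof (rule symI)
   fix G G' assume a: "(G, G') : ?R"
   then have S: "G : ?S" "G' : ?S" by auto
   show "(G', G) : ?R"
    by (rule iso[OF S(2,1), THEN iffD2, OF iso_maps_sym[OF cm[OF S(1)] iso[OF S, THEN iffD1, OF a]]])
  qed
  show "trans ?R"
  proof (rule transI)
   fix G G' G'' assume a: "(G, G') : ?R" "(G', G'') : ?R"
   then have S: "G : ?S" "G' : ?S" "G'' : ?S" by auto
   show "(G, G'') : ?R"
    by (rule iso[OF S(1,3), THEN iffD2, OF iso_maps_trans[OF iso[OF S(1,2), THEN iffD1, OF a(1)] iso[OF S(2,3), THEN iffD1, OF a(2)]]])
  qed
 qed
 have eq_sym: "sym ?R" using eq unfolding equiv_def by (elim conjE)
 have cls: "C : top_classes g b n \<longleftrightarrow> C : ?S // ?R" for C by (simp add: top_classes_def)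
 have rep: "rep C : C" "rep C : ?S" if "C : top_classes g b n" for C
 proof -
  have "C ~= {}" "C \<subseteq> ?S" using that in_quotient_imp_non_empty[OF eq] in_quotient_imp_subset[OF eq] unfolding cls by auto
  then show "rep C : C" unfolding rep_def by (simp add: some_in_eq)
  then show "rep C : ?S" using \<open>C \<subseteq> ?S\<close> by blast
 qed
 show "!!C. C : top_classes g b n ==> (SOME G. G : C) : top_graphs g b n" using rep(2) unfolding rep_def .
 have TL: "T G \<subseteq> lmaps n b ?N" if "G : ?S" for G
  unfolding T_def iso_maps_def using relabelling.relabel_lmaps[OF _ lm(1)[OF that]] by blast
 have Tsum: "(\<Sum>m\<in>T G. lprod mu ?N m) = fact M * (lprod mu (half_edges G) (lmap_of G) / real (card (Aut G)))"
  and Tne: "T G ~= {}" if G: "G : ?S" for G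
 proof -
  have "Aut G = {h. h permutes half_edges G \<and> relabel (half_edges G) h (inv_into (half_edges G) h) (lmap_of G) = lmap_of G}"
   unfolding Aut_def using marked_iso_iff[OF G G n] permutes_imp_bij by (metis (no_types, lifting))
  then have c: "card (T G) * card (Aut G) = fact M"
   using card_iso_maps[OF cm[OF G] lm(2)[OF G] _ cardH[OF G]] cardH[OF G] by (simp add: T_def)
  then show "T G ~= {}" using fact_nonzero[of M] by (metis card.empty mult_0)
  have ne: "card (Aut G) ~= 0" using c fact_nonzero[of M] by (metis mult_0_right)
  have "lprod mu ?N m = lprod mu (half_edges G) (lmap_of G)" if "m : T G" for m
   using that relabelling.lprod_relabel[OF _ lm(2)[OF G] lm(1)[OF G]] unfolding T_def iso_maps_def by blast
  then have "(\<Sum>m\<in>T G. lprod mu ?N m) = real (card (T G)) * lprod mu (half_edges G) (lmap_of G)" by simp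
  also have "real (card (T G)) = fact M / real (card (Aut G))"
   using arg_cong[OF c, of real] ne by (simp add: field_simps)
  finally show "(\<Sum>m\<in>T G. lprod mu ?N m) = fact M * (lprod mu (half_edges G) (lmap_of G) / real (card (Aut G)))"
   by simp
 qed
 have same: "C = C'" if C: "C : top_classes g b n" "C' : top_classes g b n" and m: "m : T (rep C)" "m : T (rep C')" for C C' m
 proof -
  have "lmap_of (rep C') : iso_maps (half_edges (rep C')) ?N m"
   using iso_maps_sym[OF cm[OF rep(2)[OF C(2)]]] m(2) unfolding T_def .
  then have "lmap_of (rep C') : iso_maps (half_edges (rep C')) (half_edges (rep C)) (lmap_of (rep C))"
   by (rule iso_maps_trans[OF m(1)[unfolded T_def]])
  then have "(rep C, rep C') : ?R" by (rule iso[OF rep(2)[OF C(1)] rep(2)[OF C(2)], THEN iffD2])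
  then show ?thesis by (rule quotient_eqI[OF eq C[unfolded cls] rep(1)[OF C(1)] rep(1)[OF C(2)]])
 qed
 have inj: "inj_on (%C. T (rep C)) (top_classes g b n)"
 proof (rule inj_onI)
  fix C C' assume C: "C : top_classes g b n" "C' : top_classes g b n" and e: "T (rep C) = T (rep C')"
  obtain m where "m : T (rep C)" using Tne[OF rep(2)[OF C(1)]] by blast
  then show "C = C'" using e by (intro same[OF C, of m]) simp_all
 qed
 have "(%C. T (rep C)) ` top_classes g b n \<subseteq> Pow (lmaps n b ?N)" using TL[OF rep(2)] by blast
 then have "finite ((%C. T (rep C)) ` top_classes g b n)" by (rule finite_subset) (simp add: finite_lmaps)
 then show fin: "finite (top_classes g b n)" by (rule finite_imageD[OF _ inj])
 have union: "lmaps n b ?N = (\<Union>C\<in>top_classes g b n. T (rep C))"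
 proof (intro equalityI subsetI)
  fix m assume m: "m : lmaps n b ?N"
  obtain G where G: "G : ?S" "half_edges G = ?N" "lmap_of G = m"
   using lmaps_realised[OF _ m, of g] by (auto simp: M_def)
  let ?C = "?R `` {G}"
  have C: "?C : top_classes g b n" unfolding cls using G(1) by (rule quotientI)
  have "(G, rep ?C) : ?R" using rep(1)[OF C] unfolding Image_singleton_iff .
  then have "(rep ?C, G) : ?R" by (rule symD[OF eq_sym])
  then have "lmap_of G : iso_maps (half_edges G) (half_edges (rep ?C)) (lmap_of (rep ?C))"
   by (rule iso[OF rep(2)[OF C] G(1), THEN iffD1])
  then have "m : T (rep ?C)" unfolding T_def G(2,3) .
  then show "m : (\<Union>C\<in>top_classes g b n. T (rep C))" by (rule UN_I[OF C])
 next
  fix m assume "m : (\<Union>C\<in>top_classes g b n. T (rep C))"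
  then show "m : lmaps n b ?N" using TL[OF rep(2)] by blast
 qed
 have "(\<Sum>m\<in>lmaps n b ?N. lprod mu ?N m) = (\<Sum>C\<in>top_classes g b n. \<Sum>m\<in>T (rep C). lprod mu ?N m)" unfolding union
 proof (rule sum.UNION_disjoint[OF fin])
  show "\<forall>C\<in>top_classes g b n. finite (T (rep C))" using finite_subset[OF TL[OF rep(2)] finite_lmaps] by blast
  show "\<forall>C\<in>top_classes g b n. \<forall>C'\<in>top_classes g b n. C ~= C' --> T (rep C) \<inter> T (rep C') = {}"
  proof (intro ballI impI)
   fix C C' assume C: "C : top_classes g b n" "C' : top_classes g b n" and "C ~= C'"
   then show "T (rep C) \<inter> T (rep C') = {}" using same[OF C] by (meson disjoint_iff)
  qed
 qed
 also have "... = fact M * (\<Sum>C\<in>top_classes g b n. lprod mu (half_edges (rep C)) (lmap_of (rep C)) / real (card (Aut (rep C))))"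
  unfolding sum_distrib_left by (rule sum.cong[OF refl Tsum[OF rep(2)]])
 finally show "(\<Sum>C\<in>top_classes g b n. let G = (SOME G. G : C) in lprod mu (half_edges G) (lmap_of G) / real (card (Aut G))) =
   (\<Sum>m\<in>lmaps n b {..<M}. lprod mu {..<M} m) / fact M" by (simp add: Let_def rep_def)
qed

lemma (in marked_trivalent) edge_product:
 "(\<Prod>e\<in>E. 1 / (\<Sum>h\<in>e. half_edge_weight G mu h)) = lprod mu H (lmap_of G)"
proof -
 have "half_edge_weight G mu h = lam_opt (label_weight mu) (Some (cycle_index (cyc h)))" if "h : H" for h
  using cycle_index_half_edge[OF that] by (simp add: half_edge_weight_def label_weight_def lam_opt_def fc_sigma2)
 moreover have "e \<subseteq> H" if "e : E" for e using that unfolding edges_edge_sets edge_sets_def by auto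
 ultimately have "(\<Sum>h\<in>e. half_edge_weight G mu h) = (\<Sum>z\<in>e. lam_opt (label_weight mu) ((\<lambda>x\<in>H. Some (cycle_index (cyc x))) z))" if "e : E" for e
  using that by (intro sum.cong refl) auto
 then show ?thesis unfolding lmap_of_eq lprod_def prod.case edges_edge_sets[symmetric] by simp
qed

text \<open>Each cell contributes the symplectic constant, with \<open>M div 3\<close> the number of
  vertices, times its edge product; counting orbits then replaces the weighted classes by labelled
  maps.\<close>

theorem W_formula:
 fixes g b n :: nat
 assumes n: "n \<ge> 1" and mu: "!!i. i : {1..n} ==> mu i > 0"
 defines "M \<equiv> 2 * W_degree g b n"
 shows "W g b n mu = sqrt (2 ^ (M div 3)) / (fact b * fact M) * (\<Sum>m\<in>lmaps n b {..<M}. lprod mu {..<M} m)"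
proof -
 note cs = class_sum[OF n]
 let ?TC = "top_classes g b n" and ?rep = "%C. SOME G. G : C"
 let ?I = "%x y. indicator (({1..n} \<rightarrow>\<^sub>E {0<..}) \<times> ({1..b} \<rightarrow>\<^sub>E {0<..})) (x, y) :: real"
 let ?x = "%x. exp (- (\<Sum>i=1..n. mu i * x i))"
 let ?v = "%G. lprod mu (half_edges G) (lmap_of G)"
 let ?k = "sqrt (2 ^ (M div 3))"
 have one: "has_bochner_integral (lebn {1..n} \<Otimes>\<^sub>M lebn {1..b})
   (%(x, y). ?I x y * (?x x * cell_volume G (3*g + n + b - 3) x y)) (?k * ?v G)" if G: "G : top_graphs g b n" for G
 proof -
  interpret marked_trivalent G n b "3*g + n + b - 3" by (rule top_graph_locale(1)[OF G n])
  show ?thesis using cell_volume_integral[OF mu] top_graph_locale(2)[OF G n] unfolding edge_product M_def by simp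
 qed
 have "has_bochner_integral (lebn {1..n} \<Otimes>\<^sub>M lebn {1..b})
   (%z. \<Sum>C\<in>?TC. 1 / (fact b * real (card (Aut (?rep C)))) *
    (case z of (x, y) => ?I x y * (?x x * cell_volume (?rep C) (3*g + n + b - 3) x y)))
   (\<Sum>C\<in>?TC. 1 / (fact b * real (card (Aut (?rep C)))) * (?k * ?v (?rep C)))"
  by (intro has_bochner_integral_sum has_bochner_integral_mult_right one cs(2))
 moreover have "(%z. \<Sum>C\<in>?TC. 1 / (fact b * real (card (Aut (?rep C)))) *
    (case z of (x, y) => ?I x y * (?x x * cell_volume (?rep C) (3*g + n + b - 3) x y))) =
   (%(x, y). ?I x y * (?x x * Vol g b n x y))"
  by (auto simp: fun_eq_iff Vol_def Let_def sum_distrib_left intro!: sum.cong)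
 ultimately have "W g b n mu = (\<Sum>C\<in>?TC. 1 / (fact b * real (card (Aut (?rep C)))) * (?k * ?v (?rep C)))"
  unfolding W_def by (simp add: has_bochner_integral_iff)
 also have "... = ?k / fact b * (\<Sum>C\<in>?TC. ?v (?rep C) / real (card (Aut (?rep C))))" by (simp add: sum_distrib_left)
 also have "(\<Sum>C\<in>?TC. ?v (?rep C) / real (card (Aut (?rep C)))) = (\<Sum>m\<in>lmaps n b {..<M}. lprod mu {..<M} m) / fact M"
  using cs(3)[of mu g b] unfolding Let_def M_def .
 finally show ?thesis by simp
qed

section \<open>From labelled to coloured maps\<close>

definition face_cycles :: "'h set => ('h, 'n) cmap => 'h set set" where
 "face_cycles H m = (case m of (a, t, c) => orbit (%x. a (a (t x))) ` {x : H. c x ~= None})"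

definition typed_maps :: "nat => nat => 'h set => ('h, 'n) cmap set" where
 "typed_maps n b H = {m : free_maps H. cconn H m \<and> card (bdry_cycles H m) = b \<and> card (face_cycles H m) = n}"

definition recolour :: "'h set => (nat => 'n) => ('h, nat + nat) cmap => ('h, 'n) cmap" where
 "recolour H \<phi> m = (case m of (a, s, l) =>
   (a, s, \<lambda>x\<in>H. case l x of Some (Inl i) => Some (\<phi> i) | _ => None))"

definition free_weight :: "('n => real) => 'h set => ('h, 'n) cmap => real" where
 "free_weight lam H m = (case m of (a, s, c) => \<Prod>e\<in>edge_sets H s. 1 / (\<Sum>z\<in>e. lam_opt lam (c z)))"

lemma recolour_typed:
 assumes H: "finite H" and m: "(a, s, l) : lmaps n b H"
 shows "recolour H \<phi> (a, s, l) : typed_maps n b H"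
  and "lprod (%i. lam (\<phi> i)) H (a, s, l) = free_weight lam H (recolour H \<phi> (a, s, l))"
proof -
 note D = m[unfolded lmaps_def mem_Collect_eq prod.case]
 note fm = conjunct1[OF D] and adj = conjunct2[OF conjunct2[OF conjunct2[OF conjunct2[OF D]]], rule_format]
 interpret cubic_map H a s by (rule free_maps_cubic[OF H fm])
 note L = lmaps_bijections[OF m]
 define c where "c = (\<lambda>x\<in>H. case l x of Some (Inl i) => Some (\<phi> i) | _ => None)"
 have r: "recolour H \<phi> (a, s, l) = (a, s, c)" by (simp add: recolour_def c_def)
 have cN: "c x = None \<longleftrightarrow> (\<exists>i. l x = Some (Inr i))" if "x : H" for x using L(3)[OF that] that by (auto simp: c_def)
 have cN': "c x ~= None \<longleftrightarrow> (\<exists>i. l x = Some (Inl i))" if "x : H" for x using L(3)[OF that] that by (auto simp: c_def)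
 have "c (s x) ~= None" if "x : H" "c x = None" for x using adj[OF that(1)] cN[OF that(1)] cN[of "s x"] that by auto
 moreover have "c (a (a (s x))) = c x" if "x : H" for x
  using free_maps_colour[OF fm that, of "fc x"] that unfolding fc_alt[symmetric] by (simp add: c_def orbit.base)
 ultimately have "(a, s, c) : free_maps H"
  unfolding free_maps_def cmaps_def using a_perm s_perm a_ne a_cube s_ne s_s by (auto simp: c_def)
 moreover have "cconn H (a, s, c)" using conjunct1[OF conjunct2[OF D]] by (simp add: cconn_def)
 moreover have "bdry_cycles H (a, s, c) = cyc ` {x : H. \<exists>i. l x = Some (Inr i)}"
  unfolding bdry_cycles_def prod.case fc_fun by (rule arg_cong[where f = "image cyc"]) (use cN in auto)
 moreover have "face_cycles H (a, s, c) = cyc ` {x : H. \<exists>i. l x = Some (Inl i)}"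
  unfolding face_cycles_def prod.case fc_fun by (rule arg_cong[where f = "image cyc"]) (use cN' in auto)
 ultimately show "recolour H \<phi> (a, s, l) : typed_maps n b H"
  unfolding typed_maps_def r using bij_betw_same_card[OF L(1)] bij_betw_same_card[OF L(2)] by simp
 have "lam_opt (label_weight (%i. lam (\<phi> i))) (l z) = lam_opt lam (c z)" if "z : H" for z
  using L(3)[OF that] that by (auto simp: c_def lam_opt_def label_weight_def)
 moreover have "e \<subseteq> H" if "e : edge_sets H s" for e using that by (auto simp: edge_sets_def)
 ultimately show "lprod (%i. lam (\<phi> i)) H (a, s, l) = free_weight lam H (recolour H \<phi> (a, s, l))"
  unfolding r lprod_def free_weight_def prod.case by (intro prod.cong refl arg_cong2[of _ _ _ _ "(/)"] sum.cong) auto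
qed

text \<open>A point of the fibre is a numbering of the face cycles and one of the boundary cycles;
  the colour function on \<open>{1..n}\<close> is then forced. The two factorials cancel the
  \<open>1 / fact n\<close> of the formula and the \<open>1 / fact b\<close> of the volume.\<close>

lemma card_recolour_fibre:
 fixes m :: "('h, 'n) cmap"
 assumes H: "finite H" and m: "m : typed_maps n b H"
 shows "card {z : ({1..n} \<rightarrow>\<^sub>E UNIV) \<times> lmaps n b H. recolour H (fst z) (snd z) = m} = fact n * fact b"
proof -
 obtain a s c where m': "m = (a, s, c)" by (cases m)
 have fm: "(a, s, c) : free_maps H" and conn: "cconn H (a, s, c)"
  and cb: "card (bdry_cycles H (a, s, c)) = b" and cf: "card (face_cycles H (a, s, c)) = n"
  using m by (auto simp: m' typed_maps_def)
 interpret cubic_map H a s by (rule free_maps_cubic[OF H fm])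
 define F where "F = cyc ` {x : H. c x ~= None}"
 define B where "B = cyc ` {x : H. c x = None}"
 have cF: "card F = n" using cf unfolding face_cycles_def prod.case fc_fun F_def .
 have cB: "card B = b" using cb unfolding bdry_cycles_def prod.case fc_fun B_def .
 have fin: "finite F" "finite B" using H by (auto simp: F_def B_def)
 have cp: "c (pick (cyc x)) = c x" if "x : H" for x by (rule free_maps_colour[OF fm that pick_cyc])
 have cycp: "cyc (pick (cyc x)) = cyc x" for x by (rule cyc_eq[OF pick_cyc])
 have cfc: "c (fc x) = c x" if "x : H" for x by (rule free_maps_colour[OF fm that]) (rule orbit.base)
 have pH: "pick (cyc x) : H" if "x : H" for x using pick_cyc cyc_subset[OF that] by auto
 have xF: "cyc x : F" if "x : H" "c x ~= None" for x using that by (auto simp: F_def)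
 have xB: "cyc x : B" if "x : H" "c x = None" for x using that by (auto simp: B_def)
 define P where "P = {p : F \<rightarrow>\<^sub>E {1..n}. bij_betw p F {1..n}}"
 define Q where "Q = {q : B \<rightarrow>\<^sub>E {1..b}. bij_betw q B {1..b}}"
 let ?Z = "{z : ({1..n} \<rightarrow>\<^sub>E UNIV) \<times> lmaps n b H. recolour H (fst z) (snd z) = m}"
 define lab where "lab p q = (\<lambda>x\<in>H. Some (if c x = None then Inr (q (cyc x)) else Inl (p (cyc x))))" for p q :: "'h set => nat"
 define col where "col p = (\<lambda>i\<in>{1..n}. the (c (pick (inv_into F p i))))" for p
 define pl where "pl l = (\<lambda>C\<in>F. projl (the (l (pick C))))" for l :: "'h => (nat + nat) option"
 define qr where "qr l = (\<lambda>C\<in>B. projr (the (l (pick C))))" for l :: "'h => (nat + nat) option"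
 \<comment> \<open>Numberings \<open>p\<close> and \<open>q\<close> determine a labelled map through
   \<open>lab\<close> and its colour function through \<open>col\<close>; the inverse reads the
   numbers off at an arbitrary point of each cycle.\<close>
 let ?f = "%(p, q). (col p, (a, s, lab p q))"
  and ?h = "%(\<phi> :: nat => 'n, (a :: 'h => 'h, s :: 'h => 'h, l)). (pl l, qr l)"
 have "bij_betw ?f (P \<times> Q) ?Z"
 proof (rule bij_betw_byWitness[where f' = ?h])
  show "\<forall>z\<in>P \<times> Q. ?h (?f z) = z"
  proof
   fix z assume "z : P \<times> Q"
   then obtain p q where z: "z = (p, q)" and p: "p : F \<rightarrow>\<^sub>E {1..n}" and q: "q : B \<rightarrow>\<^sub>E {1..b}"
    by (auto simp: P_def Q_def)
   have "pl (lab p q) = p"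
   proof (rule PiE_ext[of _ F "%_. UNIV"])
    show "p : F \<rightarrow>\<^sub>E UNIV" using p by auto
    fix C assume "C : F"
    then obtain x where "x : H" "c x ~= None" "C = cyc x" by (auto simp: F_def)
    then show "pl (lab p q) C = p C" using xF by (auto simp: pl_def lab_def pH cp cycp)
   qed (simp add: pl_def)
   moreover have "qr (lab p q) = q"
   proof (rule PiE_ext[of _ B "%_. UNIV"])
    show "q : B \<rightarrow>\<^sub>E UNIV" using q by auto
    fix C assume "C : B"
    then obtain x where "x : H" "c x = None" "C = cyc x" by (auto simp: B_def)
    then show "qr (lab p q) C = q C" using xB by (auto simp: qr_def lab_def pH cp cycp)
   qed (simp add: qr_def)
   ultimately show "?h (?f z) = z" by (simp add: z)
  qed
  have inZ: "\<exists>\<phi> l. z = (\<phi>, (a, s, l)) \<and> \<phi> : {1..n} \<rightarrow>\<^sub>E UNIV \<and> (a, s, l) : lmaps n b H \<and>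
    c = (\<lambda>x\<in>H. case l x of Some (Inl i) => Some (\<phi> i) | _ => None)" if zZ: "z : ?Z" for z
  proof -
   obtain \<phi> a' s' l where z: "z = (\<phi>, (a', s', l))" by (metis prod.collapse)
   have "\<phi> : {1..n} \<rightarrow>\<^sub>E UNIV" "(a', s', l) : lmaps n b H" "recolour H \<phi> (a', s', l) = m"
    using zZ unfolding z by simp_all
   then show ?thesis unfolding z recolour_def m' by auto
  qed
  have str: "pl l : P" "qr l : Q" "!!x. x : H ==> l x = Some (if c x = None then Inr (qr l (cyc x)) else Inl (pl l (cyc x)))"
    "!!x. x : H ==> c x ~= None ==> c x = Some (\<phi> (pl l (cyc x)))"
   if lm: "(a, s, l) : lmaps n b H" and cl: "c = (\<lambda>x\<in>H. case l x of Some (Inl i) => Some (\<phi> i) | _ => None)" for \<phi> l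
  proof -
   note L = lmaps_bijections[OF lm]
   have fml: "(a, s, l) : free_maps H" using lm by (simp add: lmaps_def)
   have lp: "l (pick (cyc x)) = l x" if "x : H" for x by (rule free_maps_colour[OF fml that pick_cyc])
   have cN: "c x = None \<longleftrightarrow> (\<exists>i. l x = Some (Inr i))" "c x ~= None \<longleftrightarrow> (\<exists>i. l x = Some (Inl i))" if "x : H" for x
    using L(3)[OF that] that by (auto simp: cl)
   have FB: "F = cyc ` {x : H. \<exists>i. l x = Some (Inl i)}" "B = cyc ` {x : H. \<exists>i. l x = Some (Inr i)}"
   proof -
    have "{x : H. c x ~= None} = {x : H. \<exists>i. l x = Some (Inl i)}" "{x : H. c x = None} = {x : H. \<exists>i. l x = Some (Inr i)}"
     using cN by blast+
    then show "F = cyc ` {x : H. \<exists>i. l x = Some (Inl i)}" "B = cyc ` {x : H. \<exists>i. l x = Some (Inr i)}"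
     unfolding F_def B_def by simp_all
   qed
   have "bij_betw (pl l) F {1..n}" using L(1) unfolding FB(1)[symmetric]
    by (rule bij_betw_cong[THEN iffD1, rotated]) (simp add: pl_def)
   then show "pl l : P" unfolding P_def by (auto simp: pl_def dest: bij_betwE)
   have "bij_betw (qr l) B {1..b}" using L(2) unfolding FB(2)[symmetric]
    by (rule bij_betw_cong[THEN iffD1, rotated]) (simp add: qr_def)
   then show "qr l : Q" unfolding Q_def by (auto simp: qr_def dest: bij_betwE)
   show lx: "l x = Some (if c x = None then Inr (qr l (cyc x)) else Inl (pl l (cyc x)))" if x: "x : H" for x
   proof (cases "c x = None")
    case True
    then obtain i where "l x = Some (Inr i)" using cN(1)[OF x] by auto
    then show ?thesis using True lp[OF x] xB[OF x True] by (simp add: qr_def)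
   next
    case False
    then obtain i where "l x = Some (Inl i)" using cN(2)[OF x] by auto
    then show ?thesis using False lp[OF x] xF[OF x False] by (simp add: pl_def)
   qed
   show "c x = Some (\<phi> (pl l (cyc x)))" if x: "x : H" "c x ~= None" for x
   proof -
    have "l x = Some (Inl (pl l (cyc x)))" using lx[OF x(1)] x(2) by simp
    then show ?thesis using x(1) fun_cong[OF cl, of x] by simp
   qed
  qed
  have colp: "col p (p (cyc x)) = the (c x)" if p: "p : P" and x: "x : H" "c x ~= None" for p x
  proof -
   have b: "bij_betw p F {1..n}" using p by (simp add: P_def)
   have "p (cyc x) : {1..n}" using bij_betwE[OF b] xF[OF x] by blast
   moreover have "inv_into F p (p (cyc x)) = cyc x" using bij_betw_inv_into_left[OF b xF[OF x]] .
   ultimately show ?thesis by (simp add: col_def cp[OF x(1)])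
  qed
  show "\<forall>z\<in>?Z. ?f (?h z) = z"
  proof
   fix z assume "z : ?Z"
   then obtain \<phi> l where z: "z = (\<phi>, (a, s, l))" and phi: "\<phi> : {1..n} \<rightarrow>\<^sub>E UNIV" and lm: "(a, s, l) : lmaps n b H"
    and cl: "c = (\<lambda>x\<in>H. case l x of Some (Inl i) => Some (\<phi> i) | _ => None)" using inZ by blast
   note S = str[OF lm cl]
   have "lab (pl l) (qr l) = l"
   proof (rule PiE_ext[of _ H "%_. UNIV"])
    show "l : H \<rightarrow>\<^sub>E UNIV" using cmapsD(6)[OF lmaps_cmaps[OF lm]] .
    show "lab (pl l) (qr l) x = l x" if "x : H" for x using S(3)[OF that] that by (simp add: lab_def)
   qed (simp add: lab_def)
   moreover have "col (pl l) = \<phi>"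
   proof (rule PiE_ext[OF _ phi])
    fix i assume i: "i : {1..n}"
    have b: "bij_betw (pl l) F {1..n}" using S(1) by (simp add: P_def)
    then have "i : pl l ` F" using i by (simp add: bij_betw_def)
    then obtain C where "C : F" "pl l C = i" by blast
    then obtain x where x: "x : H" "c x ~= None" "pl l (cyc x) = i" by (auto simp: F_def)
    show "col (pl l) i = \<phi> i" using colp[OF S(1) x(1,2)] S(4)[OF x(1,2)] x(3) by simp
   qed (simp add: col_def)
   ultimately show "?f (?h z) = z" by (simp add: z)
  qed
  show "?h ` ?Z \<subseteq> P \<times> Q"
  proof (rule image_subsetI)
   fix z assume "z : ?Z"
   then obtain \<phi> l where z: "z = (\<phi>, (a, s, l))" and lm: "(a, s, l) : lmaps n b H"
    and cl: "c = (\<lambda>x\<in>H. case l x of Some (Inl i) => Some (\<phi> i) | _ => None)" using inZ by blast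
   show "?h z : P \<times> Q" using str(1,2)[OF lm cl] by (simp add: z)
  qed
  show "?f ` (P \<times> Q) \<subseteq> ?Z"
  proof (rule image_subsetI)
   fix z assume "z : P \<times> Q"
   then obtain p q where z: "z = (p, q)" and pP: "p : P" and qQ: "q : Q" by auto
   have p: "bij_betw p F {1..n}" and q: "bij_betw q B {1..b}" using pP qQ by (simp_all add: P_def Q_def)
   let ?l = "lab p q"
   have l: "?l x = Some (if c x = None then Inr (q (cyc x)) else Inl (p (cyc x)))" if "x : H" for x
    using that by (simp add: lab_def)
   have "(a, s, ?l) : free_maps H" unfolding free_maps_def cmaps_def using a_perm s_perm a_ne a_cube s_ne s_s
    by (auto simp: fc_alt[symmetric] lab_def cfc)
   moreover have "cconn H (a, s, ?l)" using conn by (simp add: cconn_def)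
   moreover have "y : orbit (%x. a (a (s x))) x" if xy: "x : H" "y : H" "?l x = ?l y" for x y
   proof -
    have "cyc x = cyc y"
    proof (cases "c x = None")
     case True
     then have "c y = None" "q (cyc x) = q (cyc y)" using xy(3) unfolding l[OF xy(1)] l[OF xy(2)] by (auto split: if_splits)
     then show ?thesis using inj_onD[OF bij_betw_imp_inj_on[OF q]] xB xy(1,2) True by blast
    next
     case False
     then have "c y ~= None" "p (cyc x) = p (cyc y)" using xy(3) unfolding l[OF xy(1)] l[OF xy(2)] by (auto split: if_splits)
     then show ?thesis using inj_onD[OF bij_betw_imp_inj_on[OF p]] xF xy(1,2) False by blast
    qed
    then show ?thesis unfolding fc_fun using self_cyc[of y] by simp
   qed
   moreover have "?l ` H = Some ` ({1..n} <+> {1..b})"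
   proof -
    have "H = {x : H. c x ~= None} \<union> {x : H. c x = None}" by auto
    then have "?l ` H = ?l ` {x : H. c x ~= None} \<union> ?l ` {x : H. c x = None}" by (metis image_Un)
    also have "?l ` {x : H. c x ~= None} = (%x. Some (Inl (p (cyc x)))) ` {x : H. c x ~= None}"
     by (rule image_cong) (auto simp: lab_def)
    also have "... = Some ` Inl ` p ` F" unfolding F_def by (simp add: image_image)
    also have "p ` F = {1..n}" using p by (simp add: bij_betw_def)
    also have "?l ` {x : H. c x = None} = (%x. Some (Inr (q (cyc x)))) ` {x : H. c x = None}"
     by (rule image_cong) (auto simp: lab_def)
    also have "... = Some ` Inr ` q ` B" unfolding B_def by (simp add: image_image)
    also have "q ` B = {1..b}" using q by (simp add: bij_betw_def)
    finally show ?thesis by (simp add: Plus_def image_Un)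
   qed
   moreover have "?l (s x) ~= Some (Inr j)" if "x : H" "?l x = Some (Inr i)" for x i j
   proof -
    have "c x = None" using that(2) unfolding l[OF that(1)] by (auto split: if_splits)
    then have "c (s x) ~= None" using fm that(1) by (auto simp: free_maps_def cmaps_def)
    then show ?thesis using that(1) by (auto simp: lab_def)
   qed
   ultimately have "(a, s, ?l) : lmaps n b H" unfolding lmaps_def by blast
   moreover have "recolour H (col p) (a, s, ?l) = m"
   proof -
    have "(\<lambda>x\<in>H. case ?l x of Some (Inl i) => Some (col p i) | _ => None) = c"
    proof (rule PiE_ext[of _ H "%_. UNIV"])
     show "c : H \<rightarrow>\<^sub>E UNIV" using fm by (simp add: free_maps_def cmaps_def)
     fix x assume x: "x : H"
     show "(\<lambda>x\<in>H. case ?l x of Some (Inl i) => Some (col p i) | _ => None) x = c x"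
      using x l[OF x] colp[OF pP x] by (cases "c x = None") auto
    qed simp
    then show ?thesis by (simp add: recolour_def m')
   qed
   moreover have "col p : {1..n} \<rightarrow>\<^sub>E UNIV" by (simp add: col_def)
   ultimately show "?f z : ?Z" by (simp add: z)
  qed
 qed
 from bij_betw_same_card[OF this] have "card ?Z = card P * card Q" by (simp add: card_cartesian_product)
 moreover have "card P = fact n" using card_bijections[OF fin(1), of "{1..n}"] cF by (simp add: P_def)
 moreover have "card Q = fact b" using card_bijections[OF fin(2), of "{1..b}"] cB by (simp add: Q_def)
 ultimately show ?thesis by simp
qed

theorem sum_recolour:
 fixes lam :: "'n::finite => real"
 assumes H: "finite H"
 shows "(\<Sum>\<phi>\<in>{1..n} \<rightarrow>\<^sub>E UNIV. \<Sum>m\<in>lmaps n b H. lprod (%i. lam (\<phi> i)) H m) =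
  fact n * fact b * (\<Sum>m\<in>typed_maps n b H. free_weight lam H m)"
proof -
 let ?A = "({1..n} \<rightarrow>\<^sub>E (UNIV :: 'n set)) \<times> lmaps n b H"
 let ?r = "%z. recolour H (fst z) (snd z)"
 have finA: "finite ?A" using finite_lmaps[OF H] by (intro finite_cartesian_product finite_PiE) auto
 have finT: "finite (typed_maps n b H :: ('a, 'n) cmap set)"
  by (rule finite_subset[OF _ finite_free_maps[OF H]]) (auto simp: typed_maps_def)
 have rA: "?r z : typed_maps n b H" "lprod (%i. lam (fst z i)) H (snd z) = free_weight lam H (?r z)" if zA: "z : ?A" for z
 proof -
  obtain \<phi> a s l where z: "z = (\<phi>, (a, s, l))" by (metis prod.collapse)
  have lm: "(a, s, l) : lmaps n b H" using zA by (simp add: z)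
  show "?r z : typed_maps n b H" "lprod (%i. lam (fst z i)) H (snd z) = free_weight lam H (?r z)"
   using recolour_typed(1)[OF H lm, of \<phi>] recolour_typed(2)[OF H lm, of lam \<phi>] by (simp_all add: z)
 qed
 have "(\<Sum>\<phi>\<in>{1..n} \<rightarrow>\<^sub>E UNIV. \<Sum>m\<in>lmaps n b H. lprod (%i. lam (\<phi> i)) H m) = (\<Sum>z\<in>?A. free_weight lam H (?r z))"
  unfolding sum.cartesian_product by (rule sum.cong[OF refl]) (use rA(2) in auto)
 also have "... = (\<Sum>m\<in>typed_maps n b H. \<Sum>z\<in>{z : ?A. ?r z = m}. free_weight lam H (?r z))"
  using rA(1) by (intro sum.group[symmetric] finA finT) blast
 also have "... = (\<Sum>m\<in>typed_maps n b H. fact n * fact b * free_weight lam H m)"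
 proof (rule sum.cong[OF refl])
  fix m :: "('a, 'n) cmap" assume m: "m : typed_maps n b H"
  have "(\<Sum>z\<in>{z : ?A. ?r z = m}. free_weight lam H (?r z)) = real (card {z : ?A. ?r z = m}) * free_weight lam H m" by simp
  then show "(\<Sum>z\<in>{z : ?A. ?r z = m}. free_weight lam H (?r z)) = fact n * fact b * free_weight lam H m"
   using card_recolour_fibre[OF H m] by simp
 qed
 finally show ?thesis by (simp add: sum_distrib_left)
qed

section \<open>The main theorem\<close>

text \<open>The number of vertices is even, here \<open>2 * j\<close>, so the sign in the cube of
  \<open>kp_scale\<close> disappears and \<open>2 ^ j\<close> is the symplectic constant.\<close>

lemma kp_scale_power:
 "kp_scale ^ (2 * W_degree g b n) = of_real (sqrt (2 ^ (2 * W_degree g b n div 3)))"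
proof -
 define j where "j = 2 * g + n + b - 2"
 have W: "2 * W_degree g b n = 3 * (2 * j)" unfolding W_degree_def j_def by presburger
 have "kp_scale ^ (3 * (2 * j)) = (kp_scale ^ 3) ^ (2 * j)" by (rule power_mult)
 also have "... = ((of_real (sqrt 2)) ^ 2) ^ j" by (simp add: kp_scale_cube power_mult)
 also have "(complex_of_real (sqrt 2)) ^ 2 = 2" by (simp add: power2_eq_square flip: of_real_mult)
 finally have k: "kp_scale ^ (3 * (2 * j)) = 2 ^ j" .
 have "sqrt (2 ^ (2 * j)) = 2 ^ j" by (simp add: power_mult real_sqrt_power power2_eq_square mult.commute[of 2 j])
 then show ?thesis unfolding W k by simp
qed

lemma conn_sum_1:
 assumes H: "finite H"
 shows "conn_sum 1 (%_ _. 0) lam H = (\<Sum>m\<in>{m : (free_maps H :: ('h, 'n::finite) cmap set). cconn H m}.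
  Q_monom (of_real (free_weight lam H m)) (card (bdry_cycles H m)))" unfolding conn_sum_def
proof (rule sum.mono_neutral_cong_right)
 show "finite {m. m : (cmaps H :: ('h, 'n) cmap set) \<and> cconn H m}" by (rule finite_subset[OF _ finite_cmaps[OF H]]) auto
 show "{m : free_maps H. cconn H m} \<subseteq> {m. m : cmaps H \<and> cconn H m}" by (auto simp: free_maps_def)
 show "\<forall>m\<in>{m. m : cmaps H \<and> cconn H m} - {m : free_maps H. cconn H m}. cweight 1 (%_ _. 0) lam H m = 0"
 proof
  fix m :: "('h, 'n) cmap" assume m: "m : {m. m : cmaps H \<and> cconn H m} - {m : free_maps H. cconn H m}"
  obtain a t c where m': "m = (a, t, c)" by (cases m)
  have cm: "(a, t, c) : cmaps H" and "\<not> (\<forall>x\<in>H. t x ~= x)" using m by (auto simp: m' free_maps_def)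
  then show "cweight 1 (%_ _. 0) lam H m = 0" unfolding m' cweight_1[OF H cm] by auto
 qed
 fix m :: "('h, 'n) cmap" assume m: "m : {m : free_maps H. cconn H m}"
 obtain a t c where m': "m = (a, t, c)" by (cases m)
 have cm: "(a, t, c) : cmaps H" and t: "\<forall>x\<in>H. t x ~= x" using m by (auto simp: m' free_maps_def)
 show "cweight 1 (%_ _. 0) lam H m = Q_monom (of_real (free_weight lam H m)) (card (bdry_cycles H m))"
  unfolding m' cweight_1[OF H cm] using t by (simp add: free_weight_def)
qed

context cubic_map
begin

lemma card_edge_sets: "card H = 2 * card (edge_sets H s)"
proof -
 have e: "edge_sets H s = (%x. {x, s x}) ` H" using s_ne by (auto simp: edge_sets_def)
 have "\<Union>(edge_sets H s) = H" unfolding e by auto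
 moreover have "2 * card (edge_sets H s) = card (\<Union>(edge_sets H s))"
 proof (rule card_partition)
  fix c c' assume "c : edge_sets H s" "c' : edge_sets H s" and ne: "c ~= c'"
  then obtain x y where xy: "x : H" "c = {x, s x}" "y : H" "c' = {y, s y}" unfolding e by auto
  show "c \<inter> c' = {}"
  proof (rule ccontr)
   assume "c \<inter> c' ~= {}"
   then obtain z where z: "z = x \<or> z = s x" "z = y \<or> z = s y" unfolding xy by blast
   have "c = {z, s z}" using z(1) xy(2) s_s[OF xy(1)] by (elim disjE) (simp_all add: insert_commute)
   moreover have "c' = {z, s z}" using z(2) xy(4) s_s[OF xy(3)] by (elim disjE) (simp_all add: insert_commute)
   ultimately show False using ne by simp
  qed
 next
  fix c assume "c : edge_sets H s"
  then obtain x where x: "x : H" "c = {x, s x}" unfolding e by auto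
  then show "card c = 2" using s_ne[OF x(1)] by simp
 qed (use finite_H calculation in \<open>simp_all add: e\<close>)
 ultimately show ?thesis by simp
qed

end

text \<open>The genus comes from the Euler bound. To show that the type is inhabited, the map is
  given labels, which exist because a fibre of size \<open>fact n * fact b\<close> is not empty, and
  the labelled map is realised as a graph.\<close>

lemma typed_maps_ribbon_type:
 fixes m :: "(nat, 'n) cmap"
 assumes m: "m : free_maps {..<M}" and conn: "cconn {..<M} m"
 shows "\<exists>g. (g, card (bdry_cycles {..<M} m), card (face_cycles {..<M} m)) : ribbon_types \<and>
  2 * W_degree g (card (bdry_cycles {..<M} m)) (card (face_cycles {..<M} m)) = M"
proof -
 obtain a s c where m': "m = (a, s, c)" by (cases m)
 define H where "H = {..<M}"
 have fm: "(a, s, c) : free_maps H" and cn: "cconn H (a, s, c)" using m conn by (simp_all add: m' H_def)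
 have finH: "finite H" by (simp add: H_def)
 interpret cubic_map H a s by (rule free_maps_cubic[OF finH fm])
 define n where "n = card (face_cycles H m)"
 define b where "b = card (bdry_cycles H m)"
 let ?F = "cyc ` {x : H. c x ~= None}" and ?B = "cyc ` {x : H. c x = None}"
 have n': "n = card ?F" and b': "b = card ?B" by (simp_all add: n_def b_def m' face_cycles_def bdry_cycles_def fc_fun)
 have ne: "H ~= {}" using cn by (simp add: cconn_def)
 have "\<exists>x\<in>H. c x ~= None"
 proof -
  obtain x where x: "x : H" using ne by auto
  have "c x = None ==> c (s x) ~= None" using fm x by (auto simp: free_maps_def cmaps_def)
  then show ?thesis using x s_H[of x] by (cases "c x = None") (auto intro: bexI[of _ "s x"])
 qed
 then have n: "n \<ge> 1" unfolding n' using finH by (auto simp: Suc_le_eq card_gt_0_iff)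
 have "?F \<inter> ?B = {}"
 proof -
  have "cyc x ~= cyc y" if "x : H" "y : H" "c x ~= None" "c y = None" for x y
  proof
   assume "cyc x = cyc y"
   then have "y : cyc x" using self_cyc[of y] by simp
   then have "c y = c x" by (rule free_maps_colour[OF fm that(1)])
   then show False using that by simp
  qed
  then show ?thesis by auto
 qed
 moreover have "cyc ` H = ?F \<union> ?B"
 proof -
  have "{x : H. c x ~= None} \<union> {x : H. c x = None} = H" by auto
  then show ?thesis unfolding image_Un[symmetric] by simp
 qed
 ultimately have nb: "card (cyc ` H) = n + b" unfolding n' b' using finH by (simp add: card_Un_disjoint)
 \<comment> \<open>The face permutation is \<open>inv a \<circ> s\<close>, so the genus is computed
   for \<open>inv a\<close>, which has the same cycles as \<open>a\<close>.\<close>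
 have ia: "inv a permutes H" by (rule permutes_inv[OF a_perm])
 have perm: "permutation a" using a_perm finite_H permutation_permutes by blast
 have "\<exists>g. int (card (cycles_on H (inv a))) - int (card (edge_sets H s)) + int (card (cycles_on H (inv a \<circ> s))) = 2 - 2 * int g"
 proof (rule genus_exists[OF finH ne ia])
  show "s x : H \<and> s x ~= x \<and> s (s x) = x" if "x : H" for x using s_ne[OF that] s_s[OF that] that by simp
  show "s x = x" if "x ~: H" for x using permutes_not_in[OF s_perm that] .
  fix K assume K: "K \<subseteq> H" "K ~= {}" "inv a ` K \<subseteq> K" "s ` K \<subseteq> K"
  have "a x : K" if "x : K" for x
  proof -
   have "inv a (inv a x) : K" using that K(3) by blast
   moreover have "inv a (inv a x) = a x" using a_cube[of x] that K(1) by (auto simp: inv_a)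
   ultimately show ?thesis by simp
  qed
  then have "K \<subseteq> H \<and> K ~= {} \<and> a ` K \<subseteq> K \<and> s ` K \<subseteq> K" using K by auto
  then show "K = H" using conjunct2[OF cn[unfolded cconn_def prod.case]] by simp
 qed
 moreover have "cycles_on H (inv a) = cycles_on H a" unfolding cycles_on_def orbit_inv_eq[OF perm] ..
 moreover have "cycles_on H (inv a \<circ> s) = cyc ` H" unfolding cycles_on_def fc_def ..
 ultimately obtain g where g: "int (card (cycles_on H a)) - int (card (edge_sets H s)) + (int n + int b) = 2 - 2 * int g"
  using nb by auto
 have cM: "card H = M" by (simp add: H_def)
 have W: "2 * W_degree g b n = M" using g card_vertices card_edge_sets unfolding W_degree_def cM by presburger
 have "m : typed_maps n b H" using fm cn by (simp add: typed_maps_def m' n_def b_def)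
 note fibre = card_recolour_fibre[OF finH this]
 have "lmaps n b H ~= {}"
 proof
  assume "lmaps n b H = {}"
  then show False using fibre by simp
 qed
 then obtain l where "l : lmaps n b H" by blast
 then obtain G where G: "G : top_graphs g b n" using lmaps_realised[OF finH _ , of l n b g] W cM by auto
 \<comment> \<open>\<open>ribbon_types\<close> asks for graphs without markings, so the label fields
   are dropped.\<close>
 define G0 :: "nat ribbon_graph" where "G0 = \<lparr>half_edges = half_edges G, sigma0 = sigma0 G, sigma1 = sigma1 G,
  sigma2 = sigma2 G, bdry_half_edges = bdry_half_edges G\<rparr>"
 have f: "half_edges G0 = half_edges G" "sigma0 G0 = sigma0 G" "sigma1 G0 = sigma1 G" "sigma2 G0 = sigma2 G"
  "bdry_half_edges G0 = bdry_half_edges G" by (simp_all add: G0_def)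
 have v: "vertices G0 = vertices G" "edges G0 = edges G" "faces G0 = faces G" "boundaries G0 = boundaries G"
  unfolding vertices_def edges_def faces_def boundaries_def f by (rule refl)+
 have "ribbon_graph G0 \<longleftrightarrow> ribbon_graph G" "connected_graph G0 \<longleftrightarrow> connected_graph G" "has_type G0 g b n \<longleftrightarrow> has_type G g b n"
  unfolding ribbon_graph_def connected_graph_def has_type_def f v by (rule refl)+
 then have "ribbon_graph G0 \<and> connected_graph G0 \<and> has_type G0 g b n" using G by (simp add: top_graphs_def)
 then have "(g, b, n) : ribbon_types" using n by (auto simp: ribbon_types_def)
 then show ?thesis using W unfolding n_def b_def H_def by blast
qed

text \<open>The margin \<open>6\<close> in the bounds offsets the truncated subtraction in
  \<open>W_degree\<close>.\<close>

lemma finite_types: "finite {(g, b, n). 2 * W_degree g b n = M}"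
proof (rule finite_subset)
 show "{(g, b, n). 2 * W_degree g b n = M} \<subseteq> {..M + 6} \<times> {..M + 6} \<times> {..M + 6}" by (auto simp: W_degree_def)
qed simp

lemma W_sum:
 fixes lam :: "real^'n" and g b n :: nat
 assumes lam: "!!i. lam $ i > 0" and n: "n \<ge> 1"
 defines "M \<equiv> 2 * W_degree g b n"
 shows "complex_of_real (1 / fact n * (\<Sum>\<phi>\<in>{1..n} \<rightarrow>\<^sub>E (UNIV :: 'n set). W g b n (%i. lam $ \<phi> i))) =
  (\<Sum>m\<in>typed_maps n b {..<M}. kp_scale ^ M / fact M * of_real (free_weight (%i. lam $ i) {..<M} m))"
proof -
 let ?k = "sqrt (2 ^ (M div 3))"
 have "(\<Sum>\<phi>\<in>{1..n} \<rightarrow>\<^sub>E (UNIV :: 'n set). W g b n (%i. lam $ \<phi> i)) =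
   ?k / (fact b * fact M) * (\<Sum>\<phi>\<in>{1..n} \<rightarrow>\<^sub>E UNIV. \<Sum>m\<in>lmaps n b {..<M}. lprod (%i. lam $ \<phi> i) {..<M} m)"
 proof -
  have "W g b n (%i. lam $ \<phi> i) = ?k / (fact b * fact M) * (\<Sum>m\<in>lmaps n b {..<M}. lprod (%i. lam $ \<phi> i) {..<M} m)" for \<phi>
   unfolding M_def by (rule W_formula[OF n lam])
  then show ?thesis by (simp only: sum_distrib_left)
 qed
 also have "... = ?k / fact M * fact n * (\<Sum>m\<in>typed_maps n b {..<M}. free_weight (%i. lam $ i) {..<M} m)"
  using sum_recolour[of "{..<M}" "%i. lam $ i" n b] by simp
 finally have "1 / fact n * (\<Sum>\<phi>\<in>{1..n} \<rightarrow>\<^sub>E (UNIV :: 'n set). W g b n (%i. lam $ \<phi> i)) =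
   (\<Sum>m\<in>typed_maps n b {..<M}. ?k / fact M * free_weight (%i. lam $ i) {..<M} m)" by (simp add: sum_distrib_left)
 then show ?thesis unfolding M_def kp_scale_power by simp
qed

text \<open>Connected closed maps with \<open>M\<close> half-edges are sorted by type: the numbers
  of boundaries and faces are read off the map, and then \<open>M\<close> determines the
  genus.\<close>

lemma free_energy_coefficient:
 fixes lam :: "real^'n"
 assumes lam: "!!i. lam $ i > 0"
 shows "fps_nth (free_energy lam) M = (\<Sum>(g, b, n)\<in>{(g, b, n) : ribbon_types. 2 * W_degree g b n = M}.
  Q_monom (of_real (1 / fact n * (\<Sum>\<phi>\<in>{1..n} \<rightarrow>\<^sub>E (UNIV :: 'n set). W g b n (%i. lam $ \<phi> i)))) b)"
proof -
 let ?S = "{(g, b, n) : ribbon_types. 2 * W_degree g b n = M}"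
 let ?K = "{m : (free_maps {..<M} :: (nat, 'n) cmap set). cconn {..<M} m}"
 let ?T = "%(g, b, n). typed_maps n b {..<M} :: (nat, 'n) cmap set"
 let ?q = "%m. Q_monom (kp_scale ^ M / fact M * of_real (free_weight (%i. lam $ i) {..<M} m)) (card (bdry_cycles {..<M} m))"
 have finS: "finite ?S" by (rule finite_subset[OF _ finite_types[of M]]) auto
 have finT: "finite (typed_maps n b {..<M} :: (nat, 'n) cmap set)" for n b
  by (rule finite_subset[OF _ finite_free_maps[of "{..<M}"]]) (auto simp: typed_maps_def)
 have K: "?K = (\<Union>\<tau>\<in>?S. ?T \<tau>)"
 proof (intro equalityI subsetI)
  fix m assume m: "m : ?K"
  then obtain g where g: "(g, card (bdry_cycles {..<M} m), card (face_cycles {..<M} m)) : ?S"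
   using typed_maps_ribbon_type[of m M] by auto
  show "m : (\<Union>\<tau>\<in>?S. ?T \<tau>)" by (rule UN_I[OF g]) (use m in \<open>simp add: typed_maps_def\<close>)
 next
  fix m assume "m : (\<Union>\<tau>\<in>?S. ?T \<tau>)"
  then show "m : ?K" by (auto simp: typed_maps_def)
 qed
 have disj: "\<tau> = \<tau>'" if S: "\<tau> : ?S" "\<tau>' : ?S" and m: "m : ?T \<tau>" "m : ?T \<tau>'" for \<tau> \<tau>' m
 proof -
  obtain g b n g' b' n' where t: "\<tau> = (g, b, n)" "\<tau>' = (g', b', n')" by (metis prod_cases3)
  have "b' = b" "n' = n" using m by (auto simp: t typed_maps_def)
  \<comment> \<open>Several genera could share \<open>W_degree = 0\<close> through truncation; a
    connected map is nonempty, which excludes this.\<close>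
  moreover have "M > 0"
  proof (rule ccontr)
   assume "\<not> M > 0"
   then have "{..<M} = {}" by simp
   moreover have "cconn {..<M} m" using m(1) by (simp add: t typed_maps_def)
   ultimately show False by (auto simp: cconn_def)
  qed
  moreover have "2 * W_degree g b n = M" "2 * W_degree g' b' n' = M" using S by (auto simp: t)
  ultimately show ?thesis unfolding t W_degree_def by auto
 qed
 have "fps_nth (free_energy lam) M = fps_const (kp_scale ^ M / fact M) * conn_sum 1 (%_ _. 0) (%i. lam $ i) {..<M}"
  by (simp add: free_energy_egf[OF lam] egf_def)
 also have "... = (\<Sum>m\<in>?K. ?q m)" unfolding conn_sum_1[OF finite_lessThan] sum_distrib_left
  by (intro sum.cong refl) (simp add: Q_monom_def fps_const_mult flip: mult.assoc)
 also have "... = (\<Sum>\<tau>\<in>?S. \<Sum>m\<in>?T \<tau>. ?q m)" unfolding K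
 proof (rule sum.UNION_disjoint[OF finS])
  show "\<forall>\<tau>\<in>?S. finite (?T \<tau>)" using finT by auto
  show "\<forall>\<tau>\<in>?S. \<forall>\<tau>'\<in>?S. \<tau> ~= \<tau>' --> ?T \<tau> \<inter> ?T \<tau>' = {}"
  proof (intro ballI impI)
   fix \<tau> \<tau>' assume S: "\<tau> : ?S" "\<tau>' : ?S" and "\<tau> ~= \<tau>'"
   then show "?T \<tau> \<inter> ?T \<tau>' = {}" using disj[OF S] by (meson disjoint_iff)
  qed
 qed
 also have "... = (\<Sum>(g, b, n)\<in>?S. Q_monom (of_real (1 / fact n * (\<Sum>\<phi>\<in>{1..n} \<rightarrow>\<^sub>E (UNIV :: 'n set). W g b n (%i. lam $ \<phi> i)))) b)"
 proof (rule sum.cong[OF refl])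
  fix \<tau> assume S: "\<tau> : ?S"
  obtain g b n where t: "\<tau> = (g, b, n)" by (metis prod_cases3)
  have n: "n \<ge> 1" and M: "M = 2 * W_degree g b n" using S by (auto simp: t ribbon_types_def)
  have "(\<Sum>m\<in>?T \<tau>. ?q m) = Q_monom (\<Sum>m\<in>typed_maps n b {..<M}. kp_scale ^ M / fact M * of_real (free_weight (%i. lam $ i) {..<M} m)) b"
   unfolding t prod.case Q_monom_sum by (intro sum.cong refl) (simp add: typed_maps_def)
  then show "(\<Sum>m\<in>?T \<tau>. ?q m) = (case \<tau> of (g, b, n) =>
    Q_monom (of_real (1 / fact n * (\<Sum>\<phi>\<in>{1..n} \<rightarrow>\<^sub>E (UNIV :: 'n set). W g b n (%i. lam $ \<phi> i)))) b)"
   unfolding t prod.case W_sum[OF lam n] M .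
 qed
 finally show ?thesis .
qed

text \<open>Convergence of power series is coefficientwise, and a coefficient stays constant as soon
  as the finitely many terms of its degree are included.\<close>

lemma has_sum_graded_fps:
 fixes F :: "'a::comm_ring_1 fps"
 assumes fin: "!!k. finite {x : A. d x = k}" and F: "!!k. fps_nth F k = (\<Sum>x\<in>{x : A. d x = k}. c x)"
 shows "((%x. fps_const (c x) * fps_X ^ d x) has_sum F) A"
 unfolding has_sum_def tendsto_fps_iff eventually_finite_subsets_at_top
proof
 fix k
 let ?X = "{x : A. d x = k}"
 have "fps_nth (\<Sum>x\<in>Y. fps_const (c x) * fps_X ^ d x) k = fps_nth F k" if Y: "finite Y" "?X \<subseteq> Y" "Y \<subseteq> A" for Y
 proof -
  have "fps_nth (\<Sum>x\<in>Y. fps_const (c x) * fps_X ^ d x) k = (\<Sum>x\<in>Y. if d x = k then c x else 0)"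
   unfolding fps_sum_nth fps_mult_left_const_nth fps_X_power_nth by (intro sum.cong refl) auto
  also have "... = (\<Sum>x\<in>?X. c x)" using Y by (intro sum.mono_neutral_cong_right) auto
  finally show ?thesis using F by simp
 qed
 then show "\<exists>X. finite X \<and> X \<subseteq> A \<and> (\<forall>Y. finite Y \<and> X \<subseteq> Y \<and> Y \<subseteq> A -->
   fps_nth (\<Sum>x\<in>Y. fps_const (c x) * fps_X ^ d x) k = fps_nth F k)" using fin[of k] by (intro exI[of _ ?X]) auto
qed

text \<open>Read off from the closed formula: scaling multiplies the weight of every edge by
  \<open>1 / c\<close>, and there are \<open>W_degree g b n\<close> edges.\<close>

lemma W_homogeneous:
 assumes n: "n \<ge> 1" shows "homogeneous_neg n (W_degree g b n) (W g b n)" unfolding homogeneous_neg_def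
proof (intro allI impI)
 fix mu :: "nat => real" and c :: real assume c: "0 < c" and mu: "\<forall>i\<in>{1..n}. mu i > 0"
 let ?M = "2 * W_degree g b n"
 have "lprod (%i. c * mu i) {..<?M} m = lprod mu {..<?M} m / c ^ W_degree g b n" if m: "m : lmaps n b {..<?M}" for m
 proof -
  obtain a s l where m': "m = (a, s, l)" by (cases m)
  have fm: "(a, s, l) : free_maps {..<?M}" using m by (simp add: m' lmaps_def)
  interpret cubic_map "{..<?M}" a s by (rule free_maps_cubic[OF finite_lessThan fm])
  have E: "card (edge_sets {..<?M} s) = W_degree g b n" using card_edge_sets by simp
  have "lam_opt (label_weight (%i. c * mu i)) x = c * lam_opt (label_weight mu) x" for x
   by (simp add: lam_opt_def label_weight_def split: option.split sum.split)
  then have "lprod (%i. c * mu i) {..<?M} m = (\<Prod>e\<in>edge_sets {..<?M} s. 1 / c * (1 / (\<Sum>z\<in>e. lam_opt (label_weight mu) (l z))))"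
   by (simp add: lprod_def m' flip: sum_distrib_left)
  also have "... = (1 / c) ^ W_degree g b n * lprod mu {..<?M} m" unfolding prod.distrib by (simp add: lprod_def m' E)
  finally show ?thesis by (simp add: power_one_over)
 qed
 then have "(\<Sum>m\<in>lmaps n b {..<?M}. lprod (%i. c * mu i) {..<?M} m) = (\<Sum>m\<in>lmaps n b {..<?M}. lprod mu {..<?M} m) / c ^ W_degree g b n"
  by (simp add: sum_divide_distrib)
 then show "W g b n (%i. c * mu i) = W g b n mu / c ^ W_degree g b n"
  using W_formula[OF n, of mu g b] W_formula[OF n, of "%i. c * mu i" g b] c mu by simp
qed

theorem corollary3p2:
  fixes lam :: "real^'n"
  assumes "\<And>i. lam $ i > 0"
  shows "(\<forall>(g, b, n)\<in>ribbon_types. homogeneous_neg n (W_degree g b n) (W g b n)) \<and>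
    ((\<lambda>(g, b, n).
        fps_const (Q_monom
          (of_real (1 / fact n * (\<Sum>\<phi>\<in>{1..n} \<rightarrow>\<^sub>E (UNIV :: 'n set). W g b n (\<lambda>i. lam $ \<phi> i)))) b)
        * fps_X ^ (2 * W_degree g b n))
      has_sum free_energy lam) ribbon_types"
proof -
 have 1: "\<forall>(g, b, n)\<in>ribbon_types. homogeneous_neg n (W_degree g b n) (W g b n)"
  by (auto simp: ribbon_types_def intro: W_homogeneous)
 let ?c = "%(g, b, n). Q_monom (of_real (1 / fact n * (\<Sum>\<phi>\<in>{1..n} \<rightarrow>\<^sub>E (UNIV :: 'n set). W g b n (%i. lam $ \<phi> i)))) b"
 let ?d = "%(g, b, n). 2 * W_degree g b n"
 have S: "{\<tau> : ribbon_types. ?d \<tau> = k} = {(g, b, n) : ribbon_types. 2 * W_degree g b n = k}" for k by auto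
 have "((%\<tau>. fps_const (?c \<tau>) * fps_X ^ ?d \<tau>) has_sum free_energy lam) ribbon_types"
 proof (rule has_sum_graded_fps)
  show "finite {\<tau> : ribbon_types. ?d \<tau> = k}" for k by (rule finite_subset[OF _ finite_types[of k]]) auto
  show "fps_nth (free_energy lam) k = (\<Sum>\<tau>\<in>{\<tau> : ribbon_types. ?d \<tau> = k}. ?c \<tau>)" for k
   unfolding S by (rule free_energy_coefficient[OF assms])
 qed
 then show ?thesis using 1 by (simp add: case_prod_beta')
qed

end
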